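(* Let $(U,V)$ be a pair of real Banach spaces, $\lambda_-<\lambda_+$ real numbers, $\mathcal{U}\subset\mathbb{R}\times U$ an open neighbourhood of $[\lambda_-,\lambda_+]\times\{0\}$, and $\mathfrak{F}\in\mathcal{C}^1(\mathcal{U},V)$ such that: (a) $\mathfrak{F}(\lambda,0)=0$ and $\mathfrak{L}(\lambda):=D_u\mathfrak{F}(\lambda,0)\in\Phi_0(U,V)$ for all $(\lambda,0)\in\mathcal{U}$; (b) $\mathfrak{L}(\lambda_\pm)\in GL(U,V)$ and $\chi[\mathfrak{L}_\omega,[\lambda_-,\lambda_+]]$ is odd, where $\mathfrak{L}_\omega:[\lambda_-,\lambda_+]\to\Phi_0(U,V)$ is any analytic admissible curve $\mathcal{A}$-homotopic to $\mathfrak{L}(\lambda)$, $\lambda\in[\lambda_-,\lambda_+]$. Then: (i) There exists $\lambda_0\in(\lambda_-,\lambda_+)$ such that $(\lambda_0,0)$ is a bifurcation point of $\mathfrak{F}(\lambda,u)=0$ from $\mathcal{T}=\{(\lambda,0):(\lambda,0)\in\mathcal{U}\}$, i.e. there is a sequence $(\lambda_n,u_n)\in\mathfrak{F}^{-1}(0)$ with $u_n\neq0$ and $(\lambda_n,u_n)\to(\lambda_0,0)$. (ii) There exists $\eta_0>0$ such that, for every $\eta\in(0,\eta_0)$, there is a connected component $\mathfrak{C}$ of the set of non-trivial solutions $\mathfrak{F}^{-1}(0)\setminus\{(\lambda,0)\in\mathcal{U}:\lambda\notin\Sigma(\mathfrak{L})\}$ joining $\{(\lambda,0):\lambda\in\Sigma(\mathfrak{L})\cap(\lambda_-,\lambda_+)\}$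 to the surface $\|u\|=\eta$ (that is, meeting both sets).
   Context: $\Phi_0(U,V)$: bounded linear Fredholm operators of index zero (norm topology); $GL(U,V)$: topological isomorphisms. $\Sigma(\mathfrak{L})=\{\lambda:\mathfrak{L}(\lambda)\notin GL(U,V)\}$. $\mathcal{A}$-homotopy: a continuous path $\mathfrak{L}:[a,b]\to\Phi_0(U,V)$ is admissible if $\mathfrak{L}(a),\mathfrak{L}(b)\in GL(U,V)$. Two admissible paths $\mathfrak{L}_1,\mathfrak{L}_2$ are $\mathcal{A}$-homotopic if there is a continuous $H:[0,1]\times[a,b]\to\Phi_0(U,V)$ with $H(t,a),H(t,b)\in GL(U,V)$ for all $t$, $H(0,\cdot)=\mathfrak{L}_1$, $H(1,\cdot)=\mathfrak{L}_2$. Every admissible path is $\mathcal{A}$-homotopic to an analytic admissible path. Generalized algebraic multiplicity $\chi$: let $\mathfrak{L}$ be a $\mathcal{C}^r$ curve in $\Phi_0(U,V)$. $\lambda_0\in\Sigma(\mathfrak{L})$ is $\kappa$-algebraic ($1\leq\kappa\leq r$) if there are $\varepsilon,C>0$ with $\mathfrak{L}(\lambda)\in GL(U,V)$ and $\|\mathfrak{L}(\lambda)^{-1}\|<C|\lambda-\lambda_0|^{-\kappa}$ for $0<|\lambda-\lambda_0|<\varepsilon$, with $\kappa$ the minimal such integer. Put $\mathfrak{L}_j=\frac1{j!}\mathfrak{L}^{(j)}(\lambda_0)$. $\lambda_0$ is $\kappa$-transversal if $\bigoplus_{j=1}^{\kappa}\mathfrak{L}_j\big(\bigcap_{i=0}^{j-1}N[\mathfrak{L}_i]\big)\oplus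 R[\mathfrak{L}_0]=V$ with $\mathfrak{L}_\kappa\big(\bigcap_{i=0}^{\kappa-1}N[\mathfrak{L}_i]\big)\neq\{0\}$; then $\chi[\mathfrak{L},\lambda_0]:=\sum_{j=1}^{\kappa}j\dim\mathfrak{L}_j\big(\bigcap_{i=0}^{j-1}N[\mathfrak{L}_i]\big)$. For a general $\kappa$-algebraic $\lambda_0$ there is a polynomial $\Phi$ with values in $\mathcal{L}(U)$, $\Phi(\lambda_0)=I_U$, such that $\lambda_0$ is $\kappa$-transversal for $\mathfrak{L}^\Phi(\lambda):=\mathfrak{L}(\lambda)\Phi(\lambda)$, and $\chi[\mathfrak{L},\lambda_0]:=\chi[\mathfrak{L}^\Phi,\lambda_0]$, independently of $\Phi$. Put $\chi[\mathfrak{L},\lambda_0]=0$ if $\lambda_0\notin\Sigma(\mathfrak{L})$. If $\mathfrak{L}_\omega$ is analytic and admissible on $[a,b]$, then $\Sigma(\mathfrak{L}_\omega)$ is finite, all its points are algebraic, and $\chi[\mathfrak{L}_\omega,[a,b]]:=\sum_{\lambda\in\Sigma(\mathfrak{L}_\omega)\cap[a,b]}\chi[\mathfrak{L}_\omega,\lambda]$. *)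

theory Defs
  imports "HOL-Analysis.Analysis"
begin

section \<open>Fredholm operators of index zero and isomorphisms\<close>

definition ker :: "('a::real_normed_vector \<Rightarrow>\<^sub>L 'b::real_normed_vector) \<Rightarrow> 'a set" where
  "ker T = {x. blinfun_apply T x = 0}"

text \<open>The library's \<^const>\<open>dim\<close> returns \<open>0\<close> on infinite-dimensional subspaces, so finite
  dimensionality has to be required separately.\<close>

definition fin_dim :: "'a::real_vector set \<Rightarrow> bool" where
  "fin_dim S \<longleftrightarrow> (\<exists>B. finite B \<and> span B = S)"

text \<open>\<^term>\<open>S\<close> has finite codimension \<^term>\<open>n\<close>, the codimension being the dimension of an algebraic complement.\<close>

definition has_codim :: "'a::real_vector set \<Rightarrow> nat \<Rightarrow> bool" where
  "has_codim S n \<longleftrightarrow>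
     (\<exists>W. subspace W \<and> fin_dim W \<and> dim W = n \<and> S \<inter> W = {0} \<and> {s + w | s w. s \<in> S \<and> w \<in> W} = UNIV)"

definition Fredholm0 :: "('a::banach \<Rightarrow>\<^sub>L 'b::banach) set" where
  "Fredholm0 = {T. closed (range (blinfun_apply T)) \<and> fin_dim (ker T) \<and>
                   has_codim (range (blinfun_apply T)) (dim (ker T))}"

definition GL :: "('a::banach \<Rightarrow>\<^sub>L 'b::banach) set" where
  "GL = {T. \<exists>S. S o\<^sub>L T = id_blinfun \<and> T o\<^sub>L S = id_blinfun}"

definition blinfun_inv :: "('a::banach \<Rightarrow>\<^sub>L 'b::banach) \<Rightarrow> ('b \<Rightarrow>\<^sub>L 'a)" where
  "blinfun_inv T = (THE S. S o\<^sub>L T = id_blinfun \<and> T o\<^sub>L S = id_blinfun)"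

text \<open>\<^term>\<open>J\<close> is the parameter domain of the curve; values of \<^term>\<open>L\<close> outside \<^term>\<open>J\<close> are irrelevant.\<close>

definition singular_set :: "real set \<Rightarrow> (real \<Rightarrow> 'a::banach \<Rightarrow>\<^sub>L 'b::banach) \<Rightarrow> real set" where
  "singular_set J L = {l \<in> J. L l \<notin> GL}"

section \<open>Admissible paths\<close>

definition admissible :: "real \<Rightarrow> real \<Rightarrow> (real \<Rightarrow> 'a::banach \<Rightarrow>\<^sub>L 'b::banach) \<Rightarrow> bool" where
  "admissible a b L \<longleftrightarrow>
     continuous_on {a..b} L \<and> (\<forall>l\<in>{a..b}. L l \<in> Fredholm0) \<and> L a \<in> GL \<and> L b \<in> GL"

definition A_homotopic ::
  "real \<Rightarrow> real \<Rightarrow> (real \<Rightarrow> 'a::banach \<Rightarrow>\<^sub>L 'b::banach) \<Rightarrow> (real \<Rightarrow> 'a \<Rightarrow>\<^sub>L 'b) \<Rightarrow> bool" where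
  "A_homotopic a b L1 L2 \<longleftrightarrow> admissible a b L1 \<and> admissible a b L2 \<and>
     (\<exists>H :: real \<times> real \<Rightarrow> 'a \<Rightarrow>\<^sub>L 'b.
        continuous_on ({0..1} \<times> {a..b}) H \<and>
        (\<forall>t\<in>{0..1}. \<forall>l\<in>{a..b}. H (t, l) \<in> Fredholm0) \<and>
        (\<forall>t\<in>{0..1}. H (t, a) \<in> GL \<and> H (t, b) \<in> GL) \<and>
        (\<forall>l\<in>{a..b}. H (0, l) = L1 l \<and> H (1, l) = L2 l))"

definition real_analytic_on :: "real set \<Rightarrow> (real \<Rightarrow> 'a::real_normed_vector) \<Rightarrow> bool" where
  "real_analytic_on J f \<longleftrightarrow>
     (\<forall>t\<in>J. \<exists>r>0. \<exists>c :: nat \<Rightarrow> 'a. \<forall>s\<in>J. \<bar>s - t\<bar> < r \<longrightarrow> (\<lambda>n. (s - t) ^ n *\<^sub>R c n) sums f s)"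

section \<open>The generalized algebraic multiplicity\<close>

definition nth_deriv :: "nat \<Rightarrow> (real \<Rightarrow> 'a::real_normed_vector) \<Rightarrow> real \<Rightarrow> 'a" where
  "nth_deriv j f = ((\<lambda>g t. vector_derivative g (at t)) ^^ j) f"

definition Cr_on :: "nat \<Rightarrow> real set \<Rightarrow> (real \<Rightarrow> 'a::real_normed_vector) \<Rightarrow> bool" where
  "Cr_on r J f \<longleftrightarrow>
     (\<forall>j<r. \<forall>t\<in>J. nth_deriv j f differentiable (at t)) \<and> continuous_on J (nth_deriv r f)"

definition taylor_coeff :: "(real \<Rightarrow> 'a::real_normed_vector) \<Rightarrow> real \<Rightarrow> nat \<Rightarrow> 'a" where
  "taylor_coeff f l0 j = (1 / fact j) *\<^sub>R nth_deriv j f l0"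

definition inverse_bound ::
  "(real \<Rightarrow> 'a::banach \<Rightarrow>\<^sub>L 'b::banach) \<Rightarrow> real \<Rightarrow> nat \<Rightarrow> bool" where
  "inverse_bound L l0 k \<longleftrightarrow>
     (\<exists>\<epsilon>>0. \<exists>C>0. \<forall>l. 0 < \<bar>l - l0\<bar> \<and> \<bar>l - l0\<bar> < \<epsilon> \<longrightarrow>
        L l \<in> GL \<and> norm (blinfun_inv (L l)) < C / \<bar>l - l0\<bar> ^ k)"

definition algebraic_point ::
  "(real \<Rightarrow> 'a::banach \<Rightarrow>\<^sub>L 'b::banach) \<Rightarrow> real \<Rightarrow> nat \<Rightarrow> bool" where
  "algebraic_point L l0 k \<longleftrightarrow>
     L l0 \<notin> GL \<and> 1 \<le> k \<and>
     (\<exists>\<delta>>0. Cr_on k (ball l0 \<delta>) L \<and> (\<forall>l\<in>ball l0 \<delta>. L l \<in> Fredholm0)) \<and>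
     inverse_bound L l0 k \<and> (\<forall>m. 1 \<le> m \<and> m < k \<longrightarrow> \<not> inverse_bound L l0 m)"

text \<open>The space \<open>L\<^sub>j (N[L\<^sub>0] \<inter> \<dots> \<inter> N[L\<^sub>j\<^sub>-\<^sub>1])\<close> for \<open>j \<ge> 1\<close>, and the range of \<open>L\<^sub>0\<close> for \<open>j = 0\<close>.\<close>

definition trans_space ::
  "(real \<Rightarrow> 'a::banach \<Rightarrow>\<^sub>L 'b::banach) \<Rightarrow> real \<Rightarrow> nat \<Rightarrow> 'b set" where
  "trans_space L l0 j =
     blinfun_apply (taylor_coeff L l0 j) ` (\<Inter>i\<in>{..<j}. ker (taylor_coeff L l0 i))"

text \<open>The direct sum decomposition is expressed by unique representability of every vector.\<close>

definition transversal ::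
  "(real \<Rightarrow> 'a::banach \<Rightarrow>\<^sub>L 'b::banach) \<Rightarrow> real \<Rightarrow> nat \<Rightarrow> bool" where
  "transversal L l0 k \<longleftrightarrow>
     (\<forall>v. \<exists>!w. w \<in> Pi\<^sub>E {..k} (trans_space L l0) \<and> v = (\<Sum>j\<le>k. w j)) \<and>
     trans_space L l0 k \<noteq> {0}"

definition chi_transversal ::
  "(real \<Rightarrow> 'a::banach \<Rightarrow>\<^sub>L 'b::banach) \<Rightarrow> real \<Rightarrow> nat \<Rightarrow> nat" where
  "chi_transversal L l0 k = (\<Sum>j=1..k. j * dim (trans_space L l0 j))"

definition operator_polynomial :: "(real \<Rightarrow> 'a::banach \<Rightarrow>\<^sub>L 'a) \<Rightarrow> bool" where
  "operator_polynomial \<Phi> \<longleftrightarrow>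
     (\<exists>m. \<exists>P :: nat \<Rightarrow> 'a \<Rightarrow>\<^sub>L 'a. \<forall>t. \<Phi> t = (\<Sum>k\<le>m. t ^ k *\<^sub>R P k))"

definition transversalizes ::
  "(real \<Rightarrow> 'a::banach \<Rightarrow>\<^sub>L 'a) \<Rightarrow> (real \<Rightarrow> 'a \<Rightarrow>\<^sub>L 'b::banach) \<Rightarrow> real \<Rightarrow> nat \<Rightarrow> bool" where
  "transversalizes \<Phi> L l0 k \<longleftrightarrow>
     operator_polynomial \<Phi> \<and> \<Phi> l0 = id_blinfun \<and> transversal (\<lambda>l. L l o\<^sub>L \<Phi> l) l0 k"

text \<open>At an algebraic point a transversalizing polynomial exists and the value does not depend on
  which one is chosen. At singular points that are not algebraic the value is unspecified.\<close>

definition chi :: "(real \<Rightarrow> 'a::banach \<Rightarrow>\<^sub>L 'b::banach) \<Rightarrow> real \<Rightarrow> nat" where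
  "chi L l0 =
     (if L l0 \<in> GL then 0
      else SOME n. \<exists>k \<Phi>. algebraic_point L l0 k \<and> transversalizes \<Phi> L l0 k \<and>
                          n = chi_transversal (\<lambda>l. L l o\<^sub>L \<Phi> l) l0 k)"

text \<open>For an analytic admissible curve the singular set is a finite subset of the open interval
  between \<^term>\<open>a\<close> and \<^term>\<open>b\<close>, so only values of \<^term>\<open>L\<close> on the closed interval enter.\<close>

definition chi_total :: "(real \<Rightarrow> 'a::banach \<Rightarrow>\<^sub>L 'b::banach) \<Rightarrow> real \<Rightarrow> real \<Rightarrow> nat" where
  "chi_total L a b = (\<Sum>l\<in>singular_set {a..b} L. chi L l)"

section \<open>Nonlinear equations\<close>

definition C1_on :: "'a::real_normed_vector set \<Rightarrow> ('a \<Rightarrow> 'b::real_normed_vector) \<Rightarrow> bool" where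
  "C1_on S F \<longleftrightarrow>
     (\<exists>F' :: 'a \<Rightarrow> 'a \<Rightarrow>\<^sub>L 'b. continuous_on S F' \<and>
        (\<forall>x\<in>S. (F has_derivative blinfun_apply (F' x)) (at x)))"

definition bifurcation_point ::
  "(real \<times> 'a::real_normed_vector) set \<Rightarrow> (real \<times> 'a \<Rightarrow> 'b::real_normed_vector) \<Rightarrow> real \<Rightarrow> bool" where
  "bifurcation_point \<U> F l0 \<longleftrightarrow>
     (\<exists>(l :: nat \<Rightarrow> real) (u :: nat \<Rightarrow> 'a).
        (\<forall>n. (l n, u n) \<in> \<U> \<and> F (l n, u n) = 0 \<and> u n \<noteq> 0) \<and>
        (\<lambda>n. (l n, u n)) \<longlonglongrightarrow> (l0, 0))"

definition nontrivial_solutions ::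
  "(real \<times> 'a::banach) set \<Rightarrow> (real \<times> 'a \<Rightarrow> 'b::banach) \<Rightarrow> (real \<Rightarrow> 'a \<Rightarrow>\<^sub>L 'b) \<Rightarrow> (real \<times> 'a) set" where
  "nontrivial_solutions \<U> F L =
     {p \<in> \<U>. F p = 0} -
     {(l, 0) | l. (l, 0) \<in> \<U> \<and> l \<notin> singular_set {l. (l, 0) \<in> \<U>} L}"

end

theory Submission
  imports Defs "HOL-Homology.Homology" "Jordan_Normal_Form.Determinant"
begin

text \<open>
  Every index-zero operator becomes invertible after adding an operator with values in a suitable
  finite-dimensional space \<open>W\<close>. Along a path \<open>L\<close> one can choose a single \<open>W\<close> and a continuous path
  \<open>T\<close> of isomorphisms with \<open>T - L\<close> valued in \<open>W\<close>; at the ends \<open>L T\<inverse>\<close> restricts to an automorphism of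
  \<open>W\<close>, and the product of the two orientation signs is independent of \<open>T\<close> and invariant under
  admissible homotopies.

  For an analytic path this parity is \<open>(-1)\<close> to the total multiplicity. Near a singular point \<open>l\<^sub>0\<close> a
  transversalizing polynomial \<open>\<Phi>\<close> gives a factorization \<open>L \<Phi> = M D\<close>, with \<open>M\<close> invertible and \<open>D\<close>
  diagonal with entries \<open>(s - l\<^sub>0)\<^sup>k\<close> on a finite-dimensional space and the identity on a complement; the
  multiplicity is the sum of the exponents \<open>k\<close>, which is also the number of sign changes, counted
  modulo two, when \<open>s\<close> crosses \<open>l\<^sub>0\<close>.

  If no continuum of nontrivial solutions joined the singular set to the sphere of radius \<open>\<eta>\<close>, the compact
  solution set would split into two closed pieces. A function \<open>\<psi>\<close> separating them, adjoined as an extra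
  coordinate to the Lyapunov--Schmidt type reduction of the equation to \<open>W\<close>, yields a family of sphere
  maps with nowhere vanishing values, so the Brouwer degrees at the two ends agree. These degrees are
  the two orientation signs, contradicting odd multiplicity.
\<close>

section \<open>Isomorphisms and Fredholm operators of index zero\<close>

text \<open>The sign of an automorphism of \<open>W\<close> is defined as the Brouwer degree of its
  suspended sphere map and not as the sign of a determinant, so the linear maps at the ends of the
  path and the nonlinear reduction carry the same invariant from the outset. The obstacle to a sign
  along the path is that kernels and complements jump at singular parameters. It is met by working
  modulo operators with values in one fixed \<open>W\<close>: lifts over adjacent intervals are
  glued by an isomorphism that is the identity modulo \<open>W\<close>. For a homotopy,
  \<open>W\<close> has to serve the whole parameter square and to contain the local perturbations at
  all singular points of the analytic curve, because only signs taken in the same space are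
  compared. The multiplicity is a choice among all transversalizations, so the normal form is
  derived from an arbitrary transversalizing polynomial, and one is constructed to make the choice
  meaningful. On the nonlinear side the remainder is a small perturbation of the lift; solutions
  near the trivial branch are then continuous images of bounded sets in \<open>W\<close>, which is
  the source of compactness.\<close>

lemma continuous_on_open_nbhd:
  fixes f :: "'a::metric_space \<Rightarrow> 'b::metric_space"
  assumes f: "continuous_on S f" and U: "open U" and x: "x \<in> S" and fx: "f x \<in> U"
  shows "\<exists>d>0. \<forall>y\<in>S. dist y x < d \<longrightarrow> f y \<in> U"
proof -
  obtain e where "e > 0" "\<And>z. dist z (f x) < e \<Longrightarrow> z \<in> U" using U fx unfolding open_dist by blast
  moreover from this obtain d where "d > 0" "\<And>y. y \<in> S \<Longrightarrow> dist y x < d \<Longrightarrow> dist (f y) (f x) < e"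
    using f x unfolding continuous_on_iff by blast
  ultimately show ?thesis by blast
qed

section \<open>The Hahn-Banach theorem and dual functionals\<close>

text \<open>The one-dimensional extension step, for functionals coded by their graphs. The bound by
  the norm on a subspace already forces single-valuedness, since a pair over 0 and its negative both
  satisfy it; this is why no function appears.\<close>

lemma Hahn_Banach_graph_extend:
  fixes G :: "('a::real_normed_vector \<times> real) set"
  assumes G: "subspace G" and dom: "\<And>z a. (z, a) \<in> G \<Longrightarrow> a \<le> norm z"
  shows "\<exists>G'. subspace G' \<and> (\<forall>z a. (z, a) \<in> G' \<longrightarrow> a \<le> norm z) \<and> G \<subseteq> G' \<and> y \<in> fst ` G'"
proof -
  have G0: "(0, 0) \<in> G" using subspace_0[OF G] by (simp add: zero_prod_def)
  \<comment> \<open>Every lower bound for the value at \<open>y\<close> lies below every upper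
    bound: in the sum of the arguments \<open>y\<close> cancels.\<close>
  have key: "a - norm (z - y) \<le> norm (z' + y) - a'" if "(z, a) \<in> G" "(z', a') \<in> G" for z a z' a'
  proof -
    have "(z + z', a + a') \<in> G" using subspace_add[OF G that] by simp
    then have "a + a' \<le> norm (z + z')" by (rule dom)
    also have "\<dots> = norm ((z - y) + (z' + y))" by simp
    also have "\<dots> \<le> norm (z - y) + norm (z' + y)" by (rule norm_triangle_ineq)
    finally show ?thesis by simp
  qed
  define S where "S = {a - norm (z - y) | z a. (z, a) \<in> G}"
  \<comment> \<open>Any number between the lower and the upper bounds could be the value at
    \<open>y\<close>; the supremum of the lower ones is taken.\<close>
  define c where "c = Sup S"
  have Sne: "S \<noteq> {}" using G0 by (auto simp: S_def)
  have Sb: "bdd_above S"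
    unfolding bdd_above_def using key[OF _ G0] by (auto simp: S_def)
  have lo: "a - norm (z - y) \<le> c" if "(z, a) \<in> G" for z a
    unfolding c_def by (rule cSup_upper[OF _ Sb]) (use that in \<open>auto simp: S_def\<close>)
  have hi: "c \<le> norm (z + y) - a" if "(z, a) \<in> G" for z a
    unfolding c_def by (rule cSup_least[OF Sne]) (use that key in \<open>auto simp: S_def\<close>)
  define G' where "G' = {p + t *\<^sub>R (y, c) | p t. p \<in> G}"
  have "subspace G'"
  proof (rule subspaceI)
    show "0 \<in> G'" unfolding G'_def using subspace_0[OF G] by (intro CollectI exI[of _ 0]) (simp add: zero_prod_def)
  next
    fix p q assume "p \<in> G'" "q \<in> G'"
    then obtain p1 t1 q1 t2 where "p1 \<in> G" "q1 \<in> G" "p = p1 + t1 *\<^sub>R (y, c)" "q = q1 + t2 *\<^sub>R (y, c)"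
      unfolding G'_def by blast
    then have "p + q = (p1 + q1) + (t1 + t2) *\<^sub>R (y, c)" "p1 + q1 \<in> G"
      using subspace_add[OF G] by (auto simp: algebra_simps)
    then show "p + q \<in> G'" unfolding G'_def by blast
  next
    fix r p assume "p \<in> G'"
    then obtain p1 t1 where "p1 \<in> G" "p = p1 + t1 *\<^sub>R (y, c)"
      unfolding G'_def by blast
    then have "r *\<^sub>R p = r *\<^sub>R p1 + (r * t1) *\<^sub>R (y, c)" "r *\<^sub>R p1 \<in> G"
      using subspace_scale[OF G] by (auto simp: scaleR_add_right)
    then show "r *\<^sub>R p \<in> G'" unfolding G'_def by blast
  qed
  moreover have "b \<le> norm x" if xb: "(x, b) \<in> G'" for x b
  proof -
    obtain z a t where za: "(z, a) \<in> G" and x: "x = z + t *\<^sub>R y" and b: "b = a + t * c"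
      using xb by (auto simp: G'_def)
    consider "t = 0" | "t > 0" | "t < 0" by linarith
    then show ?thesis
    proof cases
      case 1 then show ?thesis using dom[OF za] x b by simp
    next
      case 2
      have "(inverse t *\<^sub>R z, inverse t * a) \<in> G" using subspace_scale[OF G za, of "inverse t"] by simp
      then have "c \<le> norm (inverse t *\<^sub>R z + y) - inverse t * a" by (rule hi)
      then have "t * c \<le> t * (norm (inverse t *\<^sub>R z + y) - inverse t * a)"
        using 2 by simp
      then have "t * c \<le> t * norm (inverse t *\<^sub>R z + y) - a"
        using 2 by (simp add: right_diff_distrib flip: mult.assoc)
      also have "t * norm (inverse t *\<^sub>R z + y) = norm (t *\<^sub>R (inverse t *\<^sub>R z + y))" using 2 by simp
      also have "t *\<^sub>R (inverse t *\<^sub>R z + y) = x" using 2 x by (simp add: scaleR_add_right)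
      finally show ?thesis using b by simp
    next
      case 3
      define s where "s = - t"
      have s: "s > 0" using 3 s_def by simp
      have "(inverse s *\<^sub>R z, inverse s * a) \<in> G" using subspace_scale[OF G za, of "inverse s"] by simp
      then have "inverse s * a - norm (inverse s *\<^sub>R z - y) \<le> c" by (rule lo)
      then have "s * (inverse s * a - norm (inverse s *\<^sub>R z - y)) \<le> s * c"
        using s by simp
      then have "a - s * norm (inverse s *\<^sub>R z - y) \<le> s * c"
        using s by (simp add: right_diff_distrib flip: mult.assoc)
      moreover have "s * norm (inverse s *\<^sub>R z - y) = norm (s *\<^sub>R (inverse s *\<^sub>R z - y))" using s by simp
      moreover have "s *\<^sub>R (inverse s *\<^sub>R z - y) = x" using s x by (simp add: scaleR_diff_right s_def)
      ultimately have "a - norm x \<le> s * c" by metis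
      then show ?thesis using b s_def by simp
    qed
  qed
  moreover have "G \<subseteq> G'" unfolding G'_def by (force intro: exI[of _ 0])
  moreover have "y \<in> fst ` G'"
  proof -
    have "(0, 0) + 1 *\<^sub>R (y, c) \<in> G'" unfolding G'_def using G0 by blast
    then show ?thesis by force
  qed
  ultimately show ?thesis by blast
qed

text \<open>Zorn's lemma on dominated graphs through \<open>(x, norm x)\<close>. A maximal graph is
  total by the extension step and single-valued by domination; dividing by \<open>norm x\<close>
  normalizes the value.\<close>

lemma exists_functional_eq_1:
  fixes x :: "'a::real_normed_vector"
  assumes "x \<noteq> 0"
  shows "\<exists>\<phi> :: 'a \<Rightarrow>\<^sub>L real. \<phi> x = 1"
proof -
  define \<A> where "\<A> = {G :: ('a \<times> real) set. subspace G \<and> (\<forall>z a. (z, a) \<in> G \<longrightarrow> a \<le> norm z) \<and> (x, norm x) \<in> G}"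
  have "\<exists>M\<in>\<A>. \<forall>X\<in>\<A>. M \<subseteq> X \<longrightarrow> X = M"
  proof (rule subset_Zorn_nonempty)
    have "a \<le> norm z" if za: "(z, a) \<in> span {(x, norm x)}" for z a
    proof -
      obtain k where "(z, a) = k *\<^sub>R (x, norm x)" using za unfolding span_singleton by blast
      then show ?thesis by (simp add: mult_right_mono)
    qed
    then have "span {(x, norm x)} \<in> \<A>" by (auto simp: \<A>_def span_base)
    then show "\<A> \<noteq> {}" by blast
  next
    fix \<C> assume ne: "\<C> \<noteq> {}" and ch: "subset.chain \<A> \<C>"
    have sub: "G \<in> \<A>" if "G \<in> \<C>" for G using ch that by (auto simp: subset.chain_def)
    have tot: "G \<subseteq> H \<or> H \<subseteq> G" if "G \<in> \<C>" "H \<in> \<C>" for G H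
      using ch that by (auto simp: subset.chain_def)
    have "subspace (\<Union>\<C>)"
    proof (rule subspaceI)
      show "0 \<in> \<Union>\<C>" using ne sub by (auto simp: \<A>_def subspace_0)
    next
      fix p q assume "p \<in> \<Union>\<C>" "q \<in> \<Union>\<C>"
      then obtain G where "G \<in> \<C>" "p \<in> G" "q \<in> G" using tot by blast
      then show "p + q \<in> \<Union>\<C>" using sub by (auto simp: \<A>_def intro: subspace_add)
    next
      fix r p assume "p \<in> \<Union>\<C>"
      then show "r *\<^sub>R p \<in> \<Union>\<C>" using sub by (auto simp: \<A>_def intro: subspace_scale)
    qed
    then show "\<Union>\<C> \<in> \<A>" using ne sub unfolding \<A>_def by blast
  qed
  then obtain G where G: "G \<in> \<A>" and max: "\<And>X. X \<in> \<A> \<Longrightarrow> G \<subseteq> X \<Longrightarrow> X = G" by blast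
  have sG: "subspace G" and dom: "\<And>z a. (z, a) \<in> G \<Longrightarrow> a \<le> norm z" and xG: "(x, norm x) \<in> G"
    using G by (auto simp: \<A>_def)
  have total: "\<exists>a. (z, a) \<in> G" for z
  proof -
    obtain G' where "subspace G'" "\<forall>z a. (z, a) \<in> G' \<longrightarrow> a \<le> norm z" "G \<subseteq> G'" "z \<in> fst ` G'"
      using Hahn_Banach_graph_extend[OF sG dom, of z] by auto
    then have "G' \<in> \<A>" using xG by (simp add: \<A>_def subset_iff)
    then have "G' = G" using \<open>G \<subseteq> G'\<close> by (rule max)
    then show ?thesis using \<open>z \<in> fst ` G'\<close> by force
  qed
  have unique: "a = b" if "(z, a) \<in> G" "(z, b) \<in> G" for z a b
  proof -
    have "(0, a - b) \<in> G" "(0, b - a) \<in> G"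
      using subspace_diff[OF sG that] subspace_diff[OF sG that(2,1)] by simp_all
    then have "a - b \<le> 0" "b - a \<le> 0" using dom[of 0] by fastforce+
    then show ?thesis by simp
  qed
  define f where "f z = (THE a. (z, a) \<in> G)" for z
  have f: "(z, f z) \<in> G" for z
    unfolding f_def using total unique by (metis theI)
  have "bounded_linear f"
  proof (rule bounded_linear_intro[where K=1])
    show "f (a + b) = f a + f b" for a b
      using subspace_add[OF sG f[of a] f[of b]] f[of "a + b"] unique by simp
    show "f (r *\<^sub>R a) = r *\<^sub>R f a" for r a
      using subspace_scale[OF sG f[of a], of r] f[of "r *\<^sub>R a"] unique by simp
    show "norm (f a) \<le> norm a * 1" for a
      using dom[OF f[of a]] dom[of "- a" "- f a"] subspace_neg[OF sG f[of a]] by simp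
  qed
  moreover have "f x = norm x" using unique[OF f xG] .
  ultimately have "blinfun_apply ((1 / norm x) *\<^sub>R Blinfun f) x = 1"
    using assms by (simp add: bounded_linear_Blinfun_apply scaleR_blinfun.rep_eq)
  then show ?thesis by blast
qed

text \<open>Induction in the manner of Gram-Schmidt: a functional of the residual
  \<open>x - p x\<close>, with \<open>p\<close> the projection onto the old span, vanishes on the
  old vectors, and the old functionals are corrected by multiples of it to vanish at
  \<open>x\<close>.\<close>

lemma dual_functionals:
  fixes B :: "'a::real_normed_vector set"
  assumes "finite B" "independent B"
  shows "\<exists>\<phi> :: 'a \<Rightarrow> 'a \<Rightarrow>\<^sub>L real. \<forall>b\<in>B. \<forall>b'\<in>B. \<phi> b b' = (if b = b' then 1 else 0)"
  using assms
proof (induction B rule: finite_induct)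
  case empty then show ?case by simp
next
  case (insert x B)
  then obtain \<phi> :: "'a \<Rightarrow> 'a \<Rightarrow>\<^sub>L real"
    where \<phi>: "\<And>b b'. b \<in> B \<Longrightarrow> b' \<in> B \<Longrightarrow> \<phi> b b' = (if b = b' then 1 else 0)"
    by (metis independent_insert)
  define p where "p v = (\<Sum>b\<in>B. \<phi> b v *\<^sub>R b)" for v
  have pB: "p b = b" if "b \<in> B" for b
  proof -
    have "p b = (\<Sum>b'\<in>B. if b' = b then b' else 0)"
      unfolding p_def by (rule sum.cong) (use \<phi> that in auto)
    then show ?thesis using insert that by simp
  qed
  have lin: "bounded_linear (\<lambda>v. v - p v)"
    unfolding p_def by (intro bounded_linear_intros)
  have "p x \<in> span B" unfolding p_def by (intro span_sum span_scale span_base)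
  moreover have "x \<notin> span B" using insert.prems insert.hyps by (simp add: independent_insert)
  ultimately have "x - p x \<noteq> 0" by auto
  then obtain \<psi> :: "'a \<Rightarrow>\<^sub>L real" where \<psi>: "\<psi> (x - p x) = 1" using exists_functional_eq_1 by blast
  define \<theta> where "\<theta> = \<psi> o\<^sub>L Blinfun (\<lambda>v. v - p v)"
  have \<theta>: "\<theta> v = \<psi> (v - p v)" for v by (simp add: \<theta>_def bounded_linear_Blinfun_apply[OF lin])
  define \<phi>' where "\<phi>' b = (if b = x then \<theta> else \<phi> b - (\<phi> b x) *\<^sub>R \<theta>)" for b
  have "\<phi>' b b' = (if b = b' then 1 else 0)" if "b \<in> insert x B" "b' \<in> insert x B" for b b'
    using that insert.hyps by (auto simp: \<phi>'_def \<theta> \<psi> pB \<phi> minus_blinfun.rep_eq scaleR_blinfun.rep_eq)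
  then show ?case by blast
qed

lemma dual_functionals_expand:
  fixes \<phi> :: "'a::real_normed_vector \<Rightarrow> 'a \<Rightarrow>\<^sub>L real"
  assumes "finite B" "\<forall>b\<in>B. \<forall>b'\<in>B. \<phi> b b' = (if b = b' then 1 else 0)" "v \<in> span B"
  shows "(\<Sum>b\<in>B. \<phi> b v *\<^sub>R b) = v"
proof -
  have "linear (\<lambda>v. \<Sum>b\<in>B. \<phi> b v *\<^sub>R b)"
    by (intro bounded_linear.linear bounded_linear_intros)
  moreover have "(\<Sum>b\<in>B. \<phi> b x *\<^sub>R b) = x" if "x \<in> B" for x
  proof -
    have "(\<Sum>b\<in>B. \<phi> b x *\<^sub>R b) = (\<Sum>b\<in>B. if b = x then b else 0)"
      by (rule sum.cong) (use assms(2) that in auto)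
    then show ?thesis using assms(1) that by simp
  qed
  ultimately show ?thesis
    using linear_eq_on_span[of "\<lambda>v. \<Sum>b\<in>B. \<phi> b v *\<^sub>R b" "\<lambda>v. v" B v] assms(3) linear_ident by blast
qed

section \<open>Inverses, the open mapping theorem and openness of the isomorphisms\<close>

lemma blinfun_inv_GL:
  assumes "T \<in> GL"
  shows "blinfun_inv T o\<^sub>L T = id_blinfun" "T o\<^sub>L blinfun_inv T = id_blinfun"
proof -
  obtain S where S: "S o\<^sub>L T = id_blinfun" "T o\<^sub>L S = id_blinfun" using assms by (auto simp: GL_def)
  have "R = S" if "R o\<^sub>L T = id_blinfun \<and> T o\<^sub>L R = id_blinfun" for R
  proof (rule blinfun_eqI)
    fix v
    have "R v = R (T (S v))" using S(2) by (metis blinfun_apply_blinfun_compose blinfun_apply_id_blinfun)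
    also have "\<dots> = S v" using that by (metis blinfun_apply_blinfun_compose blinfun_apply_id_blinfun)
    finally show "R v = S v" .
  qed
  then have "blinfun_inv T = S" unfolding blinfun_inv_def using S by (intro the_equality conjI)
  then show "blinfun_inv T o\<^sub>L T = id_blinfun" "T o\<^sub>L blinfun_inv T = id_blinfun" using S by auto
qed

lemma blinfun_inv_apply:
  assumes "T \<in> GL"
  shows "blinfun_inv T (blinfun_apply T x) = x" "blinfun_apply T (blinfun_inv T y) = y"
  using blinfun_inv_GL[OF assms] by (metis blinfun_apply_blinfun_compose blinfun_apply_id_blinfun)+

lemma GL_I:
  fixes S :: "'b::banach \<Rightarrow>\<^sub>L 'a::banach" and T :: "'a \<Rightarrow>\<^sub>L 'b"
  assumes "\<And>x. blinfun_apply S (T x) = x" "\<And>y. blinfun_apply T (S y) = y"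
  shows "T \<in> GL" "blinfun_inv T = S"
proof -
  have "S o\<^sub>L T = id_blinfun" "T o\<^sub>L S = id_blinfun" using assms by (auto intro: blinfun_eqI)
  then show T: "T \<in> GL" by (auto simp: GL_def)
  show "blinfun_inv T = S"
    by (rule blinfun_eqI) (metis T assms(2) blinfun_inv_apply(1))
qed

lemma GL_compose:
  assumes "S \<in> GL" "T \<in> GL"
  shows "S o\<^sub>L T \<in> GL" "blinfun_inv (S o\<^sub>L T) = blinfun_inv T o\<^sub>L blinfun_inv S"
  by (rule GL_I[where S="blinfun_inv T o\<^sub>L blinfun_inv S"]; simp add: blinfun_inv_apply assms)+

lemma GL_inv:
  assumes "T \<in> GL"
  shows "blinfun_inv T \<in> GL" "blinfun_inv (blinfun_inv T) = T"
  by (rule GL_I[where S=T]; simp add: blinfun_inv_apply assms)+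

lemma GL_id: "id_blinfun \<in> GL" "blinfun_inv id_blinfun = id_blinfun"
  by (rule GL_I[where S=id_blinfun]; simp)+

lemma GL_bij: assumes "T \<in> GL" shows "bij (blinfun_apply T)"
  by (rule bij_betw_byWitness[where f'="blinfun_apply (blinfun_inv T)"]) (auto simp: blinfun_inv_apply assms)

text \<open>The Baire half of the open mapping theorem: the closure of the image of some ball has
  interior. The error bound of one half is what makes the subsequent correction series
  geometric.\<close>

lemma surj_approx_preimage:
  fixes T :: "'a::banach \<Rightarrow>\<^sub>L 'b::banach"
  assumes "surj T"
  shows "\<exists>C>0. \<forall>v. \<exists>x. norm x \<le> C * norm v \<and> norm (v - T x) \<le> norm v / 2"
proof -
  define K where "K n = closure (blinfun_apply T ` cball 0 (real n))" for n :: nat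
  have "\<Union>(range K) = UNIV"
  proof -
    have "v \<in> \<Union>(range K)" for v
    proof -
      obtain x where x: "T x = v" using surjD[OF assms, of v] by metis
      obtain n :: nat where "norm x \<le> real n" using real_arch_simple by blast
      then have "v \<in> K n" unfolding K_def using x closure_subset by fastforce
      then show ?thesis by blast
    qed
    then show ?thesis by blast
  qed
  moreover have "\<exists>n. interior (K n) \<noteq> {}"
  proof (rule ccontr)
    assume "\<not> ?thesis"
    then have *: "interior (K n) = {}" for n by blast
    have "Met_TC.mtopology interior_of \<Union>(range K) = {}"
    proof (rule Met_TC.metric_Baire_category_alt)
      show "Met_TC.mcomplete TYPE('b)" 
        unfolding Met_TC.mcomplete_def by (auto simp: Cauchy_convergent_iff convergent_def)
      show "countable (range K)" by simp
      show "closedin Met_TC.mtopology S \<and> Met_TC.mtopology interior_of S = {}" if "S \<in> range K" for S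
        using that * by (auto simp: K_def)
    qed
    with \<open>\<Union>(range K) = UNIV\<close> show False by simp
  qed
  then obtain n v0 where "v0 \<in> interior (K n)" by blast
  then obtain e where e: "e > 0" "ball v0 e \<subseteq> K n" by (meson mem_interior)
  define C where "C = 4 * (real n + 1) / e"
  \<comment> \<open>Approximating both \<open>v0 + v\<close> and \<open>v0\<close> and subtracting
    moves the interior ball from \<open>v0\<close> to the origin.\<close>
  have near: "\<exists>x. norm x \<le> 2 * real n \<and> norm (v - T x) < d" if v: "norm v < e" and d: "d > 0" for v d
  proof -
    have "v0 + v \<in> K n" "v0 \<in> K n" using e v by (auto simp: dist_norm subset_eq)
    then obtain p1 p2 where p: "p1 \<in> blinfun_apply T ` cball 0 (real n)" "dist p1 (v0 + v) < d / 2"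
      "p2 \<in> blinfun_apply T ` cball 0 (real n)" "dist p2 v0 < d / 2"
      unfolding K_def closure_approachable using half_gt_zero[OF d] by blast
    then obtain x1 x2 where x12: "norm x1 \<le> real n" "p1 = T x1" "norm x2 \<le> real n" "p2 = T x2" by auto
    note p = p(2,4)[unfolded x12] and x12 = x12(1,3)
    have "v - T (x1 - x2) = (T x2 - v0) - (T x1 - (v0 + v))"
      by (simp add: blinfun.diff_right)
    then have "norm (v - T (x1 - x2)) \<le> dist (T x2) v0 + dist (T x1) (v0 + v)"
      unfolding dist_norm by (simp only: norm_triangle_ineq4)
    moreover have "norm (x1 - x2) \<le> norm x1 + norm x2" by (rule norm_triangle_ineq4)
    ultimately have "norm (x1 - x2) \<le> 2 * real n \<and> norm (v - T (x1 - x2)) < d" using p x12 by linarith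
    then show ?thesis by blast
  qed
  have "\<exists>x. norm x \<le> C * norm v \<and> norm (v - T x) \<le> norm v / 2" for v
  proof (cases "v = 0")
    case True then show ?thesis by (intro exI[of _ 0]) (simp add: blinfun.zero_right)
  next
    case False
    \<comment> \<open>Scaling brings \<open>v\<close> to norm \<open>e / 2\<close>, inside the ball;
      the error \<open>e / 4\<close> made there becomes \<open>norm v / 2\<close> after scaling
      back.\<close>
    define s where "s = e / (2 * norm v)"
    have s: "s > 0" using False e s_def by simp
    have "norm (s *\<^sub>R v) < e" using False e by (simp add: s_def)
    then obtain x where x: "norm x \<le> 2 * real n" "norm (s *\<^sub>R v - T x) < e / 4"
      using near[of "s *\<^sub>R v" "e/4"] e by auto
    have "norm (inverse s *\<^sub>R x) \<le> inverse s * (2 * real n)" using x s by simp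
    also have "\<dots> \<le> C * norm v" using False e by (simp add: s_def C_def field_simps)
    finally have "norm (inverse s *\<^sub>R x) \<le> C * norm v" .
    moreover have "v - T (inverse s *\<^sub>R x) = inverse s *\<^sub>R (s *\<^sub>R v - T x)"
      using s by (simp add: blinfun.scaleR_right scaleR_diff_right)
    then have "norm (v - T (inverse s *\<^sub>R x)) \<le> inverse s * (e / 4)" using x s by simp
    then have "norm (v - T (inverse s *\<^sub>R x)) \<le> norm v / 2" using False e by (simp add: s_def)
    ultimately show ?thesis by blast
  qed
  moreover have "C > 0" using e by (simp add: C_def)
  ultimately show ?thesis by blast
qed

text \<open>The residuals of repeated approximate solving halve at each stage, so the corrections
  form an absolutely convergent series in the complete domain, and its sum is an exact
  preimage.\<close>

lemma surj_bounded_preimage: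
  fixes T :: "'a::banach \<Rightarrow>\<^sub>L 'b::banach"
  assumes "surj T"
  shows "\<exists>C. \<forall>v. \<exists>x. T x = v \<and> norm x \<le> C * norm v"
proof -
  obtain C where C: "C > 0" and "\<forall>v. \<exists>x. norm x \<le> C * norm v \<and> norm (v - T x) \<le> norm v / 2"
    using surj_approx_preimage[OF assms] by blast
  then obtain g where g: "\<And>v. norm (g v) \<le> C * norm v" "\<And>v. norm (v - T (g v)) \<le> norm v / 2"
    using choice[of "\<lambda>v x. norm x \<le> C * norm v \<and> norm (v - T x) \<le> norm v / 2"] by blast
  have "\<exists>x. T x = v \<and> norm x \<le> (2 * C) * norm v" for v
  proof -
    define r where "r k = ((\<lambda>v. v - T (g v)) ^^ k) v" for k
    have r0: "r 0 = v" and rS: "r (Suc k) = r k - T (g (r k))" for k by (auto simp: r_def)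
    have rb: "norm (r k) \<le> norm v * (1/2) ^ k" for k
    proof (induction k)
      case 0 then show ?case by (simp add: r0)
    next
      case (Suc k)
      have "norm (r (Suc k)) \<le> norm (r k) / 2" unfolding rS by (rule g)
      with Suc show ?case by simp
    qed
    have gb: "norm (g (r k)) \<le> C * norm v * (1/2) ^ k" for k
      using order_trans[OF g(1) mult_left_mono[OF rb]] C by (simp add: mult.assoc)
    have geo: "(\<lambda>k. C * norm v * (1/2) ^ k) sums (C * norm v * 2)"
      using sums_mult[OF geometric_sums[of "1/2::real"], of "C * norm v"] by simp
    have sn: "summable (\<lambda>k. norm (g (r k)))"
      by (rule summable_comparison_test'[OF sums_summable[OF geo], of 0]) (use gb in auto)
    then have sg: "summable (\<lambda>k. g (r k))" by (rule summable_norm_cancel)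
    define x where "x = suminf (\<lambda>k. g (r k))"
    have part: "T (\<Sum>k<n. g (r k)) = v - r n" for n
      by (induction n) (auto simp: r0 rS blinfun.add_right blinfun.zero_right)
    have "(\<lambda>n. T (\<Sum>k<n. g (r k))) \<longlonglongrightarrow> T x"
      unfolding x_def by (intro tendsto_intros summable_LIMSEQ sg)
    moreover have "(\<lambda>n. v - r n) \<longlonglongrightarrow> v - 0"
    proof (intro tendsto_intros)
      have "(\<lambda>k. norm v * (1/2) ^ k) \<longlonglongrightarrow> norm v * 0" by (intro tendsto_intros LIMSEQ_power_zero) simp
      then show "r \<longlonglongrightarrow> 0" by (intro Lim_null_comparison[of r]) (use rb in auto)
    qed
    ultimately have "T x = v" using part LIMSEQ_unique by fastforce
    moreover have "norm x \<le> suminf (\<lambda>k. norm (g (r k)))" unfolding x_def by (rule summable_norm[OF sn])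
    moreover have "suminf (\<lambda>k. norm (g (r k))) \<le> C * norm v * 2"
      using suminf_le[OF gb sn sums_summable[OF geo]] sums_unique[OF geo] by simp
    ultimately show ?thesis by (auto simp: mult.commute mult.left_commute)
  qed
  then show ?thesis by blast
qed

lemma GL_iff_bij: "T \<in> GL \<longleftrightarrow> bij (blinfun_apply T)" for T :: "'a::banach \<Rightarrow>\<^sub>L 'b::banach"
proof
  assume bij: "bij (blinfun_apply T)"
  obtain C where C: "\<And>v. \<exists>x. T x = v \<and> norm x \<le> C * norm v"
    using surj_bounded_preimage[of T] bij by (auto simp: bij_def)
  define g where "g = inv_into UNIV (blinfun_apply T)"
  have g: "g (T x) = x" "T (g y) = y" for x y
    using bij by (auto simp: g_def bij_def surj_f_inv_f)
  have "bounded_linear g"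
  proof (rule bounded_linear_intro[where K=C])
    show "g (x + y) = g x + g y" for x y by (metis g blinfun.add_right)
    show "g (r *\<^sub>R x) = r *\<^sub>R g x" for r x by (metis g blinfun.scaleR_right)
    show "norm (g x) \<le> norm x * C" for x using C[of x] by (metis g(1) mult.commute)
  qed
  then show "T \<in> GL" by (intro GL_I[where S="Blinfun g"]) (auto simp: bounded_linear_Blinfun_apply g)
qed (rule GL_bij)

text \<open>The equation \<open>S x = y\<close> is the fixed point problem for a contraction built
  from the inverse of \<open>T\<close>; the lower bound \<open>low\<close> supplies injectivity and
  the norm of the new inverse at once.\<close>

lemma GL_perturb:
  fixes S T :: "'a::banach \<Rightarrow>\<^sub>L 'b::banach"
  assumes T: "T \<in> GL" and d: "norm (S - T) * norm (blinfun_inv T) \<le> 1 / 2"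
  shows "S \<in> GL" "norm (blinfun_inv S) \<le> 2 * norm (blinfun_inv T)"
proof -
  define M where "M = norm (blinfun_inv T)"
  have d: "norm (S - T) * M \<le> 1/2" using d M_def by simp
  have low: "norm x \<le> 2 * M * norm (S x)" for x
  proof -
    have "x = blinfun_inv T (S x - (S - T) x)" by (simp add: blinfun_inv_apply[OF T] minus_blinfun.rep_eq)
    then have "norm x \<le> M * norm (S x - (S - T) x)" using norm_blinfun M_def by metis
    also have "\<dots> \<le> M * (norm (S x) + norm (S - T) * norm x)"
      by (intro mult_left_mono order_trans[OF norm_triangle_ineq4] add_mono norm_blinfun) (auto simp: M_def)
    also have "\<dots> \<le> M * norm (S x) + 1/2 * norm x"
      using mult_right_mono[OF d, of "norm x"] by (simp add: algebra_simps)
    finally show ?thesis by simp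
  qed
  have "\<exists>x. S x = y" for y
  proof -
    define f where "f x = blinfun_inv T (y - (S - T) x)" for x
    have "dist (f x) (f x') \<le> 1/2 * dist x x'" for x x'
    proof -
      have "f x - f x' = blinfun_inv T ((S - T) (x' - x))"
        by (simp add: f_def blinfun.diff_right)
      then have "norm (f x - f x') \<le> M * (norm (S - T) * norm (x' - x))"
        unfolding M_def
        by (simp only:) (intro order_trans[OF norm_blinfun] mult_left_mono norm_blinfun norm_ge_zero)
      also have "\<dots> \<le> 1/2 * norm (x' - x)" using mult_right_mono[OF d, of "norm (x' - x)"] by (simp add: algebra_simps)
      finally show ?thesis by (simp add: dist_norm norm_minus_commute)
    qed
    then obtain x where "f x = x" using banach_fix_type[of "1/2" f] by auto
    then have "T x = y - (S - T) x" by (metis f_def blinfun_inv_apply(2)[OF T])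
    then show ?thesis by (auto simp: minus_blinfun.rep_eq)
  qed
  then have "surj S" by (metis surj_def)
  moreover have "inj S"
  proof (rule injI)
    fix x y assume "S x = S y"
    then have "S (x - y) = 0" by (simp add: blinfun.diff_right)
    then show "x = y" using low[of "x - y"] by simp
  qed
  ultimately show S: "S \<in> GL" by (simp add: GL_iff_bij bij_def)
  show "norm (blinfun_inv S) \<le> 2 * norm (blinfun_inv T)"
  proof (rule norm_blinfun_bound)
    show "norm (blinfun_inv S v) \<le> 2 * norm (blinfun_inv T) * norm v" for v
      using low[of "blinfun_inv S v"] by (simp add: blinfun_inv_apply[OF S] M_def)
  qed simp
qed

lemma open_GL: "open (GL :: ('a::banach \<Rightarrow>\<^sub>L 'b::banach) set)"
proof (unfold open_contains_ball, intro ballI)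
  fix T :: "'a \<Rightarrow>\<^sub>L 'b" assume T: "T \<in> GL"
  define M where "M = norm (blinfun_inv T)"
  have "S \<in> GL" if "dist T S < 1 / (2 * (M + 1))" for S
  proof (rule GL_perturb(1)[OF T])
    have "norm (S - T) * M \<le> 1 / (2 * (M + 1)) * M"
      using that by (intro mult_right_mono) (auto simp: dist_norm norm_minus_commute M_def)
    also have "\<dots> \<le> 1/2" using norm_ge_zero[of "blinfun_inv T", folded M_def] by (simp add: field_simps)
    finally show "norm (S - T) * norm (blinfun_inv T) \<le> 1/2" by (simp add: M_def)
  qed
  then show "\<exists>e>0. ball T e \<subseteq> GL"
    by (intro exI[of _ "1 / (2 * (M + 1))"]) (auto simp: M_def intro: add_nonneg_pos)
qed

lemma tendsto_blinfun_inv: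
  fixes T :: "'a::banach \<Rightarrow>\<^sub>L 'b::banach"
  assumes T: "T \<in> GL" and S: "(S \<longlongrightarrow> T) F"
  shows "((\<lambda>x. blinfun_inv (S x)) \<longlongrightarrow> blinfun_inv T) F"
proof -
  define M where "M = norm (blinfun_inv T)"
  have lim: "((\<lambda>x. norm (S x - T)) \<longlongrightarrow> 0) F" using S by (simp add: tendsto_norm_zero_iff LIM_zero_iff)
  have M0: "M \<ge> 0" by (simp add: M_def)
  have "eventually (\<lambda>x. norm (S x - T) < 1 / (2 * (M + 1))) F"
    using M0 by (intro order_tendstoD(2)[OF lim]) simp
  then have ev: "eventually (\<lambda>x. norm (blinfun_inv (S x) - blinfun_inv T) \<le> 2 * M * norm (S x - T) * M) F"
  proof eventually_elim
    case (elim x)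
    have "norm (S x - T) * M \<le> 1 / (2 * (M + 1)) * M" using elim M0 by (intro mult_right_mono) auto
    also have "\<dots> \<le> 1/2" using M0 by (simp add: field_simps)
    finally have *: "norm (S x - T) * norm (blinfun_inv T) \<le> 1/2" by (simp add: M_def)
    note Sx = GL_perturb[OF T *]
    \<comment> \<open>The resolvent identity: the difference of two inverses has the difference of
      the operators as a factor.\<close>
    have eq: "blinfun_inv (S x) - blinfun_inv T = blinfun_inv (S x) o\<^sub>L (T - S x) o\<^sub>L blinfun_inv T"
      by (rule blinfun_eqI) (simp add: minus_blinfun.rep_eq blinfun_inv_apply T Sx(1) blinfun.diff_right)
    have "norm (blinfun_inv (S x) - blinfun_inv T) \<le> norm (blinfun_inv (S x)) * norm (T - S x) * M"
      unfolding eq M_def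
      by (intro order_trans[OF norm_blinfun_compose] mult_right_mono norm_blinfun_compose) simp
    also have "\<dots> \<le> 2 * M * norm (T - S x) * M" using Sx(2) M0 by (intro mult_right_mono) (auto simp: M_def)
    finally show ?case by (simp add: norm_minus_commute)
  qed
  have "((\<lambda>x. 2 * M * norm (S x - T) * M) \<longlongrightarrow> 2 * M * 0 * M) F"
    by (intro tendsto_intros lim)
  then have "((\<lambda>x. blinfun_inv (S x) - blinfun_inv T) \<longlongrightarrow> 0) F"
    by (intro Lim_null_comparison[OF ev]) simp
  then show ?thesis by (simp add: LIM_zero_iff)
qed

lemma continuous_on_blinfun_inv [continuous_intros]:
  fixes T :: "'c::topological_space \<Rightarrow> 'a::banach \<Rightarrow>\<^sub>L 'b::banach"
  assumes "continuous_on X T" "\<And>x. x \<in> X \<Longrightarrow> T x \<in> GL"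
  shows "continuous_on X (\<lambda>x. blinfun_inv (T x))"
  using assms unfolding continuous_on_def by (blast intro: tendsto_blinfun_inv)

section \<open>Finite-dimensional subspaces and perturbation of index-zero operators\<close>

lemma fin_dim_basis:
  assumes "fin_dim S"
  obtains B where "finite B" "independent B" "span B = S" "card B = dim S"
proof -
  obtain A where A: "finite A" "span A = S" using assms by (auto simp: fin_dim_def)
  obtain B where B: "B \<subseteq> A" "independent B" "A \<subseteq> span B"
    using maximal_independent_subset by blast
  have "span B = S"
    using A(2) B by (metis span_mono span_span subset_antisym)
  moreover have "finite B" using A B finite_subset by blast
  moreover have "card B = dim S" using B(2) \<open>span B = S\<close> dim_eq_card_independent dim_span by metis
  ultimately show ?thesis using that B by blast
qed

lemma fin_dim_span: "finite B \<Longrightarrow> fin_dim (span B)"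
  by (auto simp: fin_dim_def)

lemma fin_dim_subset:
  assumes "fin_dim S" "subspace R" "R \<subseteq> S"
  shows "fin_dim R"
proof -
  obtain A where A: "finite A" "span A = S" using assms by (auto simp: fin_dim_def)
  obtain B where B: "B \<subseteq> R" "independent B" "R \<subseteq> span B" using maximal_independent_subset by blast
  have "finite B" using independent_span_bound[OF A(1) B(2)] A(2) B(1) assms(3) by blast
  moreover have "span B = R" using B assms(2) by (meson span_minimal subset_antisym)
  ultimately show ?thesis by (auto simp: fin_dim_def)
qed

lemma subspace_ker: "subspace (ker T)"
  by (auto simp: ker_def subspace_def blinfun.zero_right blinfun.add_right blinfun.scaleR_right)

lemma ker_zero_inj: "inj (blinfun_apply T) \<longleftrightarrow> ker T = {0}"
proof
  assume i: "inj (blinfun_apply T)"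
  have "x = 0" if "T x = 0" for x
    using injD[OF i, of x 0] that by (simp add: blinfun.zero_right)
  then show "ker T = {0}" by (auto simp: ker_def blinfun.zero_right)
next
  assume k: "ker T = {0}"
  show "inj (blinfun_apply T)"
  proof (rule injI)
    fix x y assume "T x = T y"
    then have "x - y \<in> ker T" by (simp add: ker_def blinfun.diff_right)
    then show "x = y" using k by simp
  qed
qed

lemma range_blinfun_subspace: "subspace (range (blinfun_apply T))"
  by (intro linear_subspace_image subspace_UNIV bounded_linear.linear blinfun.bounded_linear_right)

lemma bounded_linear_sum_functionals:
  fixes \<phi> :: "'c \<Rightarrow> 'a::real_normed_vector \<Rightarrow>\<^sub>L real"
  shows "bounded_linear (\<lambda>v. \<Sum>b\<in>B. \<phi> b v *\<^sub>R f b)"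
  by (intro bounded_linear_intros)

definition finrank :: "'c set \<Rightarrow> ('c \<Rightarrow> 'a::real_normed_vector \<Rightarrow>\<^sub>L real) \<Rightarrow> ('c \<Rightarrow> 'b::real_normed_vector) \<Rightarrow> 'a \<Rightarrow>\<^sub>L 'b" where
  "finrank B \<phi> f = Blinfun (\<lambda>v. \<Sum>b\<in>B. \<phi> b v *\<^sub>R f b)"

lemma finrank_apply: "blinfun_apply (finrank B \<phi> f) v = (\<Sum>b\<in>B. \<phi> b v *\<^sub>R f b)"
  by (simp add: finrank_def bounded_linear_Blinfun_apply bounded_linear_sum_functionals)

text \<open>Index zero gives the kernel and a complement of the range bases of equal size. A
  bijection between them, extended to the whole space by dual functionals, carries the kernel onto
  the complement and fills both defects.\<close>

lemma Fredholm0_perturb_GL: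
  fixes T :: "'a::banach \<Rightarrow>\<^sub>L 'b::banach"
  assumes "T \<in> Fredholm0"
  shows "\<exists>W Y. fin_dim W \<and> range (blinfun_apply Y) \<subseteq> W \<and> T + Y \<in> GL"
proof -
  obtain W where W: "subspace W" "fin_dim W" "dim W = dim (ker T)" "range T \<inter> W = {0}"
    "{s + w | s w. s \<in> range T \<and> w \<in> W} = UNIV" and fk: "fin_dim (ker T)"
    using assms by (auto simp: Fredholm0_def has_codim_def)
  obtain B where B: "finite B" "independent B" "span B = ker T" "card B = dim (ker T)"
    using fin_dim_basis[OF fk] .
  obtain C where C: "finite C" "independent C" "span C = W" "card C = dim W"
    using fin_dim_basis[OF W(2)] .
  obtain c where c: "bij_betw c B C" using finite_same_card_bij[of B C] B C W(3) by metis
  obtain \<phi> :: "'a \<Rightarrow> 'a \<Rightarrow>\<^sub>L real" where \<phi>: "\<forall>b\<in>B. \<forall>b'\<in>B. \<phi> b b' = (if b = b' then 1 else 0)"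
    using dual_functionals[OF B(1,2)] by blast
  define Y where "Y = finrank B \<phi> c"
  have Y: "Y v = (\<Sum>b\<in>B. \<phi> b v *\<^sub>R c b)" for v by (simp add: Y_def finrank_apply)
  have YW: "range Y \<subseteq> W"
  proof safe
    fix v
    have "c b \<in> span C" if "b \<in> B" for b using c that by (auto simp: bij_betw_def intro: span_base)
    then show "Y v \<in> W" unfolding Y C(3)[symmetric] by (intro span_sum span_scale) auto
  qed
  have indep: "(\<Sum>b\<in>B. r b *\<^sub>R c b) = 0 \<Longrightarrow> b \<in> B \<Longrightarrow> r b = 0" for r b
  proof -
    assume 0: "(\<Sum>b\<in>B. r b *\<^sub>R c b) = 0" and b: "b \<in> B"
    have "(\<Sum>x\<in>C. r (inv_into B c x) *\<^sub>R x) = (\<Sum>b\<in>B. r b *\<^sub>R c b)"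
      by (rule sum.reindex_bij_betw[OF c, symmetric, THEN trans]) (use c in \<open>auto simp: bij_betw_def inv_into_f_f intro!: sum.cong\<close>)
    then have "r (inv_into B c x) = 0" if "x \<in> C" for x
      using independentD[OF C(2,1) order_refl] 0 that by metis
    then show "r b = 0" using c b by (metis bij_betw_def bij_betwE inv_into_f_f)
  qed
  have "inj (T + Y)"
  proof -
    have "x = 0" if x: "(T + Y) x = 0" for x
    proof -
      have e: "T x = - Y x" using x by (simp add: plus_blinfun.rep_eq eq_neg_iff_add_eq_0)
      then have "T x \<in> W" using YW W(1) by (auto simp: subspace_neg image_subset_iff)
      then have "T x \<in> range T \<inter> W" by blast
      then have T0: "T x = 0" using W(4) by auto
      then have "Y x = 0" using e by simp
      then have "\<phi> b x = 0" if "b \<in> B" for b using indep[of "\<lambda>b. \<phi> b x"] that by (simp add: Y)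
      moreover have "x \<in> span B" using T0 B by (simp add: ker_def)
      ultimately show "x = 0" using dual_functionals_expand[OF B(1) \<phi>, of x] by simp
    qed
    then have "ker (T + Y) = {0}" by (auto simp: ker_def blinfun.zero_right)
    then show ?thesis by (simp add: ker_zero_inj)
  qed
  moreover have "surj (T + Y)"
  proof -
    have "\<exists>x. (T + Y) x = v" for v
    proof -
      have "v \<in> {s + w | s w. s \<in> range T \<and> w \<in> W}" using W(5) by simp
      then obtain x w where v: "v = T x + w" "w \<in> W" by blast
      \<comment> \<open>\<open>Y\<close> acts on \<open>x\<close> as well; that contribution stays
        in \<open>W\<close> and is subtracted before the rest is produced from the kernel.\<close>
      define w' where "w' = w - Y x"
      have "w' \<in> W" using v(2) YW W(1) by (auto simp: w'_def image_subset_iff subspace_diff)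
      then obtain r where r: "(\<Sum>x\<in>C. r x *\<^sub>R x) = w'" using C(1,3) span_finite by fastforce
      define k where "k = (\<Sum>b\<in>B. r (c b) *\<^sub>R b)"
      have "k \<in> span B" unfolding k_def by (intro span_sum span_scale span_base)
      then have Tk: "T k = 0" using B by (auto simp: ker_def)
      have \<phi>k: "\<phi> b k = r (c b)" if "b \<in> B" for b
      proof -
        have "\<phi> b k = (\<Sum>b'\<in>B. if b' = b then r (c b') else 0)"
          unfolding k_def blinfun.sum_right
          by (rule sum.cong) (use \<phi> that in \<open>auto simp: blinfun.scaleR_right\<close>)
        then show ?thesis using B(1) that by simp
      qed
      have "Y k = (\<Sum>b\<in>B. r (c b) *\<^sub>R c b)" unfolding Y by (rule sum.cong) (auto simp: \<phi>k)
      also have "\<dots> = w'" unfolding r[symmetric] by (rule sum.reindex_bij_betw[OF c])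
      finally have "(T + Y) (x + k) = v"
        by (simp add: plus_blinfun.rep_eq blinfun.add_right Tk v w'_def)
      then show ?thesis by blast
    qed
    then show ?thesis by (metis surjI)
  qed
  ultimately have "T + Y \<in> GL" by (simp add: GL_iff_bij bij_def)
  then show ?thesis using W(2) YW by blast
qed

section \<open>Lifting a path to isomorphisms modulo a finite-dimensional space\<close>

definition lift_on :: "real \<Rightarrow> real \<Rightarrow> 'b set \<Rightarrow> (real \<Rightarrow> 'a::banach \<Rightarrow>\<^sub>L 'b::banach) \<Rightarrow> (real \<Rightarrow> 'a \<Rightarrow>\<^sub>L 'b) \<Rightarrow> bool" where
  "lift_on a b W L T \<longleftrightarrow> continuous_on {a..b} T \<and>
     (\<forall>l\<in>{a..b}. T l \<in> GL \<and> range (blinfun_apply (T l - L l)) \<subseteq> W)"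

lemma lift_onD:
  assumes "lift_on a b W L T" "l \<in> {a..b}"
  shows "T l \<in> GL" "blinfun_apply (T l) x - blinfun_apply (L l) x \<in> W"
proof -
  show "T l \<in> GL" using assms by (simp add: lift_on_def)
  have "blinfun_apply (T l - L l) x \<in> W" using assms unfolding lift_on_def by blast
  then show "blinfun_apply (T l) x - blinfun_apply (L l) x \<in> W" by (simp add: minus_blinfun.rep_eq)
qed

text \<open>The two lifts may disagree at \<open>p\<close>. The isomorphism \<open>A\<close> that
  matches them there is the identity modulo \<open>W\<close>, so composing with it on the left
  changes the second lift only by operators with values in \<open>W\<close>.\<close>

lemma lift_on_append:
  fixes L :: "real \<Rightarrow> 'a::banach \<Rightarrow>\<^sub>L 'b::banach"
  assumes W: "subspace W" and 1: "lift_on a p W L T1" and 2: "lift_on p b W L T2" and ab: "a \<le> p" "p \<le> b"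
  shows "\<exists>T. lift_on a b W L T"
proof -
  define A where "A = T1 p o\<^sub>L blinfun_inv (T2 p)"
  define T where "T l = (if l \<le> p then T1 l else A o\<^sub>L T2 l)" for l
  have T1p: "T1 p \<in> GL" and T2p: "T2 p \<in> GL" using 1 2 ab by (auto simp: lift_on_def)
  have AGL: "A \<in> GL" unfolding A_def by (intro GL_compose GL_inv T1p T2p)
  have ap: "A o\<^sub>L T2 p = T1 p" unfolding A_def by (rule blinfun_eqI) (simp add: blinfun_inv_apply T2p)
  have AW: "A v - v \<in> W" for v
  proof -
    define x where "x = blinfun_inv (T2 p) v"
    have "A v - v = (T1 p x - L p x) - (T2 p x - L p x)"
      by (simp add: A_def x_def minus_blinfun.rep_eq blinfun_inv_apply T2p)
    moreover have "T1 p x - L p x \<in> W" "T2 p x - L p x \<in> W"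
      using lift_onD(2)[OF 1] lift_onD(2)[OF 2] ab by auto
    ultimately show ?thesis using subspace_diff[OF W] by metis
  qed
  have "continuous_on ({a..p} \<union> {p..b}) T"
    unfolding T_def
  proof (rule continuous_on_cases)
    show "continuous_on {a..p} T1" using 1 by (simp add: lift_on_def)
    show "continuous_on {p..b} (\<lambda>l. A o\<^sub>L T2 l)" using 2 by (auto simp: lift_on_def intro!: continuous_intros)
  qed (use ap in auto)
  moreover have "{a..p} \<union> {p..b} = {a..b}" using ab by auto
  moreover have "T l \<in> GL \<and> range (T l - L l) \<subseteq> W" if l: "l \<in> {a..b}" for l
  proof (cases "l \<le> p")
    case True then show ?thesis using 1 l by (auto simp: lift_on_def T_def)
  next
    case False
    then have l2: "T2 l \<in> GL" "\<And>x. T2 l x - L l x \<in> W" using lift_onD[OF 2] l by auto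
    have "(T l - L l) x \<in> W" for x
    proof -
      have "(T l - L l) x = (A (T2 l x) - T2 l x) + (T2 l x - L l x)"
        using False by (simp add: T_def minus_blinfun.rep_eq)
      then show ?thesis using subspace_add[OF W AW l2(2)] by metis
    qed
    then show ?thesis using False AGL l2 by (auto simp: T_def GL_compose)
  qed
  ultimately show ?thesis unfolding lift_on_def by metis
qed

text \<open>Near one parameter a constant perturbation works because \<open>GL\<close> is open;
  Bolzano subdivision and gluing extend this to the interval.\<close>

lemma lift_on_exists:
  fixes L :: "real \<Rightarrow> 'a::banach \<Rightarrow>\<^sub>L 'b::banach"
  assumes W: "subspace W" and L: "continuous_on {a..b} L" and "a \<le> b"
    and pert: "\<And>l. l \<in> {a..b} \<Longrightarrow> \<exists>Y. range (blinfun_apply Y) \<subseteq> W \<and> L l + Y \<in> GL"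
  shows "\<exists>T. lift_on a b W L T"
proof -
  define P where "P s t \<longleftrightarrow> (a \<le> s \<and> t \<le> b \<longrightarrow> (\<exists>T. lift_on s t W L T))" for s t
  have "P a b"
    using \<open>a \<le> b\<close>
  proof (induction rule: Bolzano)
    case (trans s p t)
    then show ?case unfolding P_def using lift_on_append[OF W] by (meson order_trans)
  next
    case (local x)
    then obtain Y where Y: "range (blinfun_apply Y) \<subseteq> W" "L x + Y \<in> GL" using pert[of x] by auto
    have "continuous_on {a..b} (\<lambda>l. L l + Y)" by (intro continuous_intros L)
    from continuous_on_open_nbhd[OF this open_GL, of x] obtain d where d: "d > 0" "\<And>l. \<bar>l - x\<bar> < d \<Longrightarrow> l \<in> {a..b} \<Longrightarrow> L l + Y \<in> GL"
      using local Y(2) unfolding dist_real_def by (metis atLeastAtMost_iff)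
    have "P s t" if "s \<le> x \<and> x \<le> t \<and> t - s < d" for s t
      unfolding P_def
    proof (intro impI exI)
      assume st: "a \<le> s \<and> t \<le> b"
      show "lift_on s t W L (\<lambda>l. L l + Y)"
        unfolding lift_on_def using st that Y(1) d(2)
        by (auto intro!: continuous_intros continuous_on_subset[OF L])
    qed
    then show ?case using d(1) by blast
  qed
  then show ?thesis by (simp add: P_def)
qed

section \<open>Degree of sphere maps and orientation signs\<close>

definition sph :: "nat \<Rightarrow> (nat \<Rightarrow> real) set" where
  "sph m = {x. (\<Sum>i\<le>m. (x i)\<^sup>2) = 1 \<and> (\<forall>i>m. x i = 0)}"

lemma nsphere_eq_sph: "nsphere m = top_of_set (sph m)"
  unfolding nsphere sph_def by (simp add: euclidean_product_topology)

definition unitize :: "nat \<Rightarrow> (nat \<Rightarrow> real) \<Rightarrow> nat \<Rightarrow> real" where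
  "unitize m y = (\<lambda>i. if i \<le> m then y i / sqrt (\<Sum>j\<le>m. (y j)\<^sup>2) else 0)"

text \<open>The degree of the radial projection of \<open>G\<close> on the unit sphere of the
  coordinates \<open>0..m\<close>. It is meaningful when these coordinates of \<open>G\<close> have
  no common zero on the sphere, which is why \<open>sdeg_homotopy\<close> asks for this throughout
  the deformation.\<close>

definition sdeg :: "nat \<Rightarrow> ((nat \<Rightarrow> real) \<Rightarrow> nat \<Rightarrow> real) \<Rightarrow> int" where
  "sdeg m G = Brouwer_degree2 m (\<lambda>x. unitize m (G x))"

lemma sum_squares_pos: "(i::nat) \<le> m \<Longrightarrow> y i \<noteq> 0 \<Longrightarrow> (\<Sum>j\<le>m. (y j)\<^sup>2) > (0::real)"
  by (rule sum_pos2[of _ i]) auto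

lemma unitize_in_sph:
  assumes "i \<le> m" "y i \<noteq> 0" shows "unitize m y \<in> sph m"
proof -
  define r where "r = (\<Sum>j\<le>m. (y j)\<^sup>2)"
  have r: "r > 0" unfolding r_def using assms by (rule sum_squares_pos)
  have "(\<Sum>i\<le>m. (unitize m y i)\<^sup>2) = (\<Sum>i\<le>m. (y i)\<^sup>2 / r)"
    by (rule sum.cong) (use r in \<open>auto simp: unitize_def r_def[symmetric] power_divide\<close>)
  also have "\<dots> = 1" using r by (simp add: r_def flip: sum_divide_distrib)
  finally show ?thesis by (simp add: sph_def unitize_def)
qed

lemma unitize_cong: "(\<And>i. i \<le> m \<Longrightarrow> y i = z i) \<Longrightarrow> unitize m y = unitize m z"
proof -
  assume *: "\<And>i. i \<le> m \<Longrightarrow> y i = z i"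
  then have "(\<Sum>j\<le>m. (y j)\<^sup>2) = (\<Sum>j\<le>m. (z j)\<^sup>2)" by simp
  with * show ?thesis by (simp add: unitize_def fun_eq_iff)
qed

lemma unitize_scale: "c > 0 \<Longrightarrow> unitize m (\<lambda>i. c * y i) = unitize m y"
  unfolding unitize_def by (intro ext) (auto simp: power_mult_distrib real_sqrt_mult simp flip: sum_distrib_left)

lemma unitize_sph: "x \<in> sph m \<Longrightarrow> unitize m x = x"
  unfolding unitize_def sph_def by (intro ext) auto

lemma sph_nonzero: "x \<in> sph m \<Longrightarrow> \<exists>i\<le>m. x i \<noteq> 0"
proof (rule ccontr)
  assume "x \<in> sph m" "\<not> (\<exists>i\<le>m. x i \<noteq> 0)"
  then have "(\<Sum>i\<le>m. (x i)\<^sup>2) = 1" "\<And>i. i \<le> m \<Longrightarrow> x i = 0" by (simp_all add: sph_def)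
  then show False by simp
qed

lemma continuous_on_unitize:
  fixes G :: "'c::topological_space \<Rightarrow> nat \<Rightarrow> real"
  assumes "\<And>i. i \<le> m \<Longrightarrow> continuous_on X (\<lambda>x. G x i)" "\<And>x. x \<in> X \<Longrightarrow> \<exists>i\<le>m. G x i \<noteq> 0"
  shows "continuous_on X (\<lambda>x. unitize m (G x))"
proof (rule continuous_on_coordinatewise_then_product)
  fix i
  show "continuous_on X (\<lambda>x. unitize m (G x) i)"
  proof (cases "i \<le> m")
    case True
    have "(\<Sum>j\<le>m. (G x j)\<^sup>2) \<noteq> 0" if "x \<in> X" for x
      using assms(2)[OF that] sum_squares_pos[of _ m "G x"] by fastforce
    then have "continuous_on X (\<lambda>x. G x i / sqrt (\<Sum>j\<le>m. (G x j)\<^sup>2))"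
      using True by (intro continuous_intros assms(1)) auto
    then show ?thesis using True by (simp add: unitize_def)
  next
    case False then show ?thesis by (simp add: unitize_def)
  qed
qed

lemma sdeg_cong:
  assumes "\<And>x i. x \<in> sph m \<Longrightarrow> i \<le> m \<Longrightarrow> G x i = H x i" shows "sdeg m G = sdeg m H"
  unfolding sdeg_def
  by (rule Brouwer_degree2_eq, rule unitize_cong) (simp add: nsphere_eq_sph assms)

lemma sdeg_homotopy:
  assumes cont: "\<And>i. i \<le> m \<Longrightarrow> continuous_on ({0..1} \<times> sph m) (\<lambda>p. G (fst p) (snd p) i)"
    and nz: "\<And>s x. s \<in> {0..1} \<Longrightarrow> x \<in> sph m \<Longrightarrow> \<exists>i\<le>m. G s x i \<noteq> 0"
  shows "sdeg m (G (0::real)) = sdeg m (G 1)"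
  unfolding sdeg_def
proof (rule Brouwer_degree2_homotopic)
  let ?h = "\<lambda>p. unitize m (G (fst p) (snd p))"
  have "continuous_on ({0..1} \<times> sph m) ?h"
    by (rule continuous_on_unitize[OF cont]) (use nz in auto)
  moreover have "?h ` ({0..1} \<times> sph m) \<subseteq> sph m"
  proof (intro image_subsetI)
    fix p :: "real \<times> (nat \<Rightarrow> real)" assume "p \<in> {0..1} \<times> sph m"
    then obtain i where "i \<le> m" "G (fst p) (snd p) i \<noteq> 0" using nz[of "fst p" "snd p"] by (auto simp: mem_Times_iff)
    then show "unitize m (G (fst p) (snd p)) \<in> sph m" by (rule unitize_in_sph)
  qed
  ultimately show "homotopic_with (\<lambda>x. True) (nsphere m) (nsphere m) (\<lambda>x. unitize m (G 0 x)) (\<lambda>x. unitize m (G 1 x))"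
    unfolding nsphere_eq_sph homotopic_with_def
    by (intro exI[of _ ?h]) (auto simp: continuous_map_in_subtopology image_subset_iff
      simp flip: subtopology_Times)
qed

section \<open>Degrees of linear sphere maps\<close>

text \<open>An injective linear map of the coordinates \<open>0..m\<close>. Values at larger indices
  are left free, so such maps are compared only up to \<open>m\<close>.\<close>

definition linm :: "nat \<Rightarrow> ((nat \<Rightarrow> real) \<Rightarrow> nat \<Rightarrow> real) \<Rightarrow> bool" where
  "linm m A \<longleftrightarrow> (\<exists>M. \<forall>x. \<forall>i\<le>m. A x i = (\<Sum>j\<le>m. M i j * x j)) \<and>
     (\<forall>x. (\<exists>j\<le>m. x j \<noteq> 0) \<longrightarrow> (\<exists>i\<le>m. A x i \<noteq> 0))"

lemma linmI:
  assumes "\<And>x i. i \<le> m \<Longrightarrow> A x i = (\<Sum>j\<le>m. M i j * x j)"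
    "\<And>x j. j \<le> m \<Longrightarrow> x j \<noteq> 0 \<Longrightarrow> \<exists>i\<le>m. A x i \<noteq> 0"
  shows "linm m A"
  unfolding linm_def
proof (intro conjI allI impI)
  show "\<exists>M. \<forall>x. \<forall>i\<le>m. A x i = (\<Sum>j\<le>m. M i j * x j)" using assms(1) by (intro exI[of _ M]) simp
  show "\<exists>i\<le>m. A x i \<noteq> 0" if "\<exists>j\<le>m. x j \<noteq> 0" for x using that assms(2)[of _ x] by (elim exE conjE)
qed

lemma linm_nonzero: "linm m A \<Longrightarrow> j \<le> m \<Longrightarrow> x j \<noteq> 0 \<Longrightarrow> \<exists>i\<le>m. A x i \<noteq> 0"
  unfolding linm_def by (elim conjE allE[of _ x]) blast

lemma linm_cong:
  assumes "linm m A" "\<And>i. i \<le> m \<Longrightarrow> x i = y i" "i \<le> m" shows "A x i = A y i"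
proof -
  obtain M where M: "\<And>x i. i \<le> m \<Longrightarrow> A x i = (\<Sum>j\<le>m. M i j * x j)" using assms(1) unfolding linm_def by blast
  show ?thesis unfolding M[OF assms(3)] by (rule sum.cong) (auto simp: assms(2))
qed

lemma linm_scale: assumes "linm m A" "i \<le> m" shows "A (\<lambda>i. c * x i) i = c * A x i"
proof -
  obtain M where M: "\<And>x i. i \<le> m \<Longrightarrow> A x i = (\<Sum>j\<le>m. M i j * x j)" using assms(1) unfolding linm_def by blast
  show ?thesis unfolding M[OF assms(2)] by (simp add: sum_distrib_left mult.left_commute)
qed

lemma continuous_on_linm: assumes "linm m A" "i \<le> m" shows "continuous_on X (\<lambda>x. A x i)"
proof -
  obtain M where M: "\<And>x i. i \<le> m \<Longrightarrow> A x i = (\<Sum>j\<le>m. M i j * x j)" using assms(1) unfolding linm_def by blast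
  have "continuous_on X (\<lambda>x. \<Sum>j\<le>m. M i j * x j)"
    by (intro continuous_intros continuous_on_subset[OF continuous_on_product_coordinates]) simp
  then show ?thesis by (simp add: M[OF assms(2)])
qed

lemma continuous_map_linm: assumes "linm m A"
  shows "continuous_map (nsphere m) (nsphere m) (\<lambda>x. unitize m (A x))"
proof -
  have nz: "\<exists>i\<le>m. A x i \<noteq> 0" if "x \<in> sph m" for x using assms sph_nonzero[OF that] unfolding linm_def by blast
  have "continuous_on (sph m) (\<lambda>x. unitize m (A x))"
    by (rule continuous_on_unitize[OF continuous_on_linm[OF assms] nz])
  then show ?thesis unfolding nsphere_eq_sph using nz unitize_in_sph[of _ m]
    by (auto simp: continuous_map_in_subtopology image_subset_iff)
qed

text \<open>Normalizing between the two maps multiplies by a positive factor; the outer map passes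
  it on by linearity and the final normalization removes it. Multiplicativity of the degree then
  applies.\<close>

lemma sdeg_compose:
  assumes A: "linm m A" and B: "linm m B"
  shows "sdeg m (\<lambda>x. A (B x)) = sdeg m A * sdeg m B"
proof -
  have "sdeg m (\<lambda>x. A (B x)) = Brouwer_degree2 m ((\<lambda>x. unitize m (A x)) \<circ> (\<lambda>x. unitize m (B x)))"
    unfolding sdeg_def
  proof (rule Brouwer_degree2_eq)
    fix x assume "x \<in> topspace (nsphere m)"
    then have x: "x \<in> sph m" by (simp add: nsphere_eq_sph)
    then obtain i where i: "i \<le> m" "B x i \<noteq> 0" using B sph_nonzero unfolding linm_def by metis
    define c where "c = 1 / sqrt (\<Sum>j\<le>m. (B x j)\<^sup>2)"
    have c: "c > 0" using sum_squares_pos[of i m "B x", OF i] by (simp add: c_def)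
    have "A (unitize m (B x)) i = c * A (B x) i" if "i \<le> m" for i
    proof -
      have "A (unitize m (B x)) i = A (\<lambda>i. c * B x i) i"
        by (rule linm_cong[OF A _ that]) (simp add: unitize_def c_def)
      then show ?thesis using linm_scale[OF A that] by metis
    qed
    then have "unitize m (A (unitize m (B x))) = unitize m (\<lambda>i. c * A (B x) i)" by (rule unitize_cong)
    then show "unitize m (A (B x)) = ((\<lambda>x. unitize m (A x)) \<circ> (\<lambda>x. unitize m (B x))) x"
      using unitize_scale[OF c] by simp
  qed
  then show ?thesis unfolding sdeg_def
    using Brouwer_degree2_compose[OF continuous_map_linm[OF B] continuous_map_linm[OF A]] by simp
qed

lemma sdeg_id: "sdeg m (\<lambda>x. x) = 1"
proof -
  have "sdeg m (\<lambda>x. x) = Brouwer_degree2 m id" unfolding sdeg_def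
    by (rule Brouwer_degree2_eq) (auto simp: nsphere_eq_sph unitize_sph)
  then show ?thesis by simp
qed

definition scale_at :: "nat \<Rightarrow> real \<Rightarrow> (nat \<Rightarrow> real) \<Rightarrow> nat \<Rightarrow> real" where
  "scale_at k c x = (\<lambda>i. if i = k then c * x i else x i)"

lemma linm_diag:
  assumes "\<And>i. i \<le> m \<Longrightarrow> c i \<noteq> 0" shows "linm m (\<lambda>x i. c i * x i)"
proof (rule linmI[where M="\<lambda>i j. if j = i then c i else 0"])
  show "c i * x i = (\<Sum>j\<le>m. (if j = i then c i else 0) * x j)" if "i \<le> m" for x i
  proof -
    have "(\<Sum>j\<le>m. (if j = i then c i else 0) * x j) = (\<Sum>j\<le>m. if j = i then c i * x j else 0)"
      by (rule sum.cong) auto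
    then show ?thesis using that by simp
  qed
  show "\<exists>i\<le>m. c i * x i \<noteq> 0" if "j \<le> m" "x j \<noteq> 0" for x j
    using that assms by auto
qed

lemma linm_scale_at: "c \<noteq> 0 \<Longrightarrow> linm m (scale_at k c)"
proof -
  assume "c \<noteq> 0"
  then have "linm m (\<lambda>x i. (if i = k then c else 1) * x i)" by (intro linm_diag) auto
  moreover have "(\<lambda>x i. (if i = k then c else 1) * x i) = scale_at k c" by (auto simp: scale_at_def fun_eq_iff)
  ultimately show ?thesis by simp
qed

lemma sdeg_scale_at_0: "sdeg m (scale_at 0 (-1)) = -1"
proof -
  have "sdeg m (scale_at 0 (-1)) = Brouwer_degree2 m (\<lambda>x i. if i = 0 then -x i else x i)"
    unfolding sdeg_def
  proof (rule Brouwer_degree2_eq)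
    fix x assume "x \<in> topspace (nsphere m)"
    then have "x \<in> sph m" by (simp add: nsphere_eq_sph)
    then have "scale_at 0 (-1) x \<in> sph m" 
    proof -
      have "(\<Sum>i\<le>m. (scale_at 0 (-1) x i)\<^sup>2) = (\<Sum>i\<le>m. (x i)\<^sup>2)"
        by (rule sum.cong) (auto simp: scale_at_def)
      then show ?thesis using \<open>x \<in> sph m\<close> by (simp add: sph_def) (simp add: scale_at_def)
    qed
    then show "unitize m (scale_at 0 (-1) x) = (\<lambda>i. if i = 0 then - x i else x i)"
      by (simp add: unitize_sph) (simp add: scale_at_def fun_eq_iff)
  qed
  then show ?thesis by (simp add: Brouwer_degree2_reflection)
qed

lemma linm_swap: assumes k: "k \<le> m" shows "linm m (\<lambda>x i. x (Transposition.transpose 0 k i))"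
proof (rule linmI[where M="\<lambda>i j. if j = Transposition.transpose 0 k i then 1 else 0"])
  fix x :: "nat \<Rightarrow> real" and i assume "i \<le> m"
  then have t: "Transposition.transpose 0 k i \<le> m" using k by (auto simp: Transposition.transpose_def)
  have "(\<Sum>j\<le>m. (if j = Transposition.transpose 0 k i then 1 else 0) * x j) = (\<Sum>j\<le>m. if j = Transposition.transpose 0 k i then x j else 0)"
    by (rule sum.cong) auto
  then show "x (Transposition.transpose 0 k i) = (\<Sum>j\<le>m. (if j = Transposition.transpose 0 k i then 1 else 0) * x j)"
    using t by simp
next
  fix x :: "nat \<Rightarrow> real" and j assume "j \<le> m" "x j \<noteq> 0"
  then show "\<exists>i\<le>m. x (Transposition.transpose 0 k i) \<noteq> 0"
    using k by (intro exI[of _ "Transposition.transpose 0 k j"]) (auto simp: Transposition.transpose_def)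
qed

text \<open>Conjugation with the transposition of the coordinates 0 and \<open>k\<close> reduces to
  the standard reflection. The transposition is an involution, so its degree squares to 1 and
  cancels.\<close>

lemma sdeg_reflect: assumes k: "k \<le> m" shows "sdeg m (scale_at k (-1)) = -1"
proof -
  let ?P = "\<lambda>x i. (x::nat \<Rightarrow> real) (Transposition.transpose 0 k i)"
  have "sdeg m (\<lambda>x. ?P (?P x)) = sdeg m ?P * sdeg m ?P" by (rule sdeg_compose[OF linm_swap[OF k] linm_swap[OF k]])
  then have 1: "sdeg m ?P * sdeg m ?P = 1" by (simp add: sdeg_id)
  have "linm m (\<lambda>x. scale_at 0 (-1) (?P x))"
  proof -
    obtain M where M: "\<And>x i. i \<le> m \<Longrightarrow> ?P x i = (\<Sum>j\<le>m. M i j * x j)"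
      using linm_swap[OF k] unfolding linm_def by blast
    show ?thesis
    proof (rule linmI[where M="\<lambda>i j. if i = 0 then - M i j else M i j"])
      show "scale_at 0 (-1) (?P x) i = (\<Sum>j\<le>m. (if i = 0 then - M i j else M i j) * x j)" if "i \<le> m" for x i
        using M[OF that, of x] by (auto simp: scale_at_def sum_negf)
      show "\<exists>i\<le>m. scale_at 0 (-1) (?P x) i \<noteq> 0" if j: "j \<le> m" "x j \<noteq> 0" for x j
      proof -
        obtain i where "i \<le> m" "?P x i \<noteq> 0" using linm_nonzero[OF linm_swap[OF k], of j x] j by blast
        then show ?thesis by (intro exI[of _ i]) (auto simp: scale_at_def)
      qed
    qed
  qed
  then have "sdeg m (\<lambda>x. ?P (scale_at 0 (-1) (?P x))) = sdeg m ?P * sdeg m (\<lambda>x. scale_at 0 (-1) (?P x))"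
    by (rule sdeg_compose[OF linm_swap[OF k]])
  also have "sdeg m (\<lambda>x. scale_at 0 (-1) (?P x)) = sdeg m (scale_at 0 (-1)) * sdeg m ?P"
    by (rule sdeg_compose[OF linm_scale_at linm_swap[OF k]]) simp
  also have "(\<lambda>x. ?P (scale_at 0 (-1) (?P x))) = scale_at k (-1)"
    by (intro ext) (auto simp: scale_at_def Transposition.transpose_def)
  finally show ?thesis using 1 by (simp add: sdeg_scale_at_0)
qed

lemma sdeg_scale_at: assumes k: "k \<le> m" and c: "c \<noteq> 0"
  shows "real_of_int (sdeg m (scale_at k c)) = sgn c"
proof -
  \<comment> \<open>The segment from \<open>sgn c\<close> to \<open>c\<close> avoids 0, so only the
    sign of the factor matters for the degree.\<close>
  define G where "G s = scale_at k ((1 - s) * sgn c + s * c)" for s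
  have "sdeg m (G 0) = sdeg m (G 1)"
  proof (rule sdeg_homotopy)
    show "continuous_on ({0..1} \<times> sph m) (\<lambda>p. G (fst p) (snd p) i)" if "i \<le> m" for i
    proof -
      have "continuous_on ({0..1} \<times> sph m) (\<lambda>p. snd p i)"
        by (rule continuous_on_compose2[OF continuous_on_product_coordinates continuous_on_snd]) (auto intro: continuous_on_id)
      then show ?thesis by (cases "i = k") (auto simp: G_def scale_at_def intro!: continuous_intros)
    qed
    show "\<exists>i\<le>m. G s x i \<noteq> 0" if s: "s \<in> {0..1}" and x: "x \<in> sph m" for s x
    proof -
      have "(1 - s) * sgn c + s * c \<noteq> 0"
      proof (cases "c > 0")
        case True
        then have "(1 - s) * 1 + s * c > 0" using s by (cases "s = 1") (auto intro: add_pos_nonneg)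
        then show ?thesis using True by simp
      next
        case False
        then have c: "c < 0" using c by simp
        then have "(1 - s) * 1 + s * (- c) > 0" using s c by (cases "s = 1") (force, intro add_pos_nonneg mult_nonneg_nonneg, auto)
        then have "(1 - s) * (- 1) + s * c < 0" by simp
        then show ?thesis using c by simp
      qed
      then show ?thesis using linm_scale_at[of _ m k] sph_nonzero[OF x] unfolding linm_def G_def by blast
    qed
  qed
  moreover have "G 1 = scale_at k c" "G 0 = scale_at k (sgn c)" by (auto simp: G_def)
  moreover have "real_of_int (sdeg m (scale_at k (sgn c))) = sgn c"
  proof (cases "c > 0")
    case True
    have "scale_at k 1 = (\<lambda>x. x)" by (intro ext) (simp add: scale_at_def)
    then show ?thesis using True by (simp add: sdeg_id)
  next
    case False then show ?thesis using c by (simp add: sdeg_reflect[OF k])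
  qed
  ultimately show ?thesis by simp
qed

text \<open>The diagonal map is built up by scaling one coordinate after the other; \<open>n\<close>
  counts the coordinates already scaled.\<close>

lemma sdeg_diag: assumes c: "\<And>i. i \<le> m \<Longrightarrow> c i \<noteq> 0"
  shows "real_of_int (sdeg m (\<lambda>x i. c i * x i)) = (\<Prod>i\<le>m. sgn (c i))"
proof -
  have "n \<le> Suc m \<Longrightarrow> real_of_int (sdeg m (\<lambda>x i. (if i < n then c i else 1) * x i)) = (\<Prod>i<n. sgn (c i))" for n
  proof (induction n)
    case 0 then show ?case by (simp add: sdeg_id)
  next
    case (Suc n)
    have "sdeg m (\<lambda>x i. (if i < Suc n then c i else 1) * x i) = sdeg m (\<lambda>x. scale_at n (c n) (\<lambda>i. (if i < n then c i else 1) * x i))"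
      by (rule sdeg_cong) (auto simp: scale_at_def less_Suc_eq)
    also have "\<dots> = sdeg m (scale_at n (c n)) * sdeg m (\<lambda>x i. (if i < n then c i else 1) * x i)"
      by (rule sdeg_compose[OF linm_scale_at linm_diag]) (use c Suc.prems in auto)
    finally show ?case using Suc c[of n] by (simp add: sdeg_scale_at mult.commute)
  qed
  from this[of "Suc m"] have "real_of_int (sdeg m (\<lambda>x i. (if i < Suc m then c i else 1) * x i)) = (\<Prod>i\<le>m. sgn (c i))"
    by (simp add: lessThan_Suc_atMost)
  moreover have "sdeg m (\<lambda>x i. (if i < Suc m then c i else 1) * x i) = sdeg m (\<lambda>x i. c i * x i)"
    by (rule sdeg_cong) auto
  ultimately show ?thesis by simp
qed

section \<open>Orientation signs on a finite-dimensional subspace\<close>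

text \<open>A finite-dimensional subspace whose coordinate functionals are defined and bounded on
  the whole space, so that coordinates of operator values depend continuously on the
  operator.\<close>

locale wsys =
  fixes m :: nat and w :: "nat \<Rightarrow> 'b::real_normed_vector" and \<phi> :: "nat \<Rightarrow> 'b \<Rightarrow>\<^sub>L real"
  assumes dual: "i < m \<Longrightarrow> j < m \<Longrightarrow> blinfun_apply (\<phi> i) (w j) = (if i = j then 1 else 0)"
begin

definition W :: "'b set" where "W = span (w ` {..<m})"

lemma subspace_W: "subspace W" by (simp add: W_def)

lemma sum_in_W: "(\<Sum>i<m. c i *\<^sub>R w i) \<in> W"
  unfolding W_def by (intro span_sum span_scale span_base) auto

lemma \<phi>_sum: assumes "j < m" shows "\<phi> j (\<Sum>i<m. c i *\<^sub>R w i) = c j"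
proof -
  have "\<phi> j (\<Sum>i<m. c i *\<^sub>R w i) = (\<Sum>i<m. if i = j then c i else 0)"
    unfolding blinfun.sum_right by (rule sum.cong) (use dual assms in \<open>auto simp: blinfun.scaleR_right\<close>)
  then show ?thesis using assms by simp
qed

lemma W_expand: assumes "v \<in> W" shows "(\<Sum>i<m. \<phi> i v *\<^sub>R w i) = v"
proof -
  have lin: "linear (\<lambda>v. \<Sum>i<m. \<phi> i v *\<^sub>R w i)" by (intro bounded_linear.linear bounded_linear_intros)
  have "(\<Sum>i<m. \<phi> i (w j) *\<^sub>R w i) = w j" if "j < m" for j
  proof -
    have "(\<Sum>i<m. \<phi> i (w j) *\<^sub>R w i) = (\<Sum>i<m. if i = j then w i else 0)"
      by (rule sum.cong) (use dual that in auto)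
    then show ?thesis using that by simp
  qed
  then show ?thesis
    using linear_eq_on_span[OF lin linear_ident, of "w ` {..<m}" v] assms by (auto simp: W_def)
qed

definition emb :: "(nat \<Rightarrow> real) \<Rightarrow> 'b" where "emb x = (\<Sum>j<m. x (Suc j) *\<^sub>R w j)"

text \<open>The extra coordinate \<open>x 0\<close> suspends the map, so that the degree also makes sense for \<open>W = {0}\<close>.\<close>

definition hat :: "('b \<Rightarrow> 'b) \<Rightarrow> (nat \<Rightarrow> real) \<Rightarrow> nat \<Rightarrow> real" where
  "hat A x = (\<lambda>i. case i of 0 \<Rightarrow> x 0 | Suc j \<Rightarrow> \<phi> j (A (emb x)))"

definition \<delta> :: "('b \<Rightarrow> 'b) \<Rightarrow> int" where "\<delta> A = sdeg m (hat A)"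

definition good :: "('b \<Rightarrow> 'b) \<Rightarrow> bool" where
  "good A \<longleftrightarrow> linear A \<and> (\<forall>v\<in>W. A v \<in> W) \<and> (\<forall>v\<in>W. A v = 0 \<longrightarrow> v = 0)"

lemma goodD: assumes "good A" shows "linear A" "v \<in> W \<Longrightarrow> A v \<in> W" "v \<in> W \<Longrightarrow> A v = 0 \<Longrightarrow> v = 0"
proof -
  note g = assms[unfolded good_def, THEN conjunct1] assms[unfolded good_def, THEN conjunct2, THEN conjunct1]
    assms[unfolded good_def, THEN conjunct2, THEN conjunct2]
  show "linear A" by (rule g)
  show "v \<in> W \<Longrightarrow> A v \<in> W" by (rule bspec[OF g(2)])
  show "v \<in> W \<Longrightarrow> A v = 0 \<Longrightarrow> v = 0" by (rule mp[OF bspec[OF g(3)]])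
qed

lemma emb_in_W: "emb x \<in> W" unfolding emb_def by (rule sum_in_W)

lemma \<phi>_emb: "j < m \<Longrightarrow> \<phi> j (emb x) = x (Suc j)" unfolding emb_def by (rule \<phi>_sum)

lemma W_zeroI: "v \<in> W \<Longrightarrow> (\<And>j. j < m \<Longrightarrow> \<phi> j v = 0) \<Longrightarrow> v = 0"
  using W_expand[of v] by simp

lemma linm_hat: assumes "good A" shows "linm m (hat A)"
proof (rule linmI[where M="\<lambda>i j. case i of 0 \<Rightarrow> (if j = 0 then 1 else 0) | Suc i' \<Rightarrow> (case j of 0 \<Rightarrow> 0 | Suc j' \<Rightarrow> \<phi> i' (A (w j')))"])
  have lin: "linear A" using assms by (simp add: good_def)
  fix x :: "nat \<Rightarrow> real" and i assume "i \<le> m"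
  show "hat A x i = (\<Sum>j\<le>m. (case i of 0 \<Rightarrow> if j = 0 then 1 else 0 | Suc i' \<Rightarrow> case j of 0 \<Rightarrow> 0 | Suc j' \<Rightarrow> \<phi> i' (A (w j'))) * x j)"
  proof (cases i)
    case 0 then show ?thesis by (simp add: hat_def sum.atMost_shift)
  next
    case (Suc i')
    have "\<phi> i' (A (emb x)) = (\<Sum>j<m. \<phi> i' (A (w j)) * x (Suc j))"
      unfolding emb_def by (simp add: linear_sum[OF lin] linear_scale[OF lin] blinfun.sum_right blinfun.scaleR_right mult.commute)
    then show ?thesis using Suc by (simp add: hat_def sum.atMost_shift)
  qed
next
  fix x :: "nat \<Rightarrow> real" and j assume j: "j \<le> m" "x j \<noteq> 0"
  show "\<exists>i\<le>m. hat A x i \<noteq> 0"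
  proof (rule ccontr)
    assume "\<not> ?thesis"
    then have *: "\<And>i. i \<le> m \<Longrightarrow> hat A x i = 0" by blast
    have "x 0 = 0" using *[of 0] by (simp add: hat_def)
    moreover have "A (emb x) = 0"
    proof (rule W_zeroI)
      show "A (emb x) \<in> W" using assms emb_in_W by (simp add: good_def)
      show "\<phi> j (A (emb x)) = 0" if "j < m" for j using *[of "Suc j"] that by (simp add: hat_def)
    qed
    then have "emb x = 0" using assms emb_in_W by (simp add: good_def)
    then have "x (Suc j) = 0" if "j < m" for j using \<phi>_emb[OF that, of x] by (simp add: blinfun.zero_right)
    ultimately show False using j by (cases j) auto
  qed
qed

lemma good_comp: assumes "good A" "good B" shows "good (\<lambda>v. A (B v))"
  unfolding good_def
proof (intro conjI ballI impI)
  show "linear (\<lambda>v. A (B v))" using assms linear_compose[of B A] by (simp add: good_def o_def)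
next
  note A = goodD(2,3)[OF assms(1)] and B = goodD(2,3)[OF assms(2)]
  fix v assume v: "v \<in> W"
  show "A (B v) \<in> W" by (rule A(1)[OF B(1)[OF v]])
  show "v = 0" if "A (B v) = 0" by (rule B(2)[OF v A(2)[OF B(1)[OF v] that]])
qed

lemma emb_hat: assumes "\<And>v. v \<in> W \<Longrightarrow> B v \<in> W" shows "emb (hat B x) = B (emb x)"
proof -
  have "emb (hat B x) = (\<Sum>j<m. \<phi> j (B (emb x)) *\<^sub>R w j)" unfolding emb_def[of "hat B x"] by (simp add: hat_def)
  also have "\<dots> = B (emb x)" by (rule W_expand[OF assms[OF emb_in_W]])
  finally show ?thesis .
qed

lemma \<delta>_cong: "(\<And>v. v \<in> W \<Longrightarrow> A v = B v) \<Longrightarrow> \<delta> A = \<delta> B"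
  unfolding \<delta>_def by (rule sdeg_cong) (simp add: hat_def emb_in_W split: nat.split)

lemma \<delta>_compose: assumes "good A" "good B" shows "\<delta> (\<lambda>v. A (B v)) = \<delta> A * \<delta> B"
proof -
  have "\<delta> (\<lambda>v. A (B v)) = sdeg m (\<lambda>x. hat A (hat B x))"
    unfolding \<delta>_def
  proof (rule sdeg_cong)
    fix x i
    show "hat (\<lambda>v. A (B v)) x i = hat A (hat B x) i"
      using emb_hat[of B x] assms(2) by (cases i) (auto simp: good_def hat_def[of A] hat_def[of "\<lambda>v. A (B v)"], simp add: hat_def)
  qed
  also have "\<dots> = \<delta> A * \<delta> B" unfolding \<delta>_def by (rule sdeg_compose[OF linm_hat linm_hat]) fact+
  finally show ?thesis .
qed

lemma \<delta>_id: "\<delta> (\<lambda>v. v) = 1"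
proof -
  have "\<delta> (\<lambda>v. v) = sdeg m (\<lambda>x. x)" unfolding \<delta>_def
    by (rule sdeg_cong) (auto simp: hat_def \<phi>_emb split: nat.splits)
  then show ?thesis by (simp add: sdeg_id)
qed

lemma \<delta>_inverse: assumes "good A" "good B" "\<And>v. v \<in> W \<Longrightarrow> A (B v) = v" shows "\<delta> A * \<delta> B = 1"
proof -
  have "\<delta> (\<lambda>v. A (B v)) = \<delta> (\<lambda>v. v)" by (rule \<delta>_cong) (rule assms(3))
  then show ?thesis using \<delta>_compose[OF assms(1,2)] \<delta>_id by metis
qed

text \<open>By linearity the family is determined by its values at the finitely many
  \<open>w k\<close>; continuity there already gives joint continuity on the sphere.\<close>

lemma \<delta>_homotopy:
  assumes good: "\<And>s. s \<in> {0..1} \<Longrightarrow> good (A s)"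
    and cont: "\<And>k. k < m \<Longrightarrow> continuous_on {0..1} (\<lambda>s. A s (w k))"
  shows "\<delta> (A (0::real)) = \<delta> (A 1)"
  unfolding \<delta>_def
proof (rule sdeg_homotopy[where G="\<lambda>s. hat (A s)"])
  show "\<exists>i\<le>m. hat (A s) x i \<noteq> 0" if s: "s \<in> {0..1}" and x: "x \<in> sph m" for s x
  proof -
    obtain j where j: "j \<le> m" "x j \<noteq> 0" using sph_nonzero[OF x] by auto
    show ?thesis using linm_nonzero[OF linm_hat[OF good[OF s]], of j x] j by simp
  qed
  fix i assume "i \<le> m"
  have x: "continuous_on ({0..1} \<times> sph m) (\<lambda>p. snd p j)" for j
    by (rule continuous_on_compose2[OF continuous_on_product_coordinates continuous_on_snd]) (auto intro: continuous_on_id)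
  show "continuous_on ({0..1} \<times> sph m) (\<lambda>p. hat (A (fst p)) (snd p) i)"
  proof (cases i)
    case 0 then show ?thesis using x by (simp add: hat_def)
  next
    case (Suc i')
    have c1: "continuous_on ({0..1} \<times> sph m) (\<lambda>p. \<Sum>k<m. snd p (Suc k) * \<phi> i' (A (fst p) (w k)))"
      by (intro continuous_intros x continuous_on_compose2[OF cont]) auto
    have c2: "hat (A (fst p)) (snd p) i = (\<Sum>k<m. snd p (Suc k) * \<phi> i' (A (fst p) (w k)))" if "p \<in> {0..1} \<times> sph m" for p
    proof -
      have lin: "linear (A (fst p))" using good[of "fst p"] that by (auto simp: good_def)
      show ?thesis using Suc
        by (simp add: hat_def emb_def linear_sum[OF lin] linear_scale[OF lin] blinfun.sum_right blinfun.scaleR_right)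
    qed
    show ?thesis by (rule continuous_on_eq[OF c1]) (use c2 in simp)
  qed
qed

text \<open>On \<open>W\<close> the map is \<open>P D Q\<close>, where \<open>P\<close> carries the
  basis \<open>w\<close> to \<open>b\<close>, \<open>Q\<close> goes back and \<open>D\<close> is
  diagonal for \<open>w\<close>. The signs of \<open>P\<close> and \<open>Q\<close> cancel, so the
  orientation of the eigenbasis does not enter.\<close>

lemma \<delta>_eigenbasis:
  fixes \<psi> :: "nat \<Rightarrow> 'b \<Rightarrow>\<^sub>L real"
  assumes A: "linear A" and b: "\<And>i. i < m \<Longrightarrow> b i \<in> W"
    and \<psi>: "\<And>i j. i < m \<Longrightarrow> j < m \<Longrightarrow> \<psi> i (b j) = (if i = j then 1 else 0)"
    and ex: "\<And>v. v \<in> W \<Longrightarrow> (\<Sum>i<m. \<psi> i v *\<^sub>R b i) = v"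
    and eig: "\<And>i. i < m \<Longrightarrow> A (b i) = c i *\<^sub>R b i" and c: "\<And>i. i < m \<Longrightarrow> c i \<noteq> 0"
  shows "real_of_int (\<delta> A) = (\<Prod>i<m. sgn (c i))"
proof -
  define P where "P v = (\<Sum>i<m. \<phi> i v *\<^sub>R b i)" for v
  define Q where "Q v = (\<Sum>i<m. \<psi> i v *\<^sub>R w i)" for v
  define D where "D v = (\<Sum>i<m. (c i * \<phi> i v) *\<^sub>R w i)" for v
  have \<psi>b: "\<psi> j (\<Sum>i<m. r i *\<^sub>R b i) = r j" if "j < m" for j r
  proof -
    have "\<psi> j (\<Sum>i<m. r i *\<^sub>R b i) = (\<Sum>i<m. if i = j then r i else 0)"
      unfolding blinfun.sum_right blinfun.scaleR_right by (rule sum.cong) (auto simp: \<psi> that)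
    then show ?thesis using that by simp
  qed
  have linP: "linear P" and linQ: "linear Q" and linD: "linear D" unfolding P_def Q_def D_def
    by (intro bounded_linear.linear bounded_linear_intros)+
  have PW: "P v \<in> W" for v unfolding P_def by (intro subspace_sum subspace_W subspace_scale b) auto
  have QW: "Q v \<in> W" "D v \<in> W" for v unfolding Q_def D_def by (rule sum_in_W)+
  have gP: "good P"
    unfolding good_def
  proof (intro conjI ballI impI linP PW)
    fix v assume v: "v \<in> W" "P v = 0"
    have "\<phi> j v = 0" if "j < m" for j using \<psi>b[OF that, of "\<lambda>i. \<phi> i v"] v(2) by (simp add: P_def blinfun.zero_right)
    then show "v = 0" by (rule W_zeroI[OF v(1)])
  qed
  have gQ: "good Q"
    unfolding good_def
  proof (intro conjI ballI impI linQ QW)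
    fix v assume v: "v \<in> W" "Q v = 0"
    have "\<psi> j v = 0" if "j < m" for j using \<phi>_sum[OF that, of "\<lambda>i. \<psi> i v"] v(2) by (simp add: Q_def blinfun.zero_right)
    then show "v = 0" using ex[OF v(1)] by simp
  qed
  have gD: "good D"
    unfolding good_def
  proof (intro conjI ballI impI linD QW)
    fix v assume v: "v \<in> W" "D v = 0"
    have "\<phi> j v = 0" if "j < m" for j using \<phi>_sum[OF that, of "\<lambda>i. c i * \<phi> i v"] v(2) c[OF that] by (simp add: D_def blinfun.zero_right)
    then show "v = 0" by (rule W_zeroI[OF v(1)])
  qed
  have "P (Q v) = v" if "v \<in> W" for v
    unfolding P_def Q_def using ex[OF that] by (simp add: \<phi>_sum)
  then have PQ: "\<delta> P * \<delta> Q = 1" by (rule \<delta>_inverse[OF gP gQ])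
  have "A v = P (D (Q v))" if "v \<in> W" for v
  proof -
    have "P (D (Q v)) = (\<Sum>i<m. (c i * \<psi> i v) *\<^sub>R b i)"
      unfolding P_def Q_def D_def by (simp add: \<phi>_sum)
    also have "\<dots> = (\<Sum>i<m. \<psi> i v *\<^sub>R A (b i))" by (rule sum.cong) (auto simp: eig mult.commute)
    also have "\<dots> = A (\<Sum>i<m. \<psi> i v *\<^sub>R b i)" by (simp add: linear_sum[OF A] linear_scale[OF A])
    finally show ?thesis using ex[OF that] by simp
  qed
  then have "\<delta> A = \<delta> P * (\<delta> D * \<delta> Q)"
    using \<delta>_cong[of A "\<lambda>v. P (D (Q v))"] \<delta>_compose[OF gP good_comp[OF gD gQ]] \<delta>_compose[OF gD gQ] by simp
  then have "\<delta> A = \<delta> D" using PQ by (simp add: algebra_simps)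
  moreover have "\<delta> D = sdeg m (\<lambda>x i. (case i of 0 \<Rightarrow> 1 | Suc j \<Rightarrow> c j) * x i)"
    unfolding \<delta>_def by (rule sdeg_cong) (auto simp: hat_def D_def \<phi>_sum \<phi>_emb split: nat.splits)
  moreover have "real_of_int (sdeg m (\<lambda>x i. (case i of 0 \<Rightarrow> 1 | Suc j \<Rightarrow> c j) * x i)) = (\<Prod>i\<le>m. sgn (case i of 0 \<Rightarrow> 1 | Suc j \<Rightarrow> c j))"
    by (rule sdeg_diag) (auto simp: c split: nat.splits)
  ultimately show ?thesis by (simp add: prod.atMost_shift)
qed

end

section \<open>Parity of admissible paths\<close>

lemma compact_norm_bound:
  fixes f :: "'a::topological_space \<Rightarrow> 'b::real_normed_vector"
  assumes "compact X" "continuous_on X f"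
  shows "\<exists>M>0. \<forall>x\<in>X. norm (f x) \<le> M"
proof -
  have "bounded (f ` X)" using compact_continuous_image[OF assms(2,1)] by (rule compact_imp_bounded)
  then obtain M where "M > 0" "\<And>y. y \<in> f ` X \<Longrightarrow> norm y \<le> M" unfolding bounded_pos by blast
  then show ?thesis by blast
qed

locale wsysB = wsys m w \<phi> for m and w :: "nat \<Rightarrow> 'b::banach" and \<phi>
begin

text \<open>When \<open>L\<close> and \<open>T\<close> agree modulo \<open>W\<close>, the composite
  \<open>L T\<inverse>\<close> is the identity minus an operator with values in \<open>W\<close> and
  so maps \<open>W\<close> to itself.\<close>

definition \<rho> :: "('a::banach \<Rightarrow>\<^sub>L 'b) \<Rightarrow> ('a \<Rightarrow>\<^sub>L 'b) \<Rightarrow> int" where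
  "\<rho> L T = \<delta> (\<lambda>v. blinfun_apply L (blinfun_apply (blinfun_inv T) v))"

definition Wclose :: "('a::banach \<Rightarrow>\<^sub>L 'b) \<Rightarrow> ('a \<Rightarrow>\<^sub>L 'b) \<Rightarrow> bool" where
  "Wclose S T \<longleftrightarrow> S \<in> GL \<and> T \<in> GL \<and> (\<forall>x. T x - S x \<in> W)"

lemma Wclose_sym: "Wclose S T \<Longrightarrow> Wclose T S"
  unfolding Wclose_def using subspace_neg[OF subspace_W] by (metis minus_diff_eq)

lemma good_ratio: assumes "Wclose S T" shows "good (\<lambda>v. blinfun_apply S (blinfun_inv T v))"
  unfolding good_def
proof (intro conjI ballI impI)
  have S: "S \<in> GL" and T: "T \<in> GL" and d: "\<And>x. T x - S x \<in> W" using assms by (auto simp: Wclose_def)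
  show "linear (\<lambda>v. blinfun_apply S (blinfun_inv T v))"
    by (intro bounded_linear.linear bounded_linear_intros)
  fix v assume v: "v \<in> W"
  have "v - (T (blinfun_inv T v) - S (blinfun_inv T v)) \<in> W" by (rule subspace_diff[OF subspace_W v d])
  then show "S (blinfun_inv T v) \<in> W" by (simp add: blinfun_inv_apply[OF T])
  show "v = 0" if "S (blinfun_inv T v) = 0"
    using that by (metis S T blinfun_inv_apply blinfun.zero_right)
qed

text \<open>The cocycle rule: the ratio of \<open>R\<close> and \<open>T\<close> factors through
  \<open>S\<close>.\<close>

lemma \<rho>_trans: assumes "Wclose R S" "Wclose S T" shows "\<rho> R T = \<rho> R S * \<rho> S T"
proof -
  have "S \<in> GL" using assms by (simp add: Wclose_def)
  then show ?thesis
    unfolding \<rho>_def using \<delta>_compose[OF good_ratio[OF assms(1)] good_ratio[OF assms(2)]]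
    by (simp add: blinfun_inv_apply)
qed

lemma \<rho>_refl: "T \<in> GL \<Longrightarrow> \<rho> T T = 1"
  unfolding \<rho>_def by (simp add: blinfun_inv_apply \<delta>_id)

lemma \<rho>_sym: assumes "Wclose S T" shows "\<rho> S T * \<rho> T S = 1"
  using \<rho>_trans[OF assms Wclose_sym[OF assms]] assms \<rho>_refl[of S] unfolding Wclose_def by metis

lemma \<rho>_cases: assumes "Wclose S T" shows "\<rho> S T = 1 \<or> \<rho> S T = -1"
  using \<rho>_sym[OF assms] by (simp add: zmult_eq_1_iff) blast

lemma \<rho>_path:
  fixes S T :: "real \<Rightarrow> 'a::banach \<Rightarrow>\<^sub>L 'b"
  assumes "a \<le> b" and S: "continuous_on {a..b} S" and T: "continuous_on {a..b} T"
    and cl: "\<And>r. r \<in> {a..b} \<Longrightarrow> Wclose (S r) (T r)"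
  shows "\<rho> (S a) (T a) = \<rho> (S b) (T b)"
proof -
  define g where "g s = a + s * (b - a)" for s
  have g: "g s \<in> {a..b}" if "s \<in> {0..1}" for s
    using that assms(1) mult_left_le_one_le[of "b - a" s] by (auto simp: g_def)
  have cg: "continuous_on {0..1} g" unfolding g_def by (intro continuous_intros)
  have "\<delta> (\<lambda>v. S (g 0) (blinfun_inv (T (g 0)) v)) = \<delta> (\<lambda>v. S (g 1) (blinfun_inv (T (g 1)) v))"
  proof (rule \<delta>_homotopy[where A="\<lambda>s v. S (g s) (blinfun_inv (T (g s)) v)"])
    show "good (\<lambda>v. S (g s) (blinfun_inv (T (g s)) v))" if "s \<in> {0..1}" for s
      by (rule good_ratio[OF cl[OF g[OF that]]])
    have "continuous_on {0..1} (\<lambda>s. S (g s))" "continuous_on {0..1} (\<lambda>s. T (g s))"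
      by (rule continuous_on_compose2[OF S cg] continuous_on_compose2[OF T cg]; use g in blast)+
    moreover have "T (g s) \<in> GL" if "s \<in> {0..1}" for s using cl[OF g[OF that]] by (simp add: Wclose_def)
    ultimately show "continuous_on {0..1} (\<lambda>s. S (g s) (blinfun_inv (T (g s)) (w k)))" for k
      by (intro continuous_intros)
  qed
  then show ?thesis by (simp add: \<rho>_def g_def)
qed

definition par :: "real \<Rightarrow> real \<Rightarrow> (real \<Rightarrow> 'a::banach \<Rightarrow>\<^sub>L 'b) \<Rightarrow> (real \<Rightarrow> 'a \<Rightarrow>\<^sub>L 'b) \<Rightarrow> int" where
  "par a b L T = \<rho> (L a) (T a) * \<rho> (L b) (T b)"

lemma Wclose_lift: "lift_on a b W L T \<Longrightarrow> l \<in> {a..b} \<Longrightarrow> L l \<in> GL \<Longrightarrow> Wclose (L l) (T l)"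
  unfolding Wclose_def using lift_onD by blast

lemma Wclose_lift2: assumes "lift_on a b W L T" "lift_on a b W L T'" "l \<in> {a..b}" shows "Wclose (T l) (T' l)"
proof -
  have "T' l x - T l x \<in> W" for x
    using subspace_diff[OF subspace_W lift_onD(2)[OF assms(2,3)] lift_onD(2)[OF assms(1,3)], of x x] by simp
  then show ?thesis using lift_onD(1)[OF assms(1,3)] lift_onD(1)[OF assms(2,3)] by (simp add: Wclose_def)
qed

text \<open>A change of lift multiplies the end signs by \<open>\<rho> (T a) (T' a)\<close> and
  \<open>\<rho> (T b) (T' b)\<close>. These are equal, since the lifts are invertible all along the
  path, and their product is 1.\<close>

lemma par_indep:
  assumes T: "lift_on a b W L T" and T': "lift_on a b W L T'" and L: "L a \<in> GL" "L b \<in> GL" and ab: "a \<le> b"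
  shows "par a b L T = par a b L T'"
proof -
  have in_ab: "a \<in> {a..b}" "b \<in> {a..b}" using ab by auto
  have "\<rho> (L a) (T' a) = \<rho> (L a) (T a) * \<rho> (T a) (T' a)" "\<rho> (L b) (T' b) = \<rho> (L b) (T b) * \<rho> (T b) (T' b)"
    by (rule \<rho>_trans; rule Wclose_lift[OF T] Wclose_lift2[OF T T']; use in_ab L in simp)+
  moreover have "\<rho> (T a) (T' a) = \<rho> (T b) (T' b)"
    by (rule \<rho>_path[OF ab _ _ Wclose_lift2[OF T T']]) (use T T' in \<open>auto simp: lift_on_def\<close>)
  moreover have "\<rho> (T b) (T' b) = 1 \<or> \<rho> (T b) (T' b) = -1"
    using \<rho>_cases Wclose_lift2[OF T T' in_ab(2)] by blast
  ultimately show ?thesis by (auto simp: par_def)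
qed

text \<open>Local constancy in the homotopy parameter: a lift at \<open>x\<close> can be transported
  to nearby parameters, and at the ends \<open>a\<close> and \<open>b\<close> the operators
  \<open>H\<close> themselves stay invertible, so the end signs do not move.\<close>

lemma par_homotopy:
  fixes H :: "real \<times> real \<Rightarrow> 'a::banach \<Rightarrow>\<^sub>L 'b"
  assumes H: "continuous_on ({0..1} \<times> {a..b}) H" and ab: "a \<le> b"
    and pert: "\<And>t l. t \<in> {0..1} \<Longrightarrow> l \<in> {a..b} \<Longrightarrow> \<exists>Y. range (blinfun_apply Y) \<subseteq> W \<and> H (t, l) + Y \<in> GL"
    and ends: "\<And>t. t \<in> {0..1} \<Longrightarrow> H (t, a) \<in> GL" "\<And>t. t \<in> {0..1} \<Longrightarrow> H (t, b) \<in> GL"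
    and T0: "lift_on a b W (\<lambda>l. H (0, l)) T0" and T1: "lift_on a b W (\<lambda>l. H (1, l)) T1"
  shows "par a b (\<lambda>l. H (0, l)) T0 = par a b (\<lambda>l. H (1, l)) T1"
proof -
  have in_ab: "a \<in> {a..b}" "b \<in> {a..b}" using ab by auto
  \<comment> \<open>Quantifying over all lifts lets an arbitrary lift at the intermediate parameter
    link two intervals.\<close>
  define P where "P s t \<longleftrightarrow> (0 \<le> s \<and> s \<le> t \<and> t \<le> 1 \<longrightarrow> (\<forall>T T'. lift_on a b W (\<lambda>l. H (s, l)) T \<longrightarrow> lift_on a b W (\<lambda>l. H (t, l)) T' \<longrightarrow>
     par a b (\<lambda>l. H (s, l)) T = par a b (\<lambda>l. H (t, l)) T'))" for s t
  have contH: "continuous_on {a..b} (\<lambda>l. H (t, l))" if "t \<in> {0..1}" for t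
    by (rule continuous_on_compose2[OF H]) (use that in \<open>auto intro!: continuous_intros\<close>)
  have contHt: "continuous_on {0..1} (\<lambda>t. H (t, l))" if "l \<in> {a..b}" for l
    by (rule continuous_on_compose2[OF H]) (use that in \<open>auto intro!: continuous_intros\<close>)
  have ex: "\<exists>T. lift_on a b W (\<lambda>l. H (t, l)) T" if t: "t \<in> {0..1}" for t
    by (rule lift_on_exists[OF subspace_W contH[OF t] ab pert[OF t]])
  have "(0::real) \<le> 1" by simp
  then have "P 0 1"
  proof (induction rule: Bolzano)
    case (trans s p t)
    show ?case unfolding P_def
    proof (intro impI allI)
      fix T T' assume st: "0 \<le> s \<and> s \<le> t \<and> t \<le> 1" and T: "lift_on a b W (\<lambda>l. H (s, l)) T" "lift_on a b W (\<lambda>l. H (t, l)) T'"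
      obtain R where "lift_on a b W (\<lambda>l. H (p, l)) R" using ex[of p] trans st by auto
      then show "par a b (\<lambda>l. H (s, l)) T = par a b (\<lambda>l. H (t, l)) T'"
        using trans st T unfolding P_def by auto
    qed
  next
    case (local x)
    then have x: "x \<in> {0..1}" by simp
    obtain T where T: "lift_on a b W (\<lambda>l. H (x, l)) T" using ex[OF x] by blast
    have cT: "continuous_on {a..b} T" and TGL: "\<And>l. l \<in> {a..b} \<Longrightarrow> T l \<in> GL" using T by (auto simp: lift_on_def)
    obtain M where M: "M > 0" "\<And>l. l \<in> {a..b} \<Longrightarrow> norm (blinfun_inv (T l)) \<le> M"
      using compact_norm_bound[OF compact_Icc continuous_on_blinfun_inv[OF cT TGL]] by blast
    have "uniformly_continuous_on ({0..1} \<times> {a..b}) H"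
      by (intro compact_uniformly_continuous H compact_Times compact_Icc)
    from this[unfolded uniformly_continuous_on_def, rule_format, of "1 / (2 * M)"] M(1)
    obtain d where d: "d > 0" "\<And>p q. p \<in> {0..1} \<times> {a..b} \<Longrightarrow> q \<in> {0..1} \<times> {a..b} \<Longrightarrow> dist q p < d \<Longrightarrow> dist (H q) (H p) < 1 / (2 * M)"
      by auto
    \<comment> \<open>The difference \<open>R t l - H (t, l)\<close> equals
      \<open>T l - H (x, l)\<close> and so keeps its values in \<open>W\<close>; uniform continuity
      keeps \<open>R\<close> invertible for all \<open>l\<close> simultaneously.\<close>
    define R where "R t l = T l + (H (t, l) - H (x, l))" for t l
    have RGL: "R t l \<in> GL" if t: "t \<in> {0..1}" "\<bar>t - x\<bar> < d" and l: "l \<in> {a..b}" for t l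
    proof (rule GL_perturb(1)[OF TGL[OF l]])
      have "dist (t, l) (x, l) < d" using t by (simp add: dist_Pair_Pair dist_real_def)
      then have "norm (H (t, l) - H (x, l)) < 1 / (2 * M)"
        using d(2)[of "(x, l)" "(t, l)"] x t l by (auto simp: dist_norm)
      then have "norm (R t l - T l) * norm (blinfun_inv (T l)) \<le> 1 / (2 * M) * M"
        using M(2)[OF l] M(1) by (intro mult_mono) (auto simp: R_def)
      then show "norm (R t l - T l) * norm (blinfun_inv (T l)) \<le> 1 / 2" using M(1) by simp
    qed
    have Rlift: "lift_on a b W (\<lambda>l. H (t, l)) (R t)" if t: "t \<in> {0..1}" "\<bar>t - x\<bar> < d" for t
      unfolding lift_on_def
    proof (intro conjI ballI)
      show "continuous_on {a..b} (R t)" unfolding R_def by (intro continuous_intros cT contH t x)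
      show "R t l \<in> GL" if "l \<in> {a..b}" for l by (rule RGL[OF t that])
      show "range (blinfun_apply (R t l - H (t, l))) \<subseteq> W" if "l \<in> {a..b}" for l
        using T that by (simp add: R_def lift_on_def)
    qed
    have "P s t" if st: "s \<le> x \<and> x \<le> t \<and> t - s < d" for s t
      unfolding P_def
    proof (intro impI allI)
      fix T1 T2 assume st': "0 \<le> s \<and> s \<le> t \<and> t \<le> 1" and T1: "lift_on a b W (\<lambda>l. H (s, l)) T1" and T2: "lift_on a b W (\<lambda>l. H (t, l)) T2"
      have r: "r \<in> {0..1}" "\<bar>r - x\<bar> < d" if "r \<in> {s..t}" for r using st st' that by auto
      have eq: "\<rho> (H (s, l)) (R s l) = \<rho> (H (t, l)) (R t l)" if l: "l \<in> {a..b}" and g: "\<And>r. r \<in> {0..1} \<Longrightarrow> H (r, l) \<in> GL" for l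
      proof (rule \<rho>_path[where S="\<lambda>r. H (r, l)" and T="\<lambda>r. R r l"])
        show c: "continuous_on {s..t} (\<lambda>r. H (r, l))"
          by (rule continuous_on_subset[OF contHt[OF l]]) (use r in blast)
        show "continuous_on {s..t} (\<lambda>r. R r l)" unfolding R_def by (intro continuous_intros c)
        show "Wclose (H (q, l)) (R q l)" if q: "q \<in> {s..t}" for q
          by (rule Wclose_lift[OF Rlift[OF r[OF q]] l g[OF r(1)[OF q]]])
      qed (use st in simp)
      have s: "s \<in> {s..t}" and t: "t \<in> {s..t}" using st by auto
      have "par a b (\<lambda>l. H (s, l)) T1 = par a b (\<lambda>l. H (s, l)) (R s)"
        by (rule par_indep[OF T1 Rlift[OF r[OF s]] _ _ ab]) (use ends r(1)[OF s] in auto)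
      also have "\<dots> = par a b (\<lambda>l. H (t, l)) (R t)"
        unfolding par_def using eq[OF in_ab(1) ends(1)] eq[OF in_ab(2) ends(2)] by simp
      also have "\<dots> = par a b (\<lambda>l. H (t, l)) T2"
        by (rule par_indep[OF Rlift[OF r[OF t]] T2 _ _ ab]) (use ends r(1)[OF t] in auto)
      finally show "par a b (\<lambda>l. H (s, l)) T1 = par a b (\<lambda>l. H (t, l)) T2" .
    qed
    then show ?case using d(1) by blast
  qed
  then show ?thesis using T0 T1 by (simp add: P_def)
qed

end

section \<open>Analytic operator curves\<close>

text \<open>The square and the triangular partial sums differ by terms dominated by the same
  difference for the norms, which tends to 0 by the Cauchy product of real series.\<close>

lemma (in bounded_bilinear) Cauchy_product_bilinear_sums:
  fixes x :: "nat \<Rightarrow> 'a" and y :: "nat \<Rightarrow> 'b"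
  assumes x: "x sums X" and y: "y sums Y"
    and nx: "summable (\<lambda>k. norm (x k))" and ny: "summable (\<lambda>k. norm (y k))"
  shows "(\<lambda>k. \<Sum>i\<le>k. prod (x i) (y (k - i))) sums prod X Y"
proof -
  let ?S1 = "\<lambda>n::nat. {..<n} \<times> {..<n}"
  let ?S2 = "\<lambda>n::nat. {(i,j). i + j < n}"
  let ?g = "\<lambda>(i,j). prod (x i) (y j)"
  let ?f = "\<lambda>(i,j). norm (x i) * norm (y j)"
  have S2_le_S1: "?S2 n \<subseteq> ?S1 n" for n by auto
  have finite_S1: "finite (?S1 n)" for n by simp
  have finite_S2: "finite (?S2 n)" for n by (rule finite_subset[OF S2_le_S1 finite_S1])
  obtain K where K: "K > 0" "\<And>a b. norm (prod a b) \<le> norm a * norm b * K" using pos_bounded by blast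
  have "(\<lambda>n. prod (\<Sum>k<n. x k) (\<Sum>k<n. y k)) \<longlonglongrightarrow> prod X Y"
    by (intro tendsto) (use x y in \<open>auto simp: sums_def\<close>)
  moreover have "prod (\<Sum>k<n. x k) (\<Sum>k<n. y k) = sum ?g (?S1 n)" for n
    unfolding sum_left unfolding sum_right sum.cartesian_product ..
  ultimately have 1: "(\<lambda>n. sum ?g (?S1 n)) \<longlonglongrightarrow> prod X Y" by simp
  have "(\<lambda>n. (\<Sum>k<n. norm (x k)) * (\<Sum>k<n. norm (y k))) \<longlonglongrightarrow> suminf (\<lambda>k. norm (x k)) * suminf (\<lambda>k. norm (y k))"
    by (intro tendsto_mult summable_LIMSEQ nx ny)
  then have f1: "(\<lambda>n. sum ?f (?S1 n)) \<longlonglongrightarrow> suminf (\<lambda>k. norm (x k)) * suminf (\<lambda>k. norm (y k))"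
    by (simp add: sum_product sum.cartesian_product)
  have "(\<lambda>k. \<Sum>i\<le>k. norm (x i) * norm (y (k - i))) sums (suminf (\<lambda>k. norm (x k)) * suminf (\<lambda>k. norm (y k)))"
    by (rule Cauchy_product_sums) (use nx ny in auto)
  then have f2: "(\<lambda>n. sum ?f (?S2 n)) \<longlonglongrightarrow> suminf (\<lambda>k. norm (x k)) * suminf (\<lambda>k. norm (y k))"
    by (simp only: sums_def sum.triangle_reindex)
  have lim: "(\<lambda>n. K * (sum ?f (?S1 n) - sum ?f (?S2 n))) \<longlonglongrightarrow> 0"
    using tendsto_mult[OF tendsto_const[of K] tendsto_diff[OF f1 f2]] by simp
  have "(\<lambda>n. sum ?g (?S1 n) - sum ?g (?S2 n)) \<longlonglongrightarrow> 0"
  proof (rule Lim_null_comparison[OF _ lim], intro always_eventually allI)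
    fix n
    have "norm (sum ?g (?S1 n) - sum ?g (?S2 n)) = norm (sum ?g (?S1 n - ?S2 n))"
      by (simp only: sum_diff[OF finite_S1 S2_le_S1])
    also have "\<dots> \<le> (\<Sum>p\<in>?S1 n - ?S2 n. K * ?f p)"
      by (rule order_trans[OF norm_sum sum_mono]) (auto simp: mult.commute[of K] intro: K(2))
    also have "\<dots> = K * (sum ?f (?S1 n) - sum ?f (?S2 n))"
      by (simp only: sum_diff[OF finite_S1 S2_le_S1] sum_distrib_left[symmetric])
    finally show "norm (sum ?g (?S1 n) - sum ?g (?S2 n)) \<le> K * (sum ?f (?S1 n) - sum ?f (?S2 n))" .
  qed
  with 1 have "(\<lambda>n. sum ?g (?S2 n)) \<longlonglongrightarrow> prod X Y" by (rule Lim_transform2)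
  then show ?thesis by (simp only: sums_def sum.triangle_reindex)
qed

section \<open>Power series with values in a Banach space\<close>

definition pser :: "real \<Rightarrow> (nat \<Rightarrow> 'a::banach) \<Rightarrow> (real \<Rightarrow> 'a) \<Rightarrow> real \<Rightarrow> bool" where
  "pser l0 c f r \<longleftrightarrow> r > 0 \<and> (\<forall>s. \<bar>s - l0\<bar> < r \<longrightarrow> (\<lambda>n. (s - l0) ^ n *\<^sub>R c n) sums f s)"

lemma pserD: "pser l0 c f r \<Longrightarrow> \<bar>s - l0\<bar> < r \<Longrightarrow> (\<lambda>n. (s - l0) ^ n *\<^sub>R c n) sums f s"
  and pser_pos: "pser l0 c f r \<Longrightarrow> r > 0"
  by (auto simp: pser_def)

lemma pser_mono: "pser l0 c f r \<Longrightarrow> 0 < r' \<Longrightarrow> r' \<le> r \<Longrightarrow> pser l0 c f r'"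
  by (auto simp: pser_def)

lemma pser_cong: assumes "pser l0 c f r" "\<And>s. \<bar>s - l0\<bar> < r \<Longrightarrow> f s = g s" shows "pser l0 c g r"
  using assms by (auto simp: pser_def)

text \<open>The terms of a convergent series at distance \<open>q\<close> from the centre are
  bounded.\<close>

lemma pser_bound: assumes p: "pser l0 c f r" and q: "0 < q" "q < r"
  shows "\<exists>K>0. \<forall>n. norm (c n) \<le> K * (1 / q) ^ n"
proof -
  have "(\<lambda>n. (l0 + q - l0) ^ n *\<^sub>R c n) sums f (l0 + q)" by (rule pserD[OF p]) (use q in auto)
  then have "summable (\<lambda>n. q ^ n *\<^sub>R c n)" by (simp add: sums_iff)
  then have "Bseq (\<lambda>n. q ^ n *\<^sub>R c n)" using summable_LIMSEQ_zero convergent_imp_Bseq convergentI by blast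
  then obtain K where K: "K > 0" "\<And>n. norm (q ^ n *\<^sub>R c n) \<le> K" by (auto simp: Bseq_def)
  have "norm (c n) \<le> K * (1 / q) ^ n" for n
    using K(2)[of n] q by (simp add: field_simps power_divide)
  then show ?thesis using K(1) by blast
qed

lemma pser_summable_norm: assumes p: "pser l0 c f r" and s: "\<bar>s - l0\<bar> < r"
  shows "summable (\<lambda>n. norm ((s - l0) ^ n *\<^sub>R c n))"
proof -
  define q where "q = (\<bar>s - l0\<bar> + r) / 2"
  have q: "0 < q" "q < r" "\<bar>s - l0\<bar> < q" using s pser_pos[OF p] by (auto simp: q_def)
  obtain K where K: "K > 0" "\<And>n. norm (c n) \<le> K * (1 / q) ^ n" using pser_bound[OF p q(1,2)] by blast
  have "summable (\<lambda>n. K * (\<bar>s - l0\<bar> / q) ^ n)" by (intro summable_mult summable_geometric) (use q in auto)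
  then show ?thesis
  proof (rule summable_comparison_test')
    fix n
    have "norm ((s - l0) ^ n *\<^sub>R c n) = \<bar>s - l0\<bar> ^ n * norm (c n)" by (simp add: power_abs)
    also have "\<dots> \<le> \<bar>s - l0\<bar> ^ n * (K * (1 / q) ^ n)" by (intro mult_left_mono K) auto
    finally show "norm (norm ((s - l0) ^ n *\<^sub>R c n)) \<le> K * (\<bar>s - l0\<bar> / q) ^ n"
      by (simp add: power_divide mult.commute)
  qed
qed

lemma pser_from_bound: assumes "\<And>n. norm (c n) \<le> K * q ^ n" "q > 0"
  shows "pser l0 c (\<lambda>s. suminf (\<lambda>n. (s - l0) ^ n *\<^sub>R c n)) (1 / q)"
  unfolding pser_def
proof (intro conjI allI impI)
  show "1 / q > 0" using assms by simp
  fix s assume s: "\<bar>s - l0\<bar> < 1 / q"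
  have "summable (\<lambda>n. K * (\<bar>s - l0\<bar> * q) ^ n)"
    by (intro summable_mult summable_geometric) (use assms s in \<open>auto simp: field_simps abs_mult\<close>)
  then have "summable (\<lambda>n. (s - l0) ^ n *\<^sub>R c n)"
  proof (rule summable_comparison_test')
    fix n
    have "norm ((s - l0) ^ n *\<^sub>R c n) = \<bar>s - l0\<bar> ^ n * norm (c n)" by (simp add: power_abs)
    also have "\<dots> \<le> \<bar>s - l0\<bar> ^ n * (K * q ^ n)" by (intro mult_left_mono assms) auto
    finally show "norm ((s - l0) ^ n *\<^sub>R c n) \<le> K * (\<bar>s - l0\<bar> * q) ^ n"
      by (simp add: power_mult_distrib mult.left_commute)
  qed
  then show "(\<lambda>n. (s - l0) ^ n *\<^sub>R c n) sums suminf (\<lambda>n. (s - l0) ^ n *\<^sub>R c n)" by (rule summable_sums)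
qed

lemma pser_at_center: assumes "pser l0 c f r" shows "f l0 = c 0"
proof -
  have "(\<lambda>n. (l0 - l0) ^ n *\<^sub>R c n) sums f l0" by (rule pserD[OF assms]) (use pser_pos[OF assms] in simp)
  moreover have "(\<lambda>n. (l0 - l0) ^ n *\<^sub>R c n) = (\<lambda>n. if n = 0 then c 0 else 0)" by (auto simp: fun_eq_iff power_0_left)
  ultimately show ?thesis using sums_unique2[OF _ sums_single[of 0 "\<lambda>_. c 0"]] by simp
qed

lemma pser_bilinear:
  fixes pr :: "'a::banach \<Rightarrow> 'b::banach \<Rightarrow> 'c::banach"
  assumes B: "bounded_bilinear pr" and f: "pser l0 a f r" and g: "pser l0 b g r"
  shows "pser l0 (\<lambda>n. \<Sum>i\<le>n. pr (a i) (b (n - i))) (\<lambda>s. pr (f s) (g s)) r"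
  unfolding pser_def
proof (intro conjI allI impI)
  interpret bounded_bilinear pr by fact
  show "r > 0" by (rule pser_pos[OF f])
  fix s assume s: "\<bar>s - l0\<bar> < r"
  have "(\<lambda>k. \<Sum>i\<le>k. pr ((s - l0) ^ i *\<^sub>R a i) ((s - l0) ^ (k - i) *\<^sub>R b (k - i))) sums pr (f s) (g s)"
    by (rule Cauchy_product_bilinear_sums[OF pserD[OF f s] pserD[OF g s] pser_summable_norm[OF f s] pser_summable_norm[OF g s]])
  moreover have "(\<Sum>i\<le>k. pr ((s - l0) ^ i *\<^sub>R a i) ((s - l0) ^ (k - i) *\<^sub>R b (k - i))) = (s - l0) ^ k *\<^sub>R (\<Sum>i\<le>k. pr (a i) (b (k - i)))" for k
    unfolding scaleR_sum_right
    by (rule sum.cong) (auto simp: scaleR_left scaleR_right simp flip: power_add)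
  ultimately show "(\<lambda>n. (s - l0) ^ n *\<^sub>R (\<Sum>i\<le>n. pr (a i) (b (n - i)))) sums pr (f s) (g s)" by simp
qed

lemma pser_add: "pser l0 a f r \<Longrightarrow> pser l0 b g r \<Longrightarrow> pser l0 (\<lambda>n. a n + b n) (\<lambda>s. f s + g s) r"
  unfolding pser_def by (auto simp: scaleR_add_right intro: sums_add)

lemma pser_linear: assumes "bounded_linear h" "pser l0 a f r" shows "pser l0 (\<lambda>n. h (a n)) (\<lambda>s. h (f s)) r"
  unfolding pser_def
proof (intro conjI allI impI)
  interpret bounded_linear h by fact
  show "r > 0" by (rule pser_pos[OF assms(2)])
  fix s assume "\<bar>s - l0\<bar> < r"
  then show "(\<lambda>n. (s - l0) ^ n *\<^sub>R h (a n)) sums h (f s)" using sums[OF pserD[OF assms(2)], of s] by (simp add: scaleR)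
qed

lemma pser_const: "r > 0 \<Longrightarrow> pser l0 (\<lambda>n. if n = 0 then x else 0) (\<lambda>s. x) r"
  unfolding pser_def
  using sums_single[of 0 "\<lambda>_. x"] by (auto simp: if_distrib[of "\<lambda>x. _ *\<^sub>R x"] cong: if_cong)

lemma pser_monom: assumes "r > 0" shows "pser l0 (\<lambda>n. if n = k then x else 0) (\<lambda>s. (s - l0) ^ k *\<^sub>R x) r"
  unfolding pser_def
proof (intro conjI allI impI assms)
  fix s
  have "(\<lambda>n. (s - l0) ^ n *\<^sub>R (if n = k then x else 0)) = (\<lambda>n. if n = k then (s - l0) ^ n *\<^sub>R x else 0)" by auto
  then show "(\<lambda>n. (s - l0) ^ n *\<^sub>R (if n = k then x else 0)) sums ((s - l0) ^ k *\<^sub>R x)"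
    using sums_single[of k "\<lambda>n. (s - l0) ^ n *\<^sub>R x"] by simp
qed

text \<open>Termwise differentiation: the derived coefficients satisfy geometric bounds for every
  radius below \<open>r\<close>, so the derived series converges uniformly on smaller balls.\<close>

lemma pser_has_derivative:
  assumes p: "pser l0 c f r"
  shows "\<exists>g. pser l0 (\<lambda>n. real (Suc n) *\<^sub>R c (Suc n)) g r \<and> (\<forall>s. \<bar>s - l0\<bar> < r \<longrightarrow> (f has_vector_derivative g s) (at s))"
proof -
  define d where "d n = real (Suc n) *\<^sub>R c (Suc n)" for n
  define g where "g s = suminf (\<lambda>n. (s - l0) ^ n *\<^sub>R d n)" for s
  \<comment> \<open>The factor produced by differentiation is absorbed by passing from the radius
    \<open>q\<close> to the smaller \<open>p1\<close>: for \<open>x = p1 / q < 1\<close> the numbers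
    \<open>n x^n\<close> are bounded.\<close>
  have key: "\<exists>K p. 0 < K \<and> p > \<rho> \<and> (\<forall>n. norm (d n) \<le> K * (1 / p) ^ n)" if \<rho>: "0 < \<rho>" "\<rho> < r" for \<rho>
  proof -
    define p1 where "p1 = (\<rho> + r) / 2"
    define q where "q = (p1 + r) / 2"
    have q: "0 < \<rho>" "\<rho> < p1" "p1 < q" "q < r" using \<rho> by (auto simp: p1_def q_def)
    obtain K where K: "K > 0" "\<And>n. norm (c n) \<le> K * (1 / q) ^ n" using pser_bound[OF p, of q] q by auto
    define x where "x = p1 / q"
    have x: "0 < x" "x < 1" using q by (auto simp: x_def)
    have "(\<lambda>n. real n * x ^ n) \<longlonglongrightarrow> 0" using x by (intro powser_times_n_limit_0) auto
    then have "Bseq (\<lambda>n. real n * x ^ n)" using convergent_imp_Bseq convergentI by blast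
    then obtain B where B: "B > 0" "\<And>n. norm (real n * x ^ n) \<le> B" by (auto simp: Bseq_def)
    have "norm (d n) \<le> (K * B / p1) * (1 / p1) ^ n" for n
    proof -
      have "norm (d n) \<le> real (Suc n) * (K * (1 / q) ^ Suc n)" unfolding d_def using K(2)[of "Suc n"]
        by (simp add: mult_left_mono del: of_nat_Suc power_Suc)
      also have "\<dots> = K * (real (Suc n) * x ^ Suc n) * (1 / p1) ^ Suc n"
        using q by (simp add: x_def power_divide field_simps del: of_nat_Suc)
      also have "\<dots> \<le> K * B * (1 / p1) ^ Suc n"
        using B(2)[of "Suc n"] K(1) x q by (intro mult_right_mono mult_left_mono) (auto simp del: of_nat_Suc)
      finally show ?thesis by simp
    qed
    moreover have "K * B / p1 > 0" using K B q by simp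
    ultimately show ?thesis using q by blast
  qed
  have psg: "pser l0 d g r"
    unfolding pser_def
  proof (intro conjI allI impI pser_pos[OF p])
    fix s assume s: "\<bar>s - l0\<bar> < r"
    define \<rho> where "\<rho> = (\<bar>s - l0\<bar> + r) / 2"
    have \<rho>: "0 < \<rho>" "\<rho> < r" "\<bar>s - l0\<bar> < \<rho>" using s pser_pos[OF p] by (auto simp: \<rho>_def)
    then obtain K p' where K: "0 < K" "p' > \<rho>" "\<And>n. norm (d n) \<le> K * (1 / p') ^ n" using key by blast
    have "pser l0 d g (1 / (1 / p'))" unfolding g_def using K \<rho> by (intro pser_from_bound) auto
    then show "(\<lambda>n. (s - l0) ^ n *\<^sub>R d n) sums g s" by (rule pserD) (use K \<rho> in auto)
  qed
  have "(f has_vector_derivative g s) (at s)" if s: "\<bar>s - l0\<bar> < r" for s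
  proof -
    define \<rho> where "\<rho> = (\<bar>s - l0\<bar> + r) / 2"
    have \<rho>: "0 < \<rho>" "\<rho> < r" "\<bar>s - l0\<bar> < \<rho>" using s pser_pos[OF p] by (auto simp: \<rho>_def)
    then obtain K p' where K: "0 < K" "p' > \<rho>" "\<And>n. norm (d n) \<le> K * (1 / p') ^ n" using key by blast
    define S where "S = ball l0 \<rho>"
    have Sabs: "x \<in> S \<longleftrightarrow> \<bar>x - l0\<bar> < \<rho>" for x by (auto simp: S_def dist_real_def)
    have ul: "uniform_limit S (\<lambda>n x. \<Sum>i<n. (x - l0) ^ i *\<^sub>R d i) g sequentially"
      unfolding g_def
    proof (rule Weierstrass_m_test)
      show "summable (\<lambda>n. K * (\<rho> / p') ^ n)" by (intro summable_mult summable_geometric) (use K \<rho> in auto)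
      fix n x assume "x \<in> S"
      then have "norm ((x - l0) ^ n *\<^sub>R d n) \<le> \<rho> ^ n * (K * (1 / p') ^ n)"
        using K(3)[of n] \<rho> by (auto simp: Sabs power_abs intro!: mult_mono power_mono)
      then show "norm ((x - l0) ^ n *\<^sub>R d n) \<le> K * (\<rho> / p') ^ n" by (simp add: power_divide mult.commute)
    qed
    have "\<exists>G. \<forall>x\<in>S. (\<lambda>n. (x - l0) ^ n *\<^sub>R c n) sums G x \<and> (G has_derivative (\<lambda>h. h *\<^sub>R g x)) (at x within S)"
    proof (rule has_derivative_series[where f'="\<lambda>n x h. h *\<^sub>R (real n * (x - l0) ^ (n - 1)) *\<^sub>R c n"])
      show "convex S" by (simp add: S_def)
      show "l0 \<in> S" using \<rho> by (simp add: S_def)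
      show "(\<lambda>n. (l0 - l0) ^ n *\<^sub>R c n) sums f l0" by (rule pserD[OF p]) (use pser_pos[OF p] in simp)
      show "((\<lambda>x. (x - l0) ^ n *\<^sub>R c n) has_derivative (\<lambda>h. h *\<^sub>R (real n * (x - l0) ^ (n - 1)) *\<^sub>R c n)) (at x within S)" for n x
        by (auto intro!: derivative_eq_intros)
      show "\<forall>\<^sub>F n in sequentially. \<forall>x\<in>S. \<forall>h. norm ((\<Sum>i<n. h *\<^sub>R (real i * (x - l0) ^ (i - 1)) *\<^sub>R c i) - h *\<^sub>R g x) \<le> e * norm h" if e: "e > 0" for e
      proof -
        have "\<forall>\<^sub>F n in sequentially. \<forall>x\<in>S. dist (\<Sum>i<n. (x - l0) ^ i *\<^sub>R d i) (g x) < e"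
          using ul e by (auto simp: uniform_limit_iff)
        \<comment> \<open>The term of index 0 has zero derivative, so the first \<open>n\<close>
          derived terms are the first \<open>n - 1\<close> terms of the series with coefficients
          \<open>d\<close>.\<close>
        then have "\<forall>\<^sub>F n in sequentially. \<forall>x\<in>S. dist (\<Sum>i<n - 1. (x - l0) ^ i *\<^sub>R d i) (g x) < e"
          by (rule eventually_compose_filterlim) (rule filterlim_minus_const_nat_at_top)
        then show ?thesis
          using eventually_gt_at_top[of 0]
        proof eventually_elim
          case (elim n)
          then obtain n' where n': "n = Suc n'" by (cases n) auto
          show ?case
          proof (intro ballI allI)
            fix x h :: real assume "x \<in> S"
            have "(\<Sum>i<n. h *\<^sub>R (real i * (x - l0) ^ (i - 1)) *\<^sub>R c i) = h *\<^sub>R (\<Sum>i<n'. (x - l0) ^ i *\<^sub>R d i)"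
              unfolding n' sum.lessThan_Suc_shift d_def by (simp add: scaleR_sum_right mult.commute)
            then have "norm ((\<Sum>i<n. h *\<^sub>R (real i * (x - l0) ^ (i - 1)) *\<^sub>R c i) - h *\<^sub>R g x) = \<bar>h\<bar> * norm ((\<Sum>i<n'. (x - l0) ^ i *\<^sub>R d i) - g x)"
              by (simp flip: scaleR_diff_right)
            also have "\<dots> \<le> \<bar>h\<bar> * e" using elim(1) \<open>x \<in> S\<close> n' by (intro mult_left_mono) (auto simp: dist_norm less_imp_le)
            finally show "norm ((\<Sum>i<n. h *\<^sub>R (real i * (x - l0) ^ (i - 1)) *\<^sub>R c i) - h *\<^sub>R g x) \<le> e * norm h"
              by (simp add: mult.commute)
          qed
        qed
      qed
    qed
    then obtain G where G: "\<And>x. x \<in> S \<Longrightarrow> (\<lambda>n. (x - l0) ^ n *\<^sub>R c n) sums G x" "\<And>x. x \<in> S \<Longrightarrow> (G has_derivative (\<lambda>h. h *\<^sub>R g x)) (at x within S)"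
      by blast
    have Gf: "G x = f x" if "x \<in> S" for x
      using sums_unique2[OF G(1)[OF that] pserD[OF p]] that \<rho> by (simp add: Sabs)
    have sS: "s \<in> S" using \<rho> by (simp add: Sabs)
    have "open S" by (simp add: S_def)
    then have "(G has_derivative (\<lambda>h. h *\<^sub>R g s)) (at s)" using G(2)[OF sS] at_within_open[OF sS] by simp
    then have "(f has_derivative (\<lambda>h. h *\<^sub>R g s)) (at s)"
      by (rule has_derivative_transform_within_open[OF _ \<open>open S\<close> sS]) (rule Gf)
    then show ?thesis by (simp add: has_vector_derivative_def)
  qed
  then show ?thesis using psg unfolding d_def by blast
qed

lemma pser_nth_deriv:
  assumes "pser l0 c f r"
  shows "pser l0 (((\<lambda>c n. real (Suc n) *\<^sub>R c (Suc n)) ^^ j) c) (nth_deriv j f) r"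
proof (induction j)
  case 0 then show ?case using assms by (simp add: nth_deriv_def)
next
  case (Suc j)
  obtain g where g: "pser l0 (\<lambda>n. real (Suc n) *\<^sub>R (((\<lambda>c n. real (Suc n) *\<^sub>R c (Suc n)) ^^ j) c) (Suc n)) g r"
    "\<And>s. \<bar>s - l0\<bar> < r \<Longrightarrow> (nth_deriv j f has_vector_derivative g s) (at s)"
    using pser_has_derivative[OF Suc] by blast
  have "g s = nth_deriv (Suc j) f s" if "\<bar>s - l0\<bar> < r" for s
    using vector_derivative_at[OF g(2)[OF that]] by (simp add: nth_deriv_def)
  then have "pser l0 (\<lambda>n. real (Suc n) *\<^sub>R (((\<lambda>c n. real (Suc n) *\<^sub>R c (Suc n)) ^^ j) c) (Suc n)) (nth_deriv (Suc j) f) r"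
    by (rule pser_cong[OF g(1)])
  then show ?case by simp
qed

text \<open>This turns the derivatives in the definition of transversality into power series
  coefficients; the algebra of transversal spaces can then be carried out on sequences.\<close>

lemma pser_taylor_coeff:
  assumes "pser l0 c f r" shows "taylor_coeff f l0 j = c j"
proof -
  have "((\<lambda>c n. real (Suc n) *\<^sub>R c (Suc n)) ^^ j) c n = (fact (n + j) / fact n) *\<^sub>R c (n + j)" for n
  proof (induction j arbitrary: n)
    case 0 then show ?case by simp
  next
    case (Suc j)
    have "real (Suc n) * (fact (Suc n + j) / fact (Suc n)) = fact (n + Suc j) / fact n"
      by (simp add: field_simps del: of_nat_Suc)
    then show ?case using Suc[of "Suc n"] by (simp del: of_nat_Suc fact_Suc)
  qed
  from this[of 0] have "nth_deriv j f l0 = fact j *\<^sub>R c j"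
    using pser_at_center[OF pser_nth_deriv[OF assms, of j]] by simp
  then show ?thesis by (simp add: taylor_coeff_def)
qed

lemma pser_Cr_on: assumes "pser l0 c f r" shows "Cr_on k (ball l0 r) f"
proof -
  have "nth_deriv j f differentiable (at s)" if "s \<in> ball l0 r" for j s
    using pser_has_derivative[OF pser_nth_deriv[OF assms, of j]] that
    by (auto simp: dist_real_def differentiable_def has_vector_derivative_def abs_minus_commute)
  then show ?thesis unfolding Cr_on_def
    by (auto intro!: continuous_at_imp_continuous_on differentiable_imp_continuous_within)
qed

lemma pser_continuous_on: assumes "pser l0 c f r" shows "continuous_on (ball l0 r) f"
  using pser_Cr_on[OF assms, of 0] by (simp add: Cr_on_def nth_deriv_def)

section \<open>Germs of analytic functions\<close>

definition an :: "real \<Rightarrow> (real \<Rightarrow> 'a::banach) \<Rightarrow> bool" where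
  "an l0 f \<longleftrightarrow> (\<exists>c r. pser l0 c f r)"

lemma an_common: assumes "an l0 f" "an l0 g"
  obtains a b r where "pser l0 a f r" "pser l0 b g r"
proof -
  obtain a r1 b r2 where ab: "pser l0 a f r1" "pser l0 b g r2" using assms by (auto simp: an_def)
  then have "pser l0 a f (min r1 r2)" "pser l0 b g (min r1 r2)"
    by (auto intro!: pser_mono[OF ab(1)] pser_mono[OF ab(2)] dest: pser_pos)
  then show ?thesis by (rule that)
qed

lemma an_const: "an l0 (\<lambda>s. x)" unfolding an_def using pser_const[of 1] by (intro exI) simp

lemma an_add: "an l0 f \<Longrightarrow> an l0 g \<Longrightarrow> an l0 (\<lambda>s. f s + g s)"
  by (erule an_common, assumption) (auto simp: an_def dest: pser_add)

lemma an_bilinear: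
  fixes pr :: "'a::banach \<Rightarrow> 'b::banach \<Rightarrow> 'c::banach"
  assumes "bounded_bilinear pr" "an l0 f" "an l0 g" shows "an l0 (\<lambda>s. pr (f s) (g s))"
proof -
  obtain a b r where "pser l0 a f r" "pser l0 b g r" using an_common[OF assms(2,3)] .
  from pser_bilinear[OF assms(1) this] show ?thesis unfolding an_def by blast
qed

lemma an_linear: "bounded_linear h \<Longrightarrow> an l0 f \<Longrightarrow> an l0 (\<lambda>s. h (f s))"
  unfolding an_def using pser_linear by blast

lemma an_mult: "an l0 f \<Longrightarrow> an l0 g \<Longrightarrow> an l0 (\<lambda>s. f s * g s)" for f g :: "real \<Rightarrow> real"
  by (rule an_bilinear[OF bounded_bilinear_mult])

lemma an_compose: "an l0 f \<Longrightarrow> an l0 g \<Longrightarrow> an l0 (\<lambda>s. f s o\<^sub>L g s)"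
  for f :: "real \<Rightarrow> 'b::banach \<Rightarrow>\<^sub>L 'c::banach" and g :: "real \<Rightarrow> 'a::banach \<Rightarrow>\<^sub>L 'b"
  by (rule an_bilinear[OF bounded_bilinear_blinfun_compose])

lemma an_sum: assumes "finite I" "\<And>i. i \<in> I \<Longrightarrow> an l0 (f i)" shows "an l0 (\<lambda>s. \<Sum>i\<in>I. f i s)"
  using assms by (induction I rule: finite_induct) (auto intro: an_const an_add)

lemma an_prod: fixes f :: "'i \<Rightarrow> real \<Rightarrow> real"
  assumes "finite I" "\<And>i. i \<in> I \<Longrightarrow> an l0 (f i)" shows "an l0 (\<lambda>s. \<Prod>i\<in>I. f i s)"
  using assms by (induction I rule: finite_induct) (auto intro: an_const an_mult)

lemma an_ident: "an l0 (\<lambda>s. s)"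
proof -
  have "an l0 (\<lambda>s. (s - l0) ^ 1 *\<^sub>R (1::real))" unfolding an_def by (intro exI, rule pser_monom[of 1]) simp
  from an_add[OF this an_const[of l0 l0]] show ?thesis by simp
qed

lemma an_power: "an l0 (\<lambda>s. s ^ k)" for l0 :: real
  by (induction k) (auto intro: an_const an_mult[OF an_ident])

lemma an_poly: assumes "operator_polynomial \<Phi>" shows "an l0 \<Phi>"
proof -
  obtain m P where P: "\<And>t. \<Phi> t = (\<Sum>k\<le>m. t ^ k *\<^sub>R P k)" using assms by (auto simp: operator_polynomial_def)
  have "an l0 (\<lambda>t. \<Sum>k\<le>m. t ^ k *\<^sub>R P k)"
    by (intro an_sum an_bilinear[OF bounded_bilinear_scaleR] an_power an_const) simp
  then show ?thesis by (simp add: P[abs_def])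
qed

lemma an_continuous: assumes "an l0 f" shows "continuous (at l0) f"
proof -
  obtain c r where p: "pser l0 c f r" using assms by (auto simp: an_def)
  have "l0 \<in> ball l0 r" using pser_pos[OF p] by simp
  then show ?thesis using pser_continuous_on[OF p] continuous_on_eq_continuous_at[of "ball l0 r" f] by simp
qed

lemma an_cong: assumes "an l0 f" "r > 0" "\<And>s. \<bar>s - l0\<bar> < r \<Longrightarrow> f s = g s" shows "an l0 g"
proof -
  obtain c r' where p: "pser l0 c f r'" using assms by (auto simp: an_def)
  have "pser l0 c f (min r r')" using p assms(2) by (intro pser_mono[OF p]) (auto dest: pser_pos)
  then have "pser l0 c g (min r r')" by (rule pser_cong) (use assms(3) in auto)
  then show ?thesis by (auto simp: an_def)
qed

text \<open>The coefficients of the inverse of the power series \<open>A\<close>, found by comparing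
  coefficients in the product; \<open>S\<close> is meant to be the inverse of
  \<open>A 0\<close>.\<close>

fun inv_coeff :: "('b::banach \<Rightarrow>\<^sub>L 'a::banach) \<Rightarrow> (nat \<Rightarrow> 'a \<Rightarrow>\<^sub>L 'b) \<Rightarrow> nat \<Rightarrow> 'b \<Rightarrow>\<^sub>L 'a" where
  "inv_coeff S A n = (if n = 0 then S else - (S o\<^sub>L (\<Sum>i\<in>{1..n}. A i o\<^sub>L inv_coeff S A (n - i))))"

declare inv_coeff.simps[simp del]

text \<open>The rate is chosen so that the recursion becomes a geometric sum with ratio
  \<open>x = 1 / (1 + b K)\<close>. Since \<open>b K x = 1 - x\<close>, this sum closes up to
  \<open>1 - x^n\<close>, which is at most 1, and the induction reproduces its own bound.\<close>

lemma inv_coeff_bound: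
  assumes A: "\<And>n. norm (A n) \<le> K * \<sigma> ^ n" and K: "K > 0" "\<sigma> > 0" and b: "norm S \<le> b" "b > 0"
  shows "norm (inv_coeff S A n) \<le> b * (\<sigma> * (1 + b * K)) ^ n"
proof (induction n rule: less_induct)
  case (less n)
  define q where "q = \<sigma> * (1 + b * K)"
  have q: "q > 0" using K b by (auto simp: q_def intro!: mult_pos_pos add_pos_pos)
  show ?case
  proof (cases "n = 0")
    case True then show ?thesis using b by (simp add: inv_coeff.simps[of _ _ 0])
  next
    case False
    define x where "x = 1 / (1 + b * K)"
    have bK: "b * K > 0" using b K by simp
    have x: "0 < x" "x < 1" using bK by (auto simp: x_def)
    have sq: "\<sigma> = q * x" using bK by (simp add: q_def x_def)
    have "norm (inv_coeff S A n) = norm (S o\<^sub>L (\<Sum>i\<in>{1..n}. A i o\<^sub>L inv_coeff S A (n - i)))"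
      using False by (subst inv_coeff.simps) simp
    also have "\<dots> \<le> b * (\<Sum>i\<in>{1..n}. K * \<sigma> ^ i * (b * q ^ (n - i)))"
    proof (rule order_trans[OF norm_blinfun_compose], rule mult_mono[OF b(1)])
      show "norm (\<Sum>i\<in>{1..n}. A i o\<^sub>L inv_coeff S A (n - i)) \<le> (\<Sum>i\<in>{1..n}. K * \<sigma> ^ i * (b * q ^ (n - i)))"
      proof (rule order_trans[OF norm_sum sum_mono])
        fix i assume i: "i \<in> {1..n}"
        then have "norm (inv_coeff S A (n - i)) \<le> b * q ^ (n - i)" using less[of "n - i"] by (simp add: q_def)
        then show "norm (A i o\<^sub>L inv_coeff S A (n - i)) \<le> K * \<sigma> ^ i * (b * q ^ (n - i))"
          using A[of i] K by (intro order_trans[OF norm_blinfun_compose] mult_mono) auto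
      qed
    qed (use b in auto)
    also have "(\<Sum>i\<in>{1..n}. K * \<sigma> ^ i * (b * q ^ (n - i))) = (\<Sum>i\<in>{1..n}. (b * K * q ^ n) * x ^ i)"
    proof (rule sum.cong[OF refl])
      fix i assume i: "i \<in> {1..n}"
      have "q ^ n = q ^ i * q ^ (n - i)" using i by (simp flip: power_add)
      then show "K * \<sigma> ^ i * (b * q ^ (n - i)) = (b * K * q ^ n) * x ^ i"
        by (simp add: sq power_mult_distrib)
    qed
    also have "\<dots> = (q ^ n) * (b * K * (\<Sum>i\<in>{1..n}. x ^ i))" by (simp add: sum_distrib_left mult_ac)
    also have "b * K * (\<Sum>i\<in>{1..n}. x ^ i) = 1 - x ^ n"
    proof -
      have "(1 - x) * (\<Sum>i\<in>{1..n}. x ^ i) = x - x ^ Suc n"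
        using sum_gp_multiplied[of 1 n x] False by simp
      moreover have "b * K * x = 1 - x" using bK by (simp add: x_def field_simps)
      moreover have "x * (b * K * (\<Sum>i\<in>{1..n}. x ^ i)) = (b * K * x) * (\<Sum>i\<in>{1..n}. x ^ i)" by simp
      ultimately have "x * (b * K * (\<Sum>i\<in>{1..n}. x ^ i)) = x - x ^ Suc n" by metis
      then have "x * (b * K * (\<Sum>i\<in>{1..n}. x ^ i)) = x * (1 - x ^ n)" by (simp only: right_diff_distrib mult_1_right power_Suc)
      then show ?thesis using x by simp
    qed
    also have "b * (q ^ n * (1 - x ^ n)) \<le> b * q ^ n"
      using b q x by (intro mult_left_mono) (auto simp: mult_le_cancel_left1)
    finally show ?thesis by (simp add: q_def)
  qed
qed

text \<open>The formal inverse has positive radius of convergence and is a right inverse there; near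
  \<open>l0\<close> the values of \<open>f\<close> are invertible, so a right inverse is the
  inverse.\<close>

lemma an_inverse:
  fixes f :: "real \<Rightarrow> 'a::banach \<Rightarrow>\<^sub>L 'b::banach"
  assumes "an l0 f" "f l0 \<in> GL" shows "an l0 (\<lambda>s. blinfun_inv (f s))"
proof -
  obtain A r where p: "pser l0 A f r" using assms by (auto simp: an_def)
  define S where "S = blinfun_inv (f l0)"
  have A0: "A 0 = f l0" using pser_at_center[OF p] by simp
  obtain K where K: "K > 0" "\<And>n. norm (A n) \<le> K * (1 / (r / 2)) ^ n"
    using pser_bound[OF p, of "r / 2"] pser_pos[OF p] by auto
  define q where "q = (1 / (r / 2)) * (1 + (norm S + 1) * K)"
  define B where "B = inv_coeff S A"
  have r: "r > 0" using pser_pos[OF p] .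
  have q: "q > 0" unfolding q_def using r K by (intro mult_pos_pos add_pos_nonneg) auto
  have "norm (B n) \<le> (norm S + 1) * q ^ n" for n
    unfolding B_def q_def by (rule inv_coeff_bound[OF K(2) K(1)]) (use r in \<open>auto intro: add_nonneg_pos\<close>)
  then have pB: "pser l0 B (\<lambda>s. suminf (\<lambda>n. (s - l0) ^ n *\<^sub>R B n)) (1 / q)" (is "pser _ _ ?g _")
    using q by (rule pser_from_bound)
  define r1 where "r1 = min r (1 / q)"
  have r1: "r1 > 0" using r q by (simp add: r1_def)
  have pB': "pser l0 B ?g r1" and pA': "pser l0 A f r1"
    by (rule pser_mono[OF pB r1] pser_mono[OF p r1]; simp add: r1_def)+
  have coeff: "(\<Sum>i\<le>n. A i o\<^sub>L B (n - i)) = (if n = 0 then id_blinfun else 0)" for n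
  proof (cases n)
    case 0 then show ?thesis using blinfun_inv_GL[OF assms(2)] by (simp add: B_def inv_coeff.simps[of _ _ 0] A0 S_def)
  next
    case (Suc n')
    define R where "R = (\<Sum>i\<in>{1..n}. A i o\<^sub>L B (n - i))"
    have "(\<Sum>i\<le>n. A i o\<^sub>L B (n - i)) = (A 0 o\<^sub>L B n) + R"
      unfolding R_def by (simp add: atMost_atLeast0 sum.atLeast_Suc_atMost)
    also have "B n = - (S o\<^sub>L R)" unfolding R_def B_def using Suc by (subst inv_coeff.simps) simp
    also have "(A 0 o\<^sub>L (- (S o\<^sub>L R))) + R = 0"
      by (rule blinfun_eqI) (simp add: A0 S_def plus_blinfun.rep_eq uminus_blinfun.rep_eq blinfun.minus_right blinfun_inv_apply[OF assms(2)])
    finally show ?thesis using Suc by simp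
  qed
  have "pser l0 (\<lambda>n. if n = 0 then id_blinfun else 0) (\<lambda>s. f s o\<^sub>L ?g s) r1"
    using pser_bilinear[OF bounded_bilinear_blinfun_compose pA' pB'] by (simp add: coeff)
  then have fg: "f s o\<^sub>L ?g s = id_blinfun" if "\<bar>s - l0\<bar> < r1" for s
    using sums_unique2[OF pserD[OF _ that] pserD[OF pser_const[OF r1] that]] by blast
  have "l0 \<in> ball l0 r" using r by simp
  then obtain d where d: "d > 0" "\<And>s. s \<in> ball l0 r \<Longrightarrow> dist s l0 < d \<Longrightarrow> f s \<in> GL"
    using continuous_on_open_nbhd[OF pser_continuous_on[OF p] open_GL _ assms(2)] by blast
  have "an l0 ?g" using pB by (auto simp: an_def)
  then show ?thesis
  proof (rule an_cong)
    show "min d (min r r1) > 0" using d r r1 by simp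
    fix s assume s: "\<bar>s - l0\<bar> < min d (min r r1)"
    then have G: "f s \<in> GL" using d(2)[of s] by (auto simp: dist_real_def abs_minus_commute)
    show "?g s = blinfun_inv (f s)"
    proof (rule blinfun_eqI)
      fix v
      have "f s (?g s v) = v" using fg[of s] s by (metis blinfun_apply_blinfun_compose blinfun_apply_id_blinfun min_less_iff_conj)
      then show "?g s v = blinfun_inv (f s) v" by (metis blinfun_inv_apply(1)[OF G])
    qed
  qed
qed

lemma pser_shift:
  assumes p: "pser l0 c f r" and z: "\<And>i. i < n \<Longrightarrow> c i = 0"
  shows "\<exists>g. pser l0 (\<lambda>i. c (i + n)) g r \<and> (\<forall>s. \<bar>s - l0\<bar> < r \<longrightarrow> f s = (s - l0) ^ n *\<^sub>R g s)"
proof -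
  define g where "g s = (if s = l0 then c n else inverse ((s - l0) ^ n) *\<^sub>R f s)" for s
  have "(\<lambda>i. (s - l0) ^ i *\<^sub>R c (i + n)) sums g s" if s: "\<bar>s - l0\<bar> < r" for s
  proof (cases "s = l0")
    case True
    have "(\<lambda>i. (s - l0) ^ i *\<^sub>R c (i + n)) = (\<lambda>i. if i = 0 then c n else 0)" using True by (auto simp: fun_eq_iff power_0_left)
    then show ?thesis using sums_single[of 0 "\<lambda>_. c n"] True by (simp add: g_def)
  next
    case False
    have "(\<lambda>i. (s - l0) ^ i *\<^sub>R c i) sums (f s + (\<Sum>i<n. (s - l0) ^ i *\<^sub>R c i))" using pserD[OF p s] z by simp
    then have "(\<lambda>i. (s - l0) ^ (i + n) *\<^sub>R c (i + n)) sums f s" by (subst sums_iff_shift)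
    from sums_scaleR_right[OF this, of "inverse ((s - l0) ^ n)"] show ?thesis
      using False by (simp add: g_def power_add mult.commute[of _ "(s - l0) ^ n"] flip: mult.assoc)
  qed
  then have "pser l0 (\<lambda>i. c (i + n)) g r" using pser_pos[OF p] by (simp add: pser_def)
  moreover have "f s = (s - l0) ^ n *\<^sub>R g s" for s
  proof (cases "s = l0")
    case True
    have "f l0 = c 0" by (rule pser_at_center[OF p])
    then show ?thesis using True z by (cases n) (auto simp: g_def)
  next
    case False then show ?thesis by (simp add: g_def)
  qed
  ultimately show ?thesis by blast
qed

text \<open>Either all coefficients vanish, or the first nonzero one controls the size of the
  function near the centre.\<close>

lemma an_real_dichotomy:
  fixes d :: "real \<Rightarrow> real"
  assumes "an l0 d"
  shows "(\<exists>e>0. \<forall>s. \<bar>s - l0\<bar> < e \<longrightarrow> d s = 0) \<or> (\<exists>e>0. \<exists>n. \<exists>C>0. \<forall>s. \<bar>s - l0\<bar> < e \<longrightarrow> C * \<bar>s - l0\<bar> ^ n \<le> \<bar>d s\<bar>)"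
proof -
  obtain c r where p: "pser l0 c d r" using assms by (auto simp: an_def)
  show ?thesis
  proof (cases "\<forall>n. c n = 0")
    case True
    have "d s = 0" if "\<bar>s - l0\<bar> < r" for s using sums_unique2[OF pserD[OF p that] ] True by simp
    then show ?thesis using pser_pos[OF p] by blast
  next
    case False
    define n where "n = (LEAST n. c n \<noteq> 0)"
    have n: "c n \<noteq> 0" "\<And>i. i < n \<Longrightarrow> c i = 0" unfolding n_def using False LeastI_ex[of "\<lambda>n. c n \<noteq> 0"] not_less_Least by auto
    obtain g where g: "pser l0 (\<lambda>i. c (i + n)) g r" "\<And>s. \<bar>s - l0\<bar> < r \<Longrightarrow> d s = (s - l0) ^ n *\<^sub>R g s"
      using pser_shift[OF p n(2)] by blast
    have g0: "g l0 = c n" using pser_at_center[OF g(1)] by simp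
    have "isCont g l0" using g(1) by (intro an_continuous) (auto simp: an_def)
    then have "(g \<longlongrightarrow> c n) (at l0)" by (simp add: isCont_def g0)
    then obtain e where e: "e > 0" "\<And>s. s \<noteq> l0 \<Longrightarrow> \<bar>s - l0\<bar> < e \<Longrightarrow> dist (g s) (c n) < \<bar>c n\<bar> / 2"
      using n(1) unfolding tendsto_iff eventually_at dist_real_def by (metis half_gt_zero zero_less_abs_iff UNIV_I)
    have "\<bar>c n\<bar> / 2 * \<bar>s - l0\<bar> ^ n \<le> \<bar>d s\<bar>" if s: "\<bar>s - l0\<bar> < min e r" for s
    proof -
      have "\<bar>g s - c n\<bar> \<le> \<bar>c n\<bar> / 2" using e(2)[of s] s g0 by (cases "s = l0") (auto simp: dist_real_def)
      then have "\<bar>c n\<bar> / 2 \<le> \<bar>g s\<bar>" by arith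
      then have "\<bar>c n\<bar> / 2 * \<bar>s - l0\<bar> ^ n \<le> \<bar>g s\<bar> * \<bar>s - l0\<bar> ^ n" by (intro mult_right_mono) auto
      also have "\<dots> = \<bar>d s\<bar>" using g(2)[of s] s by (simp add: abs_mult power_abs)
      finally show ?thesis .
    qed
    moreover have "min e r > 0" "\<bar>c n\<bar> / 2 > 0" using e pser_pos[OF p] n by auto
    ultimately show ?thesis by blast
  qed
qed

section \<open>Determinants and adjugates with analytic entries\<close>

lemma an_det:
  assumes "\<And>i j. i < m \<Longrightarrow> j < m \<Longrightarrow> an l0 (\<lambda>s. Q s i j)"
  shows "an l0 (\<lambda>s. Determinant.det (Matrix.mat m m (\<lambda>(i, j). Q s i j :: real)))"
proof -
  have "Determinant.det (Matrix.mat m m (\<lambda>(i, j). Q s i j)) =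
      (\<Sum>p\<in>{p. p permutes {0..<m}}. signof p * (\<Prod>i=0..<m. Q s i (p i)))" for s
  proof -
    have "Determinant.det (Matrix.mat m m (\<lambda>(i, j). Q s i j)) = (\<Sum>p\<in>{p. p permutes {0..<m}}. signof p * (\<Prod>i=0..<m. Matrix.mat m m (\<lambda>(i, j). Q s i j) $$ (i, p i)))"
      by (rule Determinant.det_def') simp
    also have "\<dots> = (\<Sum>p\<in>{p. p permutes {0..<m}}. signof p * (\<Prod>i=0..<m. Q s i (p i)))"
    proof (intro sum.cong refl arg_cong2[where f="(*)"] prod.cong)
      fix p i assume "p \<in> {p. p permutes {0..<m}}" "i \<in> {0..<m}"
      then have "i < m" "p i < m" using permutes_in_image[of p "{0..<m}" i] by auto
      then show "Matrix.mat m m (\<lambda>(i, j). Q s i j) $$ (i, p i) = Q s i (p i)" by simp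
    qed
    finally show ?thesis .
  qed
  moreover have "an l0 (\<lambda>s. \<Sum>p\<in>{p. p permutes {0..<m}}. signof p * (\<Prod>i=0..<m. Q s i (p i)))"
  proof (intro an_sum an_mult an_const an_prod finite_permutations finite_atLeastLessThan)
    fix p i assume "p \<in> {p. p permutes {0..<m}}" "i \<in> {0..<m}"
    then have "i < m" "p i < m" using permutes_in_image[of p "{0..<m}" i] by auto
    then show "an l0 (\<lambda>s. Q s i (p i))" by (rule assms)
  qed
  ultimately show ?thesis by simp
qed

lemma an_adj:
  assumes Q: "\<And>i j. i < m \<Longrightarrow> j < m \<Longrightarrow> an l0 (\<lambda>s. Q s i j)" and ij: "i < m" "j < m"
  shows "an l0 (\<lambda>s. adj_mat (Matrix.mat m m (\<lambda>(i, j). Q s i j :: real)) $$ (i, j))"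
proof -
  \<comment> \<open>Translates an index of the minor into an index of the full matrix in which row
    or column \<open>k\<close> has been deleted.\<close>
  define ii where "ii k i' = (if i' < k then i' else Suc i')" for k i' :: nat
  have "adj_mat (Matrix.mat m m (\<lambda>(i, j). Q s i j)) $$ (i, j) =
     (-1) ^ (j + i) * Determinant.det (Matrix.mat (m - 1) (m - 1) (\<lambda>(i', j'). Q s (ii j i') (ii i j')))" for s
  proof -
    have "mat_delete (Matrix.mat m m (\<lambda>(i, j). Q s i j)) j i = Matrix.mat (m - 1) (m - 1) (\<lambda>(i', j'). Q s (ii j i') (ii i j'))"
      unfolding mat_delete_def using ij by (intro eq_matI) (auto simp: ii_def)
    then show ?thesis using ij by (simp add: adj_mat_def cofactor_def)
  qed
  moreover have "an l0 (\<lambda>s. (-1) ^ (j + i) * Determinant.det (Matrix.mat (m - 1) (m - 1) (\<lambda>(i', j'). Q s (ii j i') (ii i j'))))"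
    by (intro an_mult an_const an_det Q) (auto simp: ii_def)
  ultimately show ?thesis by simp
qed

lemma adj_mat_sums:
  fixes Q :: "nat \<Rightarrow> nat \<Rightarrow> real" and m :: nat
  defines "M \<equiv> Matrix.mat m m (\<lambda>(i, j). Q i j)"
  assumes ij: "i < m" "j < m"
  shows "(\<Sum>k<m. Q i k * adj_mat M $$ (k, j)) = (if i = j then Determinant.det M else 0)"
    "(\<Sum>k<m. adj_mat M $$ (i, k) * Q k j) = (if i = j then Determinant.det M else 0)"
proof -
  have M: "M \<in> carrier_mat m m" by (simp add: M_def)
  note adj = adj_mat[OF M]
  have "(M * adj_mat M) $$ (i, j) = (\<Sum>k<m. Q i k * adj_mat M $$ (k, j))"
    using ij adj(1) M by (auto simp: times_mat_def scalar_prod_def M_def atLeast0LessThan intro!: sum.cong)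
  moreover have "(M * adj_mat M) $$ (i, j) = (if i = j then Determinant.det M else 0)"
    unfolding adj(2) using ij by simp
  ultimately show "(\<Sum>k<m. Q i k * adj_mat M $$ (k, j)) = (if i = j then Determinant.det M else 0)" by simp
  have "(adj_mat M * M) $$ (i, j) = (\<Sum>k<m. adj_mat M $$ (i, k) * Q k j)"
    using ij adj(1) M by (auto simp: times_mat_def scalar_prod_def M_def atLeast0LessThan intro!: sum.cong)
  moreover have "(adj_mat M * M) $$ (i, j) = (if i = j then Determinant.det M else 0)"
    unfolding adj(3) using ij by simp
  ultimately show "(\<Sum>k<m. adj_mat M $$ (i, k) * Q k j) = (if i = j then Determinant.det M else 0)" by simp
qed

lemma det_zero_kernel:
  fixes Q :: "nat \<Rightarrow> nat \<Rightarrow> real"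
  assumes "Determinant.det (Matrix.mat m m (\<lambda>(i, j). Q i j)) = 0"
  shows "\<exists>x. (\<exists>j<m. x j \<noteq> 0) \<and> (\<forall>i<m. (\<Sum>j<m. Q i j * x j) = 0)"
proof -
  let ?M = "Matrix.mat m m (\<lambda>(i, j). Q i j)"
  have M: "?M \<in> carrier_mat m m" by simp
  obtain v where v: "v \<in> carrier_vec m" "v \<noteq> 0\<^sub>v m" "?M *\<^sub>v v = 0\<^sub>v m"
    using det_0_iff_vec_prod_zero_field[OF M] assms by auto
  have "\<exists>j<m. Matrix.vec_index v j \<noteq> 0"
  proof (rule ccontr)
    assume "\<not> ?thesis"
    then have "v = 0\<^sub>v m" using v(1) by (intro eq_vecI) auto
    then show False using v(2) by simp
  qed
  moreover have "(\<Sum>j<m. Q i j * Matrix.vec_index v j) = 0" if "i < m" for i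
  proof -
    have "Matrix.vec_index (?M *\<^sub>v v) i = (\<Sum>j<m. Q i j * Matrix.vec_index v j)"
      using that v(1) by (auto simp: scalar_prod_def atLeast0LessThan intro!: sum.cong)
    then show ?thesis using v(3) that by simp
  qed
  ultimately show ?thesis by blast
qed

lemma wsys_exists:
  fixes W :: "'b::real_normed_vector set"
  assumes "fin_dim W"
  shows "\<exists>m w \<phi>. wsys m w \<phi> \<and> wsys.W m w = W"
proof -
  obtain B where B: "finite B" "independent B" "span B = W" using fin_dim_basis[OF assms] .
  obtain h where h: "bij_betw h {..<card B} B" using ex_bij_betw_nat_finite[OF B(1)] by (auto simp: atLeast0LessThan)
  obtain \<phi> :: "'b \<Rightarrow> 'b \<Rightarrow>\<^sub>L real" where \<phi>: "\<forall>b\<in>B. \<forall>b'\<in>B. \<phi> b b' = (if b = b' then 1 else 0)"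
    using dual_functionals[OF B(1,2)] by blast
  have hB: "h i \<in> B" if "i < card B" for i using h that by (auto simp: bij_betw_def)
  have inj: "h i = h j \<longleftrightarrow> i = j" if "i < card B" "j < card B" for i j
    using h that by (auto simp: bij_betw_def inj_on_def)
  have ws: "wsys (card B) h (\<lambda>i. \<phi> (h i))"
    by unfold_locales (use \<phi> hB inj in simp)
  moreover have "wsys.W (card B) h = W"
    unfolding wsys.W_def[OF ws] using h B(3) by (simp add: bij_betw_def)
  ultimately show ?thesis by blast
qed

lemma continuous_norm_bound:
  fixes f :: "real \<Rightarrow> 'a::real_normed_vector"
  assumes "continuous (at l0) f"
  shows "\<exists>e>0. \<forall>s. \<bar>s - l0\<bar> < e \<longrightarrow> norm (f s) \<le> norm (f l0) + 1"
proof -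
  obtain e where e: "e > 0" "\<And>s. dist s l0 < e \<Longrightarrow> dist (f s) (f l0) < 1"
    using assms[unfolded continuous_at_eps_delta, rule_format, of 1] by auto
  have "norm (f s) \<le> norm (f l0) + 1" if "\<bar>s - l0\<bar> < e" for s
    using e(2)[of s] that norm_triangle_sub[of "f s" "f l0"] by (simp add: dist_norm)
  then show ?thesis using e(1) by blast
qed

section \<open>Reduction of invertibility to a determinant\<close>

text \<open>\<open>A = L T\<inverse>\<close> is the identity modulo \<open>W\<close>, so solving
  \<open>A t = v\<close> with \<open>t = v + z\<close> leaves \<open>A z = v - A v\<close> for
  \<open>z\<close> in \<open>W\<close>, a finite system. Using the adjugate keeps the determinant as
  the only denominator, so its order of vanishing bounds the growth of the inverse.\<close>

lemma (in wsysB) Schur_complement_invert: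
  fixes T L :: "'a::banach \<Rightarrow>\<^sub>L 'b"
  assumes T: "T \<in> GL" and d: "\<And>x. T x - L x \<in> W"
  defines "Q \<equiv> \<lambda>i j. \<phi> i (L (blinfun_inv T (w j)))"
  defines "M \<equiv> Matrix.mat m m (\<lambda>(i, j). Q i j)"
  assumes adj: "\<And>i j. i < m \<Longrightarrow> j < m \<Longrightarrow> \<bar>adj_mat M $$ (i, j)\<bar> \<le> K" and K: "K \<ge> 0"
    and b: "norm (blinfun_inv T) \<le> b" and a: "norm L \<le> a" and det: "Determinant.det M \<noteq> 0"
  shows "L \<in> GL" "norm (blinfun_inv L) \<le> b * (1 + (\<Sum>j<m. \<Sum>i<m. K * norm (\<phi> i) * (1 + a * b) * norm (w j)) / \<bar>Determinant.det M\<bar>)"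
proof -
  define A where "A = L o\<^sub>L blinfun_inv T"
  define D where "D = Determinant.det M"
  have a0: "a \<ge> 0" using a norm_ge_zero order_trans by blast
  have b0: "b \<ge> 0" using b norm_ge_zero order_trans by blast
  have Aw: "v - A v \<in> W" for v using d[of "blinfun_inv T v"] by (simp add: A_def blinfun_inv_apply[OF T])
  have AW: "A v \<in> W" if "v \<in> W" for v using subspace_diff[OF subspace_W that Aw[of v]] by simp
  have nA: "norm (v - A v) \<le> (1 + a * b) * norm v" for v
  proof -
    have "norm (A v) \<le> norm A * norm v" by (rule norm_blinfun)
    also have "\<dots> \<le> a * b * norm v" unfolding A_def
      by (intro mult_right_mono order_trans[OF norm_blinfun_compose] mult_mono a b a0) auto
    finally show ?thesis using norm_triangle_ineq4[of v "A v"] by (simp add: algebra_simps)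
  qed
  have Asum: "\<phi> i (A (\<Sum>j<m. x j *\<^sub>R w j)) = (\<Sum>j<m. Q i j * x j)" for x i
    by (simp add: Q_def A_def blinfun.sum_right blinfun.scaleR_right mult.commute)
  \<comment> \<open>Cramer's rule for the coordinates of \<open>z\<close>.\<close>
  define x where "x v j = (1 / D) * (\<Sum>i<m. adj_mat M $$ (j, i) * \<phi> i (v - A v))" for v j
  define z where "z v = (\<Sum>j<m. x v j *\<^sub>R w j)" for v
  have Az: "A (z v) = v - A v" for v
  proof -
    have "\<phi> i (A (z v)) = \<phi> i (v - A v)" if i: "i < m" for i
    proof -
      have "\<phi> i (A (z v)) = (\<Sum>j<m. Q i j * x v j)" unfolding z_def by (rule Asum)
      also have "\<dots> = (1 / D) * (\<Sum>j<m. \<Sum>k<m. Q i j * adj_mat M $$ (j, k) * \<phi> k (v - A v))"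
        unfolding x_def by (simp add: sum_distrib_left mult_ac)
      also have "(\<Sum>j<m. \<Sum>k<m. Q i j * adj_mat M $$ (j, k) * \<phi> k (v - A v)) = (\<Sum>k<m. (\<Sum>j<m. Q i j * adj_mat M $$ (j, k)) * \<phi> k (v - A v))"
        unfolding sum_distrib_right by (rule sum.swap)
      also have "\<dots> = (\<Sum>k<m. if k = i then D * \<phi> k (v - A v) else 0)"
        by (rule sum.cong) (use adj_mat_sums(1)[of i m _ Q] i in \<open>auto simp: M_def D_def\<close>)
      also have "\<dots> = D * \<phi> i (v - A v)" using i by simp
      finally show ?thesis using det by (simp add: D_def)
    qed
    moreover have "A (z v) \<in> W" unfolding z_def by (intro AW sum_in_W)
    ultimately have "A (z v) - (v - A v) = 0"
      by (intro W_zeroI subspace_diff[OF subspace_W] Aw) (simp_all add: blinfun.diff_right)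
    then show ?thesis by simp
  qed
  have sol: "L (blinfun_inv T (v + z v)) = v" for v
  proof -
    have "L (blinfun_inv T (v + z v)) = A (v + z v)" by (simp add: A_def)
    then show ?thesis by (simp add: blinfun.add_right Az)
  qed
  have "u = 0" if u: "L u = 0" for u
  proof -
    define t where "t = T u"
    have At: "A t = 0" using u by (simp add: A_def t_def blinfun_inv_apply[OF T])
    have tW: "t \<in> W" using Aw[of t] At by simp
    have t: "(\<Sum>j<m. \<phi> j t *\<^sub>R w j) = t" by (rule W_expand[OF tW])
    have Q0: "(\<Sum>j<m. Q i j * \<phi> j t) = 0" for i using Asum[of i "\<lambda>j. \<phi> j t"] unfolding t At by (simp add: blinfun.zero_right)
    have "\<phi> k t = 0" if k: "k < m" for k
    proof -
      have "0 = (\<Sum>i<m. adj_mat M $$ (k, i) * (\<Sum>j<m. Q i j * \<phi> j t))" by (simp add: Q0)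
      also have "\<dots> = (\<Sum>i<m. \<Sum>j<m. adj_mat M $$ (k, i) * Q i j * \<phi> j t)" by (simp add: sum_distrib_left mult.assoc)
      also have "\<dots> = (\<Sum>j<m. (\<Sum>i<m. adj_mat M $$ (k, i) * Q i j) * \<phi> j t)"
        unfolding sum_distrib_right by (rule sum.swap)
      also have "\<dots> = (\<Sum>j<m. if j = k then D * \<phi> j t else 0)"
        by (rule sum.cong) (use adj_mat_sums(2)[of k m _ Q] k in \<open>auto simp: M_def D_def\<close>)
      also have "\<dots> = D * \<phi> k t" using k by simp
      finally show ?thesis using det by (simp add: D_def)
    qed
    then have "t = 0" by (rule W_zeroI[OF tW])
    then show "u = 0" unfolding t_def by (metis T blinfun_inv_apply(1) blinfun.zero_right)
  qed
  then have "ker L = {0}" by (auto simp: ker_def blinfun.zero_right)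
  then have "inj L" by (simp add: ker_zero_inj)
  moreover have "surj L" by (rule surjI[where f="\<lambda>v. blinfun_inv T (v + z v)"]) (rule sol)
  ultimately show G: "L \<in> GL" by (simp add: GL_iff_bij bij_def)
  show "norm (blinfun_inv L) \<le> b * (1 + (\<Sum>j<m. \<Sum>i<m. K * norm (\<phi> i) * (1 + a * b) * norm (w j)) / \<bar>Determinant.det M\<bar>)"
  proof (rule norm_blinfun_bound)
    define S where "S = (\<Sum>j<m. \<Sum>i<m. K * norm (\<phi> i) * (1 + a * b) * norm (w j))"
    have S0: "S \<ge> 0" unfolding S_def using K a0 b0 by (intro sum_nonneg mult_nonneg_nonneg) auto
    show "0 \<le> b * (1 + S / \<bar>Determinant.det M\<bar>)" using b0 S0 by simp
    fix v
    have "blinfun_inv L v = blinfun_inv T (v + z v)" by (metis G blinfun_inv_apply(1) sol)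
    then have n1: "norm (blinfun_inv L v) \<le> b * norm (v + z v)"
      using order_trans[OF norm_blinfun mult_right_mono[OF b norm_ge_zero]] by metis
    have nz: "norm (z v) \<le> (S / \<bar>D\<bar>) * norm v"
    proof -
      have "norm (z v) \<le> (\<Sum>j<m. \<bar>x v j\<bar> * norm (w j))" unfolding z_def by (rule order_trans[OF norm_sum]) simp
      also have "\<dots> \<le> (\<Sum>j<m. (1 / \<bar>D\<bar>) * (\<Sum>i<m. K * (norm (\<phi> i) * ((1 + a * b) * norm v))) * norm (w j))"
      proof (intro sum_mono mult_right_mono norm_ge_zero)
        fix j assume j: "j \<in> {..<m}"
        have "\<bar>x v j\<bar> = (1 / \<bar>D\<bar>) * \<bar>\<Sum>i<m. adj_mat M $$ (j, i) * \<phi> i (v - A v)\<bar>" by (simp add: x_def abs_mult)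
        also have "\<dots> \<le> (1 / \<bar>D\<bar>) * (\<Sum>i<m. K * (norm (\<phi> i) * ((1 + a * b) * norm v)))"
        proof (intro mult_left_mono order_trans[OF sum_abs] sum_mono)
          fix i assume i: "i \<in> {..<m}"
          have "\<bar>\<phi> i (v - A v)\<bar> \<le> norm (\<phi> i) * ((1 + a * b) * norm v)"
            using order_trans[OF norm_blinfun mult_left_mono[OF nA norm_ge_zero], of "\<phi> i" v] by simp
          then show "\<bar>adj_mat M $$ (j, i) * \<phi> i (v - A v)\<bar> \<le> K * (norm (\<phi> i) * ((1 + a * b) * norm v))"
            unfolding abs_mult using adj[of j i] i j K by (intro mult_mono) auto
        qed simp
        finally show "\<bar>x v j\<bar> \<le> (1 / \<bar>D\<bar>) * (\<Sum>i<m. K * (norm (\<phi> i) * ((1 + a * b) * norm v)))" .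
      qed
      also have "\<dots> = (S / \<bar>D\<bar>) * norm v" unfolding S_def
        by (simp add: sum_distrib_left sum_distrib_right sum_divide_distrib mult_ac)
      finally show ?thesis .
    qed
    have "norm (v + z v) \<le> (1 + S / \<bar>D\<bar>) * norm v"
      using norm_triangle_ineq[of v "z v"] nz unfolding distrib_right by linarith
    from order_trans[OF n1 mult_left_mono[OF this b0]]
    show "norm (blinfun_inv L v) \<le> b * (1 + S / \<bar>Determinant.det M\<bar>) * norm v"
      by (simp only: D_def mult.assoc)
  qed
qed

text \<open>A kernel vector of the matrix gives a nonzero vector of \<open>W\<close> annihilated by
  \<open>L T\<inverse>\<close>.\<close>

lemma (in wsysB) Schur_complement_singular:
  fixes T L :: "'a::banach \<Rightarrow>\<^sub>L 'b"
  assumes T: "T \<in> GL" and d: "\<And>x. T x - L x \<in> W"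
    and det: "Determinant.det (Matrix.mat m m (\<lambda>(i, j). \<phi> i (L (blinfun_inv T (w j))))) = 0"
  shows "L \<notin> GL"
proof
  assume L: "L \<in> GL"
  obtain x where x: "\<exists>j<m. x j \<noteq> 0" "\<And>i. i < m \<Longrightarrow> (\<Sum>j<m. \<phi> i (L (blinfun_inv T (w j))) * x j) = 0"
    using det_zero_kernel[OF det] by blast
  define z where "z = (\<Sum>j<m. x j *\<^sub>R w j)"
  have zW: "z \<in> W" unfolding z_def by (rule sum_in_W)
  have "L (blinfun_inv T z) \<in> W"
    using subspace_diff[OF subspace_W zW d[of "blinfun_inv T z"]] by (simp add: blinfun_inv_apply[OF T])
  moreover have "\<phi> i (L (blinfun_inv T z)) = 0" if "i < m" for i
    using x(2)[OF that] by (simp add: z_def blinfun.sum_right blinfun.scaleR_right mult.commute)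
  ultimately have "L (blinfun_inv T z) = 0" by (rule W_zeroI)
  then have "z = 0" by (metis L T blinfun_inv_apply blinfun.zero_right)
  then show False using x(1) \<phi>_sum[of _ x] unfolding z_def by (auto simp: blinfun.zero_right)
qed

text \<open>After one constant perturbation, invertibility of \<open>L s\<close> is decided by a
  real analytic determinant. It vanishes identically near \<open>l0\<close> or has a finite order
  \<open>n\<close>; in the second case the adjugate formula bounds the inverse by a pole of that
  order.\<close>

lemma GL_dichotomy:
  fixes L :: "real \<Rightarrow> 'a::banach \<Rightarrow>\<^sub>L 'b::banach"
  assumes L: "an l0 L" and F: "L l0 \<in> Fredholm0"
  shows "(\<exists>e>0. \<forall>s. \<bar>s - l0\<bar> < e \<longrightarrow> L s \<notin> GL) \<or>
    (\<exists>e>0. \<exists>n. \<exists>C>0. \<forall>s. 0 < \<bar>s - l0\<bar> \<and> \<bar>s - l0\<bar> < e \<longrightarrow> L s \<in> GL \<and> norm (blinfun_inv (L s)) \<le> C / \<bar>s - l0\<bar> ^ n)"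
proof -
  obtain W0 Y where W0: "fin_dim W0" "range (blinfun_apply Y) \<subseteq> W0" "L l0 + Y \<in> GL" using Fredholm0_perturb_GL[OF F] by blast
  obtain m and w :: "nat \<Rightarrow> 'b" and \<phi> where ws: "wsys m w \<phi>" and WW: "wsys.W m w = W0" using wsys_exists[OF W0(1)] by blast
  interpret wsysB m w \<phi> using ws by (simp add: wsysB_def)
  define T where "T s = L s + Y" for s
  have T: "an l0 T" unfolding T_def by (intro an_add L an_const)
  have TI: "an l0 (\<lambda>s. blinfun_inv (T s))" using an_inverse[OF T] W0(3) by (simp add: T_def)
  have d: "T s x - L s x \<in> W" for s x using W0(2) WW by (auto simp: T_def plus_blinfun.rep_eq)
  define Q where "Q s i j = \<phi> i (L s (blinfun_inv (T s) (w j)))" for s i j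
  define M where "M s = Matrix.mat m m (\<lambda>(i, j). Q s i j)" for s
  have "an l0 (\<lambda>s. L s o\<^sub>L blinfun_inv (T s))" by (rule an_compose[OF L TI])
  moreover have "bounded_linear (\<lambda>X::'b \<Rightarrow>\<^sub>L 'b. \<phi> i (X (w j)))" for i j by (intro bounded_linear_intros)
  ultimately have "an l0 (\<lambda>s. \<phi> i ((L s o\<^sub>L blinfun_inv (T s)) (w j)))" for i j by (rule an_linear[rotated])
  then have Q: "an l0 (\<lambda>s. Q s i j)" for i j by (simp add: Q_def)
  obtain e1 where e1: "e1 > 0" "\<And>s. \<bar>s - l0\<bar> < e1 \<Longrightarrow> T s \<in> GL"
  proof -
    obtain c r where p: "pser l0 c T r" using T by (auto simp: an_def)
    have "l0 \<in> ball l0 r" using pser_pos[OF p] by simp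
    moreover have "T l0 \<in> GL" using W0(3) by (simp add: T_def)
    ultimately obtain e where "e > 0" "\<And>s. s \<in> ball l0 r \<Longrightarrow> dist s l0 < e \<Longrightarrow> T s \<in> GL"
      using continuous_on_open_nbhd[OF pser_continuous_on[OF p] open_GL] by blast
    then show ?thesis using pser_pos[OF p] by (intro that[of "min e r"]) (auto simp: dist_real_def abs_minus_commute)
  qed
  have det: "an l0 (\<lambda>s. Determinant.det (M s))" unfolding M_def by (intro an_det Q)
  from an_real_dichotomy[OF this] show ?thesis
  proof
    assume "\<exists>e>0. \<forall>s. \<bar>s - l0\<bar> < e \<longrightarrow> Determinant.det (M s) = 0"
    then obtain e where e: "e > 0" "\<And>s. \<bar>s - l0\<bar> < e \<Longrightarrow> Determinant.det (M s) = 0" by blast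
    have "L s \<notin> GL" if s: "\<bar>s - l0\<bar> < min e e1" for s
    proof -
      have "T s \<in> GL" using e1(2) s by simp
      from Schur_complement_singular[OF this d] show ?thesis using e(2)[of s] s by (simp add: M_def Q_def)
    qed
    moreover have "min e e1 > 0" using e e1 by simp
    ultimately show ?thesis by blast
  next
    assume "\<exists>e>0. \<exists>n. \<exists>C>0. \<forall>s. \<bar>s - l0\<bar> < e \<longrightarrow> C * \<bar>s - l0\<bar> ^ n \<le> \<bar>Determinant.det (M s)\<bar>"
    then obtain e n C where e: "e > 0" "C > 0" "\<And>s. \<bar>s - l0\<bar> < e \<Longrightarrow> C * \<bar>s - l0\<bar> ^ n \<le> \<bar>Determinant.det (M s)\<bar>" by blast
    define b where "b = norm (blinfun_inv (T l0)) + 1"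
    define a where "a = norm (L l0) + 1"
    obtain e2 where e2: "e2 > 0" "\<And>s. \<bar>s - l0\<bar> < e2 \<Longrightarrow> norm (blinfun_inv (T s)) \<le> b"
      using continuous_norm_bound[OF an_continuous[OF TI]] unfolding b_def by blast
    obtain e3 where e3: "e3 > 0" "\<And>s. \<bar>s - l0\<bar> < e3 \<Longrightarrow> norm (L s) \<le> a"
      using continuous_norm_bound[OF an_continuous[OF L]] unfolding a_def by blast
    \<comment> \<open>The sum of the squares is a single analytic function that bounds all entries
      of the adjugate at once.\<close>
    have "an l0 (\<lambda>s. \<Sum>i<m. \<Sum>j<m. (adj_mat (M s) $$ (i, j))\<^sup>2)"
      unfolding M_def power2_eq_square by (intro an_sum an_mult an_adj Q) auto
    from continuous_norm_bound[OF an_continuous[OF this]]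
    obtain e4 K2 where e4: "e4 > 0" "\<And>s. \<bar>s - l0\<bar> < e4 \<Longrightarrow> \<bar>\<Sum>i<m. \<Sum>j<m. (adj_mat (M s) $$ (i, j))\<^sup>2\<bar> \<le> K2"
      by (auto simp: real_norm_def)
    define K where "K = sqrt K2"
    have K2: "K2 \<ge> 0" using e4(2)[of l0] e4(1) by simp
    have adj: "\<bar>adj_mat (M s) $$ (i, j)\<bar> \<le> K" if s: "\<bar>s - l0\<bar> < e4" and ij: "i < m" "j < m" for s i j
    proof -
      have "(adj_mat (M s) $$ (i, j))\<^sup>2 \<le> (\<Sum>j<m. (adj_mat (M s) $$ (i, j))\<^sup>2)"
        using ij by (intro member_le_sum) auto
      also have "\<dots> \<le> (\<Sum>i<m. \<Sum>j<m. (adj_mat (M s) $$ (i, j))\<^sup>2)"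
        using ij by (intro member_le_sum[of i "{..<m}" "\<lambda>i. \<Sum>j<m. (adj_mat (M s) $$ (i, j))\<^sup>2"]) (auto intro: sum_nonneg)
      also have "\<dots> \<le> K2" using e4(2)[OF s] by simp
      finally show ?thesis unfolding K_def by (simp add: real_le_rsqrt)
    qed
    define S where "S = (\<Sum>j<m. \<Sum>i<m. K * norm (\<phi> i) * (1 + a * b) * norm (w j))"
    have ab: "a > 0" "b > 0" by (auto simp: a_def b_def intro: add_nonneg_pos)
    have S0: "S \<ge> 0" unfolding S_def K_def using K2 ab by (intro sum_nonneg mult_nonneg_nonneg) auto
    \<comment> \<open>The radius is at most 1 so that the constant term of the estimate is also
      dominated by the pole.\<close>
    define e' where "e' = min 1 (min (min e e1) (min e2 (min e3 e4)))"
    have "e' > 0" using e e1 e2 e3 e4 by (simp add: e'_def)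
    moreover have "L s \<in> GL \<and> norm (blinfun_inv (L s)) \<le> (b * (1 + S / C)) / \<bar>s - l0\<bar> ^ n" if s: "0 < \<bar>s - l0\<bar> \<and> \<bar>s - l0\<bar> < e'" for s
    proof -
      have t: "\<bar>s - l0\<bar> ^ n > 0" "\<bar>s - l0\<bar> ^ n \<le> 1" using s by (auto simp: e'_def intro: power_le_one)
      have D: "C * \<bar>s - l0\<bar> ^ n \<le> \<bar>Determinant.det (M s)\<bar>" using e(3) s by (simp add: e'_def)
      have D1: "C * \<bar>s - l0\<bar> ^ n > 0" using t e(2) by simp
      then have D0: "Determinant.det (M s) \<noteq> 0" using D by linarith
      have TG: "T s \<in> GL" using e1(2) s by (simp add: e'_def)
      have bb: "norm (blinfun_inv (T s)) \<le> b" using e2(2) s by (simp add: e'_def)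
      have aa: "norm (L s) \<le> a" using e3(2) s by (simp add: e'_def)
      have K0: "K \<ge> 0" using K2 by (simp add: K_def)
      have ad: "\<bar>adj_mat (M s) $$ (i, j)\<bar> \<le> K" if "i < m" "j < m" for i j using adj[OF _ that, of s] s by (simp add: e'_def)
      note inv = Schur_complement_invert[OF TG d, of K b a, OF ad[unfolded M_def Q_def] K0 bb aa D0[unfolded M_def Q_def]]
      have "norm (blinfun_inv (L s)) \<le> b * (1 + S / \<bar>Determinant.det (M s)\<bar>)"
        unfolding M_def Q_def S_def by (rule inv(2))
      also have "\<dots> \<le> b * (1 + S / (C * \<bar>s - l0\<bar> ^ n))"
        using ab S0 D D1 by (intro mult_left_mono add_left_mono divide_left_mono) auto
      also have "\<dots> \<le> b * (1 / \<bar>s - l0\<bar> ^ n + S / (C * \<bar>s - l0\<bar> ^ n))"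
        using ab t by (intro mult_left_mono add_right_mono) auto
      also have "\<dots> = (b * (1 + S / C)) / \<bar>s - l0\<bar> ^ n" using t e(2) by (simp add: field_simps)
      finally show ?thesis using inv(1) by blast
    qed
    moreover have "b * (1 + S / C) > 0" using ab S0 e(2) by (intro mult_pos_pos add_pos_nonneg) auto
    ultimately show ?thesis by blast
  qed
qed

section \<open>Transversality and local normal forms\<close>

text \<open>Bordering with prescribed images \<open>y b\<close> of a kernel basis.
  \<open>ind\<close> says that these are independent modulo the range and \<open>sp\<close> that
  they span the space together with it.\<close>

lemma GL_border:
  fixes T :: "'a::banach \<Rightarrow>\<^sub>L 'b::banach" and \<phi> :: "'a \<Rightarrow> 'a \<Rightarrow>\<^sub>L real"
  assumes B: "finite B" "span B = ker T"
    and \<phi>: "\<forall>b\<in>B. \<forall>b'\<in>B. \<phi> b b' = (if b = b' then 1 else 0)"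
    and ind: "\<And>r. (\<Sum>b\<in>B. r b *\<^sub>R y b) \<in> range (blinfun_apply T) \<Longrightarrow> \<forall>b\<in>B. r b = 0"
    and sp: "\<And>v. \<exists>x r. v = T x + (\<Sum>b\<in>B. r b *\<^sub>R y b)"
  shows "T + finrank B \<phi> y \<in> GL"
proof -
  define Y where "Y = finrank B \<phi> y"
  have Y: "Y v = (\<Sum>b\<in>B. \<phi> b v *\<^sub>R y b)" for v by (simp add: Y_def finrank_apply)
  have "x = 0" if x: "(T + Y) x = 0" for x
  proof -
    have "Y x = T (- x)" using x by (simp add: plus_blinfun.rep_eq blinfun.minus_right add_eq_0_iff)
    then have "\<forall>b\<in>B. \<phi> b x = 0" by (intro ind) (auto simp: Y)
    moreover from this have "T x = 0" using x by (simp add: plus_blinfun.rep_eq Y)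
    then have "x \<in> span B" using B by (simp add: ker_def)
    ultimately show "x = 0" using dual_functionals_expand[OF B(1) \<phi>, of x] by simp
  qed
  then have "ker (T + Y) = {0}" by (auto simp: ker_def blinfun.zero_right)
  then have "inj (T + Y)" by (simp add: ker_zero_inj)
  moreover have "\<exists>x. (T + Y) x = v" for v
  proof -
    obtain x r where v: "v = T x + (\<Sum>b\<in>B. r b *\<^sub>R y b)" using sp by blast
    define k where "k = (\<Sum>b\<in>B. (r b - \<phi> b x) *\<^sub>R b)"
    have "k \<in> span B" unfolding k_def by (intro span_sum span_scale span_base)
    then have Tk: "T k = 0" using B by (auto simp: ker_def)
    have \<phi>k: "\<phi> b k = r b - \<phi> b x" if "b \<in> B" for b
    proof -
      have "\<phi> b k = (\<Sum>b'\<in>B. if b' = b then r b' - \<phi> b' x else 0)"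
        unfolding k_def blinfun.sum_right
        by (rule sum.cong) (use \<phi> that in \<open>auto simp: blinfun.scaleR_right\<close>)
      then show ?thesis using B(1) that by simp
    qed
    have "Y (x + k) = (\<Sum>b\<in>B. r b *\<^sub>R y b)" unfolding Y
      by (rule sum.cong) (auto simp: blinfun.add_right \<phi>k)
    then have "(T + Y) (x + k) = v" by (simp add: plus_blinfun.rep_eq blinfun.add_right Tk v)
    then show ?thesis by blast
  qed
  then have "surj (T + Y)" by (metis surjI)
  ultimately show ?thesis by (simp add: GL_iff_bij bij_def Y_def)
qed

text \<open>Index zero turns spanning into counting. The projection along the range onto a fixed
  complement \<open>W\<close> is injective on the span of \<open>S\<close>, so \<open>S\<close>
  spans a complement exactly when it has \<open>dim W\<close> elements.\<close>

lemma Fredholm0_complement_card: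
  fixes T :: "'a::banach \<Rightarrow>\<^sub>L 'b::banach"
  assumes T: "T \<in> Fredholm0" and S: "finite S" "independent S" and tr: "span S \<inter> range (blinfun_apply T) \<subseteq> {0}"
  shows "(\<forall>v. \<exists>x. v - T x \<in> span S) \<longleftrightarrow> card S = dim (ker T)"
proof -
  let ?R = "range (blinfun_apply T)"
  obtain W where W: "subspace W" "fin_dim W" "dim W = dim (ker T)" "?R \<inter> W = {0}"
    "{s + w | s w. s \<in> ?R \<and> w \<in> W} = UNIV"
    using T by (auto simp: Fredholm0_def has_codim_def)
  obtain C where C: "finite C" "independent C" "span C = W" "card C = dim W" using fin_dim_basis[OF W(2)] .
  have R: "subspace ?R" by (rule range_blinfun_subspace)
  have ex: "\<exists>w. w \<in> W \<and> v - w \<in> ?R" for v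
  proof -
    have "v \<in> {s + w | s w. s \<in> ?R \<and> w \<in> W}" using W(5) by simp
    then obtain s w where "v = s + w" "s \<in> ?R" "w \<in> W" by blast
    then show ?thesis by (intro exI[of _ w]) simp
  qed
  then obtain p where p: "\<And>v. p v \<in> W" "\<And>v. v - p v \<in> ?R" by metis
  have un: "w = p v" if "w \<in> W" "v - w \<in> ?R" for v w
  proof -
    have "(v - p v) - (v - w) \<in> ?R" by (rule subspace_diff[OF R p(2) that(2)])
    then have "w - p v \<in> ?R \<inter> W" using subspace_diff[OF W(1) that(1) p(1)] by simp
    then show ?thesis using W(4) by simp
  qed
  have lin: "linear p"
  proof (rule linearI)
    fix u v
    have "(u - p u) + (v - p v) \<in> ?R" by (rule subspace_add[OF R p(2) p(2)])
    then have "(u + v) - (p u + p v) \<in> ?R" by (simp add: algebra_simps)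
    then show "p (u + v) = p u + p v" using un[of "p u + p v" "u + v"] subspace_add[OF W(1) p(1) p(1)] by simp
  next
    fix r v
    have "r *\<^sub>R (v - p v) \<in> ?R" by (rule subspace_scale[OF R p(2)])
    then have "r *\<^sub>R v - r *\<^sub>R p v \<in> ?R" by (simp add: scaleR_diff_right)
    then show "p (r *\<^sub>R v) = r *\<^sub>R p v" using un[of "r *\<^sub>R p v" "r *\<^sub>R v"] subspace_scale[OF W(1) p(1)] by simp
  qed
  have inj: "inj_on p (span S)"
  proof (rule inj_onI)
    fix x y assume xy: "x \<in> span S" "y \<in> span S" "p x = p y"
    then have "p (x - y) = 0" using lin by (simp add: linear_diff)
    then have "x - y \<in> ?R" using p(2)[of "x - y"] by simp
    moreover have "x - y \<in> span S" using xy by (simp add: span_diff)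
    ultimately show "x = y" using tr by auto
  qed
  have ind: "independent (p ` S)" by (rule linear_independent_injective_image[OF lin S(2) inj])
  have card: "card (p ` S) = card S" by (rule card_image[OF inj_on_subset[OF inj span_superset]])
  have pS: "p ` S \<subseteq> span C" using p(1) C(3) by auto
  have span_p: "span (p ` S) = p ` span S" using lin by (rule linear_span_image)
  show ?thesis
  proof
    assume *: "\<forall>v. \<exists>x. v - T x \<in> span S"
    have "C \<subseteq> span (p ` S)"
    proof
      fix v assume v: "v \<in> C"
      then have vW: "v \<in> W" using C(3) span_base by auto
      obtain x where x: "v - T x \<in> span S" using * by blast
      have "v = p v" by (rule un[OF vW]) (use subspace_0[OF R] in simp)
      moreover have "p (v - T x) = p v" using un[of "p v" "v - T x"] p(1)[of v] subspace_diff[OF R p(2)[of v], of "T x"]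
        by (auto simp: algebra_simps)
      ultimately show "v \<in> span (p ` S)" unfolding span_p using x by (metis imageI)
    qed
    then have "card C \<le> card (p ` S)" using independent_span_bound[of "p ` S" C] S(1) C(2) by auto
    moreover have "card (p ` S) \<le> card C" using independent_span_bound[OF C(1) ind pS] by auto
    ultimately show "card S = dim (ker T)" using card C(4) W(3) by simp
  next
    assume c: "card S = dim (ker T)"
    have "C \<subseteq> span (p ` S)"
    proof (rule ccontr)
      assume "\<not> ?thesis"
      then obtain v where v: "v \<in> C" "v \<notin> span (p ` S)" by blast
      then have "independent (insert v (p ` S))" using ind by (simp add: independent_insertI)
      moreover have "insert v (p ` S) \<subseteq> span C" using pS v(1) span_base by auto
      ultimately have "card (insert v (p ` S)) \<le> card C" using independent_span_bound[OF C(1)] by blast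
      moreover have "v \<notin> p ` S" using v(2) span_base[of v "p ` S"] by auto
      ultimately show False using card c C(4) W(3) S(1) by simp
    qed
    then have WpS: "W \<subseteq> p ` span S" unfolding span_p[symmetric] C(3)[symmetric] by (rule span_minimal) simp
    show "\<forall>v. \<exists>x. v - T x \<in> span S"
    proof
      fix v
      obtain s where s: "s \<in> span S" "p s = p v" using WpS p(1)[of v] by (metis imageE subsetD)
      then have "p (v - s) = 0" using lin by (simp add: linear_diff)
      then have "v - s \<in> ?R" using p(2)[of "v - s"] by simp
      then obtain x where "v - s = T x" by blast
      then have "v - T x = s" by (simp add: algebra_simps)
      then show "\<exists>x. v - T x \<in> span S" using s by metis
    qed
  qed
qed

section \<open>Kernel flags and transversal sums\<close>

text \<open>A basis adapted to a decreasing flag, built from its deep end by successive extension.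
  The level \<open>\<kappa> e\<close> is capped at \<open>Suc k\<close>, so vectors of the top level
  may lie in still deeper spaces.\<close>

lemma flag_basis:
  fixes N :: "nat \<Rightarrow> 'a::real_vector set"
  assumes "\<And>j. subspace (N j)" "\<And>j. N (Suc j) \<subseteq> N j" "fin_dim (N 1)"
  shows "\<exists>E \<kappa>. finite E \<and> independent E \<and> span E = N 1 \<and> (\<forall>e\<in>E. 1 \<le> \<kappa> e \<and> \<kappa> e \<le> Suc k) \<and>
     (\<forall>j. 1 \<le> j \<and> j \<le> Suc k \<longrightarrow> span {e \<in> E. j \<le> \<kappa> e} = N j)"
  using assms
proof (induction k arbitrary: N)
  case 0
  obtain E where E: "finite E" "independent E" "span E = N 1" using fin_dim_basis[OF "0.prems"(3)] .
  have "span {e \<in> E. j \<le> 1} = N j" if "1 \<le> j \<and> j \<le> Suc 0" for j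
  proof -
    have "j = 1" using that by simp
    then show ?thesis using E by simp
  qed
  then show ?case using E by (intro exI[of _ E] exI[of _ "\<lambda>_. 1"]) auto
next
  case (Suc k)
  have "fin_dim (N (Suc 1))" by (rule fin_dim_subset[OF Suc.prems(3) Suc.prems(1)]) (use Suc.prems(2)[of 1] in simp)
  from Suc.IH[of "\<lambda>j. N (Suc j)", OF Suc.prems(1) Suc.prems(2) this]
  obtain E' \<kappa>' where E'0: "finite E'" "independent E'" "span E' = N (Suc 1)" "\<forall>e\<in>E'. 1 \<le> \<kappa>' e \<and> \<kappa>' e \<le> Suc k"
     "\<forall>j. 1 \<le> j \<and> j \<le> Suc k \<longrightarrow> span {e \<in> E'. j \<le> \<kappa>' e} = N (Suc j)"
    by (elim exE conjE)
  note E' = E'0(1-3) E'0(4)[rule_format] E'0(5)[rule_format]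
  have E'N: "E' \<subseteq> N 1" using E'(3) span_superset[of E'] Suc.prems(2)[of 1] by auto
  obtain E where E: "E' \<subseteq> E" "E \<subseteq> N 1" "independent E" "N 1 \<subseteq> span E"
    using maximal_independent_subset_extend[OF E'N E'(2)] by blast
  have spE: "span E = N 1" using E Suc.prems(1)[of 1] by (meson span_minimal subset_antisym)
  have finE: "finite E"
  proof -
    obtain B where B: "finite B" "span B = N 1" using Suc.prems(3) by (auto simp: fin_dim_def)
    show ?thesis using independent_span_bound[OF B(1) E(3)] E(2) B(2) by blast
  qed
  \<comment> \<open>Old vectors carry their level in the shifted flag, hence the successor; the
    vectors added by the extension have level exactly 1.\<close>
  define \<kappa> where "\<kappa> e = (if e \<in> E' then Suc (\<kappa>' e) else 1)" for e
  have "span {e \<in> E. j \<le> \<kappa> e} = N j" if j: "1 \<le> j \<and> j \<le> Suc (Suc k)" for j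
  proof (cases "j = 1")
    case True
    have "{e \<in> E. j \<le> \<kappa> e} = E" using True by (auto simp: \<kappa>_def)
    then show ?thesis using spE True by simp
  next
    case False
    then obtain j' where j': "j = Suc j'" "1 \<le> j'" "j' \<le> Suc k" using j by (cases j) auto
    have "{e \<in> E. j \<le> \<kappa> e} = {e \<in> E'. j' \<le> \<kappa>' e}" using j' E(1) by (auto simp: \<kappa>_def split: if_splits)
    then show ?thesis using E'(5)[of j'] j' by simp
  qed
  moreover have "1 \<le> \<kappa> e \<and> \<kappa> e \<le> Suc (Suc k)" for e using E'(4)[of e] by (auto simp: \<kappa>_def)
  ultimately show ?case using finE E(3) spE by blast
qed

definition Nsp :: "(nat \<Rightarrow> 'a::banach \<Rightarrow>\<^sub>L 'b::banach) \<Rightarrow> nat \<Rightarrow> 'a set" where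
  "Nsp c j = (\<Inter>i\<in>{..<j}. ker (c i))"

definition Wsp :: "(nat \<Rightarrow> 'a::banach \<Rightarrow>\<^sub>L 'b::banach) \<Rightarrow> nat \<Rightarrow> 'b set" where
  "Wsp c j = blinfun_apply (c j) ` Nsp c j"

text \<open>The sum of the spaces \<open>Wsp c l\<close> over \<open>l < j\<close>. The
  representatives \<open>y l\<close> stay visible because the transversalization builds its
  correction from them.\<close>

definition Ssp :: "(nat \<Rightarrow> 'a::banach \<Rightarrow>\<^sub>L 'b::banach) \<Rightarrow> nat \<Rightarrow> 'b set" where
  "Ssp c j = {v. \<exists>y. (\<forall>l<j. y l \<in> Nsp c l) \<and> v = (\<Sum>l<j. c l (y l))}"

text \<open>Directness of the sum in successive form, one new space against its predecessors, since
  transversalization repairs one index at a time.\<close>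

definition dirsum :: "(nat \<Rightarrow> 'a::banach \<Rightarrow>\<^sub>L 'b::banach) \<Rightarrow> nat \<Rightarrow> bool" where
  "dirsum c j \<longleftrightarrow> (\<forall>i\<le>j. Wsp c i \<inter> Ssp c i \<subseteq> {0})"

definition sum_indep :: "(nat \<Rightarrow> 'a::banach \<Rightarrow>\<^sub>L 'b::banach) \<Rightarrow> nat \<Rightarrow> bool" where
  "sum_indep c k \<longleftrightarrow> (\<forall>w. (\<forall>j\<le>k. w j \<in> Wsp c j) \<and> (\<Sum>j\<le>k. w j) = 0 \<longrightarrow> (\<forall>j\<le>k. w j = 0))"

lemma pser_trans_space: "pser l0 c A r \<Longrightarrow> trans_space A l0 j = Wsp c j"
  by (simp add: trans_space_def Wsp_def Nsp_def pser_taylor_coeff)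

lemma subspace_Nsp: "subspace (Nsp c j)" unfolding Nsp_def by (intro subspace_Inter) (auto simp: subspace_ker)

lemma subspace_Wsp: "subspace (Wsp c j)" unfolding Wsp_def
  by (intro linear_subspace_image subspace_Nsp bounded_linear.linear blinfun.bounded_linear_right)

lemma Nsp_Suc: "Nsp c (Suc j) = Nsp c j \<inter> ker (c j)" by (auto simp: Nsp_def less_Suc_eq)

lemma Nsp_decr: "Nsp c (Suc j) \<subseteq> Nsp c j" by (auto simp: Nsp_Suc)

lemma Nsp_1: "Nsp c 1 = ker (c 0)" by (auto simp: Nsp_def)

lemma Nsp_0: "Nsp c 0 = UNIV" by (auto simp: Nsp_def)

lemma Nsp_ker: "x \<in> Nsp c j \<Longrightarrow> i < j \<Longrightarrow> c i x = 0" by (auto simp: Nsp_def ker_def)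

lemma Nsp_cong: "(\<And>i. i < j \<Longrightarrow> c i = c' i) \<Longrightarrow> Nsp c j = Nsp c' j" by (auto simp: Nsp_def)

lemma Ssp_cong: assumes "\<And>i. i < j \<Longrightarrow> c i = c' i" shows "Ssp c j = Ssp c' j"
proof -
  have N: "Nsp c l = Nsp c' l" if "l < j" for l using assms that by (intro Nsp_cong) auto
  have S: "(\<Sum>l<j. c l (y l)) = (\<Sum>l<j. c' l (y l))" for y by (intro sum.cong) (auto simp: assms)
  show ?thesis unfolding Ssp_def S using N by auto
qed

lemma subspace_Ssp: "subspace (Ssp c j)"
proof (rule subspaceI)
  show "0 \<in> Ssp c j" unfolding Ssp_def
    by (intro CollectI exI[of _ "\<lambda>_. 0"]) (auto simp: blinfun.zero_right subspace_0[OF subspace_Nsp])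
next
  fix u v assume "u \<in> Ssp c j" "v \<in> Ssp c j"
  then obtain y z where "\<And>l. l < j \<Longrightarrow> y l \<in> Nsp c l" "u = (\<Sum>l<j. c l (y l))" "\<And>l. l < j \<Longrightarrow> z l \<in> Nsp c l" "v = (\<Sum>l<j. c l (z l))"
    by (auto simp: Ssp_def)
  then show "u + v \<in> Ssp c j" unfolding Ssp_def
    by (intro CollectI exI[of _ "\<lambda>l. y l + z l"]) (auto simp: blinfun.add_right sum.distrib intro: subspace_add[OF subspace_Nsp])
next
  fix a v assume "v \<in> Ssp c j"
  then obtain z where "\<And>l. l < j \<Longrightarrow> z l \<in> Nsp c l" "v = (\<Sum>l<j. c l (z l))" by (auto simp: Ssp_def)
  then show "a *\<^sub>R v \<in> Ssp c j" unfolding Ssp_def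
    by (intro CollectI exI[of _ "\<lambda>l. a *\<^sub>R z l"]) (auto simp: blinfun.scaleR_right scaleR_sum_right intro: subspace_scale[OF subspace_Nsp])
qed

lemma dirsum_sum_indep: "dirsum c k \<Longrightarrow> sum_indep c k"
proof (induction k)
  case 0 then show ?case by (auto simp: sum_indep_def)
next
  case (Suc k)
  have IH: "sum_indep c k" using Suc by (auto simp: dirsum_def)
  show ?case unfolding sum_indep_def
  proof (intro allI impI, elim conjE)
    fix w j assume w: "\<forall>j\<le>Suc k. w j \<in> Wsp c j" "(\<Sum>j\<le>Suc k. w j) = 0" and j: "j \<le> Suc k"
    have "\<forall>l. \<exists>y. l \<le> Suc k \<longrightarrow> y \<in> Nsp c l \<and> w l = c l y" using w(1) by (auto simp: Wsp_def)
    then obtain y where y: "\<And>l. l \<le> Suc k \<Longrightarrow> y l \<in> Nsp c l \<and> w l = c l (y l)" by metis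
    have "(\<Sum>l<Suc k. w l) = (\<Sum>l<Suc k. c l (y l))" by (intro sum.cong) (use y in auto)
    then have "(\<Sum>l<Suc k. w l) \<in> Ssp c (Suc k)" unfolding Ssp_def using y by (intro CollectI exI[of _ y]) auto
    moreover have "w (Suc k) = - (\<Sum>l<Suc k. w l)" using w(2) by (simp add: lessThan_Suc_atMost eq_neg_iff_add_eq_0 add.commute)
    ultimately have "w (Suc k) \<in> Ssp c (Suc k)" using subspace_neg[OF subspace_Ssp] by metis
    then have 0: "w (Suc k) = 0" using Suc.prems w(1) by (auto simp: dirsum_def)
    then have "(\<Sum>j\<le>k. w j) = 0" using w(2) by simp
    then show "w j = 0" using IH w(1) 0 j unfolding sum_indep_def by (metis le_Suc_eq)
  qed
qed

text \<open>A vector of level \<open>\<kappa> e\<close> is annihilated by all earlier coefficients,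
  and \<open>y e\<close> is its first image that can be nonzero. Independence of the transversal
  spaces makes the \<open>y e\<close> independent modulo the range. Vectors of level
  \<open>Suc k\<close> contribute none, so by index zero the sum fills the space exactly when there
  are none.\<close>

lemma flag_transversal:
  fixes c :: "nat \<Rightarrow> 'a::banach \<Rightarrow>\<^sub>L 'b::banach"
  assumes F: "c 0 \<in> Fredholm0" and ind: "sum_indep c k"
    and E: "finite E" "independent E" "span E = ker (c 0)"
    and \<kappa>: "\<forall>e\<in>E. 1 \<le> \<kappa> e \<and> \<kappa> e \<le> Suc k"
    and lev: "\<forall>j. 1 \<le> j \<and> j \<le> Suc k \<longrightarrow> span {e \<in> E. j \<le> \<kappa> e} = Nsp c j"
  defines "E1 \<equiv> {e \<in> E. \<kappa> e \<le> k}" and "y \<equiv> \<lambda>e. c (\<kappa> e) e"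
  shows "\<And>j. 1 \<le> j \<Longrightarrow> j \<le> k \<Longrightarrow> Wsp c j = span (y ` {e \<in> E. \<kappa> e = j})"
    and "\<And>e n. e \<in> E \<Longrightarrow> n < \<kappa> e \<Longrightarrow> c n e = 0"
    and "\<And>r. (\<Sum>e\<in>E1. r e *\<^sub>R y e) \<in> range (blinfun_apply (c 0)) \<Longrightarrow> \<forall>e\<in>E1. r e = 0"
    and "inj_on y E1" "independent (y ` E1)" "span (y ` E1) \<inter> range (blinfun_apply (c 0)) \<subseteq> {0}"
    and "(\<forall>v. \<exists>x. v - c 0 x \<in> span (y ` E1)) \<longleftrightarrow> E1 = E"
proof -
  note \<kappa> = \<kappa>[rule_format] and lev = lev[rule_format]
  have eN: "e \<in> Nsp c (\<kappa> e)" if "e \<in> E" for e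
    using lev[of "\<kappa> e"] \<kappa>[OF that] that span_base[of e "{e' \<in> E. \<kappa> e \<le> \<kappa> e'}"] by auto
  show z: "c n e = 0" if "e \<in> E" "n < \<kappa> e" for e n using Nsp_ker[OF eN[OF that(1)] that(2)] .
  have fE1: "finite E1" using E(1) by (simp add: E1_def)
  have linc: "linear (blinfun_apply (c j))" for j by (intro bounded_linear.linear blinfun.bounded_linear_right)
  show Wj: "Wsp c j = span (y ` {e \<in> E. \<kappa> e = j})" if j: "1 \<le> j" "j \<le> k" for j
  proof -
    have "Wsp c j = span (c j ` {e \<in> E. j \<le> \<kappa> e})"
      unfolding Wsp_def using lev[of j] j linear_span_image[OF linc] by (metis le_SucI)
    also have "\<dots> = span (y ` {e \<in> E. \<kappa> e = j})"
    proof (rule span_eq[THEN iffD2], intro conjI subsetI)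
      fix v assume "v \<in> c j ` {e \<in> E. j \<le> \<kappa> e}"
      then obtain e where e: "e \<in> E" "j \<le> \<kappa> e" "v = c j e" by blast
      show "v \<in> span (y ` {e \<in> E. \<kappa> e = j})"
      proof (cases "\<kappa> e = j")
        case True then show ?thesis using e by (intro span_base) (auto simp: y_def)
      next
        case False then show ?thesis using e z[of e j] by (simp add: span_zero)
      qed
    next
      fix v assume "v \<in> y ` {e \<in> E. \<kappa> e = j}"
      then show "v \<in> span (c j ` {e \<in> E. j \<le> \<kappa> e})" by (intro span_base) (auto simp: y_def)
    qed
    finally show ?thesis .
  qed
  \<comment> \<open>A relation among the \<open>y e\<close> of one level puts the corresponding
    combination of the \<open>e\<close> into the next space of the flag, hence into the span of
    deeper basis vectors, against independence of \<open>E\<close>.\<close>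
  have level: "r e = 0" if j: "1 \<le> j" "j \<le> k" and s: "(\<Sum>e\<in>{e \<in> E. \<kappa> e = j}. r e *\<^sub>R y e) = 0" and e: "e \<in> E" "\<kappa> e = j" for r j e
  proof -
    let ?J = "{e \<in> E. \<kappa> e = j}" and ?J1 = "{e \<in> E. Suc j \<le> \<kappa> e}"
    define x where "x = (\<Sum>e\<in>?J. r e *\<^sub>R e)"
    have "c j x = (\<Sum>e\<in>?J. r e *\<^sub>R y e)" unfolding x_def blinfun.sum_right
      by (rule sum.cong) (auto simp: y_def blinfun.scaleR_right)
    then have "x \<in> ker (c j)" using s by (simp add: ker_def)
    moreover have "x \<in> Nsp c j" unfolding x_def
      by (intro subspace_sum subspace_Nsp subspace_scale) (use eN in auto)
    ultimately have "x \<in> Nsp c (Suc j)" by (simp add: Nsp_Suc)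
    then have "x \<in> span ?J1" using lev[of "Suc j"] j by simp
    then obtain q where q: "x = (\<Sum>e\<in>?J1. q e *\<^sub>R e)" using E(1) by (auto simp: span_finite)
    define h where "h e = (if \<kappa> e = j then r e else if Suc j \<le> \<kappa> e then - q e else 0)" for e
    have "(\<Sum>e\<in>E. h e *\<^sub>R e) = (\<Sum>e\<in>?J \<union> ?J1. h e *\<^sub>R e)"
      using E(1) by (intro sum.mono_neutral_right) (auto simp: h_def)
    also have "\<dots> = (\<Sum>e\<in>?J. h e *\<^sub>R e) + (\<Sum>e\<in>?J1. h e *\<^sub>R e)" 
    proof (rule sum.union_disjoint)
      show "finite ?J" "finite ?J1" using E(1) by simp_all
      show "?J \<inter> ?J1 = {}" by auto
    qed
    also have "(\<Sum>e\<in>?J. h e *\<^sub>R e) = x" unfolding x_def by (rule sum.cong) (auto simp: h_def)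
    also have "(\<Sum>e\<in>?J1. h e *\<^sub>R e) = - x" unfolding q sum_negf[symmetric] by (rule sum.cong) (auto simp: h_def)
    finally have "(\<Sum>e\<in>E. h e *\<^sub>R e) = 0" by simp
    then have "h e = 0" using independentD[OF E(2,1) order_refl] e(1) by blast
    then show ?thesis using e by (simp add: h_def)
  qed
  show ind2: "\<forall>e\<in>E1. r e = 0" if r: "(\<Sum>e\<in>E1. r e *\<^sub>R y e) \<in> range (blinfun_apply (c 0))" for r
  proof -
    obtain x where x: "(\<Sum>e\<in>E1. r e *\<^sub>R y e) = c 0 x" using r by blast
    \<comment> \<open>The range part enters as component 0; the other terms are grouped by level, so
      that \<open>sum_indep\<close> applies.\<close>
    define w where "w j = (if j = 0 then - c 0 x else (\<Sum>e\<in>{e \<in> E. \<kappa> e = j}. r e *\<^sub>R y e))" for j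
    have wW: "w j \<in> Wsp c j" if "j \<le> k" for j
    proof (cases "j = 0")
      case True
      then show ?thesis by (auto simp: w_def Wsp_def Nsp_0 intro: range_eqI[of _ _ "- x"] simp: blinfun.minus_right)
    next
      case False
      then have "w j = (\<Sum>e\<in>{e \<in> E. \<kappa> e = j}. r e *\<^sub>R y e)" by (simp add: w_def)
      also have "\<dots> \<in> span (y ` {e \<in> E. \<kappa> e = j})" by (intro span_sum span_scale span_base imageI)
      finally show ?thesis using Wj[of j] that False by simp
    qed
    have "(\<Sum>j\<in>{1..k}. w j) = (\<Sum>j\<in>{1..k}. \<Sum>e\<in>{e \<in> E1. \<kappa> e = j}. r e *\<^sub>R y e)"
      by (intro sum.cong) (auto simp: w_def E1_def intro!: sum.cong)
    also have "\<dots> = (\<Sum>e\<in>E1. r e *\<^sub>R y e)"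
      by (rule sum.group[OF fE1]) (use \<kappa> in \<open>auto simp: E1_def\<close>)
    finally have "(\<Sum>j\<le>k. w j) = 0"
      using x by (simp add: atMost_atLeast0 sum.atLeast_Suc_atMost w_def)
    then have w0: "w j = 0" if "j \<le> k" for j using ind wW that unfolding sum_indep_def by blast
    show ?thesis
    proof
      fix e assume e: "e \<in> E1"
      then have e': "e \<in> E" "1 \<le> \<kappa> e" "\<kappa> e \<le> k" using \<kappa> by (auto simp: E1_def)
      have "(\<Sum>e'\<in>{e' \<in> E. \<kappa> e' = \<kappa> e}. r e' *\<^sub>R y e') = 0" using w0[of "\<kappa> e"] e' by (simp add: w_def)
      then show "r e = 0" using level[OF e'(2,3)] e'(1) by blast
    qed
  qed
  show inj: "inj_on y E1"
  proof (rule inj_onI)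
    fix e e' assume e: "e \<in> E1" "e' \<in> E1" "y e = y e'"
    show "e = e'"
    proof (rule ccontr)
      assume ne: "e \<noteq> e'"
      define r where "r x = (if x = e then 1 else if x = e' then -1 else 0::real)" for x
      have "(\<Sum>x\<in>E1. r x *\<^sub>R y x) = (\<Sum>x\<in>{e, e'}. r x *\<^sub>R y x)"
        using e fE1 by (intro sum.mono_neutral_right) (auto simp: r_def)
      also have "\<dots> = 0" using ne e by (simp add: r_def)
      finally have "r e = 0" using ind2[of r] e(1) subspace_0[OF range_blinfun_subspace] by metis
      then show False by (simp add: r_def)
    qed
  qed
  show indY: "independent (y ` E1)"
  proof (rule independent_if_scalars_zero)
    show "finite (y ` E1)" using fE1 by simp
    fix f x assume s: "(\<Sum>x\<in>y ` E1. f x *\<^sub>R x) = 0" and x: "x \<in> y ` E1"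
    have "(\<Sum>e\<in>E1. f (y e) *\<^sub>R y e) = 0" using s by (simp add: sum.reindex[OF inj])
    then have "\<forall>e\<in>E1. f (y e) = 0" using ind2[of "\<lambda>e. f (y e)"] subspace_0[OF range_blinfun_subspace] by metis
    then show "f x = 0" using x by auto
  qed
  show tr: "span (y ` E1) \<inter> range (blinfun_apply (c 0)) \<subseteq> {0}"
  proof
    fix v assume v: "v \<in> span (y ` E1) \<inter> range (blinfun_apply (c 0))"
    then obtain f where "v = (\<Sum>x\<in>y ` E1. f x *\<^sub>R x)" using fE1 by (auto simp: span_finite)
    then have v2: "v = (\<Sum>e\<in>E1. f (y e) *\<^sub>R y e)" by (simp add: sum.reindex[OF inj])
    then have "\<forall>e\<in>E1. f (y e) = 0" using v by (intro ind2) auto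
    then show "v \<in> {0}" using v2 by simp
  qed
  have "card (y ` E1) = card E1" by (rule card_image[OF inj])
  moreover have "card E = dim (ker (c 0))" using E dim_span_eq_card_independent by metis
  moreover have "card E1 = card E \<longleftrightarrow> E1 = E" using card_subset_eq[OF E(1), of E1] by (auto simp: E1_def)
  ultimately show "(\<forall>v. \<exists>x. v - c 0 x \<in> span (y ` E1)) \<longleftrightarrow> E1 = E"
    using Fredholm0_complement_card[OF F _ indY tr] fE1 by simp
qed

text \<open>Spanning forces every kernel basis vector to have level at most \<open>k\<close>. The
  dimension of \<open>Wsp c j\<close> is the number of vectors of level \<open>j\<close>, so the
  weighted sum of dimensions is the sum of the exponents. Invertibility of the bordered operator
  holds for every dual system, which leaves its choice to the factorization.\<close>

lemma transversal_normal_form: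
  fixes c :: "nat \<Rightarrow> 'a::banach \<Rightarrow>\<^sub>L 'b::banach"
  assumes F: "c 0 \<in> Fredholm0" and un: "\<forall>v. \<exists>!w. w \<in> Pi\<^sub>E {..k} (Wsp c) \<and> v = (\<Sum>j\<le>k. w j)" and Wk: "Wsp c k \<noteq> {0}" and k: "1 \<le> k"
  shows "\<exists>E \<kappa>. finite E \<and> independent E \<and> span E = ker (c 0) \<and> (\<forall>e\<in>E. 1 \<le> \<kappa> e \<and> \<kappa> e \<le> k) \<and> (\<exists>e\<in>E. \<kappa> e = k) \<and>
     (\<forall>e\<in>E. \<forall>n<\<kappa> e. c n e = 0) \<and>
     (\<forall>\<theta>. (\<forall>b\<in>E. \<forall>b'\<in>E. blinfun_apply (\<theta> b) b' = (if b = b' then 1 else 0)) \<longrightarrow> c 0 + finrank E \<theta> (\<lambda>e. c (\<kappa> e) e) \<in> GL) \<and>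
     (\<Sum>j=1..k. j * dim (Wsp c j)) = (\<Sum>e\<in>E. \<kappa> e)"
proof -
  have ind: "sum_indep c k" unfolding sum_indep_def
  proof (intro allI impI, elim conjE)
    fix w j assume w: "\<forall>j\<le>k. w j \<in> Wsp c j" "(\<Sum>j\<le>k. w j) = 0" and j: "j \<le> k"
    let ?w = "restrict w {..k}" and ?z = "restrict (\<lambda>_. 0) {..k}"
    have "(\<Sum>j\<le>k. ?w j) = (\<Sum>j\<le>k. w j)" "(\<Sum>j\<le>k. ?z j) = 0" by (auto intro!: sum.cong sum.neutral)
    then have "?w \<in> Pi\<^sub>E {..k} (Wsp c) \<and> 0 = (\<Sum>j\<le>k. ?w j)" using w by auto
    moreover have "?z \<in> Pi\<^sub>E {..k} (Wsp c) \<and> 0 = (\<Sum>j\<le>k. ?z j)"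
      using subspace_0[OF subspace_Wsp] \<open>(\<Sum>j\<le>k. ?z j) = 0\<close> by auto
    ultimately have "?w = ?z" using un[rule_format, of 0] by blast
    then show "w j = 0" using j by (metis atMost_iff restrict_apply')
  qed
  have fk: "fin_dim (ker (c 0))" using F by (simp add: Fredholm0_def)
  obtain E \<kappa> where E: "finite E" "independent E" "span E = Nsp c 1" and \<kappa>: "\<forall>e\<in>E. 1 \<le> \<kappa> e \<and> \<kappa> e \<le> Suc k"
    and lev: "\<forall>j. 1 \<le> j \<and> j \<le> Suc k \<longrightarrow> span {e \<in> E. j \<le> \<kappa> e} = Nsp c j"
    using flag_basis[of "Nsp c" k, OF subspace_Nsp Nsp_decr fk[folded Nsp_1]] by blast
  note E = E(1,2) E(3)[unfolded Nsp_1]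
  note ft = flag_transversal[OF F ind E \<kappa> lev]
  note \<kappa> = \<kappa>[rule_format] and lev = lev[rule_format]
  let ?y = "\<lambda>e. c (\<kappa> e) e" and ?E1 = "{e \<in> E. \<kappa> e \<le> k}"
  have "\<exists>x. v - c 0 x \<in> span (?y ` ?E1)" for v
  proof -
    obtain w where w: "w \<in> Pi\<^sub>E {..k} (Wsp c)" "v = (\<Sum>j\<le>k. w j)" using un by blast
    obtain x where x: "w 0 = c 0 x" using PiE_mem[OF w(1), of 0] by (auto simp: Wsp_def)
    have "w j \<in> span (?y ` ?E1)" if "j \<in> {1..k}" for j
    proof -
      have "w j \<in> span (?y ` {e \<in> E. \<kappa> e = j})" using PiE_mem[OF w(1), of j] ft(1)[of j] that by auto
      then show ?thesis by (rule subsetD[OF span_mono, rotated]) (use that in auto)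
    qed
    then have "(\<Sum>j\<in>{1..k}. w j) \<in> span (?y ` ?E1)" by (rule span_sum)
    moreover have "v - c 0 x = (\<Sum>j\<in>{1..k}. w j)" unfolding w(2) by (simp add: atMost_atLeast0 sum.atLeast_Suc_atMost x)
    ultimately show ?thesis by metis
  qed
  then have E1: "?E1 = E" and sp: "\<And>v. \<exists>x. v - c 0 x \<in> span (?y ` E)" using ft(7) by auto
  have \<kappa>k: "1 \<le> \<kappa> e \<and> \<kappa> e \<le> k" if "e \<in> E" for e using \<kappa>[OF that] E1 that by blast
  have inj: "inj_on ?y E" using ft(4) unfolding E1 .
  have "c 0 + finrank E \<theta> ?y \<in> GL" if \<theta>: "\<forall>b\<in>E. \<forall>b'\<in>E. blinfun_apply (\<theta> b) b' = (if b = b' then 1 else 0)" for \<theta>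
  proof (rule GL_border[OF E(1,3) \<theta>])
    show "\<forall>b\<in>E. r b = 0" if "(\<Sum>b\<in>E. r b *\<^sub>R ?y b) \<in> range (blinfun_apply (c 0))" for r using ft(3)[of r] that unfolding E1 .
    fix v
    obtain x where x: "v - c 0 x \<in> span (?y ` E)" using sp by blast
    then obtain f where "v - c 0 x = (\<Sum>z\<in>?y ` E. f z *\<^sub>R z)" using E(1) by (auto simp: span_finite)
    then have "v = c 0 x + (\<Sum>b\<in>E. f (?y b) *\<^sub>R ?y b)" by (simp add: sum.reindex[OF inj] algebra_simps)
    then show "\<exists>x r. v = c 0 x + (\<Sum>b\<in>E. r b *\<^sub>R ?y b)" by (intro exI[of _ x] exI[of _ "\<lambda>b. f (?y b)"])
  qed
  moreover have "\<exists>e\<in>E. \<kappa> e = k"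
  proof (rule ccontr)
    assume "\<not> ?thesis"
    then have S: "{e \<in> E. \<kappa> e = k} = {}" by blast
    have "Wsp c k = span (?y ` {e \<in> E. \<kappa> e = k})" by (rule ft(1)[OF k order_refl])
    also have "\<dots> = {0}" unfolding S by simp
    finally show False using Wk by simp
  qed
  moreover have "(\<Sum>j=1..k. j * dim (Wsp c j)) = (\<Sum>e\<in>E. \<kappa> e)"
  proof -
    have "dim (Wsp c j) = card {e \<in> E. \<kappa> e = j}" if j: "j \<in> {1..k}" for j
    proof -
      have "independent (?y ` {e \<in> E. \<kappa> e = j})"
        by (rule independent_mono[OF ft(5)]) (use j in auto)
      then have "dim (Wsp c j) = card (?y ` {e \<in> E. \<kappa> e = j})" using ft(1)[of j] j dim_span_eq_card_independent by auto
      also have "\<dots> = card {e \<in> E. \<kappa> e = j}" by (rule card_image[OF inj_on_subset[OF inj]]) auto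
      finally show ?thesis .
    qed
    then have "(\<Sum>j=1..k. j * dim (Wsp c j)) = (\<Sum>j=1..k. \<Sum>e\<in>{e \<in> E. \<kappa> e = j}. \<kappa> e)"
      by (intro sum.cong) auto
    also have "\<dots> = (\<Sum>e\<in>E. \<kappa> e)" by (rule sum.group[OF E(1)]) (use \<kappa>k in auto)
    finally show ?thesis .
  qed
  ultimately show ?thesis using E \<kappa>k ft(2) by blast
qed

text \<open>The converse direction: triviality of the space with index \<open>Suc k\<close> bounds
  all levels by \<open>k\<close>, and counting then yields spanning. Nontriviality with index
  \<open>k\<close> supplies a vector of level exactly \<open>k\<close>.\<close>

lemma transversal_of_dirsum:
  fixes c :: "nat \<Rightarrow> 'a::banach \<Rightarrow>\<^sub>L 'b::banach"
  assumes F: "c 0 \<in> Fredholm0" and d: "dirsum c k" and k: "1 \<le> k" and N: "Nsp c (Suc k) = {0}" "Nsp c k \<noteq> {0}"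
  shows "\<forall>v. \<exists>!w. w \<in> Pi\<^sub>E {..k} (Wsp c) \<and> v = (\<Sum>j\<le>k. w j)" "Wsp c k \<noteq> {0}"
proof -
  have ind: "sum_indep c k" by (rule dirsum_sum_indep[OF d])
  have fk: "fin_dim (ker (c 0))" using F by (simp add: Fredholm0_def)
  obtain E \<kappa> where E: "finite E" "independent E" "span E = Nsp c 1" and \<kappa>: "\<forall>e\<in>E. 1 \<le> \<kappa> e \<and> \<kappa> e \<le> Suc k"
    and lev: "\<forall>j. 1 \<le> j \<and> j \<le> Suc k \<longrightarrow> span {e \<in> E. j \<le> \<kappa> e} = Nsp c j"
    using flag_basis[of "Nsp c" k, OF subspace_Nsp Nsp_decr fk[folded Nsp_1]] by blast
  note E = E(1,2) E(3)[unfolded Nsp_1]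
  note ft = flag_transversal[OF F ind E \<kappa> lev]
  note \<kappa> = \<kappa>[rule_format] and lev = lev[rule_format]
  let ?y = "\<lambda>e. c (\<kappa> e) e" and ?E1 = "{e \<in> E. \<kappa> e \<le> k}"
  have e0: "e \<noteq> 0" if "e \<in> E" for e using E(2) that dependent_zero by blast
  have "\<kappa> e \<le> k" if "e \<in> E" for e
  proof (rule ccontr)
    assume "\<not> ?thesis"
    then have "e \<in> span {e \<in> E. Suc k \<le> \<kappa> e}" using that by (intro span_base) auto
    then show False using lev[of "Suc k"] N(1) e0[OF that] by simp
  qed
  then have E1: "?E1 = E" by blast
  have sp: "\<And>v. \<exists>x. v - c 0 x \<in> span (?y ` E)" using ft(7) E1 by auto
  have inj: "inj_on ?y E" using ft(4) unfolding E1 .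
  have ex: "\<exists>w. w \<in> Pi\<^sub>E {..k} (Wsp c) \<and> v = (\<Sum>j\<le>k. w j)" for v
  proof -
    obtain x where x: "v - c 0 x \<in> span (?y ` E)" using sp by blast
    then obtain f where f: "v - c 0 x = (\<Sum>z\<in>?y ` E. f z *\<^sub>R z)" using E(1) by (auto simp: span_finite)
    define w where "w = restrict (\<lambda>j. if j = 0 then c 0 x else (\<Sum>e\<in>{e \<in> E. \<kappa> e = j}. f (?y e) *\<^sub>R ?y e)) {..k}"
    have "w j \<in> Wsp c j" if "j \<le> k" for j
    proof (cases "j = 0")
      case True then show ?thesis by (auto simp: w_def Wsp_def Nsp_0)
    next
      case False
      then have "w j = (\<Sum>e\<in>{e \<in> E. \<kappa> e = j}. f (?y e) *\<^sub>R ?y e)" using that by (simp add: w_def)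
      also have "\<dots> \<in> span (?y ` {e \<in> E. \<kappa> e = j})" by (intro span_sum span_scale span_base imageI)
      finally show ?thesis using ft(1)[of j] that False by simp
    qed
    moreover have "w \<in> extensional {..k}" by (simp add: w_def)
    ultimately have "w \<in> Pi\<^sub>E {..k} (Wsp c)" by (auto simp: PiE_def)
    moreover have "(\<Sum>j\<in>{1..k}. w j) = v - c 0 x"
    proof -
      have "(\<Sum>j\<in>{1..k}. w j) = (\<Sum>j\<in>{1..k}. \<Sum>e\<in>{e \<in> E. \<kappa> e = j}. f (?y e) *\<^sub>R ?y e)"
        by (intro sum.cong) (auto simp: w_def)
      also have "\<dots> = (\<Sum>e\<in>E. f (?y e) *\<^sub>R ?y e)"
        by (rule sum.group[OF E(1)]) (use \<kappa> E1 in auto)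
      finally show ?thesis using f by (simp add: sum.reindex[OF inj])
    qed
    then have "v = (\<Sum>j\<le>k. w j)" by (simp add: atMost_atLeast0 sum.atLeast_Suc_atMost w_def)
    ultimately show ?thesis by blast
  qed
  show "\<forall>v. \<exists>!w. w \<in> Pi\<^sub>E {..k} (Wsp c) \<and> v = (\<Sum>j\<le>k. w j)"
  proof (intro allI ex_ex1I ex)
    fix v w w' assume w: "w \<in> Pi\<^sub>E {..k} (Wsp c) \<and> v = (\<Sum>j\<le>k. w j)" and w': "w' \<in> Pi\<^sub>E {..k} (Wsp c) \<and> v = (\<Sum>j\<le>k. w' j)"
    have a: "\<forall>j\<le>k. w j - w' j \<in> Wsp c j" using w w' by (auto intro!: subspace_diff[OF subspace_Wsp])
    have b: "(\<Sum>j\<le>k. w j - w' j) = 0" using w w' by (simp add: sum_subtractf)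
    have "(\<forall>j\<le>k. w j - w' j \<in> Wsp c j) \<and> (\<Sum>j\<le>k. w j - w' j) = 0 \<longrightarrow> (\<forall>j\<le>k. w j - w' j = 0)"
      using ind unfolding sum_indep_def by (elim allE[where x="\<lambda>j. w j - w' j"])
    then have "\<forall>j\<le>k. w j - w' j = 0" using a b by blast
    then show "w = w'" using w w' by (intro PiE_ext[of w "{..k}" "Wsp c" w']) auto
  qed
  have "\<exists>e\<in>E. \<kappa> e = k"
  proof (rule ccontr)
    assume *: "\<not> ?thesis"
    then have "\<kappa> e < k" if "e \<in> E" for e using E1 that by (metis (mono_tags, lifting) le_neq_implies_less mem_Collect_eq)
    then have S: "{e \<in> E. k \<le> \<kappa> e} = {}" by fastforce
    have "span {e \<in> E. k \<le> \<kappa> e} = Nsp c k" by (rule lev) (use k in simp)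
    then show False using N(2) unfolding S by simp
  qed
  then obtain e where e: "e \<in> E" "\<kappa> e = k" by blast
  have "?y e \<in> Wsp c k" using ft(1)[of k] k e by (auto intro: span_base)
  moreover have "?y e \<noteq> 0"
  proof
    assume "?y e = 0"
    then have z: "0 \<in> ?y ` ?E1" using e(1) unfolding E1 by (metis (no_types, lifting) image_eqI)
    show False by (rule notE[OF ft(5) dependent_zero[OF z]])
  qed
  ultimately show "Wsp c k \<noteq> {0}" by blast
qed

section \<open>Operator polynomials and transversalization\<close>

lemma operator_polynomial_const: "operator_polynomial (\<lambda>t. P)"
  unfolding operator_polynomial_def by (intro exI[of _ 0] exI[of _ "\<lambda>_. P"]) simp

lemma operator_polynomial_add:
  assumes "operator_polynomial f" "operator_polynomial g" shows "operator_polynomial (\<lambda>t. f t + g t)"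
proof -
  obtain m P n Q where f: "\<And>t. f t = (\<Sum>k\<le>m. t ^ k *\<^sub>R P k)" and g: "\<And>t. g t = (\<Sum>k\<le>n. t ^ k *\<^sub>R Q k)"
    using assms unfolding operator_polynomial_def by blast
  have pad: "(\<Sum>k\<le>m. t ^ k *\<^sub>R P k) = (\<Sum>k\<le>max m n. t ^ k *\<^sub>R (if k \<le> m then P k else 0))" for m n t and P :: "nat \<Rightarrow> 'a \<Rightarrow>\<^sub>L 'a"
    by (rule sum.mono_neutral_cong_left) auto
  have "f t + g t = (\<Sum>k\<le>max m n. t ^ k *\<^sub>R ((if k \<le> m then P k else 0) + (if k \<le> n then Q k else 0)))" for t
    unfolding f g pad[of t P m n] pad[of t Q n m] max.commute[of n m] scaleR_add_right sum.distrib ..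
  then show ?thesis unfolding operator_polynomial_def
    by (intro exI[of _ "max m n"] exI[of _ "\<lambda>k. (if k \<le> m then P k else 0) + (if k \<le> n then Q k else 0)"]) simp
qed

lemma operator_polynomial_scale:
  assumes "operator_polynomial f" shows "operator_polynomial (\<lambda>t. r *\<^sub>R f t)"
proof -
  obtain m P where f: "\<And>t. f t = (\<Sum>k\<le>m. t ^ k *\<^sub>R P k)" using assms unfolding operator_polynomial_def by blast
  have "r *\<^sub>R f t = (\<Sum>k\<le>m. t ^ k *\<^sub>R (r *\<^sub>R P k))" for t unfolding f scaleR_sum_right by (simp add: mult.commute)
  then show ?thesis unfolding operator_polynomial_def by (intro exI[of _ m] exI[of _ "\<lambda>k. r *\<^sub>R P k"]) simp
qed

lemma operator_polynomial_shift:
  assumes "operator_polynomial f" shows "operator_polynomial (\<lambda>t. t *\<^sub>R f t)"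
proof -
  obtain m P where f: "\<And>t. f t = (\<Sum>k\<le>m. t ^ k *\<^sub>R P k)" using assms unfolding operator_polynomial_def by blast
  have "t *\<^sub>R f t = (\<Sum>k\<le>Suc m. t ^ k *\<^sub>R (case k of 0 \<Rightarrow> 0 | Suc k \<Rightarrow> P k))" for t
    unfolding f sum.atMost_Suc_shift by (simp add: scaleR_sum_right)
  then show ?thesis unfolding operator_polynomial_def by (intro exI[of _ "Suc m"] exI[of _ "\<lambda>k. case k of 0 \<Rightarrow> 0 | Suc k \<Rightarrow> P k"]) simp
qed

text \<open>Polynomials are given in powers of \<open>t\<close>, whereas the constructions expand
  about \<open>l0\<close>; a factor \<open>t - l0\<close> is a shift plus a scaling.\<close>

lemma operator_polynomial_power_shift:
  assumes "operator_polynomial f" shows "operator_polynomial (\<lambda>t. (t - l0) ^ n *\<^sub>R f t)"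
proof (induction n)
  case 0 then show ?case using assms by simp
next
  case (Suc n)
  have "operator_polynomial (\<lambda>t. t *\<^sub>R ((t - l0) ^ n *\<^sub>R f t) + (- l0) *\<^sub>R ((t - l0) ^ n *\<^sub>R f t))"
    by (intro operator_polynomial_add operator_polynomial_shift operator_polynomial_scale Suc)
  then show ?case by (simp add: algebra_simps)
qed

lemma operator_polynomial_sum:
  assumes "finite I" "\<And>i. i \<in> I \<Longrightarrow> operator_polynomial (f i)" shows "operator_polynomial (\<lambda>t. \<Sum>i\<in>I. f i t)"
  using assms by (induction I rule: finite_induct) (auto intro: operator_polynomial_const operator_polynomial_add)

lemma operator_polynomial_compose:
  assumes "operator_polynomial f" "operator_polynomial g" shows "operator_polynomial (\<lambda>t. f t o\<^sub>L g t)"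
proof -
  obtain m P where f: "\<And>t. f t = (\<Sum>k\<le>m. t ^ k *\<^sub>R P k)" using assms unfolding operator_polynomial_def by blast
  obtain n Q where g: "\<And>t. g t = (\<Sum>k\<le>n. t ^ k *\<^sub>R Q k)" using assms unfolding operator_polynomial_def by blast
  have left: "operator_polynomial (\<lambda>t. R o\<^sub>L g t)" for R
  proof -
    have "R o\<^sub>L g t = (\<Sum>k\<le>n. t ^ k *\<^sub>R (R o\<^sub>L Q k))" for t
      unfolding g by (rule blinfun_eqI) (simp add: blinfun.sum_left blinfun.sum_right blinfun.scaleR_left blinfun.scaleR_right)
    then show ?thesis unfolding operator_polynomial_def by (intro exI[of _ n] exI[of _ "\<lambda>k. R o\<^sub>L Q k"]) simp
  qed
  have "f t o\<^sub>L g t = (\<Sum>k\<le>m. (t - 0) ^ k *\<^sub>R (P k o\<^sub>L g t))" for t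
    unfolding f by (rule blinfun_eqI) (simp add: blinfun.sum_left blinfun.scaleR_left)
  moreover have "operator_polynomial (\<lambda>t. \<Sum>k\<le>m. (t - 0) ^ k *\<^sub>R (P k o\<^sub>L g t))"
    by (intro operator_polynomial_sum operator_polynomial_power_shift left) simp
  ultimately show ?thesis by simp
qed

text \<open>The obstruction to directness at index \<open>Suc j\<close> is the part of the
  transversal space that falls into the lower sum. Writing such images as sums of
  \<open>c l (y l)\<close> with \<open>y l\<close> in \<open>Nsp c l\<close>, a polynomial
  correction removes them from the coefficient \<open>Suc j\<close>. Lower coefficients are
  unchanged, because \<open>c i\<close> vanishes on \<open>Nsp c l\<close> for
  \<open>i < l\<close>.\<close>

lemma transversalization_step:
  fixes A :: "real \<Rightarrow> 'a::banach \<Rightarrow>\<^sub>L 'b::banach"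
  assumes p: "pser l0 c A r" and d: "dirsum c j" and fin: "fin_dim (ker (c 0))"
  shows "\<exists>\<Psi> c'. operator_polynomial \<Psi> \<and> \<Psi> l0 = id_blinfun \<and> pser l0 c' (\<lambda>s. A s o\<^sub>L \<Psi> s) r \<and> c' 0 = c 0 \<and> dirsum c' (Suc j)"
proof -
  \<comment> \<open>The vectors responsible for the obstruction; a finite-dimensional space, being
    contained in the kernel of \<open>c 0\<close>.\<close>
  define X where "X = {x \<in> Nsp c (Suc j). c (Suc j) x \<in> Ssp c (Suc j)}"
  have sX: "subspace X"
    unfolding X_def using subspace_Nsp[of c "Suc j"] subspace_Ssp[of c "Suc j"]
    by (auto simp: subspace_def blinfun.zero_right blinfun.add_right blinfun.scaleR_right)
  have "X \<subseteq> ker (c 0)" using Nsp_ker[of _ c "Suc j" 0] by (auto simp: X_def ker_def)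
  then have "fin_dim X" by (rule fin_dim_subset[OF fin sX])
  then obtain B where B: "finite B" "independent B" "span B = X" by (rule fin_dim_basis)
  obtain \<theta> :: "'a \<Rightarrow> 'a \<Rightarrow>\<^sub>L real" where \<theta>: "\<forall>b\<in>B. \<forall>b'\<in>B. \<theta> b b' = (if b = b' then 1 else 0)"
    using dual_functionals[OF B(1,2)] by blast
  have "\<forall>b\<in>B. \<exists>y. (\<forall>l<Suc j. y l \<in> Nsp c l) \<and> c (Suc j) b = (\<Sum>l<Suc j. c l (y l))"
  proof
    fix b assume "b \<in> B"
    then have "b \<in> X" using B(3) span_base by blast
    then show "\<exists>y. (\<forall>l<Suc j. y l \<in> Nsp c l) \<and> c (Suc j) b = (\<Sum>l<Suc j. c l (y l))" by (simp add: X_def Ssp_def)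
  qed
  from bchoice[OF this] obtain y where y: "\<And>b l. b \<in> B \<Longrightarrow> l < Suc j \<Longrightarrow> y b l \<in> Nsp c l"
    "\<And>b. b \<in> B \<Longrightarrow> c (Suc j) b = (\<Sum>l<Suc j. c l (y b l))" by blast
  define P where "P l = finrank B \<theta> (\<lambda>b. y b l)" for l
  have PN: "P l x \<in> Nsp c l" if "l < Suc j" for l x
    unfolding P_def finrank_apply by (intro subspace_sum subspace_Nsp subspace_scale y that)
  define pi where "pi x = (\<Sum>b\<in>B. \<theta> b x *\<^sub>R b)" for x
  have lin_pi: "linear pi" unfolding pi_def by (rule bounded_linear.linear[OF bounded_linear_sum_functionals])
  have pi_X: "pi x \<in> X" for x unfolding pi_def B(3)[symmetric] by (intro span_sum span_scale span_base)
  have pi_id: "pi x = x" if "x \<in> X" for x unfolding pi_def using dual_functionals_expand[OF B(1) \<theta>, of x] that B(3) by simp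
  have sumP: "(\<Sum>i<Suc j. c i (P i x)) = c (Suc j) (pi x)" for x
  proof -
    have "(\<Sum>i<Suc j. c i (P i x)) = (\<Sum>i<Suc j. \<Sum>b\<in>B. \<theta> b x *\<^sub>R c i (y b i))"
      unfolding P_def finrank_apply blinfun.sum_right blinfun.scaleR_right ..
    also have "\<dots> = (\<Sum>b\<in>B. \<Sum>i<Suc j. \<theta> b x *\<^sub>R c i (y b i))" by (rule sum.swap)
    also have "\<dots> = (\<Sum>b\<in>B. \<theta> b x *\<^sub>R c (Suc j) b)" by (intro sum.cong) (auto simp: y(2) scaleR_sum_right simp del: sum.lessThan_Suc)
    finally show ?thesis by (simp add: pi_def blinfun.sum_right blinfun.scaleR_right)
  qed
  \<comment> \<open>\<open>- P l\<close> sits at order \<open>Suc j - l\<close>, so that its product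
    with \<open>c l\<close> enters the new series at order exactly \<open>Suc j\<close>.\<close>
  define \<psi> where "\<psi> n = (if n = 0 then id_blinfun else if n \<le> Suc j then - P (Suc j - n) else 0)" for n
  define \<Psi> where "\<Psi> s = (\<Sum>n\<le>Suc j. (s - l0) ^ n *\<^sub>R \<psi> n)" for s
  have op: "operator_polynomial \<Psi>" unfolding \<Psi>_def
    by (intro operator_polynomial_sum operator_polynomial_power_shift operator_polynomial_const) simp
  have p\<Psi>: "pser l0 \<psi> \<Psi> r" unfolding pser_def
  proof (intro conjI allI impI pser_pos[OF p])
    show "(\<lambda>n. (s - l0) ^ n *\<^sub>R \<psi> n) sums \<Psi> s" for s unfolding \<Psi>_def by (rule sums_finite) (auto simp: \<psi>_def)
  qed
  have \<Psi>0: "\<Psi> l0 = id_blinfun" using pser_at_center[OF p\<Psi>] by (simp add: \<psi>_def)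
  define c' where "c' n = (\<Sum>i\<le>n. c i o\<^sub>L \<psi> (n - i))" for n
  have pc': "pser l0 c' (\<lambda>s. A s o\<^sub>L \<Psi> s) r" unfolding c'_def by (rule pser_bilinear[OF bounded_bilinear_blinfun_compose p p\<Psi>])
  have c'x: "c' n x = c n x - (\<Sum>i<n. c i (P (Suc j - (n - i)) x))" if n: "n \<le> Suc j" for n x
  proof -
    have "c' n x = (\<Sum>i<n. c i (\<psi> (n - i) x)) + c n (\<psi> 0 x)"
      unfolding c'_def lessThan_Suc_atMost[symmetric] by (simp add: blinfun.sum_left blinfun.add_left)
    also have "(\<Sum>i<n. c i (\<psi> (n - i) x)) = (\<Sum>i<n. - c i (P (Suc j - (n - i)) x))"
      by (rule sum.cong) (use n in \<open>auto simp: \<psi>_def blinfun.minus_left blinfun.minus_right\<close>)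
    finally show ?thesis by (simp add: \<psi>_def sum_negf)
  qed
  have same: "c' n = c n" if n: "n \<le> j" for n
  proof (rule blinfun_eqI)
    fix x
    have "c i (P (Suc j - (n - i)) x) = 0" if i: "i < n" for i
      by (rule Nsp_ker[OF PN]) (use i n in auto)
    then show "c' n x = c n x" using c'x[of n x] n by simp
  qed
  have top: "c' (Suc j) x = c (Suc j) (x - pi x)" for x
  proof -
    have "(\<Sum>i<Suc j. c i (P (Suc j - (Suc j - i)) x)) = (\<Sum>i<Suc j. c i (P i x))" by (intro sum.cong) auto
    then show ?thesis using c'x[of "Suc j" x] sumP[of x] by (simp add: blinfun.diff_right)
  qed
  have "dirsum c' (Suc j)" unfolding dirsum_def
  proof (intro allI impI)
    fix i assume i: "i \<le> Suc j"
    have NS: "Nsp c' i = Nsp c i" "Ssp c' i = Ssp c i" using same i by (auto intro!: Nsp_cong Ssp_cong)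
    show "Wsp c' i \<inter> Ssp c' i \<subseteq> {0}"
    proof (cases "i \<le> j")
      case True
      then have "Wsp c' i = Wsp c i" using NS same by (simp add: Wsp_def)
      then show ?thesis using d True NS by (simp add: dirsum_def)
    next
      case False
      then have i': "i = Suc j" using i by simp
      show ?thesis
      proof
        fix v assume v: "v \<in> Wsp c' i \<inter> Ssp c' i"
        then obtain x where x: "x \<in> Nsp c (Suc j)" "v = c' (Suc j) x" using NS i' by (auto simp: Wsp_def)
        \<comment> \<open>\<open>z\<close> lies in \<open>X\<close> and is therefore fixed by
          \<open>pi\<close>, but \<open>pi\<close> is a projection and annihilates it.\<close>
        define z where "z = x - pi x"
        have "z \<in> Nsp c (Suc j)" unfolding z_def by (rule subspace_diff[OF subspace_Nsp x(1)]) (use pi_X[of x] in \<open>simp add: X_def\<close>)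
        moreover have "c (Suc j) z \<in> Ssp c (Suc j)" using v x(2) top NS i' by (simp add: z_def)
        ultimately have "z \<in> X" by (simp add: X_def)
        then have "z = pi z" using pi_id by simp
        also have "\<dots> = pi x - pi (pi x)" unfolding z_def by (rule linear_diff[OF lin_pi])
        also have "\<dots> = 0" using pi_id[OF pi_X] by simp
        finally show "v \<in> {0}" using x(2) top by (simp add: z_def blinfun.zero_right)
      qed
    qed
  qed
  moreover have "c' 0 = c 0" by (rule same) simp
  ultimately show ?thesis using op \<Psi>0 pc' by blast
qed

lemma transversalization_iterate:
  fixes L :: "real \<Rightarrow> 'a::banach \<Rightarrow>\<^sub>L 'b::banach"
  assumes p: "pser l0 a L r" and fin: "fin_dim (ker (L l0))"
  shows "\<exists>\<Phi> c. operator_polynomial \<Phi> \<and> \<Phi> l0 = id_blinfun \<and> pser l0 c (\<lambda>s. L s o\<^sub>L \<Phi> s) r \<and> c 0 = L l0 \<and> dirsum c j"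
proof (induction j)
  case 0
  have "L s o\<^sub>L id_blinfun = L s" for s by (rule blinfun_eqI) simp
  moreover have "dirsum a 0" by (auto simp: dirsum_def Ssp_def)
  ultimately show ?case using p pser_at_center[OF p] operator_polynomial_const[of id_blinfun]
    by (intro exI[of _ "\<lambda>_. id_blinfun"] exI[of _ a]) simp
next
  case (Suc j)
  then obtain \<Phi> c where \<Phi>: "operator_polynomial \<Phi>" "\<Phi> l0 = id_blinfun" "pser l0 c (\<lambda>s. L s o\<^sub>L \<Phi> s) r" "c 0 = L l0" "dirsum c j" by blast
  have "fin_dim (ker (c 0))" using fin \<Phi>(4) by simp
  from transversalization_step[OF \<Phi>(3,5) this] obtain \<Psi> c' where \<Psi>: "operator_polynomial \<Psi>" "\<Psi> l0 = id_blinfun"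
    "pser l0 c' (\<lambda>s. (L s o\<^sub>L \<Phi> s) o\<^sub>L \<Psi> s) r" "c' 0 = c 0" "dirsum c' (Suc j)" by blast
  have assoc: "(L s o\<^sub>L \<Phi> s) o\<^sub>L \<Psi> s = L s o\<^sub>L (\<Phi> s o\<^sub>L \<Psi> s)" for s by (rule blinfun_eqI) simp
  have "\<Phi> l0 o\<^sub>L \<Psi> l0 = id_blinfun" using \<Phi>(2) \<Psi>(2) by (intro blinfun_eqI) simp
  then show ?case using operator_polynomial_compose[OF \<Phi>(1) \<Psi>(1)] \<Psi>(3,4,5) \<Phi>(4) unfolding assoc
    by (intro exI[of _ "\<lambda>s. \<Phi> s o\<^sub>L \<Psi> s"] exI[of _ c']) simp
qed

text \<open>For \<open>x\<close> in the intersection of kernels, \<open>L s (\<Phi> s x)\<close>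
  vanishes to order \<open>Suc n\<close> while the inverse grows at most with order
  \<open>n\<close>. Hence \<open>\<Phi> s x\<close> tends to 0, but it also tends to
  \<open>x\<close>.\<close>

lemma Nsp_trivial_of_inverse_bound:
  fixes L :: "real \<Rightarrow> 'a::banach \<Rightarrow>\<^sub>L 'b::banach"
  assumes p: "pser l0 c (\<lambda>s. L s o\<^sub>L \<Phi> s) r" and \<Phi>: "operator_polynomial \<Phi>" "\<Phi> l0 = id_blinfun"
    and e: "e > 0" "\<And>s. 0 < \<bar>s - l0\<bar> \<Longrightarrow> \<bar>s - l0\<bar> < e \<Longrightarrow> L s \<in> GL \<and> norm (blinfun_inv (L s)) \<le> C / \<bar>s - l0\<bar> ^ n" and C: "C > 0"
  shows "Nsp c (Suc n) = {0}"
proof -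
  have "x = 0" if x: "x \<in> Nsp c (Suc n)" for x
  proof -
    have bl: "bounded_linear (\<lambda>X::'a \<Rightarrow>\<^sub>L 'b. X x)" "bounded_linear (\<lambda>X::'a \<Rightarrow>\<^sub>L 'a. X x)" by (intro bounded_linear_intros)+
    have "pser l0 (\<lambda>i. c i x) (\<lambda>s. L s (\<Phi> s x)) r" using pser_linear[OF bl(1) p] by simp
    from pser_shift[OF this, of "Suc n"] Nsp_ker[OF x] obtain g where
      g: "pser l0 (\<lambda>i. c (i + Suc n) x) g r" "\<And>s. \<bar>s - l0\<bar> < r \<Longrightarrow> L s (\<Phi> s x) = (s - l0) ^ Suc n *\<^sub>R g s" by blast
    have "an l0 g" using g(1) by (auto simp: an_def)
    then have cg: "(g \<longlongrightarrow> g l0) (at l0)" using an_continuous by (auto simp: isCont_def)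
    have lim0: "((\<lambda>s. C * \<bar>s - l0\<bar> * norm (g s)) \<longlongrightarrow> C * \<bar>l0 - l0\<bar> * norm (g l0)) (at l0)" by (intro tendsto_intros cg)
    have "\<forall>\<^sub>F s in at l0. norm (\<Phi> s x) \<le> C * \<bar>s - l0\<bar> * norm (g s)"
      unfolding eventually_at
    proof (intro exI[of _ "min e r"] conjI ballI impI)
      show "min e r > 0" using e pser_pos[OF p] by simp
      fix s assume s: "s \<noteq> l0 \<and> dist s l0 < min e r"
      then have s': "0 < \<bar>s - l0\<bar>" "\<bar>s - l0\<bar> < e" "\<bar>s - l0\<bar> < r" by (auto simp: dist_real_def)
      have "\<Phi> s x = blinfun_inv (L s) ((s - l0) ^ Suc n *\<^sub>R g s)" using g(2)[OF s'(3)] e(2)[OF s'(1,2)] by (metis blinfun_inv_apply(1))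
      then have "norm (\<Phi> s x) \<le> norm (blinfun_inv (L s)) * norm ((s - l0) ^ Suc n *\<^sub>R g s)" by (metis norm_blinfun)
      also have "\<dots> \<le> C / \<bar>s - l0\<bar> ^ n * (\<bar>s - l0\<bar> ^ Suc n * norm (g s))"
        using e(2)[OF s'(1,2)] by (intro mult_mono) (auto simp: power_abs abs_mult C less_imp_le)
      also have "\<dots> = C * \<bar>s - l0\<bar> * norm (g s)" using s'(1) by simp
      finally show "norm (\<Phi> s x) \<le> C * \<bar>s - l0\<bar> * norm (g s)" .
    qed
    then have "((\<lambda>s. \<Phi> s x) \<longlongrightarrow> 0) (at l0)" by (rule Lim_null_comparison) (use lim0 in simp)
    moreover have "((\<lambda>s. \<Phi> s x) \<longlongrightarrow> \<Phi> l0 x) (at l0)"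
      using an_continuous[OF an_linear[OF bl(2) an_poly[OF \<Phi>(1)]]] by (simp add: isCont_def)
    ultimately have "\<Phi> l0 x = 0" using LIM_unique by blast
    then show ?thesis using \<Phi>(2) by simp
  qed
  then show ?thesis using subspace_0[OF subspace_Nsp] by blast
qed

lemma Fredholm0_ker_GL:
  fixes T :: "'a::banach \<Rightarrow>\<^sub>L 'b::banach"
  assumes "T \<in> Fredholm0" "ker T = {0}" shows "T \<in> GL"
proof -
  obtain W where W: "fin_dim W" "dim W = dim (ker T)" "{s + w | s w. s \<in> range (blinfun_apply T) \<and> w \<in> W} = UNIV"
    using assms(1) by (auto simp: Fredholm0_def has_codim_def)
  obtain C where C: "finite C" "span C = W" "card C = dim W" using fin_dim_basis[OF W(1)] .
  have "dim (span ({} :: 'a set)) = 0" using dim_span_eq_card_independent[OF independent_empty, where 'a='a] by simp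
  then have "dim W = 0" using W(2) assms(2) by simp
  then have "C = {}" using C by simp
  then have "W = {0}" using C by simp
  then have "surj (blinfun_apply T)" using W(3) by auto
  then show ?thesis using assms(2) by (simp add: GL_iff_bij bij_def ker_zero_inj)
qed

text \<open>The growth order \<open>n\<close> of the inverse tells how many transversalization steps
  suffice: after \<open>n\<close> of them the kernels up to index \<open>n\<close> have trivial
  intersection.\<close>

lemma transversalizes_exists:
  fixes L :: "real \<Rightarrow> 'a::banach \<Rightarrow>\<^sub>L 'b::banach"
  assumes L: "an l0 L" and F: "L l0 \<in> Fredholm0" and nG: "L l0 \<notin> GL"
    and e: "e > 0" "\<And>s. 0 < \<bar>s - l0\<bar> \<Longrightarrow> \<bar>s - l0\<bar> < e \<Longrightarrow> L s \<in> GL \<and> norm (blinfun_inv (L s)) \<le> C / \<bar>s - l0\<bar> ^ n" and C: "C > 0"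
  shows "\<exists>k \<Phi>. 1 \<le> k \<and> transversalizes \<Phi> L l0 k"
proof -
  obtain a r where p: "pser l0 a L r" using L by (auto simp: an_def)
  have fk: "fin_dim (ker (L l0))" using F by (simp add: Fredholm0_def)
  obtain \<Phi> c where \<Phi>: "operator_polynomial \<Phi>" "\<Phi> l0 = id_blinfun" "pser l0 c (\<lambda>s. L s o\<^sub>L \<Phi> s) r" "c 0 = L l0" "dirsum c n"
    using transversalization_iterate[OF p fk] by blast
  have N: "Nsp c (Suc n) = {0}" by (rule Nsp_trivial_of_inverse_bound[OF \<Phi>(3,1,2) e C])
  \<comment> \<open>The least such index is the order of transversality: minimality gives a nonzero
    intersection just before it, and singularity of \<open>L l0\<close> makes it positive.\<close>
  define k where "k = (LEAST k. Nsp c (Suc k) = {0})"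
  have k: "Nsp c (Suc k) = {0}" unfolding k_def by (rule LeastI[of _ n]) (rule N)
  have kn: "k \<le> n" unfolding k_def by (rule Least_le) (rule N)
  have N1: "Nsp c 1 \<noteq> {0}" using Fredholm0_ker_GL[OF F] nG \<Phi>(4) Nsp_1[of c] by metis
  have k1: "1 \<le> k"
  proof (rule ccontr)
    assume "\<not> 1 \<le> k"
    then have "k = 0" by simp
    then show False using k N1 by simp
  qed
  have Nk: "Nsp c k \<noteq> {0}"
  proof -
    obtain k' where k': "k = Suc k'" using k1 by (cases k) auto
    then have "k' < k" by simp
    then have "\<not> Nsp c (Suc k') = {0}" unfolding k_def by (rule not_less_Least)
    then show ?thesis unfolding k' .
  qed
  have F': "c 0 \<in> Fredholm0" using F \<Phi>(4) by simp
  have d: "dirsum c k" using \<Phi>(5) kn by (auto simp: dirsum_def)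
  have "transversal (\<lambda>s. L s o\<^sub>L \<Phi> s) l0 k"
    unfolding transversal_def pser_trans_space[OF \<Phi>(3)] using transversal_of_dirsum[OF F' d k1 k Nk]
    by (simp add: pser_trans_space[OF \<Phi>(3), abs_def])
  then show ?thesis using \<Phi>(1,2) k1 unfolding transversalizes_def by blast
qed

lemma isCont_open:
  fixes f :: "real \<Rightarrow> 'a::metric_space"
  assumes "continuous (at l0) f" "open U" "f l0 \<in> U"
  shows "\<exists>e>0. \<forall>s. \<bar>s - l0\<bar> < e \<longrightarrow> f s \<in> U"
proof -
  obtain d where d: "d > 0" "\<And>z. dist z (f l0) < d \<Longrightarrow> z \<in> U" using assms(2,3) unfolding open_dist by blast
  obtain e where "e > 0" "\<And>s. dist s l0 < e \<Longrightarrow> dist (f s) (f l0) < d"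
    using assms(1)[unfolded continuous_at_eps_delta, rule_format, OF d(1)] by blast
  then show ?thesis using d(2) by (auto simp: dist_real_def)
qed

lemma finrank_eq_sum: "finrank B \<theta> f = (\<Sum>b\<in>B. blinfun_scaleR_left (f b) o\<^sub>L \<theta> b)"
  by (rule blinfun_eqI) (simp add: finrank_apply blinfun.sum_left)

lemma continuous_on_finrank:
  assumes "\<And>b. b \<in> B \<Longrightarrow> continuous_on X (\<lambda>s. f s b)"
  shows "continuous_on X (\<lambda>s. finrank B \<theta> (f s))"
  unfolding finrank_eq_sum
  by (intro continuous_intros bounded_linear.continuous_on[OF bounded_linear_blinfun_scaleR_left] assms)

section \<open>Diagonal local factorization\<close>

text \<open>For a dual system, this multiplies the coordinate \<open>\<theta> e\<close> by
  \<open>g e\<close> and is the identity on the common kernel of the functionals.\<close>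

definition Dg :: "'a::banach set \<Rightarrow> ('a \<Rightarrow> 'a \<Rightarrow>\<^sub>L real) \<Rightarrow> ('a \<Rightarrow> real) \<Rightarrow> 'a \<Rightarrow>\<^sub>L 'a" where
  "Dg E \<theta> g = id_blinfun + finrank E \<theta> (\<lambda>e. (g e - 1) *\<^sub>R e)"

definition dual_on :: "'a::real_normed_vector set \<Rightarrow> ('a \<Rightarrow> 'a \<Rightarrow>\<^sub>L real) \<Rightarrow> bool" where
  "dual_on E \<theta> \<longleftrightarrow> finite E \<and> (\<forall>b\<in>E. \<forall>b'\<in>E. \<theta> b b' = (if b = b' then 1 else 0))"

lemma Dg_apply: "Dg E \<theta> g x = x + (\<Sum>e\<in>E. (\<theta> e x * (g e - 1)) *\<^sub>R e)"
  by (simp add: Dg_def plus_blinfun.rep_eq finrank_apply)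

lemma dual_on_sum: assumes "dual_on E \<theta>" "e \<in> E" shows "\<theta> e (\<Sum>b\<in>E. r b *\<^sub>R b) = r e"
proof -
  have "\<theta> e (\<Sum>b\<in>E. r b *\<^sub>R b) = (\<Sum>b\<in>E. if b = e then r b else 0)"
    unfolding blinfun.sum_right by (rule sum.cong) (use assms in \<open>auto simp: dual_on_def blinfun.scaleR_right\<close>)
  then show ?thesis using assms by (simp add: dual_on_def)
qed

lemma \<theta>_Dg: assumes "dual_on E \<theta>" "e \<in> E" shows "\<theta> e (Dg E \<theta> g x) = g e * \<theta> e x"
  unfolding Dg_apply blinfun.add_right dual_on_sum[OF assms] by (simp add: algebra_simps)

lemma Dg_compose: assumes "dual_on E \<theta>" shows "Dg E \<theta> g (Dg E \<theta> h x) = Dg E \<theta> (\<lambda>e. g e * h e) x"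
proof -
  have "Dg E \<theta> g (Dg E \<theta> h x) = Dg E \<theta> h x + (\<Sum>e\<in>E. (h e * \<theta> e x * (g e - 1)) *\<^sub>R e)"
    unfolding Dg_apply[of E \<theta> g] by (simp add: \<theta>_Dg[OF assms])
  also have "\<dots> = x + (\<Sum>e\<in>E. (\<theta> e x * (h e - 1) + h e * \<theta> e x * (g e - 1)) *\<^sub>R e)"
    unfolding Dg_apply[of E \<theta> h] by (simp add: scaleR_add_left sum.distrib add.assoc)
  also have "\<dots> = Dg E \<theta> (\<lambda>e. g e * h e) x"
    unfolding Dg_apply by (intro arg_cong2[where f="(+)"] refl sum.cong) (simp_all add: algebra_simps)
  finally show ?thesis .
qed

lemma Dg_one: assumes "\<And>e. e \<in> E \<Longrightarrow> g e = 1" shows "Dg E \<theta> g x = x"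
  unfolding Dg_apply using assms by simp

lemma Dg_GL: assumes "dual_on E \<theta>" "\<And>e. e \<in> E \<Longrightarrow> g e \<noteq> 0"
  shows "Dg E \<theta> g \<in> GL" "blinfun_inv (Dg E \<theta> g) = Dg E \<theta> (\<lambda>e. 1 / g e)"
proof -
  have "Dg E \<theta> (\<lambda>e. 1 / g e) (Dg E \<theta> g x) = x" "Dg E \<theta> g (Dg E \<theta> (\<lambda>e. 1 / g e) x) = x" for x
    unfolding Dg_compose[OF assms(1)] by (rule Dg_one, use assms(2) in simp)+
  then show "Dg E \<theta> g \<in> GL" "blinfun_inv (Dg E \<theta> g) = Dg E \<theta> (\<lambda>e. 1 / g e)" by (rule GL_I)+
qed

lemma Dg_eigen: assumes "dual_on E \<theta>" "e \<in> E" shows "Dg E \<theta> g e = g e *\<^sub>R e"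
proof -
  have "(\<Sum>b\<in>E. (\<theta> b e * (g b - 1)) *\<^sub>R b) = (\<Sum>b\<in>E. if b = e then (g b - 1) *\<^sub>R b else 0)"
    by (rule sum.cong) (use assms in \<open>auto simp: dual_on_def\<close>)
  also have "\<dots> = (g e - 1) *\<^sub>R e" using assms by (simp add: dual_on_def)
  finally show ?thesis unfolding Dg_apply by (simp add: algebra_simps)
qed

text \<open>Since \<open>c n e = 0\<close> below \<open>\<kappa> e\<close>, the power
  \<open>(s - l0)^\<kappa>\<close> divides \<open>A s e\<close>. \<open>M\<close> keeps
  \<open>A s\<close> on the complement of the span of \<open>E\<close> and carries the quotients on
  \<open>E\<close>; at \<open>l0\<close> it is the bordered operator.\<close>

lemma local_factorization:
  fixes A :: "real \<Rightarrow> 'a::banach \<Rightarrow>\<^sub>L 'b::banach"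
  assumes p: "pser l0 c A r" and E: "dual_on E \<theta>" and \<kappa>: "\<And>e. e \<in> E \<Longrightarrow> 1 \<le> \<kappa> e"
    and z: "\<And>e n. e \<in> E \<Longrightarrow> n < \<kappa> e \<Longrightarrow> c n e = 0"
  shows "\<exists>M. continuous_on (ball l0 r) M \<and> M l0 = c 0 + finrank E \<theta> (\<lambda>e. c (\<kappa> e) e) \<and>
     (\<forall>s\<in>ball l0 r. \<forall>x. A s x = M s (Dg E \<theta> (\<lambda>e. (s - l0) ^ \<kappa> e) x))"
proof -
  have "\<forall>e\<in>E. \<exists>g. pser l0 (\<lambda>i. c (i + \<kappa> e) e) g r \<and> (\<forall>s. \<bar>s - l0\<bar> < r \<longrightarrow> A s e = (s - l0) ^ \<kappa> e *\<^sub>R g s)"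
  proof
    fix e assume e: "e \<in> E"
    have "bounded_linear (\<lambda>X::'a \<Rightarrow>\<^sub>L 'b. X e)" by (intro bounded_linear_intros)
    from pser_linear[OF this p] have "pser l0 (\<lambda>i. c i e) (\<lambda>s. A s e) r" .
    from pser_shift[OF this z[OF e]] show "\<exists>g. pser l0 (\<lambda>i. c (i + \<kappa> e) e) g r \<and> (\<forall>s. \<bar>s - l0\<bar> < r \<longrightarrow> A s e = (s - l0) ^ \<kappa> e *\<^sub>R g s)" by simp
  qed
  from bchoice[OF this] obtain g where g: "\<And>e. e \<in> E \<Longrightarrow> pser l0 (\<lambda>i. c (i + \<kappa> e) e) (g e) r"
    "\<And>e s. e \<in> E \<Longrightarrow> \<bar>s - l0\<bar> < r \<Longrightarrow> A s e = (s - l0) ^ \<kappa> e *\<^sub>R g e s" by blast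
  define P where "P = Dg E \<theta> (\<lambda>_. 0)"
  define M where "M s = (A s o\<^sub>L P) + finrank E \<theta> (\<lambda>e. g e s)" for s
  have Px: "P x = x - (\<Sum>e\<in>E. \<theta> e x *\<^sub>R e)" for x by (simp add: P_def Dg_apply sum_negf)
  have "continuous_on (ball l0 r) M" unfolding M_def
    by (intro continuous_intros continuous_on_finrank pser_continuous_on[OF p] pser_continuous_on[OF g(1)])
  moreover have "M l0 = c 0 + finrank E \<theta> (\<lambda>e. c (\<kappa> e) e)"
  proof (rule blinfun_eqI)
    fix x
    have "c 0 (\<Sum>e\<in>E. \<theta> e x *\<^sub>R e) = 0" unfolding blinfun.sum_right
      by (rule sum.neutral) (use z \<kappa> in \<open>fastforce simp: blinfun.scaleR_right\<close>)
    then have "c 0 (P x) = c 0 x" by (simp add: Px blinfun.diff_right)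
    moreover have "g e l0 = c (\<kappa> e) e" if "e \<in> E" for e using pser_at_center[OF g(1)[OF that]] by simp
    ultimately show "M l0 x = (c 0 + finrank E \<theta> (\<lambda>e. c (\<kappa> e) e)) x"
      by (simp add: M_def plus_blinfun.rep_eq finrank_apply pser_at_center[OF p])
  qed
  moreover have "A s x = M s (Dg E \<theta> (\<lambda>e. (s - l0) ^ \<kappa> e) x)" if s: "s \<in> ball l0 r" for s x
  proof -
    have s': "\<bar>s - l0\<bar> < r" using s by (auto simp: dist_real_def)
    let ?d = "Dg E \<theta> (\<lambda>e. (s - l0) ^ \<kappa> e) x"
    have "P ?d = P x" unfolding P_def Dg_compose[OF E] by simp
    then have "M s ?d = A s (P x) + (\<Sum>e\<in>E. ((s - l0) ^ \<kappa> e * \<theta> e x) *\<^sub>R g e s)"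
      by (simp add: M_def plus_blinfun.rep_eq finrank_apply \<theta>_Dg[OF E])
    also have "(\<Sum>e\<in>E. ((s - l0) ^ \<kappa> e * \<theta> e x) *\<^sub>R g e s) = (\<Sum>e\<in>E. \<theta> e x *\<^sub>R A s e)"
      by (rule sum.cong) (auto simp: g(2)[OF _ s'] mult.commute)
    also have "A s (P x) + (\<Sum>e\<in>E. \<theta> e x *\<^sub>R A s e) = A s x"
      by (simp add: Px blinfun.diff_right blinfun.sum_right blinfun.scaleR_right)
    finally show ?thesis by simp
  qed
  ultimately show ?thesis by blast
qed

text \<open>The coefficient algebra and the factorization together, for an arbitrary
  transversalizing polynomial; the dual functionals are fixed here.\<close>

lemma transversalizes_normal_form:
  fixes L :: "real \<Rightarrow> 'a::banach \<Rightarrow>\<^sub>L 'b::banach"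
  assumes L: "an l0 L" and F: "L l0 \<in> Fredholm0" and tr: "transversalizes \<Phi> L l0 k" and k: "1 \<le> k"
  obtains E \<theta> \<kappa> M r y where "dual_on E \<theta>" "independent E" "\<And>e. e \<in> E \<Longrightarrow> 1 \<le> \<kappa> e \<and> \<kappa> e \<le> k" "\<exists>e\<in>E. \<kappa> e = k"
    "r > 0" "continuous_on (ball l0 r) M" "M l0 = L l0 + finrank E \<theta> y" "M l0 \<in> GL"
    "\<And>s x. s \<in> ball l0 r \<Longrightarrow> L s (\<Phi> s x) = M s (Dg E \<theta> (\<lambda>e. (s - l0) ^ \<kappa> e) x)"
    "\<And>e. e \<in> E \<Longrightarrow> L l0 e = 0" "chi_transversal (\<lambda>s. L s o\<^sub>L \<Phi> s) l0 k = (\<Sum>e\<in>E. \<kappa> e)"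
proof -
  have \<Phi>: "operator_polynomial \<Phi>" "\<Phi> l0 = id_blinfun" "transversal (\<lambda>s. L s o\<^sub>L \<Phi> s) l0 k" using tr by (auto simp: transversalizes_def)
  have "an l0 (\<lambda>s. L s o\<^sub>L \<Phi> s)" by (rule an_compose[OF L an_poly[OF \<Phi>(1)]])
  then obtain c r where p: "pser l0 c (\<lambda>s. L s o\<^sub>L \<Phi> s) r" by (auto simp: an_def)
  have c0: "c 0 = L l0" using pser_at_center[OF p] \<Phi>(2) by (intro blinfun_eqI) (metis blinfun_apply_blinfun_compose blinfun_apply_id_blinfun)
  have F': "c 0 \<in> Fredholm0" using F c0 by simp
  have ts: "trans_space (\<lambda>s. L s o\<^sub>L \<Phi> s) l0 = Wsp c" using pser_trans_space[OF p] by blast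
  have un: "\<forall>v. \<exists>!w. w \<in> Pi\<^sub>E {..k} (Wsp c) \<and> v = (\<Sum>j\<le>k. w j)" and Wk: "Wsp c k \<noteq> {0}"
    using \<Phi>(3) unfolding transversal_def ts by blast+
  from transversal_normal_form[OF F' un Wk k]
  obtain E \<kappa> where E: "finite E" "independent E" "span E = ker (c 0)" "\<forall>e\<in>E. 1 \<le> \<kappa> e \<and> \<kappa> e \<le> k" "\<exists>e\<in>E. \<kappa> e = k"
    "\<forall>e\<in>E. \<forall>n<\<kappa> e. c n e = 0"
    "\<forall>\<theta>. (\<forall>b\<in>E. \<forall>b'\<in>E. blinfun_apply (\<theta> b) b' = (if b = b' then 1 else 0)) \<longrightarrow> c 0 + finrank E \<theta> (\<lambda>e. c (\<kappa> e) e) \<in> GL"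
    "(\<Sum>j=1..k. j * dim (Wsp c j)) = (\<Sum>e\<in>E. \<kappa> e)" by (elim exE conjE)
  obtain \<theta> :: "'a \<Rightarrow> 'a \<Rightarrow>\<^sub>L real" where \<theta>: "\<forall>b\<in>E. \<forall>b'\<in>E. \<theta> b b' = (if b = b' then 1 else 0)"
    using dual_functionals[OF E(1,2)] by blast
  have d: "dual_on E \<theta>" using E(1) \<theta> by (simp add: dual_on_def)
  have G: "c 0 + finrank E \<theta> (\<lambda>e. c (\<kappa> e) e) \<in> GL" using E(7) \<theta> by blast
  have k1: "\<And>e. e \<in> E \<Longrightarrow> 1 \<le> \<kappa> e" and z: "\<And>e n. e \<in> E \<Longrightarrow> n < \<kappa> e \<Longrightarrow> c n e = 0" using E(4,6) by auto
  obtain M where M: "continuous_on (ball l0 r) M" "M l0 = c 0 + finrank E \<theta> (\<lambda>e. c (\<kappa> e) e)"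
    "\<forall>s\<in>ball l0 r. \<forall>x. (L s o\<^sub>L \<Phi> s) x = M s (Dg E \<theta> (\<lambda>e. (s - l0) ^ \<kappa> e) x)"
    using local_factorization[OF p d, of \<kappa>] k1 z by blast
  show ?thesis
  proof (rule that[of E \<theta> \<kappa> r M "\<lambda>e. c (\<kappa> e) e"])
    show "dual_on E \<theta>" "independent E" "\<exists>e\<in>E. \<kappa> e = k" "r > 0" "continuous_on (ball l0 r) M"
      by (fact d E(2) E(5) pser_pos[OF p] M(1))+
    show "M l0 = L l0 + finrank E \<theta> (\<lambda>e. c (\<kappa> e) e)" using M(2) c0 by simp
    show "M l0 \<in> GL" using M(2) G by simp
    show "L l0 e = 0" if "e \<in> E" for e using z[OF that, of 0] k1[OF that] c0 by simp
    show "chi_transversal (\<lambda>s. L s o\<^sub>L \<Phi> s) l0 k = (\<Sum>e\<in>E. \<kappa> e)" unfolding chi_transversal_def ts by (rule E(8))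
    show "L s (\<Phi> s x) = M s (Dg E \<theta> (\<lambda>e. (s - l0) ^ \<kappa> e) x)" if "s \<in> ball l0 r" for s x
      using M(3) that by simp
  qed (use E(4) in auto)
qed

text \<open>The pole order of the inverse is read off the factorization: the inverse of the diagonal
  factor grows like \<open>\<bar>s - l0\<bar>\<close> to the power \<open>- k\<close>, and a basis
  vector with exponent \<open>k\<close> attains this rate. So the order in
  \<open>transversalizes\<close> is the one that \<open>algebraic_point\<close> demands.\<close>

lemma algebraic_point_of_transversalizes:
  fixes L :: "real \<Rightarrow> 'a::banach \<Rightarrow>\<^sub>L 'b::banach"
  assumes L: "an l0 L" and F: "d > 0" "\<And>s. s \<in> ball l0 d \<Longrightarrow> L s \<in> Fredholm0" and nG: "L l0 \<notin> GL"
    and tr: "transversalizes \<Phi> L l0 k" and k: "1 \<le> k"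
  shows "algebraic_point L l0 k"
proof -
  have F0: "L l0 \<in> Fredholm0" using F by simp
  obtain E \<theta> \<kappa> M r y where E: "dual_on E \<theta>" "independent E" "\<And>e. e \<in> E \<Longrightarrow> 1 \<le> \<kappa> e \<and> \<kappa> e \<le> k" "\<exists>e\<in>E. \<kappa> e = k"
    "r > 0" "continuous_on (ball l0 r) M" and M0: "M l0 = L l0 + finrank E \<theta> y" and GM: "M l0 \<in> GL"
    and fac: "\<And>s x. s \<in> ball l0 r \<Longrightarrow> L s (\<Phi> s x) = M s (Dg E \<theta> (\<lambda>e. (s - l0) ^ \<kappa> e) x)"
    and "\<And>e. e \<in> E \<Longrightarrow> L l0 e = 0" "chi_transversal (\<lambda>s. L s o\<^sub>L \<Phi> s) l0 k = (\<Sum>e\<in>E. \<kappa> e)"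
    by (rule transversalizes_normal_form[OF L F0 tr k]) blast
  note E = E GM
  have \<Phi>: "operator_polynomial \<Phi>" "\<Phi> l0 = id_blinfun" using tr by (auto simp: transversalizes_def)
  have c\<Phi>: "continuous (at l0) \<Phi>" by (rule an_continuous[OF an_poly[OF \<Phi>(1)]])
  have cM: "continuous (at l0) M" using E(5,6) continuous_on_eq_continuous_at[of "ball l0 r" M] by simp
  have "\<Phi> l0 \<in> GL" using \<Phi>(2) GL_id by simp
  from isCont_open[OF c\<Phi> open_GL this] isCont_open[OF cM open_GL E(7)]
  obtain ea eb where "ea > 0" "\<And>s. \<bar>s - l0\<bar> < ea \<Longrightarrow> \<Phi> s \<in> GL" "eb > 0" "\<And>s. \<bar>s - l0\<bar> < eb \<Longrightarrow> M s \<in> GL" by blast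
  then obtain e1 where e1: "e1 > 0" "\<And>s. \<bar>s - l0\<bar> < e1 \<Longrightarrow> \<Phi> s \<in> GL \<and> M s \<in> GL"
    by (metis min_less_iff_conj)
  have "((\<lambda>s. blinfun_inv (M s)) \<longlongrightarrow> blinfun_inv (M l0)) (at l0)" using cM by (intro tendsto_blinfun_inv E(7)) (simp add: isCont_def)
  then have cMi: "continuous (at l0) (\<lambda>s. blinfun_inv (M s))" by (simp add: isCont_def)
  obtain e2 where e2: "e2 > 0" "\<And>s. \<bar>s - l0\<bar> < e2 \<Longrightarrow> norm (blinfun_inv (M s)) \<le> norm (blinfun_inv (M l0)) + 1"
    using continuous_norm_bound[OF cMi] by blast
  obtain e3 where e3: "e3 > 0" "\<And>s. \<bar>s - l0\<bar> < e3 \<Longrightarrow> norm (\<Phi> s) \<le> norm (\<Phi> l0) + 1"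
    using continuous_norm_bound[OF c\<Phi>] by blast
  \<comment> \<open>Bounds the inverse of the diagonal factor up to the pole: each entry of it
    differs from 1 by at most \<open>2 / \<bar>t\<bar> ^ k\<close>.\<close>
  define S where "S = 1 + (\<Sum>e\<in>E. 2 * norm (\<theta> e) * norm e)"
  have S0: "S > 0" unfolding S_def by (intro add_pos_nonneg sum_nonneg) auto
  define a where "a = norm (\<Phi> l0) + 1"
  define b where "b = norm (blinfun_inv (M l0)) + 1"
  have ab: "a > 0" "b > 0" by (auto simp: a_def b_def intro: add_nonneg_pos)
  define \<epsilon> where "\<epsilon> = min 1 (min (min e1 e2) (min e3 r))"
  have \<epsilon>: "\<epsilon> > 0" using e1 e2 e3 E(5) by (simp add: \<epsilon>_def)
  \<comment> \<open>The added 1 makes the inequality strict, as \<open>inverse_bound\<close>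
    requires.\<close>
  have inv: "L s \<in> GL \<and> norm (blinfun_inv (L s)) < (a * S * b + 1) / \<bar>s - l0\<bar> ^ k" if s: "0 < \<bar>s - l0\<bar> \<and> \<bar>s - l0\<bar> < \<epsilon>" for s
  proof -
    define t where "t = s - l0"
    have t: "t \<noteq> 0" "\<bar>t\<bar> < 1" "s \<in> ball l0 r" using s by (auto simp: t_def \<epsilon>_def dist_real_def)
    have G: "\<Phi> s \<in> GL" "M s \<in> GL" using e1(2)[of s] s by (auto simp: \<epsilon>_def)
    define D where "D = Dg E \<theta> (\<lambda>e. t ^ \<kappa> e)"
    have DG: "D \<in> GL" "blinfun_inv D = Dg E \<theta> (\<lambda>e. 1 / t ^ \<kappa> e)" unfolding D_def using Dg_GL[OF E(1)] t by auto
    have eq: "L s = (M s o\<^sub>L D) o\<^sub>L blinfun_inv (\<Phi> s)"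
      by (rule blinfun_eqI) (use fac[OF t(3)] in \<open>simp add: D_def t_def flip: \<close>, metis G(1) blinfun_inv_apply(2))
    have LG: "L s \<in> GL" and Li: "blinfun_inv (L s) = \<Phi> s o\<^sub>L (blinfun_inv D o\<^sub>L blinfun_inv (M s))"
      unfolding eq using GL_compose[OF GL_compose(1)[OF G(2) DG(1)] GL_inv(1)[OF G(1)]] GL_compose(2)[OF G(2) DG(1)] GL_inv(2)[OF G(1)] by auto
    have tk: "0 < \<bar>t\<bar> ^ k" "\<bar>t\<bar> ^ k \<le> 1" using t by (auto intro: power_le_one)
    have nD: "norm (blinfun_inv D) \<le> S / \<bar>t\<bar> ^ k"
    proof (rule norm_blinfun_bound)
      show "0 \<le> S / \<bar>t\<bar> ^ k" using S0 by simp
      fix x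
      have "norm (blinfun_inv D x) \<le> norm x + (\<Sum>e\<in>E. norm ((\<theta> e x * (1 / t ^ \<kappa> e - 1)) *\<^sub>R e))"
        unfolding DG(2) Dg_apply by (rule order_trans[OF norm_triangle_ineq add_left_mono[OF norm_sum]])
      also have "\<dots> \<le> norm x / \<bar>t\<bar> ^ k + (\<Sum>e\<in>E. (2 * norm (\<theta> e) * norm e) * (norm x / \<bar>t\<bar> ^ k))"
      proof (intro add_mono sum_mono)
        show "norm x \<le> norm x / \<bar>t\<bar> ^ k" using tk by (simp add: divide_simps mult_left_le)
        fix e assume e: "e \<in> E"
        have "\<bar>t\<bar> ^ k \<le> \<bar>t\<bar> ^ \<kappa> e" using E(3)[OF e] t by (intro power_decreasing) auto
        then have "\<bar>1 / t ^ \<kappa> e\<bar> \<le> 1 / \<bar>t\<bar> ^ k" using tk t by (simp add: power_abs frac_le)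
        moreover have "1 \<le> 1 / \<bar>t\<bar> ^ k" using tk by simp
        moreover have "\<bar>X - 1\<bar> \<le> Q + Q" if "\<bar>X\<bar> \<le> Q" "1 \<le> Q" for X Q :: real using that by arith
        ultimately have "\<bar>1 / t ^ \<kappa> e - 1\<bar> \<le> 1 / \<bar>t\<bar> ^ k + 1 / \<bar>t\<bar> ^ k" by blast
        then have h: "\<bar>1 / t ^ \<kappa> e - 1\<bar> \<le> 2 / \<bar>t\<bar> ^ k" by simp
        have "\<bar>\<theta> e x\<bar> \<le> norm (\<theta> e) * norm x" using norm_blinfun[of "\<theta> e" x] by simp
        then have "\<bar>\<theta> e x\<bar> * \<bar>1 / t ^ \<kappa> e - 1\<bar> * norm e \<le> (norm (\<theta> e) * norm x) * (2 / \<bar>t\<bar> ^ k) * norm e"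
          using h by (intro mult_right_mono mult_mono) auto
        then show "norm ((\<theta> e x * (1 / t ^ \<kappa> e - 1)) *\<^sub>R e) \<le> (2 * norm (\<theta> e) * norm e) * (norm x / \<bar>t\<bar> ^ k)"
          by (simp add: abs_mult mult_ac)
      qed
      also have "\<dots> = S / \<bar>t\<bar> ^ k * norm x" unfolding S_def sum_distrib_right[symmetric] by (simp add: algebra_simps add_divide_distrib)
      finally show "norm (blinfun_inv D x) \<le> S / \<bar>t\<bar> ^ k * norm x" .
    qed
    have nM: "norm (blinfun_inv (M s)) \<le> b" and n\<Phi>: "norm (\<Phi> s) \<le> a" using e2(2)[of s] e3(2)[of s] s by (auto simp: \<epsilon>_def a_def b_def)
    have "norm (blinfun_inv (L s)) \<le> a * (S / \<bar>t\<bar> ^ k * b)"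
      unfolding Li using ab S0 by (intro order_trans[OF norm_blinfun_compose] mult_mono n\<Phi> order_trans[OF norm_blinfun_compose[of "blinfun_inv D"]] nD nM) auto
    also have "\<dots> < (a * S * b + 1) / \<bar>t\<bar> ^ k" using tk t(1) by (simp add: divide_simps mult_ac)
    finally show ?thesis using LG by (simp add: t_def)
  qed
  have "inverse_bound L l0 k" unfolding inverse_bound_def
    by (rule exI[of _ \<epsilon>], rule conjI[OF \<epsilon>], rule exI[of _ "a * S * b + 1"], rule conjI)
       (use inv ab S0 in \<open>auto intro!: add_nonneg_pos\<close>)
  moreover have "\<not> inverse_bound L l0 m" if m: "m < k" for m
  proof
    assume "inverse_bound L l0 m"
    then obtain \<epsilon>' C where C: "\<epsilon>' > 0" "C > 0" "\<And>s. 0 < \<bar>s - l0\<bar> \<and> \<bar>s - l0\<bar> < \<epsilon>' \<Longrightarrow> L s \<in> GL \<and> norm (blinfun_inv (L s)) < C / \<bar>s - l0\<bar> ^ m"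
      unfolding inverse_bound_def by blast
    \<comment> \<open>A bound of order \<open>m < k\<close> would force \<open>\<Phi> s e\<close> to
      0 along this vector, whereas it tends to \<open>e\<close>.\<close>
    obtain e where e: "e \<in> E" "\<kappa> e = k" using E(4) by blast
    have e0: "e \<noteq> 0" using E(2) e(1) dependent_zero by blast
    have bl: "bounded_linear (\<lambda>X::'a \<Rightarrow>\<^sub>L 'a. X e)" by (intro bounded_linear_intros)
    have lim\<Phi>: "((\<lambda>s. \<Phi> s e) \<longlongrightarrow> e) (at l0)"
      using an_continuous[OF an_linear[OF bl an_poly[OF \<Phi>(1)]], of l0] \<Phi>(2) by (simp add: isCont_def)
    have limM: "((\<lambda>s. M s e) \<longlongrightarrow> M l0 e) (at l0)" using cM unfolding isCont_def by (intro tendsto_intros)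
    have lim0: "((\<lambda>s. C * \<bar>s - l0\<bar> * norm (M s e)) \<longlongrightarrow> C * \<bar>l0 - l0\<bar> * norm (M l0 e)) (at l0)" by (intro tendsto_intros limM)
    have "\<forall>\<^sub>F s in at l0. norm (\<Phi> s e) \<le> C * \<bar>s - l0\<bar> * norm (M s e)"
      unfolding eventually_at
    proof (intro exI[of _ "min 1 (min \<epsilon>' r)"] conjI ballI impI)
      show "min 1 (min \<epsilon>' r) > 0" using C E(5) by simp
      fix s assume s: "s \<noteq> l0 \<and> dist s l0 < min 1 (min \<epsilon>' r)"
      define t where "t = \<bar>s - l0\<bar>"
      have t: "0 < t" "t < 1" "t < \<epsilon>'" "s \<in> ball l0 r" using s by (auto simp: dist_real_def t_def)
      have G: "L s \<in> GL" "norm (blinfun_inv (L s)) \<le> C / t ^ m" using C(3)[of s] t by (auto simp: t_def less_imp_le)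
      have "L s (\<Phi> s e) = (s - l0) ^ k *\<^sub>R M s e" using fac[OF t(4), of e] Dg_eigen[OF E(1) e(1)] e(2) by (simp add: blinfun.scaleR_right)
      then have "\<Phi> s e = blinfun_inv (L s) ((s - l0) ^ k *\<^sub>R M s e)" by (metis G(1) blinfun_inv_apply(1))
      then have "norm (\<Phi> s e) \<le> norm (blinfun_inv (L s)) * norm ((s - l0) ^ k *\<^sub>R M s e)" by (metis norm_blinfun)
      also have "\<dots> \<le> C / t ^ m * (t ^ k * norm (M s e))"
        using G(2) C(2) t(1) by (intro mult_mono) (auto simp: power_abs t_def)
      also have "\<dots> = C * t ^ (k - m) * norm (M s e)" using m t(1) by (simp add: power_diff)
      also have "\<dots> \<le> C * t ^ 1 * norm (M s e)"
        using m t C(2) by (intro mult_right_mono mult_left_mono power_decreasing) auto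
      finally show "norm (\<Phi> s e) \<le> C * \<bar>s - l0\<bar> * norm (M s e)" by (simp add: t_def)
    qed
    then have "((\<lambda>s. \<Phi> s e) \<longlongrightarrow> 0) (at l0)" by (rule Lim_null_comparison) (use lim0 in simp)
    then show False using lim\<Phi> LIM_unique e0 by blast
  qed
  moreover obtain c r' where p: "pser l0 c L r'" using L by (auto simp: an_def)
  have "Cr_on k (ball l0 (min d r')) L"
    using pser_mono[OF p, of "min d r'"] pser_pos[OF p] F(1) by (intro pser_Cr_on) auto
  then have "\<exists>\<delta>>0. Cr_on k (ball l0 \<delta>) L \<and> (\<forall>l\<in>ball l0 \<delta>. L l \<in> Fredholm0)"
    using F pser_pos[OF p] by (intro exI[of _ "min d r'"]) auto
  ultimately show ?thesis unfolding algebraic_point_def using nG k by blast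
qed

section \<open>The sign of the local model\<close>

lemma (in wsys) card_basis_W: assumes "finite B" "independent B" "span B = W" shows "card B = m"
proof -
  have inj: "inj_on w {..<m}"
    by (rule inj_onI) (metis dual lessThan_iff zero_neq_one)
  have "independent (w ` {..<m})"
  proof (rule independent_if_scalars_zero)
    fix f x assume s: "(\<Sum>x\<in>w ` {..<m}. f x *\<^sub>R x) = 0" and x: "x \<in> w ` {..<m}"
    then obtain j where j: "j < m" "x = w j" by blast
    have "(\<Sum>i<m. f (w i) *\<^sub>R w i) = 0" using s by (simp add: sum.reindex[OF inj])
    then show "f x = 0" using \<phi>_sum[OF j(1), of "\<lambda>i. f (w i)"] j by (simp add: blinfun.zero_right)
  qed simp
  then have "dim W = card (w ` {..<m})" unfolding W_def by (rule dim_span_eq_card_independent)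
  moreover have "card (w ` {..<m}) = m" using card_image[OF inj] by simp
  moreover have "dim W = card B" using dim_span_eq_card_independent[OF assms(2)] assms(3) by simp
  ultimately show ?thesis by simp
qed

lemma (in wsys) \<delta>_eigenset:
  assumes A: "linear A" and B: "finite B" "independent B" "span B = W"
    and eig: "\<And>b. b \<in> B \<Longrightarrow> A b = g b *\<^sub>R b" and g: "\<And>b. b \<in> B \<Longrightarrow> g b \<noteq> 0"
  shows "real_of_int (\<delta> A) = (\<Prod>b\<in>B. sgn (g b))"
proof -
  have card: "card B = m" by (rule card_basis_W[OF B])
  obtain h where h: "bij_betw h {..<m} B" using ex_bij_betw_nat_finite[OF B(1)] card by (auto simp: atLeast0LessThan)
  obtain \<psi> :: "'b \<Rightarrow> 'b \<Rightarrow>\<^sub>L real" where \<psi>: "\<forall>b\<in>B. \<forall>b'\<in>B. \<psi> b b' = (if b = b' then 1 else 0)"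
    using dual_functionals[OF B(1,2)] by blast
  have hB: "h i \<in> B" if "i < m" for i using h that by (auto simp: bij_betw_def)
  have inj: "h i = h j \<longleftrightarrow> i = j" if "i < m" "j < m" for i j using h that by (auto simp: bij_betw_def inj_on_def)
  have "real_of_int (\<delta> A) = (\<Prod>i<m. sgn (g (h i)))"
  proof (rule \<delta>_eigenbasis[OF A, where b=h and \<psi>="\<lambda>i. \<psi> (h i)"])
    show "h i \<in> W" if "i < m" for i using hB[OF that] B(3) span_base by blast
    show "\<psi> (h i) (h j) = (if i = j then 1 else 0)" if "i < m" "j < m" for i j using \<psi> hB inj that by simp
    show "(\<Sum>i<m. \<psi> (h i) v *\<^sub>R h i) = v" if "v \<in> W" for v
      using sum.reindex_bij_betw[OF h, of "\<lambda>b. \<psi> b v *\<^sub>R b"] dual_functionals_expand[OF B(1) \<psi>, of v] that B(3) by simp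
    show "A (h i) = g (h i) *\<^sub>R h i" if "i < m" for i by (rule eig[OF hB[OF that]])
    show "g (h i) \<noteq> 0" if "i < m" for i by (rule g[OF hB[OF that]])
  qed
  also have "\<dots> = (\<Prod>b\<in>B. sgn (g b))" by (rule prod.reindex_bij_betw[OF h])
  finally show ?thesis .
qed

text \<open>With the isomorphism frozen, adding the perturbation changes the diagonal entries from
  \<open>g\<close> to \<open>1 + g\<close>. The ratio is conjugate to a diagonal operator: it has
  eigenvalue \<open>g / (1 + g)\<close> on \<open>y e\<close> and is the identity on the range of
  \<open>K0\<close>. Positivity of \<open>1 + g\<close> leaves the sign of \<open>g\<close>.\<close>

lemma (in wsysB) local_model_sign:
  fixes K0 :: "'a::banach \<Rightarrow>\<^sub>L 'b"
  assumes E: "dual_on E \<theta>" "independent E" and K0: "\<And>e. e \<in> E \<Longrightarrow> K0 e = 0"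
    and M0: "M0 = K0 + finrank E \<theta> y" "M0 \<in> GL" and y: "\<And>e. e \<in> E \<Longrightarrow> y e \<in> W"
    and g: "\<And>e. e \<in> E \<Longrightarrow> g e \<noteq> 0" "\<And>e. e \<in> E \<Longrightarrow> 1 + g e > 0"
  shows "real_of_int (\<rho> (M0 o\<^sub>L Dg E \<theta> g) ((M0 o\<^sub>L Dg E \<theta> g) + finrank E \<theta> y)) = (\<Prod>e\<in>E. sgn (g e))"
proof -
  have fE: "finite E" using E(1) by (simp add: dual_on_def)
  define h where "h e = g e / (1 + g e)" for e
  have M0e: "M0 e = y e" if "e \<in> E" for e
  proof -
    have "(\<Sum>b\<in>E. \<theta> b e *\<^sub>R y b) = (\<Sum>b\<in>E. if b = e then y b else 0)"
      by (rule sum.cong) (use E(1) that in \<open>auto simp: dual_on_def\<close>)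
    then show ?thesis using K0[OF that] fE that by (simp add: M0(1) plus_blinfun.rep_eq finrank_apply)
  qed
  have T: "(M0 o\<^sub>L Dg E \<theta> g) + finrank E \<theta> y = M0 o\<^sub>L Dg E \<theta> (\<lambda>e. 1 + g e)"
  proof (rule blinfun_eqI)
    fix x
    have "finrank E \<theta> y x = M0 (\<Sum>e\<in>E. \<theta> e x *\<^sub>R e)"
      unfolding finrank_apply blinfun.sum_right by (rule sum.cong) (auto simp: M0e blinfun.scaleR_right)
    moreover have "Dg E \<theta> (\<lambda>e. 1 + g e) x = Dg E \<theta> g x + (\<Sum>e\<in>E. \<theta> e x *\<^sub>R e)"
      unfolding Dg_apply add.assoc sum.distrib[symmetric] by (intro arg_cong2[where f="(+)"] refl sum.cong) (simp_all add: algebra_simps)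
    ultimately show "((M0 o\<^sub>L Dg E \<theta> g) + finrank E \<theta> y) x = (M0 o\<^sub>L Dg E \<theta> (\<lambda>e. 1 + g e)) x"
      by (simp add: plus_blinfun.rep_eq blinfun.add_right)
  qed
  have g1: "\<And>e. e \<in> E \<Longrightarrow> 1 + g e \<noteq> 0" using g(2) by (metis less_irrefl)
  have DG: "Dg E \<theta> (\<lambda>e. 1 + g e) \<in> GL" "blinfun_inv (Dg E \<theta> (\<lambda>e. 1 + g e)) = Dg E \<theta> (\<lambda>e. 1 / (1 + g e))"
    using Dg_GL[OF E(1), of "\<lambda>e. 1 + g e"] g1 by blast+
  define A where "A v = M0 (Dg E \<theta> h (blinfun_inv M0 v))" for v
  have Aeq: "(M0 o\<^sub>L Dg E \<theta> g) (blinfun_inv ((M0 o\<^sub>L Dg E \<theta> g) + finrank E \<theta> y) v) = A v" for v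
    unfolding T GL_compose(2)[OF M0(2) DG(1)] DG(2) A_def
    by (simp add: Dg_compose[OF E(1)] h_def[abs_def])
  have linA: "linear A" unfolding A_def by (intro bounded_linear.linear bounded_linear_intros)
  have eigE: "A (y e) = h e *\<^sub>R y e" if "e \<in> E" for e
    using M0e[OF that] blinfun_inv_apply(1)[OF M0(2), of e] Dg_eigen[OF E(1) that, of h] by (simp add: A_def blinfun.scaleR_right)
  define P where "P = Dg E \<theta> (\<lambda>_. 0)"
  have KP: "K0 x = M0 (P x)" for x
  proof -
    have "\<theta> e (P x) = 0" if "e \<in> E" for e using \<theta>_Dg[OF E(1) that, of "\<lambda>_. 0" x] by (simp add: P_def)
    then have "finrank E \<theta> y (P x) = 0" by (simp add: finrank_apply)
    moreover have "K0 (P x) = K0 x" unfolding P_def Dg_apply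
      by (simp add: blinfun.add_right blinfun.sum_right blinfun.scaleR_right blinfun.minus_right K0)
    ultimately show ?thesis by (simp add: M0(1) plus_blinfun.rep_eq)
  qed
  have eigR: "A v = v" if "v \<in> range (blinfun_apply K0)" for v
  proof -
    obtain x where "v = M0 (P x)" using KP \<open>v \<in> range (blinfun_apply K0)\<close> by auto
    then show ?thesis by (simp add: A_def blinfun_inv_apply[OF M0(2)] P_def Dg_compose[OF E(1)])
  qed
  have span_y: "M0 (\<Sum>e\<in>E. r e *\<^sub>R e) = (\<Sum>e\<in>E. r e *\<^sub>R y e)" for r
    unfolding blinfun.sum_right by (rule sum.cong) (auto simp: M0e blinfun.scaleR_right)
  have dis: "r e = 0" if s: "(\<Sum>e\<in>E. r e *\<^sub>R y e) \<in> range (blinfun_apply K0)" and e: "e \<in> E" for r e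
  proof -
    obtain x where "(\<Sum>e\<in>E. r e *\<^sub>R y e) = K0 x" using s by auto
    then have "M0 (\<Sum>e\<in>E. r e *\<^sub>R e) = M0 (P x)" unfolding span_y KP .
    then have "(\<Sum>e\<in>E. r e *\<^sub>R e) = P x" by (metis M0(2) blinfun_inv_apply(1))
    then have "r e = \<theta> e (P x)" using dual_on_sum[OF E(1) e, of r] by simp
    also have "\<dots> = 0" using \<theta>_Dg[OF E(1) e, of "\<lambda>_. 0" x] by (simp add: P_def)
    finally show ?thesis .
  qed
  have R0: "0 \<in> range (blinfun_apply K0)" by (rule subspace_0[OF range_blinfun_subspace])
  have injy: "inj_on y E"
    by (rule inj_onI) (metis M0(2) M0e blinfun_inv_apply(1))
  \<comment> \<open>The eigenbasis of \<open>W\<close> consists of the \<open>y e\<close> and any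
    basis of this part: a vector of \<open>W\<close> minus its \<open>y\<close>-component lies in
    the range of \<open>K0\<close> and still in \<open>W\<close>.\<close>
  define R where "R = W \<inter> range (blinfun_apply K0)"
  have "subspace R" unfolding R_def by (rule subspace_inter[OF subspace_W range_blinfun_subspace])
  moreover have "fin_dim W" unfolding W_def by (intro fin_dim_span) simp
  ultimately have "fin_dim R" by (intro fin_dim_subset[of W R]) (auto simp: R_def)
  then obtain B where B: "finite B" "independent B" "span B = R" by (rule fin_dim_basis)
  have BR: "b \<in> R" if "b \<in> B" for b using span_base[OF that] B(3) by simp
  have disj: "y ` E \<inter> B = {}"
  proof (rule ccontr)
    assume "\<not> ?thesis"
    then obtain e where e: "e \<in> E" "y e \<in> B" by blast
    have "(\<Sum>b\<in>E. (if b = e then 1 else 0) *\<^sub>R y b) = (\<Sum>b\<in>E. if b = e then y b else 0)" by (rule sum.cong) auto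
    then have "(\<Sum>b\<in>E. (if b = e then 1 else 0) *\<^sub>R y b) = y e" using fE e(1) by simp
    then have "(\<Sum>b\<in>E. (if b = e then 1 else 0) *\<^sub>R y b) \<in> range (blinfun_apply K0)" using BR[OF e(2)] by (simp add: R_def)
    from dis[OF this e(1)] show False by simp
  qed
  have ind: "independent (y ` E \<union> B)"
  proof (rule independent_if_scalars_zero)
    show "finite (y ` E \<union> B)" using fE B(1) by simp
    fix f x assume s: "(\<Sum>x\<in>y ` E \<union> B. f x *\<^sub>R x) = 0" and x: "x \<in> y ` E \<union> B"
    have "(\<Sum>x\<in>y ` E \<union> B. f x *\<^sub>R x) = (\<Sum>x\<in>y ` E. f x *\<^sub>R x) + (\<Sum>x\<in>B. f x *\<^sub>R x)"
      by (rule sum.union_disjoint) (use fE B(1) disj in auto)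
    then have s2: "(\<Sum>e\<in>E. f (y e) *\<^sub>R y e) = - (\<Sum>x\<in>B. f x *\<^sub>R x)" using s by (simp add: sum.reindex[OF injy] eq_neg_iff_add_eq_0)
    have "(\<Sum>x\<in>B. f x *\<^sub>R x) \<in> range (blinfun_apply K0)"
      by (intro subspace_sum range_blinfun_subspace subspace_scale) (use BR in \<open>auto simp: R_def\<close>)
    then have "(\<Sum>e\<in>E. f (y e) *\<^sub>R y e) \<in> range (blinfun_apply K0)" unfolding s2 by (rule subspace_neg[OF range_blinfun_subspace])
    then have fy: "f (y e) = 0" if "e \<in> E" for e using dis[of "\<lambda>e. f (y e)"] that by blast
    then have "(\<Sum>x\<in>B. f x *\<^sub>R x) = 0" using s2 by simp
    then have "f b = 0" if "b \<in> B" for b using independentD[OF B(2,1) order_refl] that by blast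
    then show "f x = 0" using fy x by auto
  qed
  have sp: "span (y ` E \<union> B) = W"
  proof
    show "span (y ` E \<union> B) \<subseteq> W" by (rule span_minimal[OF _ subspace_W]) (use y BR in \<open>auto simp: R_def\<close>)
    show "W \<subseteq> span (y ` E \<union> B)"
    proof
      fix v assume v: "v \<in> W"
      define x where "x = blinfun_inv M0 v"
      define q where "q = (\<Sum>e\<in>E. \<theta> e x *\<^sub>R y e)"
      have "v = M0 x" by (simp add: x_def blinfun_inv_apply[OF M0(2)])
      then have vq: "v - q = K0 x" by (simp add: M0(1) plus_blinfun.rep_eq finrank_apply q_def)
      have "q \<in> W" unfolding q_def by (intro subspace_sum subspace_W subspace_scale y)
      then have "v - q \<in> W" by (rule subspace_diff[OF subspace_W v])
      moreover have "v - q \<in> range (blinfun_apply K0)" unfolding vq by blast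
      ultimately have "v - q \<in> R" unfolding R_def by blast
      then have "v - q \<in> span (y ` E \<union> B)" using B(3) span_mono[of B "y ` E \<union> B"] by auto
      moreover have "q \<in> span (y ` E \<union> B)" unfolding q_def by (intro span_sum span_scale span_base) auto
      ultimately have "(v - q) + q \<in> span (y ` E \<union> B)" by (rule span_add)
      then show "v \<in> span (y ` E \<union> B)" by simp
    qed
  qed
  define G where "G b = (if b \<in> B then 1 else h (the_inv_into E y b))" for b
  have Gy: "G (y e) = h e" if "e \<in> E" for e using that disj by (auto simp: G_def the_inv_into_f_f[OF injy])
  have GB: "G b = 1" and BR2: "b \<in> range (blinfun_apply K0)" if "b \<in> B" for b
    using that BR[OF that] by (simp_all add: G_def R_def)
  have h0: "h e \<noteq> 0" "sgn (h e) = sgn (g e)" if "e \<in> E" for e using g[OF that] by (auto simp: h_def sgn_divide)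
  have "real_of_int (\<delta> A) = (\<Prod>b\<in>y ` E \<union> B. sgn (G b))"
  proof (rule \<delta>_eigenset[OF linA _ ind sp])
    show "finite (y ` E \<union> B)" using fE B(1) by simp
    show "A b = G b *\<^sub>R b" if "b \<in> y ` E \<union> B" for b
      using that eigR[OF BR2] by (auto simp: eigE Gy GB)
    show "G b \<noteq> 0" if "b \<in> y ` E \<union> B" for b using that by (auto simp: Gy GB h0)
  qed
  also have "\<dots> = (\<Prod>b\<in>y ` E. sgn (G b)) * (\<Prod>b\<in>B. sgn (G b))"
    by (rule prod.union_disjoint) (use fE B(1) disj in auto)
  also have "(\<Prod>b\<in>B. sgn (G b)) = 1" by (simp add: G_def)
  also have "(\<Prod>b\<in>y ` E. sgn (G b)) = (\<Prod>e\<in>E. sgn (g e))" by (simp add: prod.reindex[OF injy] Gy h0)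
  finally show ?thesis unfolding \<rho>_def Aeq by simp
qed

section \<open>Multiplicity and parity\<close>

text \<open>\<open>mu\<close> is the sum of the exponents of a local factorization of \<open>L\<close> at \<open>l0\<close>, and \<open>Ys\<close> spans the range of a
  perturbation that makes \<open>L l0\<close> invertible.\<close>

definition localdata :: "(real \<Rightarrow> 'a::banach \<Rightarrow>\<^sub>L 'b::banach) \<Rightarrow> real \<Rightarrow> nat \<Rightarrow> 'b set \<Rightarrow> bool" where
  "localdata L l0 mu Ys \<longleftrightarrow> (\<exists>\<Phi> E \<theta> \<kappa> M r y. operator_polynomial \<Phi> \<and> \<Phi> l0 = id_blinfun \<and> dual_on E \<theta> \<and> independent E \<and>
     (\<forall>e\<in>E. 1 \<le> \<kappa> e) \<and> r > 0 \<and> continuous_on (ball l0 r) M \<and> M l0 = L l0 + finrank E \<theta> y \<and> M l0 \<in> GL \<and>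
     (\<forall>s\<in>ball l0 r. \<forall>x. L s (\<Phi> s x) = M s (Dg E \<theta> (\<lambda>e. (s - l0) ^ \<kappa> e) x)) \<and>
     (\<forall>e\<in>E. L l0 e = 0) \<and> mu = (\<Sum>e\<in>E. \<kappa> e) \<and> Ys = y ` E)"

text \<open>A constructed transversalization shows that the choice in \<open>chi\<close> has a
  candidate; the factorization is then taken for the order and the polynomial behind the chosen
  value.\<close>

lemma localdata_exists:
  fixes L :: "real \<Rightarrow> 'a::banach \<Rightarrow>\<^sub>L 'b::banach"
  assumes L: "an l0 L" and F: "d > 0" "\<And>s. s \<in> ball l0 d \<Longrightarrow> L s \<in> Fredholm0" and nG: "L l0 \<notin> GL"
    and e: "e > 0" "\<And>s. 0 < \<bar>s - l0\<bar> \<Longrightarrow> \<bar>s - l0\<bar> < e \<Longrightarrow> L s \<in> GL \<and> norm (blinfun_inv (L s)) \<le> C / \<bar>s - l0\<bar> ^ n" and C: "C > 0"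
  shows "\<exists>Ys. finite Ys \<and> localdata L l0 (chi L l0) Ys"
proof -
  have F0: "L l0 \<in> Fredholm0" using F by simp
  obtain k0 \<Phi>0 where k0: "1 \<le> k0" "transversalizes \<Phi>0 L l0 k0" using transversalizes_exists[OF L F0 nG e C] by blast
  have "algebraic_point L l0 k0" by (rule algebraic_point_of_transversalizes[OF L F nG k0(2,1)])
  then have "\<exists>n k \<Phi>. algebraic_point L l0 k \<and> transversalizes \<Phi> L l0 k \<and> n = chi_transversal (\<lambda>l. L l o\<^sub>L \<Phi> l) l0 k"
    using k0 by blast
  from someI_ex[OF this] have "\<exists>k \<Phi>. algebraic_point L l0 k \<and> transversalizes \<Phi> L l0 k \<and> chi L l0 = chi_transversal (\<lambda>l. L l o\<^sub>L \<Phi> l) l0 k"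
    using nG by (simp add: chi_def)
  then obtain k \<Phi> where k: "algebraic_point L l0 k" "transversalizes \<Phi> L l0 k" "chi L l0 = chi_transversal (\<lambda>l. L l o\<^sub>L \<Phi> l) l0 k" by blast
  have k1: "1 \<le> k" using k(1) by (simp add: algebraic_point_def)
  obtain E \<theta> \<kappa> M r y where E: "dual_on E \<theta>" "independent E" "\<And>e. e \<in> E \<Longrightarrow> 1 \<le> \<kappa> e \<and> \<kappa> e \<le> k" "\<exists>e\<in>E. \<kappa> e = k"
    "r > 0" "continuous_on (ball l0 r) M" "M l0 = L l0 + finrank E \<theta> y" "M l0 \<in> GL"
    "\<And>s x. s \<in> ball l0 r \<Longrightarrow> L s (\<Phi> s x) = M s (Dg E \<theta> (\<lambda>e. (s - l0) ^ \<kappa> e) x)"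
    "\<And>e. e \<in> E \<Longrightarrow> L l0 e = 0" "chi_transversal (\<lambda>s. L s o\<^sub>L \<Phi> s) l0 k = (\<Sum>e\<in>E. \<kappa> e)"
    by (rule transversalizes_normal_form[OF L F0 k(2) k1]) blast
  have "localdata L l0 (chi L l0) (y ` E)"
    unfolding localdata_def
    by (rule exI[of _ \<Phi>], rule exI[of _ E], rule exI[of _ \<theta>], rule exI[of _ \<kappa>], rule exI[of _ M], rule exI[of _ r], rule exI[of _ y])
       (use E k(2,3) in \<open>auto simp: transversalizes_def\<close>)
  moreover have "finite (y ` E)" using E(1) by (simp add: dual_on_def)
  ultimately show ?thesis by blast
qed

lemma lift_on_subset: "lift_on a b W L T \<Longrightarrow> a \<le> a' \<Longrightarrow> b' \<le> b \<Longrightarrow> lift_on a' b' W L T"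
  unfolding lift_on_def by (auto intro: continuous_on_subset)

text \<open>Near \<open>l0\<close> the given lift is exchanged for the constant perturbation
  \<open>Y1\<close>, and the factors of the factorization are frozen at \<open>l0\<close>. This
  yields the product of the signs of \<open>t^\<kappa>\<close>, which is 1 on the right and
  \<open>(-1)^mu\<close> on the left.\<close>

lemma (in wsysB) local_parity:
  fixes L :: "real \<Rightarrow> 'a::banach \<Rightarrow>\<^sub>L 'b"
  assumes ld: "localdata L l0 mu Ys" and YW: "Ys \<subseteq> W" and Lc: "continuous_on {a..b} L" and l0: "a < l0" "l0 < b" and T: "lift_on a b W L T"
  shows "\<exists>\<epsilon>>0. \<forall>t. 0 < t \<and> t < \<epsilon> \<longrightarrow> a < l0 - t \<and> l0 + t < b \<and> L (l0 - t) \<in> GL \<and> L (l0 + t) \<in> GL \<and>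
     real_of_int (\<rho> (L (l0 - t)) (T (l0 - t)) * \<rho> (L (l0 + t)) (T (l0 + t))) = (-1) ^ mu"
proof -
  obtain \<Phi> E \<theta> \<kappa> M r y where \<Phi>: "operator_polynomial \<Phi>" "\<Phi> l0 = id_blinfun" and E: "dual_on E \<theta>" "independent E"
    and \<kappa>: "\<forall>e\<in>E. 1 \<le> \<kappa> e" and r: "r > 0" and Mc: "continuous_on (ball l0 r) M" and M0: "M l0 = L l0 + finrank E \<theta> y" "M l0 \<in> GL"
    and fac: "\<forall>s\<in>ball l0 r. \<forall>x. L s (\<Phi> s x) = M s (Dg E \<theta> (\<lambda>e. (s - l0) ^ \<kappa> e) x)"
    and K0: "\<forall>e\<in>E. L l0 e = 0" and mu: "mu = (\<Sum>e\<in>E. \<kappa> e)" and Ys: "Ys = y ` E"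
    using ld unfolding localdata_def by (elim exE conjE)
  have fE: "finite E" using E(1) by (simp add: dual_on_def)
  have yW: "y e \<in> W" if "e \<in> E" for e using YW Ys that by blast
  define Y1 where "Y1 = finrank E \<theta> y"
  have Y1W: "Y1 x \<in> W" for x unfolding Y1_def finrank_apply by (intro subspace_sum subspace_W subspace_scale yW)
  have c\<Phi>: "continuous_on UNIV \<Phi>"
    using an_continuous[OF an_poly[OF \<Phi>(1)]] by (simp add: continuous_at_imp_continuous_on)
  have \<Phi>0: "\<Phi> l0 \<in> GL" using \<Phi>(2) GL_id by simp
  have c1: "continuous (at l0) \<Phi>" using c\<Phi> by (simp add: continuous_on_eq_continuous_at)
  have c2: "continuous (at l0) M" using Mc r by (simp add: continuous_on_eq_continuous_at)
  obtain ea where ea': "ea > 0" "\<forall>s. \<bar>s - l0\<bar> < ea \<longrightarrow> \<Phi> s \<in> GL" using isCont_open[OF c1 open_GL \<Phi>0] by (elim exE conjE)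
  obtain eb where eb': "eb > 0" "\<forall>s. \<bar>s - l0\<bar> < eb \<longrightarrow> M s \<in> GL" using isCont_open[OF c2 open_GL M0(2)] by (elim exE conjE)
  have ea: "ea > 0" "\<And>s. \<bar>s - l0\<bar> < ea \<Longrightarrow> \<Phi> s \<in> GL" "eb > 0" "\<And>s. \<bar>s - l0\<bar> < eb \<Longrightarrow> M s \<in> GL"
    using ea' eb' by simp_all
  define e1 where "e1 = min r (min ea eb)"
  have e1: "e1 > 0" using ea r by (simp add: e1_def)
  have G: "\<Phi> (l0 + p) \<in> GL" "M (l0 + p) \<in> GL" "l0 + p \<in> ball l0 r" if "\<bar>p\<bar> < e1" for p
    using that ea(2)[of "l0 + p"] ea(4)[of "l0 + p"] by (auto simp: e1_def dist_real_def)
  define Gf where "Gf z = (M (l0 + fst z) o\<^sub>L Dg E \<theta> (\<lambda>e. snd z ^ \<kappa> e)) o\<^sub>L blinfun_inv (\<Phi> (l0 + fst z))" for z :: "real \<times> real"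
  have cG: "continuous_on (ball 0 e1 \<times> UNIV) Gf" unfolding Gf_def Dg_def
  proof (intro continuous_intros continuous_on_finrank)
    show "continuous_on (ball 0 e1 \<times> UNIV) (\<lambda>z. M (l0 + fst z))"
      by (rule continuous_on_compose2[OF Mc]) (use G(3) in \<open>auto intro!: continuous_intros simp: dist_real_def\<close>)
    show "continuous_on (ball 0 e1 \<times> UNIV) (\<lambda>z. \<Phi> (l0 + fst z))"
      by (rule continuous_on_compose2[OF c\<Phi>]) (auto intro!: continuous_intros)
    show "\<Phi> (l0 + fst z) \<in> GL" if "z \<in> ball 0 e1 \<times> UNIV" for z using G(1)[of "fst z"] that by (auto simp: dist_real_def)
  qed
  have T00: "Gf (0, 0) + Y1 = M l0"
  proof (rule blinfun_eqI)
    fix x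
    have z: "(\<lambda>e. (0::real) ^ \<kappa> e) e = 0" if "e \<in> E" for e using \<kappa> that by (fastforce simp: power_0_left)
    define P where "P = Dg E \<theta> (\<lambda>e. 0 ^ \<kappa> e)"
    have "\<theta> e (P x) = 0" if "e \<in> E" for e using \<theta>_Dg[OF E(1) that, of "\<lambda>e. 0 ^ \<kappa> e" x] z[OF that] by (simp add: P_def)
    then have "finrank E \<theta> y (P x) = 0" by (simp add: finrank_apply)
    moreover have "L l0 (P x) = L l0 x" unfolding P_def Dg_apply
      using K0 by (simp add: blinfun.add_right blinfun.sum_right blinfun.scaleR_right blinfun.minus_right)
    ultimately show "(Gf (0, 0) + Y1) x = M l0 x"
      by (simp add: Gf_def \<Phi>(2) GL_id(2) M0(1) plus_blinfun.rep_eq Y1_def P_def)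
  qed
  have "continuous_on (ball 0 e1 \<times> UNIV) (\<lambda>z. Gf z + Y1)" by (intro continuous_intros cG)
  from continuous_on_open_nbhd[OF this open_GL, of "(0, 0)"] T00 M0(2) e1
  obtain d where d: "d > 0" "\<And>z. z \<in> ball 0 e1 \<times> UNIV \<Longrightarrow> dist z (0, 0) < d \<Longrightarrow> Gf z + Y1 \<in> GL" by auto
  \<comment> \<open>\<open>d / 2\<close> controls the distance in the plane by its two coordinates;
    the bound 1 gives \<open>\<bar>t ^ \<kappa> e\<bar> < 1\<close>, so the entries
    \<open>1 + t^\<kappa>\<close> are positive.\<close>
  define \<epsilon> where "\<epsilon> = min (min 1 e1) (min (d / 2) (min (l0 - a) (b - l0)))"
  have \<epsilon>: "\<epsilon> > 0" using e1 d(1) l0 by (simp add: \<epsilon>_def)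
  have TG: "Gf (p, q) + Y1 \<in> GL" if "\<bar>p\<bar> < \<epsilon>" "\<bar>q\<bar> < \<epsilon>" for p q
  proof (rule d(2))
    show "(p, q) \<in> ball 0 e1 \<times> UNIV" using that by (auto simp: \<epsilon>_def dist_real_def)
    have "dist (p, q) (0, 0) \<le> \<bar>p\<bar> + \<bar>q\<bar>" using norm_Pair_le[of p q] by (simp add: dist_norm)
    then show "dist (p, q) (0, 0) < d" using that by (auto simp: \<epsilon>_def)
  qed
  have GG: "Gf (p, q) \<in> GL" if "\<bar>p\<bar> < \<epsilon>" "q \<noteq> 0" for p q
    unfolding Gf_def fst_conv snd_conv
    by (intro GL_compose(1) GL_inv(1) Dg_GL(1)[OF E(1)] G) (use that in \<open>auto simp: \<epsilon>_def\<close>)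
  have Gdiag: "Gf (q, q) = L (l0 + q)" if "\<bar>q\<bar> < \<epsilon>" for q
  proof (rule blinfun_eqI)
    fix v
    have q: "\<bar>q\<bar> < e1" using that by (simp add: \<epsilon>_def)
    have "L (l0 + q) (\<Phi> (l0 + q) (blinfun_inv (\<Phi> (l0 + q)) v)) = M (l0 + q) (Dg E \<theta> (\<lambda>e. (l0 + q - l0) ^ \<kappa> e) (blinfun_inv (\<Phi> (l0 + q)) v))"
      using fac G(3)[OF q] by blast
    then show "Gf (q, q) v = L (l0 + q) v" by (simp add: Gf_def blinfun_inv_apply(2)[OF G(1)[OF q]])
  qed
  have sgn1: "real_of_int (\<rho> (L (l0 + t)) (L (l0 + t) + Y1)) = (\<Prod>e\<in>E. sgn (t ^ \<kappa> e))" if t: "\<bar>t\<bar> < \<epsilon>" "t \<noteq> 0" for t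
  proof -
    have st: "\<bar>s * t\<bar> < \<epsilon>" if "s \<in> {0..1}" for s
    proof -
      have "\<bar>s * t\<bar> \<le> \<bar>t\<bar>" using that by (auto simp: abs_mult mult_left_le_one_le)
      then show ?thesis using t by simp
    qed
    have cS: "continuous_on {0..1} (\<lambda>s. Gf (s * t, t))"
      by (rule continuous_on_compose2[OF cG]) (use st in \<open>auto intro!: continuous_intros simp: dist_real_def \<epsilon>_def\<close>)
    have "\<rho> (Gf (0 * t, t)) (Gf (0 * t, t) + Y1) = \<rho> (Gf (1 * t, t)) (Gf (1 * t, t) + Y1)"
    proof (rule \<rho>_path[where S="\<lambda>s. Gf (s * t, t)" and T="\<lambda>s. Gf (s * t, t) + Y1"])
      show "Wclose (Gf (s * t, t)) (Gf (s * t, t) + Y1)" if "s \<in> {0..1}" for s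
        unfolding Wclose_def using GG[OF st[OF that] t(2)] TG[OF st[OF that] t(1)] Y1W by (simp add: plus_blinfun.rep_eq)
    qed (use cS in \<open>auto intro!: continuous_intros\<close>)
    then have "\<rho> (L (l0 + t)) (L (l0 + t) + Y1) = \<rho> (Gf (0, t)) (Gf (0, t) + Y1)" using Gdiag[OF t(1)] by simp
    moreover have "Gf (0, t) = M l0 o\<^sub>L Dg E \<theta> (\<lambda>e. t ^ \<kappa> e)" by (rule blinfun_eqI) (simp add: Gf_def \<Phi>(2) GL_id(2))
    moreover have "real_of_int (\<rho> (M l0 o\<^sub>L Dg E \<theta> (\<lambda>e. t ^ \<kappa> e)) ((M l0 o\<^sub>L Dg E \<theta> (\<lambda>e. t ^ \<kappa> e)) + finrank E \<theta> y)) = (\<Prod>e\<in>E. sgn (t ^ \<kappa> e))"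
    proof (rule local_model_sign[OF E _ M0 yW])
      show "L l0 e = 0" if "e \<in> E" for e using K0 that by blast
      show "t ^ \<kappa> e \<noteq> 0" for e using t(2) by simp
      show "1 + t ^ \<kappa> e > 0" if "e \<in> E" for e
      proof -
        have "\<bar>t ^ \<kappa> e\<bar> \<le> \<bar>t\<bar> ^ 1" unfolding power_abs using \<kappa> that t(1) by (intro power_decreasing) (auto simp: \<epsilon>_def)
        then show ?thesis using t(1) by (auto simp: \<epsilon>_def)
      qed
    qed
    ultimately show ?thesis by (simp add: Y1_def)
  qed
  have "a < l0 - t \<and> l0 + t < b \<and> L (l0 - t) \<in> GL \<and> L (l0 + t) \<in> GL \<and>
     real_of_int (\<rho> (L (l0 - t)) (T (l0 - t)) * \<rho> (L (l0 + t)) (T (l0 + t))) = (-1) ^ mu" if t: "0 < t \<and> t < \<epsilon>" for t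
  proof -
    have ab: "a < l0 - t" "l0 + t < b" using t by (auto simp: \<epsilon>_def)
    have LG: "L (l0 - t) \<in> GL" "L (l0 + t) \<in> GL" using GG[of "- t" "- t"] GG[of t t] Gdiag[of "- t"] Gdiag[of t] t by auto
    have lT: "lift_on (l0 - t) (l0 + t) W L T" by (rule lift_on_subset[OF T]) (use ab in auto)
    have lY: "lift_on (l0 - t) (l0 + t) W L (\<lambda>s. L s + Y1)"
      unfolding lift_on_def
    proof (intro conjI ballI)
      show "continuous_on {l0 - t..l0 + t} (\<lambda>s. L s + Y1)"
        by (intro continuous_intros continuous_on_subset[OF Lc]) (use ab in auto)
      show "L s + Y1 \<in> GL" if "s \<in> {l0 - t..l0 + t}" for s
        using TG[of "s - l0" "s - l0"] Gdiag[of "s - l0"] that t by auto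
      show "range (blinfun_apply (L s + Y1 - L s)) \<subseteq> W" for s using Y1W by auto
    qed
    have "par (l0 - t) (l0 + t) L T = par (l0 - t) (l0 + t) L (\<lambda>s. L s + Y1)"
      by (rule par_indep[OF lT lY LG]) (use t in simp)
    then have "real_of_int (\<rho> (L (l0 - t)) (T (l0 - t)) * \<rho> (L (l0 + t)) (T (l0 + t))) = (\<Prod>e\<in>E. sgn ((- t) ^ \<kappa> e)) * (\<Prod>e\<in>E. sgn (t ^ \<kappa> e))"
      using sgn1[of "- t"] sgn1[of t] t by (simp add: par_def)
    also have "(\<Prod>e\<in>E. sgn (t ^ \<kappa> e)) = 1" using t by (intro prod.neutral) simp
    also have "(\<Prod>e\<in>E. sgn ((- t) ^ \<kappa> e)) * 1 = (\<Prod>e\<in>E. (-1) ^ \<kappa> e)"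
    proof -
      have "sgn ((- t) ^ k) = (-1) ^ k" for k :: nat using t by (cases "even k") (simp_all add: sgn_minus)
      then show ?thesis by simp
    qed
    also have "\<dots> = (-1) ^ mu" unfolding mu by (simp add: power_sum)
    finally show ?thesis using ab LG by simp
  qed
  then show ?thesis using \<epsilon> by blast
qed

text \<open>The sign is constant between singular points and jumps by the local parity at each; the
  leftmost singular point is split off, with induction on their number.\<close>

lemma (in wsysB) parity_count:
  fixes L :: "real \<Rightarrow> 'a::banach \<Rightarrow>\<^sub>L 'b"
  assumes Lc: "continuous_on {a..b} L" and T: "lift_on a b W L T" and fin: "finite (singular_set {a..b} L)"
    and ld: "\<And>l. l \<in> singular_set {a..b} L \<Longrightarrow> \<exists>Ys. Ys \<subseteq> W \<and> localdata L l (mu l) Ys"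
    and xy: "a \<le> x" "x \<le> y" "y \<le> b" "L x \<in> GL" "L y \<in> GL"
  shows "real_of_int (\<rho> (L x) (T x) * \<rho> (L y) (T y)) = (-1) ^ (\<Sum>l\<in>singular_set {x..y} L. mu l)"
  using xy
proof (induction "card (singular_set {x..y} L)" arbitrary: x rule: less_induct)
  case (less x)
  have sub: "singular_set {u..v} L \<subseteq> singular_set {a..b} L" if "a \<le> u" "v \<le> b" for u v using that by (auto simp: singular_set_def)
  have fxy: "finite (singular_set {x..y} L)" by (rule finite_subset[OF sub fin]) (use less.prems in auto)
  have cl: "Wclose (L s) (T s)" if "s \<in> {a..b}" "L s \<in> GL" for s by (rule Wclose_lift[OF T that])
  have sq: "\<rho> (L s) (T s) * \<rho> (L s) (T s) = 1" if "s \<in> {a..b}" "L s \<in> GL" for s using \<rho>_cases[OF cl[OF that]] by auto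
  have const: "\<rho> (L u) (T u) = \<rho> (L v) (T v)" if uv: "a \<le> u" "u \<le> v" "v \<le> b" and n: "singular_set {u..v} L = {}" for u v
  proof (rule \<rho>_path[OF uv(2)])
    show "continuous_on {u..v} L" "continuous_on {u..v} T"
      using Lc T uv by (auto simp: lift_on_def intro: continuous_on_subset)
    show "Wclose (L s) (T s)" if "s \<in> {u..v}" for s
      by (rule cl) (use that uv n in \<open>auto simp: singular_set_def\<close>)
  qed
  show ?case
  proof (cases "singular_set {x..y} L = {}")
    case True
    then show ?thesis using const[of x y] less.prems sq[of y] by simp
  next
    case False
    define l where "l = Min (singular_set {x..y} L)"
    have l: "l \<in> singular_set {x..y} L" unfolding l_def by (rule Min_in[OF fxy False])
    have lmin: "l \<le> l'" if "l' \<in> singular_set {x..y} L" for l' unfolding l_def by (rule Min_le[OF fxy that])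
    have lxy: "x < l" "l < y" using l less.prems by (auto simp: singular_set_def less_le)
    obtain Ys where Ys: "Ys \<subseteq> W" "localdata L l (mu l) Ys" using ld[of l] sub[of x y] l less.prems by blast
    have al: "a < l" "l < b" using lxy less.prems by linarith+
    from local_parity[OF Ys(2,1) Lc al T]
    obtain \<epsilon> where \<epsilon>: "\<epsilon> > 0" "\<And>t. 0 < t \<and> t < \<epsilon> \<Longrightarrow> L (l - t) \<in> GL \<and> L (l + t) \<in> GL \<and>
       real_of_int (\<rho> (L (l - t)) (T (l - t)) * \<rho> (L (l + t)) (T (l + t))) = (-1) ^ mu l"
      by blast
    \<comment> \<open>Halved distances keep \<open>l - t\<close> and \<open>l + t\<close> in
      \<open>[x, y]\<close> and \<open>t\<close> below \<open>\<epsilon>\<close>. The punctured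
      \<open>\<epsilon>\<close>-neighbourhood is regular, so \<open>l\<close> is the only singular
      point passed.\<close>
    define t where "t = min (\<epsilon> / 2) (min ((l - x) / 2) ((y - l) / 2))"
    have t: "0 < t" "t < \<epsilon>" "x \<le> l - t" "l + t \<le> y" using \<epsilon>(1) lxy by (auto simp: t_def min_def field_simps)
    note jump = \<epsilon>(2)[of t]
    have nos: "singular_set {x..l - t} L = {}"
      using lmin t by (force simp: singular_set_def)
    have mid: "singular_set {x..y} L = insert l (singular_set {l + t..y} L)"
    proof -
      have "s = l" if s: "s \<in> {x..y}" "L s \<notin> GL" "s < l + t" for s
      proof (rule ccontr)
        assume "s \<noteq> l"
        moreover have "l \<le> s" using lmin[of s] s by (simp add: singular_set_def)
        ultimately have "0 < s - l \<and> s - l < \<epsilon>" using s t by simp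
        from \<epsilon>(2)[OF this] show False using s by simp
      qed
      then show ?thesis using l t lxy by (force simp: singular_set_def)
    qed
    have lnot: "l \<notin> singular_set {l + t..y} L" using t by (auto simp: singular_set_def)
    have f2: "finite (singular_set {l + t..y} L)" using fxy mid by simp
    have "card (singular_set {l + t..y} L) < card (singular_set {x..y} L)" unfolding mid using lnot f2 by simp
    then have IH: "real_of_int (\<rho> (L (l + t)) (T (l + t)) * \<rho> (L y) (T y)) = (-1) ^ (\<Sum>l\<in>singular_set {l + t..y} L. mu l)"
      by (rule less.hyps) (use jump t less.prems lxy in auto)
    have c1: "\<rho> (L x) (T x) = \<rho> (L (l - t)) (T (l - t))" by (rule const) (use less.prems t lxy nos in auto)
    have s1: "\<rho> (L (l + t)) (T (l + t)) * \<rho> (L (l + t)) (T (l + t)) = 1" by (rule sq) (use jump t less.prems lxy in auto)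
    have "\<rho> (L x) (T x) * \<rho> (L y) (T y) = (\<rho> (L (l - t)) (T (l - t)) * \<rho> (L (l + t)) (T (l + t))) * (\<rho> (L (l + t)) (T (l + t)) * \<rho> (L y) (T y))"
      using s1 by (simp add: c1 algebra_simps)
    then have "real_of_int (\<rho> (L x) (T x) * \<rho> (L y) (T y)) = (-1) ^ mu l * (-1) ^ (\<Sum>l\<in>singular_set {l + t..y} L. mu l)"
      using jump t IH by (metis of_int_mult)
    also have "\<dots> = (-1) ^ (\<Sum>l\<in>singular_set {x..y} L. mu l)" unfolding mid using lnot f2 by (simp add: power_add)
    finally show ?thesis .
  qed
qed

lemma real_analytic_on_an:
  fixes L :: "real \<Rightarrow> 'a::banach"
  assumes "real_analytic_on {a..b} L" "a < l" "l < b" shows "an l L"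
proof -
  obtain r c where r: "r > 0" "\<And>s. s \<in> {a..b} \<Longrightarrow> \<bar>s - l\<bar> < r \<Longrightarrow> (\<lambda>n. (s - l) ^ n *\<^sub>R c n) sums L s"
    using assms unfolding real_analytic_on_def by (metis atLeastAtMost_iff less_imp_le)
  have "pser l c L (min r (min (l - a) (b - l)))"
    unfolding pser_def
  proof (intro conjI allI impI)
    show "min r (min (l - a) (b - l)) > 0" using r(1) assms by simp
    fix s assume s: "\<bar>s - l\<bar> < min r (min (l - a) (b - l))"
    show "(\<lambda>n. (s - l) ^ n *\<^sub>R c n) sums L s"
    proof (rule r(2))
      have "\<bar>s - l\<bar> < l - a" "\<bar>s - l\<bar> < b - l" using s by simp_all
      then have "a \<le> s" "s \<le> b" unfolding abs_less_iff by linarith+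
      then show "s \<in> {a..b}" by simp
    qed (use s in simp)
  qed
  then show ?thesis by (auto simp: an_def)
qed

text \<open>Analytic dichotomy and connectedness exclude an interval of singular points; singular
  points are then isolated, hence finitely many by compactness.\<close>

lemma analytic_admissible_singular:
  fixes L :: "real \<Rightarrow> 'a::banach \<Rightarrow>\<^sub>L 'b::banach"
  assumes ra: "real_analytic_on {a..b} L" and ad: "admissible a b L" and ab: "a < b"
  shows "finite (singular_set {a..b} L)"
    "\<And>l. l \<in> singular_set {a..b} L \<Longrightarrow> \<exists>Ys. finite Ys \<and> localdata L l (chi L l) Ys"
proof -
  have Lc: "continuous_on {a..b} L" and F: "\<And>l. l \<in> {a..b} \<Longrightarrow> L l \<in> Fredholm0" and ends: "L a \<in> GL" "L b \<in> GL"
    using ad by (auto simp: admissible_def)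
  \<comment> \<open>Open by definition and closed by the dichotomy; since \<open>a\<close> is
    regular, this set is empty.\<close>
  define Bad where "Bad = {l \<in> {a..b}. \<exists>e>0. \<forall>s\<in>{a..b}. \<bar>s - l\<bar> < e \<longrightarrow> L s \<notin> GL}"
  have nbhd: "\<exists>e>0. \<forall>s\<in>{a..b}. \<bar>s - l\<bar> < e \<longrightarrow> L s \<in> GL" if "l \<in> {a..b}" "L l \<in> GL" for l
    using continuous_on_open_nbhd[OF Lc open_GL that] by (simp add: dist_real_def)
  have int: "a < l \<and> l < b" if "l \<in> {a..b}" "L l \<notin> GL" for l using that ends by (auto simp: less_le)
  have dich: "\<exists>e>0. \<forall>s\<in>{a..b}. 0 < \<bar>s - l\<bar> \<and> \<bar>s - l\<bar> < e \<longrightarrow> L s \<in> GL" if l: "l \<in> {a..b}" "l \<notin> Bad" for l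
  proof (cases "L l \<in> GL")
    case True then show ?thesis using nbhd[OF l(1)] by blast
  next
    case False
    then have i: "a < l" "l < b" using int[OF l(1)] by auto
    from GL_dichotomy[OF real_analytic_on_an[OF ra i] F[OF l(1)]] show ?thesis
    proof
      assume "\<exists>e>0. \<forall>s. \<bar>s - l\<bar> < e \<longrightarrow> L s \<notin> GL"
      then have "l \<in> Bad" using l(1) unfolding Bad_def by blast
      then show ?thesis using l(2) by simp
    qed blast
  qed
  have "openin (top_of_set {a..b}) Bad" unfolding openin_euclidean_subtopology_iff
  proof (intro conjI ballI)
    show "Bad \<subseteq> {a..b}" by (auto simp: Bad_def)
    fix l assume "l \<in> Bad"
    then obtain e where e: "e > 0" "\<And>s. s \<in> {a..b} \<Longrightarrow> \<bar>s - l\<bar> < e \<Longrightarrow> L s \<notin> GL" unfolding Bad_def by blast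
    have "x \<in> Bad" if x: "x \<in> {a..b}" "dist x l < e / 2" for x
    proof -
      have "L s \<notin> GL" if s: "s \<in> {a..b}" "\<bar>s - x\<bar> < e / 2" for s
      proof (rule e(2)[OF s(1)])
        show "\<bar>s - l\<bar> < e" using s(2) x(2) unfolding dist_real_def by arith
      qed
      then have "\<forall>s\<in>{a..b}. \<bar>s - x\<bar> < e / 2 \<longrightarrow> L s \<notin> GL" by blast
      then show ?thesis using x(1) e(1) unfolding Bad_def by (auto intro!: exI[of _ "e / 2"])
    qed
    then show "\<exists>e>0. \<forall>x\<in>{a..b}. dist x l < e \<longrightarrow> x \<in> Bad" using e(1) by (intro exI[of _ "e / 2"]) auto
  qed
  moreover have "closedin (top_of_set {a..b}) Bad"
  proof -
    have "openin (top_of_set {a..b}) ({a..b} - Bad)" unfolding openin_euclidean_subtopology_iff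
    proof (intro conjI ballI)
      fix l assume l: "l \<in> {a..b} - Bad"
      then obtain e where e: "e > 0" "\<And>s. s \<in> {a..b} \<Longrightarrow> 0 < \<bar>s - l\<bar> \<Longrightarrow> \<bar>s - l\<bar> < e \<Longrightarrow> L s \<in> GL" using dich by blast
      have "x \<notin> Bad" if x: "x \<in> {a..b}" "dist x l < e" for x
      proof (cases "x = l")
        case True then show ?thesis using l by simp
      next
        case False
        then have "L x \<in> GL" using e(2)[of x] x by (simp add: dist_real_def)
        then show ?thesis using x(1) unfolding Bad_def by force
      qed
      then show "\<exists>e>0. \<forall>x\<in>{a..b}. dist x l < e \<longrightarrow> x \<in> {a..b} - Bad" using e(1) by blast
    qed blast
    moreover have "Bad \<subseteq> {a..b}" by (auto simp: Bad_def)
    ultimately show ?thesis by (simp add: closedin_def)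
  qed
  ultimately have "Bad = {} \<or> Bad = {a..b}" using connected_clopen[of "{a..b}"] connected_Icc by blast
  moreover have "a \<notin> Bad" using ends ab unfolding Bad_def by force
  ultimately have Bad: "Bad = {}" using ab by auto
  show "finite (singular_set {a..b} L)"
  proof -
    have "finite ({a..b} \<inter> {l \<in> {a..b}. L l \<notin> GL})"
    proof (rule finite_not_islimpt_in_compact[OF compact_Icc])
      fix z assume z: "z \<in> {a..b}"
      then obtain e where e: "e > 0" "\<And>s. s \<in> {a..b} \<Longrightarrow> 0 < \<bar>s - z\<bar> \<Longrightarrow> \<bar>s - z\<bar> < e \<Longrightarrow> L s \<in> GL" using dich Bad by blast
      show "\<not> z islimpt {l \<in> {a..b}. L l \<notin> GL}"
      proof
        assume "z islimpt {l \<in> {a..b}. L l \<notin> GL}"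
        then obtain s where "s \<in> {a..b}" "L s \<notin> GL" "s \<noteq> z" "dist s z < e" unfolding islimpt_approachable using e(1) by blast
        then show False using e(2)[of s] by (simp add: dist_real_def)
      qed
    qed
    moreover have "{a..b} \<inter> {l \<in> {a..b}. L l \<notin> GL} = singular_set {a..b} L" unfolding singular_set_def by blast
    ultimately show ?thesis by simp
  qed
  fix l assume "l \<in> singular_set {a..b} L"
  then have l: "l \<in> {a..b}" "L l \<notin> GL" by (auto simp: singular_set_def)
  then have i: "a < l" "l < b" using int by auto
  have an: "an l L" by (rule real_analytic_on_an[OF ra i])
  have "\<not> (\<exists>e>0. \<forall>s. \<bar>s - l\<bar> < e \<longrightarrow> L s \<notin> GL)" using Bad l unfolding Bad_def by blast
  then obtain e n C where e: "e > 0" "C > 0" "\<And>s. 0 < \<bar>s - l\<bar> \<and> \<bar>s - l\<bar> < e \<Longrightarrow> L s \<in> GL \<and> norm (blinfun_inv (L s)) \<le> C / \<bar>s - l\<bar> ^ n"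
    using GL_dichotomy[OF an F[OF l(1)]] by blast
  show "\<exists>Ys. finite Ys \<and> localdata L l (chi L l) Ys"
  proof (rule localdata_exists[OF an _ _ l(2) e(1) _ e(2)])
    show "min (l - a) (b - l) > 0" using i by simp
    show "L s \<in> Fredholm0" if "s \<in> ball l (min (l - a) (b - l))" for s using that by (intro F) (auto simp: dist_real_def)
    show "L s \<in> GL \<and> norm (blinfun_inv (L s)) \<le> C / \<bar>s - l\<bar> ^ n" if "0 < \<bar>s - l\<bar>" "\<bar>s - l\<bar> < e" for s using e(3) that by blast
  qed
qed

lemma odd_parity_lift:
  fixes L L\<omega> :: "real \<Rightarrow> 'a::banach \<Rightarrow>\<^sub>L 'b::banach"
  assumes ab: "a < b" and ra: "real_analytic_on {a..b} L\<omega>" and ad: "admissible a b L\<omega>"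
    and hom: "A_homotopic a b L\<omega> L" and odd: "odd (chi_total L\<omega> a b)"
  shows "\<exists>m w \<phi> T. wsysB m (w :: nat \<Rightarrow> 'b) \<phi> \<and> lift_on a b (wsys.W m w) L T \<and>
    wsysB.\<rho> m w \<phi> (L a) (T a) \<noteq> wsysB.\<rho> m w \<phi> (L b) (T b)"
proof -
  let ?K = "{0..1::real} \<times> {a..b}"
  let ?S = "singular_set {a..b} L\<omega>"
  obtain H where H: "continuous_on ?K H" and HF: "\<forall>t\<in>{0..1}. \<forall>l\<in>{a..b}. H (t, l) \<in> Fredholm0"
    and HG: "\<forall>t\<in>{0..1}. H (t, a) \<in> GL \<and> H (t, b) \<in> GL" and H01: "\<forall>l\<in>{a..b}. H (0, l) = L\<omega> l \<and> H (1, l) = L l"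
    using hom unfolding A_homotopic_def by (elim exE conjE)
  have "\<exists>B Y d. finite B \<and> range (blinfun_apply Y) \<subseteq> span B \<and> d > 0 \<and> (\<forall>z\<in>?K. dist z x < d \<longrightarrow> H z + Y \<in> GL)" if x: "x \<in> ?K" for x
  proof -
    have "H x \<in> Fredholm0" using HF x by (cases x) auto
    then obtain W Y where WY: "fin_dim W" "range (blinfun_apply Y) \<subseteq> W" "H x + Y \<in> GL" using Fredholm0_perturb_GL by blast
    obtain B where B: "finite B" "span B = W" using WY(1) by (auto simp: fin_dim_def)
    have c: "continuous_on ?K (\<lambda>z. H z + Y)" by (intro continuous_intros H)
    from continuous_on_open_nbhd[OF c open_GL x WY(3)]
    obtain d where "d > 0" "\<forall>z\<in>?K. dist z x < d \<longrightarrow> H z + Y \<in> GL" by blast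
    then show ?thesis using B WY(2) by blast
  qed
  then obtain B Y d where BY: "\<And>x. x \<in> ?K \<Longrightarrow> finite (B x) \<and> range (blinfun_apply (Y x)) \<subseteq> span (B x) \<and> d x > 0 \<and> (\<forall>z\<in>?K. dist z x < d x \<longrightarrow> H z + Y x \<in> GL)"
    by metis
  have "?K \<subseteq> (\<Union>x\<in>?K. ball x (d x))" using BY by (meson UN_I centre_in_ball subsetI)
  moreover have "compact ?K" by (intro compact_Times compact_Icc)
  ultimately obtain C where C: "C \<subseteq> ?K" "finite C" "?K \<subseteq> (\<Union>x\<in>C. ball x (d x))"
    by (rule_tac compactE_image[of ?K ?K "\<lambda>x. ball x (d x)"]) auto
  note sing = analytic_admissible_singular[OF ra ad ab]
  obtain Ys where Ys: "\<And>l. l \<in> ?S \<Longrightarrow> finite (Ys l) \<and> localdata L\<omega> l (chi L\<omega> l) (Ys l)" using sing(2) by metis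
  \<comment> \<open>One \<open>W\<close> for everything: perturbations from a finite cover of the
    square make the homotopy liftable, and the sets \<open>Ys\<close> let each local sign be
    computed in the same space.\<close>
  define D where "D = (\<Union>x\<in>C. B x) \<union> (\<Union>l\<in>?S. Ys l)"
  have fD: "finite D" unfolding D_def using C BY Ys sing(1) by (blast intro: finite_UN_I)
  then have "fin_dim (span D)" by (auto simp: fin_dim_def)
  from wsys_exists[OF this] obtain m w \<phi> where ws: "wsys m w \<phi>" "wsys.W m w = span D" by blast
  interpret wsysB m w \<phi> using ws(1) by (simp add: wsysB_def)
  have pert: "\<exists>Y. range (blinfun_apply Y) \<subseteq> W \<and> H (t, l) + Y \<in> GL" if tl: "t \<in> {0..1}" "l \<in> {a..b}" for t l
  proof -
    have z: "(t, l) \<in> ?K" using tl by simp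
    then obtain x where x: "x \<in> C" "(t, l) \<in> ball x (d x)" using C(3) by blast
    have xK: "x \<in> ?K" using x(1) C(1) by blast
    have "span (B x) \<subseteq> W" unfolding ws(2) D_def by (rule span_mono) (use x(1) in blast)
    then have "range (blinfun_apply (Y x)) \<subseteq> W" using BY[OF xK] by blast
    moreover have "H (t, l) + Y x \<in> GL" using BY[OF xK] z x(2) by (simp add: dist_commute)
    ultimately show ?thesis by blast
  qed
  have cH: "continuous_on {a..b} (\<lambda>l. H (t, l))" if "t \<in> {0..1}" for t
    by (rule continuous_on_compose2[OF H]) (use that in \<open>auto intro!: continuous_intros\<close>)
  have le: "a \<le> b" using ab by simp
  have "\<exists>T. lift_on a b W (\<lambda>l. H (t, l)) T" if "t \<in> {0..1}" for t
    by (rule lift_on_exists[OF subspace_W cH[OF that] le pert[OF that]])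
  from this[of 0] this[of 1] obtain T0 T1 where T0: "lift_on a b W (\<lambda>l. H (0, l)) T0" and T1: "lift_on a b W (\<lambda>l. H (1, l)) T1" by auto
  have eq: "par a b (\<lambda>l. H (0, l)) T0 = par a b (\<lambda>l. H (1, l)) T1"
    by (rule par_homotopy[OF H le pert _ _ T0 T1]) (use HG in auto)
  have lift0: "lift_on a b W L\<omega> T0" using T0 H01 by (simp add: lift_on_def)
  have lift1: "lift_on a b W L T1" using T1 H01 by (simp add: lift_on_def)
  have ends: "L\<omega> a \<in> GL" "L\<omega> b \<in> GL" "continuous_on {a..b} L\<omega>" using ad by (auto simp: admissible_def)
  have "real_of_int (\<rho> (L\<omega> a) (T0 a) * \<rho> (L\<omega> b) (T0 b)) = (-1) ^ (\<Sum>l\<in>?S. chi L\<omega> l)"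
  proof (rule parity_count[OF ends(3) lift0 sing(1)])
    show "\<exists>Ys. Ys \<subseteq> W \<and> localdata L\<omega> l (chi L\<omega> l) Ys" if "l \<in> ?S" for l
    proof (intro exI conjI)
      show "Ys l \<subseteq> W" unfolding ws(2) D_def using that by (blast intro: span_base)
      show "localdata L\<omega> l (chi L\<omega> l) (Ys l)" using Ys[OF that] by blast
    qed
  qed (use ends le in auto)
  then have "real_of_int (\<rho> (L\<omega> a) (T0 a) * \<rho> (L\<omega> b) (T0 b)) = -1" using odd by (simp add: chi_total_def)
  then have "\<rho> (L\<omega> a) (T0 a) * \<rho> (L\<omega> b) (T0 b) = -1" by linarith
  then have "\<rho> (L a) (T1 a) * \<rho> (L b) (T1 b) = -1" using eq H01 le by (simp add: par_def)
  moreover have "x * x \<noteq> -1" for x :: int by (metis neg_0_le_iff_le not_one_le_zero zero_le_square)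
  ultimately have "\<rho> (L a) (T1 a) \<noteq> \<rho> (L b) (T1 b)" by metis
  then show ?thesis using lift1 wsysB_axioms by blast
qed

section \<open>Continua of nontrivial solutions\<close>

text \<open>Continuity of the derivative is uniform near the compact segment of trivial solutions;
  the mean value inequality in \<open>u\<close> turns it into a small Lipschitz constant for the
  nonlinear remainder.\<close>

lemma C1_uniform_remainder:
  fixes F :: "real \<times> 'a::banach \<Rightarrow> 'b::banach"
  assumes op: "open \<U>" and nb: "{a..b} \<times> {0} \<subseteq> \<U>" and C1: "C1_on \<U> F"
    and L: "\<And>l. (l, 0) \<in> \<U> \<Longrightarrow> ((\<lambda>u. F (l, u)) has_derivative blinfun_apply (L l)) (at 0)" and e: "\<epsilon> > 0"
  shows "\<exists>r>0. \<forall>l\<in>{a..b}. \<forall>u v. norm u \<le> r \<longrightarrow> norm v \<le> r \<longrightarrow>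
    (l, u) \<in> \<U> \<and> norm ((F (l, u) - L l u) - (F (l, v) - L l v)) \<le> \<epsilon> * norm (u - v)"
proof -
  obtain F' where cF: "continuous_on \<U> F'" and dF: "\<And>x. x \<in> \<U> \<Longrightarrow> (F has_derivative blinfun_apply (F' x)) (at x)"
    using C1 unfolding C1_on_def by blast
  let ?S = "{a..b} \<times> {0::'a}"
  have "\<exists>d>0. ball x d \<subseteq> \<U> \<and> (\<forall>y\<in>ball x d. dist (F' y) (F' x) < \<epsilon> / 2)" if x: "x \<in> ?S" for x
  proof -
    have xU: "x \<in> \<U>" using nb x by blast
    obtain d1 where d1: "d1 > 0" "ball x d1 \<subseteq> \<U>" using op xU open_contains_ball by blast
    obtain d2 where d2: "d2 > 0" "\<And>y. y \<in> \<U> \<Longrightarrow> dist y x < d2 \<Longrightarrow> dist (F' y) (F' x) < \<epsilon> / 2"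
      using cF xU e unfolding continuous_on_iff by (metis half_gt_zero)
    have "\<forall>y\<in>ball x (min d1 d2). dist (F' y) (F' x) < \<epsilon> / 2" using d1(2) d2(2) by (auto simp: dist_commute)
    then show ?thesis using d1 d2(1) by (intro exI[of _ "min d1 d2"]) auto
  qed
  then obtain d where d: "\<And>x. x \<in> ?S \<Longrightarrow> d x > 0 \<and> ball x (d x) \<subseteq> \<U> \<and> (\<forall>y\<in>ball x (d x). dist (F' y) (F' x) < \<epsilon> / 2)" by metis
  have cov: "?S \<subseteq> \<Union>((\<lambda>x. ball x (d x)) ` ?S)" using d by (meson UN_I centre_in_ball subsetI)
  have "compact ?S" by (intro compact_Times) auto
  \<comment> \<open>A Lebesgue number: \<open>(l, u)\<close> and \<open>(l, 0)\<close> lie in a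
    common ball of the cover, so comparison with its centre bounds the change of the
    derivative.\<close>
  from Heine_Borel_lemma[OF this cov] obtain e0 where e0: "e0 > 0" "\<And>x. x \<in> ?S \<Longrightarrow> \<exists>G\<in>(\<lambda>x. ball x (d x)) ` ?S. ball x e0 \<subseteq> G" by blast
  have near: "(l, u) \<in> \<U> \<and> dist (F' (l, u)) (F' (l, 0)) \<le> \<epsilon>" if l: "l \<in> {a..b}" and u: "norm u < e0" for l u
  proof -
    obtain x where x: "x \<in> ?S" "ball (l, 0) e0 \<subseteq> ball x (d x)" using e0(2)[of "(l, 0)"] l by auto
    have "(l, u) \<in> ball (l, 0) e0" using u by (simp add: dist_Pair_Pair)
    moreover have "(l, 0) \<in> ball (l, 0::'a) e0" using e0 by simp
    ultimately have i: "(l, u) \<in> ball x (d x)" "(l, 0) \<in> ball x (d x)" using x(2) by blast+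
    have "dist (F' (l, u)) (F' x) < \<epsilon> / 2" "dist (F' (l, 0)) (F' x) < \<epsilon> / 2" using d[OF x(1)] i by blast+
    then have "dist (F' (l, u)) (F' (l, 0)) < \<epsilon>" by (rule dist_triangle_half_l)
    then show ?thesis using d[OF x(1)] i by auto
  qed
  show ?thesis
  proof (intro exI[of _ "e0 / 2"] conjI ballI allI impI)
    show "e0 / 2 > 0" using e0 by simp
    fix l u v assume l: "l \<in> {a..b}" and u: "norm (u::'a) \<le> e0 / 2" and v: "norm (v::'a) \<le> e0 / 2"
    show "(l, u) \<in> \<U>" using near[OF l, of u] u e0 by simp
    have pd: "((\<lambda>u. F (l, u)) has_derivative (\<lambda>h. F' (l, x) (0, h))) (at x)" if "norm x < e0" for x
    proof -
      have "((\<lambda>u. (l, u)) has_derivative (\<lambda>h. (0, h))) (at x)" by (auto intro!: derivative_eq_intros)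
      from has_derivative_compose[OF this dF] near[OF l that] show ?thesis by simp
    qed
    have Leq: "L l h = F' (l, 0) (0, h)" for h
    proof -
      have "(l, 0) \<in> \<U>" using nb l by auto
      from has_derivative_unique[OF L[OF this] pd[of 0]] e0 show ?thesis by (metis norm_zero)
    qed
    show "norm ((F (l, u) - L l u) - (F (l, v) - L l v)) \<le> \<epsilon> * norm (u - v)"
    proof (rule differentiable_bound[where S="cball 0 (e0 / 2)" and f="\<lambda>u. F (l, u) - L l u" and f'="\<lambda>x h. F' (l, x) (0, h) - L l h"])
      fix x :: 'a assume "x \<in> cball 0 (e0 / 2)"
      then have x: "norm x < e0" using e0 by simp
      have "((\<lambda>u. F (l, u) - L l u) has_derivative (\<lambda>h. F' (l, x) (0, h) - L l h)) (at x)"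
        by (intro has_derivative_diff pd[OF x] bounded_linear_imp_has_derivative blinfun.bounded_linear_right)
      then show "((\<lambda>u. F (l, u) - L l u) has_derivative (\<lambda>h. F' (l, x) (0, h) - L l h)) (at x within cball 0 (e0 / 2))"
        by (rule has_derivative_at_withinI)
      show "onorm (\<lambda>h. F' (l, x) (0, h) - L l h) \<le> \<epsilon>"
      proof (rule onorm_bound)
        fix h
        have "norm (F' (l, x) (0, h) - L l h) = norm ((F' (l, x) - F' (l, 0)) (0, h))" by (simp add: Leq minus_blinfun.rep_eq)
        also have "\<dots> \<le> norm (F' (l, x) - F' (l, 0)) * norm (0::real, h)" by (rule norm_blinfun)
        also have "\<dots> \<le> \<epsilon> * norm h" using near[OF l x] by (simp add: dist_norm norm_Pair mult_right_mono)
        finally show "norm (F' (l, x) (0, h) - L l h) \<le> \<epsilon> * norm h" .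
      qed (use e in simp)
    qed (use u v in auto)
  qed
qed

text \<open>For invertible \<open>L l'\<close> with a uniform bound on the inverse, a solution
  satisfies \<open>norm u \<le> norm u / 2\<close>, so only the trivial one exists nearby.\<close>

lemma regular_point_isolated:
  fixes F :: "real \<times> 'a::banach \<Rightarrow> 'b::banach"
  assumes op: "open \<U>" and nb: "{a..b} \<times> {0} \<subseteq> \<U>" and C1: "C1_on \<U> F"
    and L: "\<And>l. (l, 0) \<in> \<U> \<Longrightarrow> ((\<lambda>u. F (l, u)) has_derivative blinfun_apply (L l)) (at 0)"
    and triv: "\<And>l. (l, 0) \<in> \<U> \<Longrightarrow> F (l, 0) = 0" and Lc: "continuous_on {a..b} L"
    and l: "l \<in> {a..b}" "L l \<in> GL"
  shows "\<exists>d>0. \<forall>l'\<in>{a..b}. \<forall>u. \<bar>l' - l\<bar> < d \<longrightarrow> norm u < d \<longrightarrow> L l' \<in> GL \<and> (F (l', u) = 0 \<longrightarrow> u = 0)"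
proof -
  define N where "N = norm (blinfun_inv (L l)) + 1"
  have N: "N > 0" unfolding N_def by (simp add: add_nonneg_pos)
  \<comment> \<open>The constant serves twice: it keeps \<open>L l'\<close> invertible with inverse
    bounded by \<open>2 N\<close>, and as remainder constant it leaves the factor one half.\<close>
  have e: "1 / (4 * N) > 0" using N by simp
  from C1_uniform_remainder[OF op nb C1 L e]
  obtain r where r: "r > 0" "\<forall>l\<in>{a..b}. \<forall>u v. norm u \<le> r \<longrightarrow> norm v \<le> r \<longrightarrow>
    (l, u) \<in> \<U> \<and> norm ((F (l, u) - L l u) - (F (l, v) - L l v)) \<le> 1 / (4 * N) * norm (u - v)" by blast
  obtain d0 where d0: "d0 > 0" "\<And>l'. l' \<in> {a..b} \<Longrightarrow> dist l' l < d0 \<Longrightarrow> dist (L l') (L l) < 1 / (4 * N)"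
    using Lc l(1) e unfolding continuous_on_iff by metis
  have main: "L l' \<in> GL \<and> (F (l', u) = 0 \<longrightarrow> u = 0)" if l': "l' \<in> {a..b}" "\<bar>l' - l\<bar> < d0" and u: "norm u < r" for l' u
  proof -
    have "norm (L l' - L l) \<le> 1 / (4 * N)" using d0(2)[OF l'(1)] l'(2) by (simp add: dist_norm)
    then have "norm (L l' - L l) * norm (blinfun_inv (L l)) \<le> 1 / (4 * N) * N" by (intro mult_mono) (use N in \<open>auto simp: N_def\<close>)
    also have "\<dots> \<le> 1 / 2" using N by simp
    finally have G: "L l' \<in> GL" "norm (blinfun_inv (L l')) \<le> 2 * norm (blinfun_inv (L l))" using GL_perturb[OF l(2)] by blast+
    have "u = 0" if F0: "F (l', u) = 0"
    proof -
      have "F (l', 0) = 0" by (rule triv) (use nb l'(1) in auto)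
      then have b: "norm (L l' u) \<le> 1 / (4 * N) * norm u"
        using r(2)[rule_format, OF l'(1), of u 0] u r(1) F0 by simp
      have "norm u = norm (blinfun_inv (L l') (L l' u))" by (simp add: blinfun_inv_apply[OF G(1)])
      also have "\<dots> \<le> norm (blinfun_inv (L l')) * norm (L l' u)" by (rule norm_blinfun)
      also have "\<dots> \<le> (2 * N) * (1 / (4 * N) * norm u)" by (intro mult_mono b) (use G(2) N in \<open>auto simp: N_def\<close>)
      also have "\<dots> = norm u / 2" using N by simp
      finally show "u = 0" by simp
    qed
    then show ?thesis using G by blast
  qed
  show ?thesis
    by (rule exI[of _ "min d0 r"]) (use main d0(1) r(1) in auto)
qed

section \<open>Truncation, contractions and compactness\<close>

text \<open>The retraction onto the closed ball of radius \<open>r\<close>. Composing with it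
  extends the remainder to the whole space at the cost of a factor 2 in the Lipschitz
  constant.\<close>

definition radial :: "real \<Rightarrow> 'a::real_normed_vector \<Rightarrow> 'a" where
  "radial r u = (r / max r (norm u)) *\<^sub>R u"

lemma radial_id: "r > 0 \<Longrightarrow> norm u \<le> r \<Longrightarrow> radial r u = u"
  by (simp add: radial_def max_def)

lemma norm_radial: "r > 0 \<Longrightarrow> norm (radial r u) \<le> r"
  by (auto simp: radial_def max_def field_simps)

lemma continuous_radial: "r > 0 \<Longrightarrow> continuous_on X (radial r)"
  unfolding radial_def by (intro continuous_intros) (auto simp: max_def)

lemma radial_lipschitz:
  assumes r: "r > 0" shows "norm (radial r u - radial r v) \<le> 2 * norm (u - v)"
proof -
  define M where "M = max r (norm u)"
  define N where "N = max r (norm v)"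
  have M: "M > 0" "r \<le> M" and N: "N > 0" "norm v \<le> N" using r by (auto simp: M_def N_def)
  have MN: "\<bar>N - M\<bar> \<le> norm (u - v)"
  proof -
    have "\<bar>N - M\<bar> \<le> \<bar>norm u - norm v\<bar>" unfolding M_def N_def max_def by auto
    also have "\<dots> \<le> norm (u - v)" by (rule norm_triangle_ineq3)
    finally show ?thesis .
  qed
  have "radial r u - radial r v = (r / M) *\<^sub>R (u - v) + (r / M - r / N) *\<^sub>R v"
    by (simp add: radial_def M_def N_def algebra_simps)
  then have "norm (radial r u - radial r v) \<le> r / M * norm (u - v) + \<bar>r / M - r / N\<bar> * norm v"
    using norm_triangle_ineq[of "(r / M) *\<^sub>R (u - v)" "(r / M - r / N) *\<^sub>R v"] r M by simp
  moreover have "r / M * norm (u - v) \<le> 1 * norm (u - v)" by (rule mult_right_mono) (use M in auto)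
  moreover have "\<bar>r / M - r / N\<bar> * norm v \<le> norm (u - v)"
  proof -
    have "r / M - r / N = (r / M) * ((N - M) / N)" using M N by (simp add: field_simps)
    then have "\<bar>r / M - r / N\<bar> = (r / M) * (\<bar>N - M\<bar> / N)" using r M N by (simp add: abs_mult)
    also have "\<dots> \<le> 1 * (norm (u - v) / N)" by (intro mult_mono divide_right_mono MN) (use r M N in auto)
    finally have "\<bar>r / M - r / N\<bar> * norm v \<le> norm (u - v) / N * N" by (intro mult_mono) (use N in auto)
    then show ?thesis using N by simp
  qed
  ultimately show ?thesis by simp
qed

text \<open>The distance of two fixed points is at most twice the displacement caused by changing
  the parameter at one of them; 2 comes from \<open>1 / (1 - 1 / 2)\<close>.\<close>

lemma continuous_fixpoint:
  fixes \<Phi> :: "'p::topological_space \<Rightarrow> 'a::real_normed_vector \<Rightarrow> 'a"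
  assumes lip: "\<And>p u v. p \<in> P \<Longrightarrow> norm (\<Phi> p u - \<Phi> p v) \<le> 1 / 2 * norm (u - v)"
    and cont: "\<And>u. continuous_on P (\<lambda>p. \<Phi> p u)" and fp: "\<And>p. p \<in> P \<Longrightarrow> \<Phi> p (S p) = S p"
  shows "continuous_on P S"
  unfolding continuous_on_def
proof
  fix q assume q: "q \<in> P"
  have "norm (S p - S q) \<le> 2 * norm (\<Phi> p (S q) - \<Phi> q (S q))" if p: "p \<in> P" for p
  proof -
    have "S p - S q = (\<Phi> p (S p) - \<Phi> p (S q)) + (\<Phi> p (S q) - \<Phi> q (S q))" using fp p q by simp
    then have "norm (S p - S q) \<le> norm (\<Phi> p (S p) - \<Phi> p (S q)) + norm (\<Phi> p (S q) - \<Phi> q (S q))" by (metis norm_triangle_ineq)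
    then show ?thesis using lip[OF p, of "S p" "S q"] by simp
  qed
  then have "\<forall>\<^sub>F p in at q within P. norm (S p - S q) \<le> 2 * norm (\<Phi> p (S q) - \<Phi> q (S q))"
    by (simp add: eventually_at_filter)
  moreover have "((\<lambda>p. 2 * norm (\<Phi> p (S q) - \<Phi> q (S q))) \<longlongrightarrow> 0) (at q within P)"
  proof -
    have "((\<lambda>p. \<Phi> p (S q)) \<longlongrightarrow> \<Phi> q (S q)) (at q within P)" using cont[of "S q"] q by (simp add: continuous_on_def)
    then have "((\<lambda>p. 2 * norm (\<Phi> p (S q) - \<Phi> q (S q))) \<longlongrightarrow> 2 * norm (\<Phi> q (S q) - \<Phi> q (S q))) (at q within P)"
      by (intro tendsto_intros)
    then show ?thesis by simp
  qed
  ultimately have "((\<lambda>p. S p - S q) \<longlongrightarrow> 0) (at q within P)" by (rule Lim_null_comparison)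
  then show "(S \<longlongrightarrow> S q) (at q within P)" by (rule LIM_zero_cancel)
qed

text \<open>Whyburn's lemma: in a compact Hausdorff space, closed sets that no connected set joins
  can be separated by a clopen partition.\<close>

lemma compact_separation:
  fixes S :: "'a::metric_space set"
  assumes S: "compact S" and K: "closed K0" "closed K1" "K0 \<subseteq> S" "K1 \<subseteq> S"
    and no: "\<And>C. connected C \<Longrightarrow> C \<subseteq> S \<Longrightarrow> C \<inter> K0 = {} \<or> C \<inter> K1 = {}"
  shows "\<exists>A B. closed A \<and> closed B \<and> A \<union> B = S \<and> A \<inter> B = {} \<and> K0 \<subseteq> A \<and> K1 \<subseteq> B"
proof -
  have "separated_between (top_of_set S) K0 K1"
  proof (rule cut_wire_fence_theorem)
    show "compact_space (top_of_set S)" using S by (simp add: compact_space_subtopology)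
    show "Hausdorff_space (top_of_set S)" by (simp add: Hausdorff_space_subtopology)
    show "closedin (top_of_set S) K0" "closedin (top_of_set S) K1" using K by (simp_all add: closed_subset)
    show "disjnt C K0 \<or> disjnt C K1" if "connectedin (top_of_set S) C" for C
      using no[of C] that by (auto simp: connectedin_subtopology disjnt_def)
  qed
  then obtain A B where "closedin (top_of_set S) A" "closedin (top_of_set S) B" "A \<union> B = S" "disjnt A B" "K0 \<subseteq> A" "K1 \<subseteq> B"
    unfolding separated_between_alt by auto
  moreover have "closed S" using S by (rule compact_imp_closed)
  ultimately show ?thesis unfolding disjnt_def
    by (intro exI[of _ A] exI[of _ B]) (auto intro: closedin_closed_trans)
qed

text \<open>Local compactness of the span, expressed by coordinates instead of the norm.\<close>

lemma compact_box_image: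
  fixes w :: "nat \<Rightarrow> 'b::real_normed_vector"
  shows "\<exists>K. compact K \<and> (\<forall>c. (\<forall>j<n. \<bar>c j\<bar> \<le> C) \<longrightarrow> (\<Sum>j<n. c j *\<^sub>R w j) \<in> K)"
proof (induction n)
  case 0 show ?case by (rule exI[of _ "{0}"]) simp
next
  case (Suc n)
  then obtain K where K: "compact K" "\<forall>c. (\<forall>j<n. \<bar>c j\<bar> \<le> C) \<longrightarrow> (\<Sum>j<n. c j *\<^sub>R w j) \<in> K" by blast
  have "compact ((\<lambda>t. t *\<^sub>R w n) ` {-C..C})" by (intro compact_continuous_image continuous_intros) auto
  then have c: "compact {x + y |x y. x \<in> K \<and> y \<in> (\<lambda>t. t *\<^sub>R w n) ` {-C..C}}" by (rule compact_sums[OF K(1)])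
  have "(\<Sum>j<Suc n. c j *\<^sub>R w j) \<in> {x + y |x y. x \<in> K \<and> y \<in> (\<lambda>t. t *\<^sub>R w n) ` {-C..C}}" if "\<forall>j<Suc n. \<bar>c j\<bar> \<le> C" for c
  proof -
    have "(\<Sum>j<n. c j *\<^sub>R w j) \<in> K" using K(2) that by simp
    moreover have "c n *\<^sub>R w n \<in> (\<lambda>t. t *\<^sub>R w n) ` {-C..C}" using that[rule_format, of n] by (auto simp: abs_le_iff)
    ultimately show ?thesis unfolding sum.lessThan_Suc by blast
  qed
  then show ?case using c by blast
qed

text \<open>The lift makes \<open>T l u + s Q(l, u) = y\<close> a contraction problem with constant
  \<open>\<kappa> N\<close>. The factor \<open>s\<close> prepares the deformation of the nonlinear
  equation to the linear one.\<close>

lemma solution_operator: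
  fixes T :: "real \<Rightarrow> 'a::banach \<Rightarrow>\<^sub>L 'b::banach" and Q :: "real \<times> 'a \<Rightarrow> 'b"
  assumes Tc: "continuous_on X T" and TG: "\<And>l. l \<in> X \<Longrightarrow> T l \<in> GL" and N: "\<And>l. l \<in> X \<Longrightarrow> norm (blinfun_inv (T l)) \<le> N"
    and \<kappa>: "0 \<le> \<kappa>" "\<kappa> * N \<le> 1 / 2" and Qc: "continuous_on (X \<times> UNIV) Q"
    and Ql: "\<And>l u v. l \<in> X \<Longrightarrow> norm (Q (l, u) - Q (l, v)) \<le> \<kappa> * norm (u - v)"
  shows "\<exists>S :: real \<times> real \<times> 'b \<Rightarrow> 'a. continuous_on ({0..1} \<times> X \<times> UNIV) S \<and>
    (\<forall>s\<in>{0..1}. \<forall>l\<in>X. \<forall>y u. T l u + s *\<^sub>R Q (l, u) = y \<longleftrightarrow> u = S (s, l, y))"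
proof -
  define \<Phi> where "\<Phi> p u = blinfun_inv (T (fst (snd p))) (snd (snd p) - fst p *\<^sub>R Q (fst (snd p), u))" for p :: "real \<times> real \<times> 'b" and u
  define P where "P = {0..1::real} \<times> X \<times> (UNIV :: 'b set)"
  have lip: "norm (\<Phi> p u - \<Phi> p v) \<le> 1 / 2 * norm (u - v)" if p: "p \<in> P" for p u v
  proof -
    obtain s l y where q: "p = (s, l, y)" by (cases p)
    have s: "s \<in> {0..1}" and l: "l \<in> X" using p q by (auto simp: P_def)
    have "\<Phi> p u - \<Phi> p v = blinfun_inv (T l) (s *\<^sub>R (Q (l, v) - Q (l, u)))"
      by (simp add: q \<Phi>_def blinfun.diff_right blinfun.scaleR_right scaleR_diff_right)
    then have "norm (\<Phi> p u - \<Phi> p v) \<le> norm (blinfun_inv (T l)) * norm (s *\<^sub>R (Q (l, v) - Q (l, u)))" by (simp only: norm_blinfun)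
    also have "\<dots> \<le> N * (\<kappa> * norm (u - v))"
    proof (rule mult_mono[OF N[OF l]])
      have "norm (s *\<^sub>R (Q (l, v) - Q (l, u))) \<le> 1 * norm (Q (l, v) - Q (l, u))"
        unfolding norm_scaleR by (rule mult_right_mono) (use s in auto)
      then show "norm (s *\<^sub>R (Q (l, v) - Q (l, u))) \<le> \<kappa> * norm (u - v)" using Ql[OF l, of v u] by (simp add: norm_minus_commute)
      show "0 \<le> N" using N[OF l] norm_ge_zero order_trans by blast
    qed simp
    also have "\<dots> = (\<kappa> * N) * norm (u - v)" by simp
    also have "\<dots> \<le> 1 / 2 * norm (u - v)" by (rule mult_right_mono[OF \<kappa>(2)]) simp
    finally show ?thesis .
  qed
  have ex: "\<exists>!u. \<Phi> p u = u" if "p \<in> P" for p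
    by (rule banach_fix_type[of "1/2"]) (use lip[OF that] in \<open>auto simp: dist_norm\<close>)
  define S where "S p = (THE u. \<Phi> p u = u)" for p
  have fp: "\<Phi> p (S p) = S p" if "p \<in> P" for p unfolding S_def by (rule theI'[OF ex[OF that]])
  have cont: "continuous_on P (\<lambda>p. \<Phi> p u)" for u
    unfolding \<Phi>_def
  proof (intro continuous_intros)
    show "continuous_on P (\<lambda>p. T (fst (snd p)))"
      by (rule continuous_on_compose2[OF Tc]) (auto simp: P_def intro!: continuous_intros)
    show "continuous_on P (\<lambda>p. Q (fst (snd p), u))"
      by (rule continuous_on_compose2[OF Qc]) (auto simp: P_def intro!: continuous_intros)
    show "T (fst (snd p)) \<in> GL" if "p \<in> P" for p using TG that by (auto simp: P_def)
  qed
  have "continuous_on P S" by (rule continuous_fixpoint[OF lip cont fp])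
  moreover have "T l u + s *\<^sub>R Q (l, u) = y \<longleftrightarrow> u = S (s, l, y)" if "s \<in> {0..1}" "l \<in> X" for s l y u
  proof -
    have p: "(s, l, y) \<in> P" using that by (simp add: P_def)
    have "T l u + s *\<^sub>R Q (l, u) = y \<longleftrightarrow> T l u = y - s *\<^sub>R Q (l, u)" by (simp add: eq_diff_eq)
    also have "\<dots> \<longleftrightarrow> \<Phi> (s, l, y) u = u" unfolding \<Phi>_def fst_conv snd_conv using blinfun_inv_apply[OF TG[OF that(2)]] by metis
    also have "\<dots> \<longleftrightarrow> u = S (s, l, y)" using ex[OF p] fp[OF p] by blast
    finally show ?thesis .
  qed
  ultimately show ?thesis unfolding P_def by blast
qed

text \<open>The extra coordinate \<open>\<psi> + 3 max x\<^sub>0 0\<close> cuts the finite-dimensional reduction down to the region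
  \<open>\<psi> < 0\<close>: it cannot vanish together with the reduced equation, so the degree of the combined map is
  constant in the parameter, and at a regular parameter it is the degree of the linearization.\<close>

lemma (in wsysB) degree_continuation:
  fixes L T :: "real \<Rightarrow> 'a::banach \<Rightarrow>\<^sub>L 'b" and Q :: "real \<times> 'a \<Rightarrow> 'b" and \<psi> :: "real \<times> 'a \<Rightarrow> real"
  assumes ab: "a \<le> b" and Lc: "continuous_on {a..b} L" and T: "lift_on a b W L T" and LG: "L a \<in> GL" "L b \<in> GL"
    and N: "\<And>l. l \<in> {a..b} \<Longrightarrow> norm (blinfun_inv (T l)) \<le> N" "norm (blinfun_inv (L a)) \<le> N" "norm (blinfun_inv (L b)) \<le> N"
    and \<kappa>: "0 \<le> \<kappa>" "\<kappa> * N \<le> 1 / 2" and Qc: "continuous_on ({a..b} \<times> UNIV) Q" and Q0: "\<And>l. l \<in> {a..b} \<Longrightarrow> Q (l, 0) = 0"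
    and Ql: "\<And>l u v. l \<in> {a..b} \<Longrightarrow> norm (Q (l, u) - Q (l, v)) \<le> \<kappa> * norm (u - v)"
    and \<psi>c: "continuous_on ({a..b} \<times> UNIV) \<psi>" and \<psi>1: "\<And>p. \<psi> p \<ge> -1"
    and \<psi>\<eta>: "\<And>l u. l \<in> {a..b} \<Longrightarrow> \<eta> \<le> norm u \<Longrightarrow> \<psi> (l, u) > 0" and \<psi>0: "\<And>l. l \<in> {a..b} \<Longrightarrow> \<psi> (l, 0) < 0"
    and \<psi>z: "\<And>l u. l \<in> {a..b} \<Longrightarrow> L l u + Q (l, u) = 0 \<Longrightarrow> \<psi> (l, u) \<noteq> 0"
  shows "\<rho> (L a) (T a) = \<rho> (L b) (T b)"
proof -
  have Tc: "continuous_on {a..b} T" using T by (simp add: lift_on_def)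
  note TG = lift_onD(1)[OF T]
  have exS: "\<exists>S :: real \<times> real \<times> 'b \<Rightarrow> 'a. continuous_on ({0..1} \<times> {a..b} \<times> UNIV) S \<and>
    (\<forall>s\<in>{0..1}. \<forall>l\<in>{a..b}. \<forall>y u. T l u + s *\<^sub>R Q (l, u) = y \<longleftrightarrow> u = S (s, l, y))"
    by (rule solution_operator[OF Tc TG N(1) \<kappa> Qc Ql])
  obtain S :: "real \<times> real \<times> 'b \<Rightarrow> 'a" where Sc: "continuous_on ({0..1} \<times> {a..b} \<times> UNIV) S"
    and S: "\<forall>s\<in>{0..1}. \<forall>l\<in>{a..b}. \<forall>y u. T l u + s *\<^sub>R Q (l, u) = y \<longleftrightarrow> u = S (s, l, y)"
    using exS by (elim exE conjE)
  have S1: "T l (S (s, l, y)) + s *\<^sub>R Q (l, S (s, l, y)) = y" if "s \<in> {0..1}" "l \<in> {a..b}" for s l y using S that by blast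
  have S2: "S (s, l, y) = u" if "s \<in> {0..1}" "l \<in> {a..b}" "T l u + s *\<^sub>R Q (l, u) = y" for s l y u using S[rule_format, OF that(1,2), of u y] that(3) by simp
  \<comment> \<open>The reduced equation on \<open>W\<close>: its zeros are the
    \<open>y = T u - L u\<close> for which the solution \<open>u\<close> of the lifted equation
    satisfies \<open>L u + s Q = 0\<close>.\<close>
  define f where "f s l y = y - (T l (S (s, l, y)) - L l (S (s, l, y)))" for s l y
  have fW: "f s l y \<in> W" if "l \<in> {a..b}" "y \<in> W" for s l y
    unfolding f_def by (rule subspace_diff[OF subspace_W that(2) lift_onD(2)[OF T that(1)]])
  have f0: "L l (S (s, l, y)) + s *\<^sub>R Q (l, S (s, l, y)) = 0" "y = T l (S (s, l, y)) - L l (S (s, l, y))"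
    if sl: "s \<in> {0..1}" "l \<in> {a..b}" and z: "f s l y = 0" for s l y
  proof -
    show y: "y = T l (S (s, l, y)) - L l (S (s, l, y))" using z by (simp add: f_def)
    have "T l (S (s, l, y)) + s *\<^sub>R Q (l, S (s, l, y)) = T l (S (s, l, y)) - L l (S (s, l, y))"
      using S1[OF sl, of y] y by (rule trans)
    then show "L l (S (s, l, y)) + s *\<^sub>R Q (l, S (s, l, y)) = 0" by (simp add: algebra_simps)
  qed
  have "continuous_on {a..b} (\<lambda>l. T l - L l)" by (intro continuous_intros Tc Lc)
  from compact_norm_bound[OF compact_Icc this] obtain KY where KY: "KY > 0" "\<forall>l\<in>{a..b}. norm (T l - L l) \<le> KY" by blast
  define C where "C = (\<Sum>j<m. norm (\<phi> j)) * (KY * \<bar>\<eta>\<bar>)"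
  have C0: "C \<ge> 0" unfolding C_def using KY by (intro mult_nonneg_nonneg sum_nonneg) auto
  have Cb: "\<bar>\<phi> j (T l u - L l u)\<bar> \<le> C" if "j < m" "l \<in> {a..b}" "norm u \<le> \<bar>\<eta>\<bar>" for j l u
  proof -
    have "norm (T l u - L l u) = norm ((T l - L l) u)" by (simp add: minus_blinfun.rep_eq)
    also have "\<dots> \<le> norm (T l - L l) * norm u" by (rule norm_blinfun)
    also have "\<dots> \<le> KY * \<bar>\<eta>\<bar>" by (intro mult_mono) (use KY that in auto)
    finally have n: "norm (T l u - L l u) \<le> KY * \<bar>\<eta>\<bar>" .
    have "norm (\<phi> j (T l u - L l u)) \<le> norm (\<phi> j) * norm (T l u - L l u)" by (rule norm_blinfun)
    also have "\<dots> \<le> (\<Sum>j<m. norm (\<phi> j)) * (KY * \<bar>\<eta>\<bar>)"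
      by (intro mult_mono n member_le_sum sum_nonneg) (use that in auto)
    finally show ?thesis by (simp add: C_def)
  qed
  \<comment> \<open>With this scaling, zeros with \<open>norm u < \<eta>\<close> have all
    coordinates beyond the first at most \<open>1 / (2 (m + 1))\<close> on the unit sphere, which
    forces the coordinate 0 to be large.\<close>
  define R where "R = 2 * (real m + 1) * (C + 1)"
  have R: "R > 0" unfolding R_def using C0 by simp
  \<comment> \<open>\<open>\<tau> = 0\<close> is the nonlinear map with the cut-off coordinate,
    \<open>\<tau> = 1\<close> the suspended linear ratio. The factor 3 beats
    \<open>\<psi> \<ge> -1\<close> as soon as \<open>x 0 > 1 / 2\<close>.\<close>
  define G where "G \<tau> l x i = (case i of 0 \<Rightarrow> (1 - \<tau>) * (\<psi> (l, S (1 - \<tau>, l, R *\<^sub>R emb x)) + 3 * max (x 0) 0) + \<tau> * x 0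
      | Suc j \<Rightarrow> \<phi> j (f (1 - \<tau>) l (R *\<^sub>R emb x)) / R)" for \<tau> l :: real and x i
  let ?X = "{0..1::real} \<times> {a..b} \<times> sph m"
  have Gc: "continuous_on ?X (\<lambda>p. G (fst p) (fst (snd p)) (snd (snd p)) i)" for i
  proof -
    have x: "continuous_on ?X (\<lambda>p. snd (snd p) j)" for j
      by (rule continuous_on_compose2[OF continuous_on_product_coordinates continuous_on_snd[OF continuous_on_snd]]) (auto intro: continuous_on_id)
    have e: "continuous_on ?X (\<lambda>p. R *\<^sub>R emb (snd (snd p)))" unfolding emb_def by (intro continuous_intros x)
    have s: "continuous_on ?X (\<lambda>p. S (1 - fst p, fst (snd p), R *\<^sub>R emb (snd (snd p))))"
      by (rule continuous_on_compose2[OF Sc]) (auto intro!: continuous_intros e)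
    have ps: "continuous_on ?X (\<lambda>p. \<psi> (fst (snd p), S (1 - fst p, fst (snd p), R *\<^sub>R emb (snd (snd p)))))"
      by (rule continuous_on_compose2[OF \<psi>c]) (auto intro!: continuous_intros s)
    have t: "continuous_on ?X (\<lambda>p. T (fst (snd p)))" by (rule continuous_on_compose2[OF Tc]) (auto intro!: continuous_intros)
    have l: "continuous_on ?X (\<lambda>p. L (fst (snd p)))" by (rule continuous_on_compose2[OF Lc]) (auto intro!: continuous_intros)
    show ?thesis
    proof (cases i)
      case 0
      show ?thesis unfolding G_def 0 nat.case by (intro continuous_intros ps x)
    next
      case (Suc j)
      show ?thesis unfolding G_def Suc nat.case f_def by (intro continuous_intros s t l e) (use R in simp)
    qed
  qed
  have Gz: "f (1 - \<tau>) l (R *\<^sub>R emb x) = 0" if "l \<in> {a..b}" "\<forall>i\<le>m. G \<tau> l x i = 0" for \<tau> l x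
  proof (rule W_zeroI)
    show "f (1 - \<tau>) l (R *\<^sub>R emb x) \<in> W" by (intro fW that subspace_scale[OF subspace_W] emb_in_W)
    fix j assume "j < m"
    then have "G \<tau> l x (Suc j) = 0" using that(2) by simp
    then show "\<phi> j (f (1 - \<tau>) l (R *\<^sub>R emb x)) = 0" using R by (simp add: G_def)
  qed
  have sphx: "(x 0)\<^sup>2 + (\<Sum>j<m. (x (Suc j))\<^sup>2) = 1" if "x \<in> sph m" for x
    using that by (simp add: sph_def sum.atMost_shift)
  have along: "sdeg m (G 0 a) = sdeg m (G 0 b)"
  proof -
    have lin: "a + t * (b - a) \<in> {a..b}" if "t \<in> {0..1}" for t
    proof -
      have "0 \<le> t * (b - a)" "t * (b - a) \<le> b - a" using that ab by (auto simp: mult_left_le_one_le)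
      then show ?thesis by simp
    qed
    have "sdeg m (G 0 (a + 0 * (b - a))) = sdeg m (G 0 (a + 1 * (b - a)))"
    proof (rule sdeg_homotopy[where G="\<lambda>t. G 0 (a + t * (b - a))"])
      show "continuous_on ({0..1} \<times> sph m) (\<lambda>p. G 0 (a + fst p * (b - a)) (snd p) i)" for i
      proof -
        have c: "continuous_on ({0..1} \<times> sph m) (\<lambda>p. (0::real, a + fst p * (b - a), snd p))" by (intro continuous_intros)
        have "(\<lambda>p. (0::real, a + fst p * (b - a), snd p)) ` ({0..1} \<times> sph m) \<subseteq> ?X"
        proof (rule image_subsetI)
          fix p :: "real \<times> (nat \<Rightarrow> real)" assume "p \<in> {0..1} \<times> sph m"
          then show "(0, a + fst p * (b - a), snd p) \<in> ?X" using lin[of "fst p"] by (simp only: mem_Times_iff fst_conv snd_conv) simp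
        qed
        from continuous_on_compose2[OF Gc c this, of i] show ?thesis by simp
      qed
      fix t :: real and x assume t: "t \<in> {0..1}" and x: "x \<in> sph m"
      define l where "l = a + t * (b - a)"
      have l: "l \<in> {a..b}" unfolding l_def by (rule lin[OF t])
      \<comment> \<open>At a common zero \<open>\<psi>\<close> is nonzero, so \<open>x 0 > 0\<close>
        and \<open>\<psi> < 0\<close>. Then \<open>u\<close> lies inside the ball of radius
        \<open>\<eta>\<close> and the scaling gives \<open>x 0 > 1 / 2\<close>, where the extra
        coordinate is positive.\<close>
      show "\<exists>i\<le>m. G 0 (a + t * (b - a)) x i \<noteq> 0"
      proof (rule ccontr)
        assume "\<not> ?thesis"
        then have z: "\<forall>i\<le>m. G 0 l x i = 0" by (simp add: l_def)
        define y where "y = R *\<^sub>R emb x"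
        define u where "u = S (1, l, y)"
        have fz: "f 1 l y = 0" using Gz[OF l z] by (simp add: y_def)
        have "L l u + 1 *\<^sub>R Q (l, u) = 0" and yu: "y = T l u - L l u"
          unfolding u_def by (rule f0[OF _ l fz], simp)+
        then have nz: "\<psi> (l, u) \<noteq> 0" using \<psi>z[OF l] by simp
        have "G 0 l x 0 = 0" using z by blast
        then have e: "\<psi> (l, u) + 3 * max (x 0) 0 = 0" by (simp add: G_def u_def y_def)
        then have x0: "x 0 > 0" "\<psi> (l, u) < 0" using nz by (auto simp: max_def split: if_splits)
        have un: "norm u < \<eta>" using \<psi>\<eta>[OF l, of u] x0(2) by (metis leI order.asym)
        have xb: "\<bar>x (Suc j)\<bar> \<le> 1 / (2 * (real m + 1))" if "j < m" for j
        proof -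
          have "R * x (Suc j) = \<phi> j y" unfolding y_def using \<phi>_emb[OF that] by (simp add: blinfun.scaleR_right)
          moreover have "\<bar>\<phi> j y\<bar> \<le> C" unfolding yu by (rule Cb[OF that l]) (use un in simp)
          moreover have "R * \<bar>x (Suc j)\<bar> = \<bar>R * x (Suc j)\<bar>" using R by (simp add: abs_mult)
          ultimately have "R * \<bar>x (Suc j)\<bar> \<le> C" by simp
          then have "\<bar>x (Suc j)\<bar> \<le> C / R" using R by (simp add: field_simps)
          also have "\<dots> \<le> (C + 1) / R" using R by (simp add: divide_right_mono)
          also have "\<dots> = 1 / (2 * (real m + 1))" unfolding R_def using C0 by simp
          finally show ?thesis .
        qed
        have "(\<Sum>j<m. (x (Suc j))\<^sup>2) \<le> (\<Sum>j<m. (1 / (2 * (real m + 1)))\<^sup>2)"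
          by (rule sum_mono) (metis xb lessThan_iff abs_ge_zero power2_abs power_mono)
        also have "\<dots> = real m / (4 * (real m + 1)\<^sup>2)" by (simp add: power2_eq_square) (simp add: algebra_simps)
        also have "\<dots> \<le> 1 / 4" by (simp add: divide_simps power2_eq_square) (simp add: algebra_simps)
        finally have "(x 0)\<^sup>2 \<ge> 3 / 4" using sphx[OF x] by simp
        moreover have "(x 0)\<^sup>2 \<le> (1 / 2)\<^sup>2" if "x 0 \<le> 1 / 2" using that x0(1) by (intro power_mono) auto
        ultimately have "x 0 > 1 / 2" by (fastforce simp: power2_eq_square)
        then show False using e \<psi>1[of "(l, u)"] by simp
      qed
    qed
    then show ?thesis by simp
  qed
  \<comment> \<open>Invertibility of \<open>L l\<close> leaves only \<open>u = 0\<close> among the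
    zeros of the reduced equation, hence only the two poles of the sphere. There the extra
    coordinate keeps the sign of \<open>x 0\<close> during the whole deformation because
    \<open>-1 \<le> \<psi> (l, 0) < 0\<close>.\<close>
  have at_end: "sdeg m (G 0 l) = \<rho> (L l) (T l)" if l: "l \<in> {a..b}" and G1: "L l \<in> GL" "norm (blinfun_inv (L l)) \<le> N" for l
  proof -
    have "sdeg m (G 0 l) = sdeg m (G 1 l)"
    proof (rule sdeg_homotopy[where G="\<lambda>t. G t l"])
      show "continuous_on ({0..1} \<times> sph m) (\<lambda>p. G (fst p) l (snd p) i)" for i
      proof -
        have c: "continuous_on ({0..1} \<times> sph m) (\<lambda>p. (fst p, l, snd p))" by (intro continuous_intros)
        have "(\<lambda>p. (fst p, l, snd p)) ` ({0..1} \<times> sph m) \<subseteq> ?X" using l by auto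
        from continuous_on_compose2[OF Gc c this, of i] show ?thesis by simp
      qed
      fix t :: real and x assume t: "t \<in> {0..1}" and x: "x \<in> sph m"
      show "\<exists>i\<le>m. G t l x i \<noteq> 0"
      proof (rule ccontr)
        assume "\<not> ?thesis"
        then have z: "\<forall>i\<le>m. G t l x i = 0" by simp
        define y where "y = R *\<^sub>R emb x"
        define u where "u = S (1 - t, l, y)"
        have t1: "1 - t \<in> {0..1}" using t by simp
        have fz: "f (1 - t) l y = 0" using Gz[OF l z] by (simp add: y_def)
        have Lu: "L l u + (1 - t) *\<^sub>R Q (l, u) = 0" and yu: "y = T l u - L l u"
          unfolding u_def by (rule f0[OF t1 l fz])+
        have "norm (L l u) = \<bar>1 - t\<bar> * norm (Q (l, u))" using Lu by (metis eq_neg_iff_add_eq_0 norm_minus_cancel norm_scaleR)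
        also have "\<dots> \<le> 1 * (\<kappa> * norm u)" by (intro mult_mono) (use t Ql[OF l, of u 0] Q0[OF l] in auto)
        finally have Lb: "norm (L l u) \<le> \<kappa> * norm u" by simp
        have "norm u = norm (blinfun_inv (L l) (L l u))" by (simp add: blinfun_inv_apply[OF G1(1)])
        also have "\<dots> \<le> norm (blinfun_inv (L l)) * norm (L l u)" by (rule norm_blinfun)
        also have "\<dots> \<le> N * (\<kappa> * norm u)"
          by (intro mult_mono Lb G1(2)) (use order_trans[OF norm_ge_zero G1(2)] in simp_all)
        also have "\<dots> = (\<kappa> * N) * norm u" by simp
        also have "\<dots> \<le> 1 / 2 * norm u" by (rule mult_right_mono[OF \<kappa>(2)]) simp
        finally have u0: "u = 0" by simp
        then have y0: "y = 0" using yu by simp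
        then have "x (Suc j) = 0" if "j < m" for j using \<phi>_emb[OF that, of x] R by (simp add: y_def)
        then have x1: "x 0 = 1 \<or> x 0 = -1" using sphx[OF x] by (simp add: power2_eq_1_iff)
        have "G t l x 0 = 0" using z by blast
        then have e: "(1 - t) * (\<psi> (l, 0) + 3 * max (x 0) 0) + t * x 0 = 0" using u0 by (simp add: G_def u_def y_def)
        show False
        proof (cases "x 0 = 1")
          case True
          have "(1 - t) * 2 \<le> (1 - t) * (\<psi> (l, 0) + 3)" by (rule mult_left_mono) (use t \<psi>1[of "(l, 0)"] in auto)
          then show False using e True t by simp
        next
          case False
          then have e': "(1 - t) * \<psi> (l, 0) = t" using e x1 by simp
          have "(1 - t) * \<psi> (l, 0) \<le> 0" using t \<psi>0[OF l] by (simp add: mult_nonneg_nonpos)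
          then have "t = 0" using e' t by simp
          then show False using e' \<psi>0[OF l] by simp
        qed
      qed
    qed
    also have "sdeg m (G 1 l) = sdeg m (hat (\<lambda>v. L l (blinfun_inv (T l) v)))"
    proof (rule sdeg_cong)
      fix x :: "nat \<Rightarrow> real" and i assume "i \<le> m"
      define y where "y = R *\<^sub>R emb x"
      \<comment> \<open>With the nonlinearity switched off the reduced map is exactly
        \<open>L T\<inverse>\<close>; by linearity the scaling \<open>R\<close> cancels.\<close>
      have "S (0, l, y) = blinfun_inv (T l) y" by (rule S2[OF _ l]) (simp_all add: blinfun_inv_apply[OF TG[OF l]])
      then have "f 0 l y = L l (blinfun_inv (T l) y)" by (simp add: f_def blinfun_inv_apply[OF TG[OF l]])
      then have "f 0 l y = R *\<^sub>R L l (blinfun_inv (T l) (emb x))" by (simp add: y_def blinfun.scaleR_right)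
      then show "G 1 l x i = hat (\<lambda>v. L l (blinfun_inv (T l) v)) x i"
        using R by (cases i) (simp_all add: G_def hat_def y_def blinfun.scaleR_right)
    qed
    finally show ?thesis by (simp add: \<rho>_def \<delta>_def)
  qed
  show ?thesis using along at_end[of a] at_end[of b] LG N(2,3) ab by simp
qed

text \<open>The remainder radius \<open>r\<close> serves as \<open>\<eta>0\<close>: on that ball the
  truncated equation, to which the degree argument applies, coincides with \<open>F = 0\<close>. The
  negation of the claim is exactly what the separation of the compact solution set needs.\<close>

lemma (in wsysB) solution_continuum:
  fixes F :: "real \<times> 'a::banach \<Rightarrow> 'b" and L T :: "real \<Rightarrow> 'a \<Rightarrow>\<^sub>L 'b"
  assumes ab: "a < b" and op: "open \<U>" and nb: "{a..b} \<times> {0} \<subseteq> \<U>" and C1: "C1_on \<U> F"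
    and L: "\<And>l. (l, 0) \<in> \<U> \<Longrightarrow> ((\<lambda>u. F (l, u)) has_derivative blinfun_apply (L l)) (at 0)"
    and triv: "\<And>l. (l, 0) \<in> \<U> \<Longrightarrow> F (l, 0) = 0" and Lc: "continuous_on {a..b} L"
    and LG: "L a \<in> GL" "L b \<in> GL" and T: "lift_on a b W L T" and odd: "\<rho> (L a) (T a) \<noteq> \<rho> (L b) (T b)"
  shows "\<exists>\<eta>0>0. \<forall>\<eta>. 0 < \<eta> \<and> \<eta> < \<eta>0 \<longrightarrow> (\<exists>C. connected C \<and>
    C \<subseteq> {p. fst p \<in> {a..b} \<and> p \<in> \<U> \<and> F p = 0 \<and> (snd p = 0 \<longrightarrow> L (fst p) \<notin> GL)} \<and>
    (\<exists>l. (l, 0) \<in> C) \<and> (\<exists>l u. (l, u) \<in> C \<and> norm u = \<eta>))"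
proof -
  have Tc: "continuous_on {a..b} T" using T by (simp add: lift_on_def)
  note TG = lift_onD(1)[OF T]
  have "continuous_on {a..b} (\<lambda>l. blinfun_inv (T l))" by (intro continuous_intros Tc TG)
  from compact_norm_bound[OF compact_Icc this] obtain N0 where N0: "N0 > 0" "\<forall>l\<in>{a..b}. norm (blinfun_inv (T l)) \<le> N0" by blast
  define N where "N = N0 + norm (blinfun_inv (L a)) + norm (blinfun_inv (L b))"
  have N: "N > 0" "\<And>l. l \<in> {a..b} \<Longrightarrow> norm (blinfun_inv (T l)) \<le> N" "norm (blinfun_inv (L a)) \<le> N" "norm (blinfun_inv (L b)) \<le> N"
    using N0 by (auto simp: N_def add.assoc intro!: add_pos_nonneg add_increasing2)
  have e: "1 / (4 * N) > 0" using N by simp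
  from C1_uniform_remainder[OF op nb C1 L e]
  obtain r where r: "r > 0" and rem: "\<forall>l\<in>{a..b}. \<forall>u v. norm u \<le> r \<longrightarrow> norm v \<le> r \<longrightarrow>
    (l, u) \<in> \<U> \<and> norm ((F (l, u) - L l u) - (F (l, v) - L l v)) \<le> 1 / (4 * N) * norm (u - v)" by blast
  \<comment> \<open>The remainder constant \<open>1 / (4 N)\<close> is doubled by the radial
    truncation.\<close>
  define \<kappa> where "\<kappa> = 1 / (2 * N)"
  have \<kappa>: "0 \<le> \<kappa>" "\<kappa> * N \<le> 1 / 2" using N by (auto simp: \<kappa>_def)
  have inU: "(l, u) \<in> \<U>" if "l \<in> {a..b}" "norm u \<le> r" for l u using rem that by blast
  obtain F' where "\<forall>x\<in>\<U>. (F has_derivative blinfun_apply (F' x)) (at x)" using C1 unfolding C1_on_def by blast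
  then have Fc: "continuous_on \<U> F" by (metis continuous_at_imp_continuous_on has_derivative_continuous)
  define Q where "Q p = F (fst p, radial r (snd p)) - L (fst p) (radial r (snd p))" for p
  have Qeq: "L l u + Q (l, u) = F (l, u)" if "norm u \<le> r" for l u using that r by (simp add: Q_def radial_id)
  have Q0: "Q (l, 0) = 0" if "l \<in> {a..b}" for l
  proof -
    have "F (l, 0) = 0" by (rule triv) (use nb that in auto)
    then show ?thesis using r by (simp add: Q_def radial_id)
  qed
  have Ql: "norm (Q (l, u) - Q (l, v)) \<le> \<kappa> * norm (u - v)" if l: "l \<in> {a..b}" for l u v
  proof -
    have "norm (Q (l, u) - Q (l, v)) \<le> 1 / (4 * N) * norm (radial r u - radial r v)"
      unfolding Q_def fst_conv snd_conv using rem l norm_radial[OF r, of u] norm_radial[OF r, of v] by blast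
    also have "\<dots> \<le> 1 / (4 * N) * (2 * norm (u - v))" by (rule mult_left_mono[OF radial_lipschitz[OF r]]) (use N in simp)
    finally show ?thesis by (simp add: \<kappa>_def)
  qed
  have Qc: "continuous_on ({a..b} \<times> UNIV) Q"
  proof -
    have c: "continuous_on ({a..b} \<times> UNIV) (\<lambda>p. radial r (snd p))"
      by (rule continuous_on_compose2[OF continuous_radial[OF r, of UNIV]]) (auto intro!: continuous_intros)
    have "continuous_on ({a..b} \<times> UNIV) (\<lambda>p. F (fst p, radial r (snd p)))"
      by (rule continuous_on_compose2[OF Fc]) (auto intro!: continuous_intros c inU norm_radial[OF r])
    moreover have "continuous_on ({a..b} \<times> (UNIV :: 'a set)) (\<lambda>p. L (fst p))"
      by (rule continuous_on_compose2[OF Lc]) (auto intro!: continuous_intros)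
    ultimately show ?thesis unfolding Q_def by (intro continuous_intros c)
  qed
  have exS: "\<exists>S :: real \<times> real \<times> 'b \<Rightarrow> 'a. continuous_on ({0..1} \<times> {a..b} \<times> UNIV) S \<and>
    (\<forall>s\<in>{0..1}. \<forall>l\<in>{a..b}. \<forall>y u. T l u + s *\<^sub>R Q (l, u) = y \<longleftrightarrow> u = S (s, l, y))"
    by (rule solution_operator[OF Tc TG N(2) \<kappa> Qc Ql])
  obtain S :: "real \<times> real \<times> 'b \<Rightarrow> 'a" where Sc: "continuous_on ({0..1} \<times> {a..b} \<times> UNIV) S"
    and S: "\<forall>s\<in>{0..1}. \<forall>l\<in>{a..b}. \<forall>y u. T l u + s *\<^sub>R Q (l, u) = y \<longleftrightarrow> u = S (s, l, y)"
    using exS by (elim exE conjE)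
  have "continuous_on {a..b} (\<lambda>l. T l - L l)" by (intro continuous_intros Tc Lc)
  from compact_norm_bound[OF compact_Icc this] obtain KY where KY: "KY > 0" "\<forall>l\<in>{a..b}. norm (T l - L l) \<le> KY" by blast
  have "\<exists>d. d > 0 \<and> (\<forall>l'\<in>{a..b}. \<forall>u. \<bar>l' - l\<bar> < d \<longrightarrow> norm u < d \<longrightarrow> L l' \<in> GL \<and> (F (l', u) = 0 \<longrightarrow> u = 0))"
    if "l \<in> {a..b} \<and> L l \<in> GL" for l
    using regular_point_isolated[OF op nb C1 L triv Lc] that by blast
  then obtain d where d: "\<And>l. l \<in> {a..b} \<and> L l \<in> GL \<Longrightarrow> d l > 0 \<and>
      (\<forall>l'\<in>{a..b}. \<forall>u. \<bar>l' - l\<bar> < d l \<longrightarrow> norm u < d l \<longrightarrow> L l' \<in> GL \<and> (F (l', u) = 0 \<longrightarrow> u = 0))" by metis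
  show ?thesis
  proof (intro exI[of _ r] conjI allI impI)
    show "r > 0" by (rule r)
    fix \<eta> assume \<eta>: "0 < \<eta> \<and> \<eta> < r"
    define Z where "Z = {p \<in> {a..b} \<times> cball 0 \<eta>. F p = 0}"
    have ZU: "{a..b} \<times> cball 0 \<eta> \<subseteq> \<U>" using inU \<eta> by auto
    have clZ: "closed Z" unfolding Z_def
      by (rule continuous_closed_preimage_constant[OF continuous_on_subset[OF Fc ZU]]) (intro closed_Times closed_cball closed_atLeastAtMost)
    \<comment> \<open>A solution is recovered by the solution operator from \<open>l\<close> and
      \<open>y = T u - L u\<close>, and \<open>y\<close> ranges over a bounded part of
      \<open>W\<close>; so \<open>Z\<close> is a closed subset of a continuous image of a compact
      set.\<close>
    have cZ: "compact Z"
    proof -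
      define C where "C = (\<Sum>j<m. norm (\<phi> j)) * (KY * \<eta>)"
      obtain K where K: "compact K" "\<forall>c. (\<forall>j<m. \<bar>c j\<bar> \<le> C) \<longrightarrow> (\<Sum>j<m. c j *\<^sub>R w j) \<in> K" using compact_box_image[of m C w] by (elim exE conjE)
      have cK: "compact ((\<lambda>q. (fst q, S (1, fst q, snd q))) ` ({a..b} \<times> K))"
        by (intro compact_continuous_image compact_Times compact_Icc K(1) continuous_intros continuous_on_compose2[OF Sc]) auto
      have "Z \<subseteq> (\<lambda>q. (fst q, S (1, fst q, snd q))) ` ({a..b} \<times> K)"
      proof
        fix p assume "p \<in> Z"
        then obtain l u where p: "p = (l, u)" and l: "l \<in> {a..b}" and u: "norm u \<le> \<eta>" and Fz: "F (l, u) = 0" by (auto simp: Z_def)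
        define y where "y = T l u - L l u"
        have yW: "y \<in> W" unfolding y_def by (rule lift_onD(2)[OF T l])
        have "L l u + Q (l, u) = 0" using Qeq[of u l] u \<eta> Fz by simp
        then have "T l u + 1 *\<^sub>R Q (l, u) = y" by (simp add: y_def eq_neg_iff_add_eq_0 add.commute)
        then have uS: "u = S (1, l, y)" using S l by (metis atLeastAtMost_iff order_refl zero_le_one)
        have Cy: "\<bar>\<phi> j y\<bar> \<le> C" if "j < m" for j
        proof -
          have "norm y = norm ((T l - L l) u)" by (simp add: y_def minus_blinfun.rep_eq)
          also have "\<dots> \<le> norm (T l - L l) * norm u" by (rule norm_blinfun)
          also have "\<dots> \<le> KY * \<eta>" by (intro mult_mono) (use KY l u in auto)
          finally have n: "norm y \<le> KY * \<eta>" .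
          have "norm (\<phi> j y) \<le> norm (\<phi> j) * norm y" by (rule norm_blinfun)
          also have "\<dots> \<le> C" unfolding C_def
            by (intro mult_mono n member_le_sum sum_nonneg) (use that in auto)
          finally show ?thesis by simp
        qed
        have "(\<Sum>j<m. \<phi> j y *\<^sub>R w j) \<in> K" by (rule K(2)[rule_format]) (rule Cy)
        then have "y \<in> K" using W_expand[OF yW] by simp
        then show "p \<in> (\<lambda>q. (fst q, S (1, fst q, snd q))) ` ({a..b} \<times> K)"
          by (intro image_eqI[of _ _ "(l, y)"]) (use p uS l in auto)
      qed
      then show ?thesis using compact_Int_closed[OF cK clZ] by (simp add: inf.absorb2)
    qed
    define SS where "SS = {p \<in> Z. snd p = 0 \<longrightarrow> L (fst p) \<notin> GL}"
    have cSS: "compact SS"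
    proof -
      \<comment> \<open>An open set around the regular trivial solutions that contains no other
        solutions over \<open>[a, b]\<close>. Removing it drops precisely the regular trivial
        solutions and preserves compactness.\<close>
      define Reg where "Reg = (\<Union>l\<in>{l\<in>{a..b}. L l \<in> GL}. ball l (d l) \<times> ball (0::'a) (d l))"
      have "SS = Z - Reg"
      proof (rule Set.set_eqI)
        fix p :: "real \<times> 'a" obtain l u where p: "p = (l, u)" by (cases p)
        have "\<not> (p \<in> SS \<and> p \<in> Reg)"
        proof
          assume "p \<in> SS \<and> p \<in> Reg"
          then obtain l0 where l0: "l0 \<in> {a..b} \<and> L l0 \<in> GL" "\<bar>l - l0\<bar> < d l0" "norm u < d l0" and ps: "p \<in> SS"
            unfolding Reg_def p by (auto simp: dist_real_def abs_minus_commute)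
          have l: "l \<in> {a..b}" "F (l, u) = 0" using ps p by (auto simp: SS_def Z_def)
          have "L l \<in> GL \<and> (F (l, u) = 0 \<longrightarrow> u = 0)" using d[OF l0(1)] l(1) l0(2,3) by blast
          then show False using ps l p by (simp add: SS_def)
        qed
        moreover have "p \<in> Reg" if "p \<in> Z" "p \<notin> SS"
        proof -
          have "u = 0" "L l \<in> GL" "l \<in> {a..b}" using that p by (auto simp: SS_def Z_def)
          then show ?thesis unfolding Reg_def p using d[of l] by force
        qed
        moreover have "p \<in> SS \<Longrightarrow> p \<in> Z" by (simp add: SS_def)
        ultimately show "p \<in> SS \<longleftrightarrow> p \<in> Z - Reg" by blast
      qed
      moreover have "open Reg" unfolding Reg_def by (intro open_UN ballI open_Times open_ball)
      ultimately show ?thesis using compact_diff[OF cZ] by simp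
    qed
    show "\<exists>C. connected C \<and> C \<subseteq> {p. fst p \<in> {a..b} \<and> p \<in> \<U> \<and> F p = 0 \<and> (snd p = 0 \<longrightarrow> L (fst p) \<notin> GL)} \<and>
      (\<exists>l. (l, 0) \<in> C) \<and> (\<exists>l u. (l, u) \<in> C \<and> norm u = \<eta>)" (is ?goal)
    proof (rule ccontr)
      assume ng: "\<not> ?goal"
      have SSsub: "SS \<subseteq> {p. fst p \<in> {a..b} \<and> p \<in> \<U> \<and> F p = 0 \<and> (snd p = 0 \<longrightarrow> L (fst p) \<notin> GL)}"
        using ZU by (auto simp: SS_def Z_def)
      define K0 where "K0 = SS \<inter> {p. snd p = 0}"
      define K1 where "K1 = SS \<inter> {p. norm (snd p) = \<eta>}"
      have clSS: "closed SS" by (rule compact_imp_closed[OF cSS])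
      have "\<exists>A B. closed A \<and> closed B \<and> A \<union> B = SS \<and> A \<inter> B = {} \<and> K0 \<subseteq> A \<and> K1 \<subseteq> B"
      proof (rule compact_separation[OF cSS])
        show "closed K0" unfolding K0_def by (intro closed_Int clSS closed_Collect_eq continuous_intros)
        show "closed K1" unfolding K1_def by (intro closed_Int clSS closed_Collect_eq continuous_intros)
        show "K0 \<subseteq> SS" "K1 \<subseteq> SS" by (auto simp: K0_def K1_def)
        show "C \<inter> K0 = {} \<or> C \<inter> K1 = {}" if C: "connected C" "C \<subseteq> SS" for C
        proof (rule ccontr)
          assume "\<not> ?thesis"
          then obtain p q where pq: "p \<in> C" "p \<in> K0" "q \<in> C" "q \<in> K1" by blast
          then have "snd p = 0" "norm (snd q) = \<eta>" by (auto simp: K0_def K1_def)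
          then have "(fst p, 0) \<in> C" "(fst q, snd q) \<in> C" "norm (snd q) = \<eta>" using pq by (metis prod.collapse)+
          then have ?goal using C SSsub by (intro exI[of _ C]) blast
          then show False using ng by blast
        qed
      qed
      then obtain A B where AB: "closed A" "closed B" "A \<union> B = SS" "A \<inter> B = {}" "K0 \<subseteq> A" "K1 \<subseteq> B" by blast
      \<comment> \<open>The whole trivial segment joins the negative side, which makes
        \<open>\<psi> (l, 0) < 0\<close> at regular parameters too.\<close>
      define A' where "A' = A \<union> {a..b} \<times> {0}"
      \<comment> \<open>The positive side receives the exterior of the ball. The half-space
        \<open>b + 1 \<le> fst p\<close> keeps the set nonempty even when the space of the
        \<open>u\<close> is zero.\<close>
      define B' where "B' = B \<union> ({p. \<eta> \<le> norm (snd p)} \<union> {p. b + 1 \<le> fst p})"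
      have cl: "closed A'" "closed B'" unfolding A'_def B'_def
        by (intro closed_Un AB closed_Times closed_atLeastAtMost closed_singleton closed_Collect_le continuous_intros)+
      have "(a, 0) \<in> A'" "(b + 1, 0) \<in> B'" using ab by (auto simp: A'_def B'_def)
      then have ne: "A' \<noteq> {}" "B' \<noteq> {}" by blast+
      have SSD: "fst p \<in> {a..b} \<and> norm (snd p) \<le> \<eta>" if "p \<in> SS" for p using that by (auto simp: SS_def Z_def)
      have dis: "p \<notin> B'" if p: "p \<in> A'" for p
      proof
        assume pB: "p \<in> B'"
        show False
        proof (cases "p \<in> A")
          case True
          then have "p \<in> SS" using AB by blast
          then have "norm (snd p) = \<eta>" using pB SSD[of p] True AB(4) by (auto simp: B'_def)
          then have "p \<in> K1" using \<open>p \<in> SS\<close> by (simp add: K1_def)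
          then show False using True AB by blast
        next
          case False
          then have p0: "fst p \<in> {a..b}" "snd p = 0" using p by (auto simp: A'_def)
          then have "p \<in> B" using pB \<eta> by (auto simp: B'_def)
          then have "p \<in> K0" using AB(3) p0 by (auto simp: K0_def)
          then show False using False AB by blast
        qed
      qed
      \<comment> \<open>A difference of distances changes sign between the two pieces; clipping at
        -1 provides the lower bound used by the degree argument.\<close>
      define \<psi> where "\<psi> p = max (-1) (infdist p A' - infdist p B')" for p
      have neg: "\<psi> p < 0" if "p \<in> A'" for p
        using that infdist_pos_not_in_closed[OF cl(2) ne(2) dis[OF that]] by (simp add: \<psi>_def)
      have pos: "\<psi> p > 0" if "p \<in> B'" for p
      proof -
        have "p \<notin> A'" using dis that by blast
        from infdist_pos_not_in_closed[OF cl(1) ne(1) this] show ?thesis using that by (simp add: \<psi>_def)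
      qed
      have "\<rho> (L a) (T a) = \<rho> (L b) (T b)"
      proof (rule degree_continuation[OF _ Lc T LG N(2-4) \<kappa> Qc Q0 Ql, where \<psi>=\<psi> and \<eta>=\<eta>])
        show "a \<le> b" using ab by simp
        show "continuous_on ({a..b} \<times> UNIV) \<psi>" unfolding \<psi>_def by (intro continuous_intros)
        show "\<psi> p \<ge> -1" for p by (simp add: \<psi>_def)
        show "\<psi> (l, u) > 0" if "\<eta> \<le> norm u" for l u by (rule pos) (use that in \<open>simp add: B'_def\<close>)
        show "\<psi> (l, 0) < 0" if "l \<in> {a..b}" for l by (rule neg) (use that in \<open>simp add: A'_def\<close>)
        show "\<psi> (l, u) \<noteq> 0" if l: "l \<in> {a..b}" and z: "L l u + Q (l, u) = 0" for l u
        proof (cases "\<eta> \<le> norm u \<or> u = 0")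
          case True
          then have "(l, u) \<in> A' \<or> (l, u) \<in> B'" using l by (auto simp: A'_def B'_def)
          then show ?thesis using neg pos by fastforce
        next
          case False
          then have "(l, u) \<in> SS" using Qeq[of u l] z l \<eta> by (auto simp: SS_def Z_def)
          then have "(l, u) \<in> A' \<or> (l, u) \<in> B'" using AB(3) by (auto simp: A'_def B'_def)
          then show ?thesis using neg pos by fastforce
        qed
      qed
      then show False using odd by simp
    qed
  qed
qed

theorem theorem4p1:
  fixes \<U> :: "(real \<times> 'a::banach) set"
    and F :: "real \<times> 'a \<Rightarrow> 'b::banach"
    and L L\<omega> :: "real \<Rightarrow> 'a \<Rightarrow>\<^sub>L 'b"
    and lm lp :: real
  assumes lt: "lm < lp"
    and U_open: "open \<U>"
    and U_nbhd: "{lm..lp} \<times> {0} \<subseteq> \<U>"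
    and F_C1: "C1_on \<U> F"
    and L_def: "\<And>l. (l, 0) \<in> \<U> \<Longrightarrow> ((\<lambda>u. F (l, u)) has_derivative blinfun_apply (L l)) (at 0)"
    and F_triv: "\<And>l. (l, 0) \<in> \<U> \<Longrightarrow> F (l, 0) = 0"
    and L_Fredholm: "\<And>l. (l, 0) \<in> \<U> \<Longrightarrow> L l \<in> Fredholm0"
    and L_ends: "L lm \<in> GL" "L lp \<in> GL"
    and L\<omega>_analytic: "real_analytic_on {lm..lp} L\<omega>"
    and L\<omega>_admissible: "admissible lm lp L\<omega>"
    and L\<omega>_homotopic: "A_homotopic lm lp L\<omega> L"
    and chi_odd: "odd (chi_total L\<omega> lm lp)"
  shows "(\<exists>l0\<in>{lm<..<lp}. bifurcation_point \<U> F l0) \<and>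
         (\<exists>\<eta>0>0. \<forall>\<eta>\<in>{0<..<\<eta>0}. \<exists>\<CC>\<in>components (nontrivial_solutions \<U> F L).
            \<CC> \<inter> {(l, 0) | l. l \<in> singular_set {l. (l, 0) \<in> \<U>} L \<inter> {lm<..<lp}} \<noteq> {} \<and>
            \<CC> \<inter> {(l, u). norm u = \<eta>} \<noteq> {})"
  proof -
  have Lc: "continuous_on {lm..lp} L" using L\<omega>_homotopic by (simp add: A_homotopic_def admissible_def)
  obtain m and w :: "nat \<Rightarrow> 'b" and \<phi> T where ws: "wsysB m w \<phi>" and T: "lift_on lm lp (wsys.W m w) L T"
    and ne: "wsysB.\<rho> m w \<phi> (L lm) (T lm) \<noteq> wsysB.\<rho> m w \<phi> (L lp) (T lp)"
    using odd_parity_lift[OF lt L\<omega>_analytic L\<omega>_admissible L\<omega>_homotopic chi_odd] by (elim exE conjE)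
  define X where "X = {p. fst p \<in> {lm..lp} \<and> p \<in> \<U> \<and> F p = 0 \<and> (snd p = 0 \<longrightarrow> L (fst p) \<notin> GL)}"
  have "\<exists>\<eta>0>0. \<forall>\<eta>. 0 < \<eta> \<and> \<eta> < \<eta>0 \<longrightarrow> (\<exists>C. connected C \<and> C \<subseteq> X \<and> (\<exists>l. (l, 0) \<in> C) \<and> (\<exists>l u. (l, u) \<in> C \<and> norm u = \<eta>))"
    unfolding X_def by (rule wsysB.solution_continuum[OF ws lt U_open U_nbhd F_C1 L_def F_triv Lc L_ends T ne])
  then obtain \<eta>0 where \<eta>0: "\<eta>0 > 0" and cont: "\<And>\<eta>. 0 < \<eta> \<and> \<eta> < \<eta>0 \<Longrightarrow>
      \<exists>C. connected C \<and> C \<subseteq> X \<and> (\<exists>l. (l, 0) \<in> C) \<and> (\<exists>l u. (l, u) \<in> C \<and> norm u = \<eta>)" by blast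
  have inner: "l \<in> {lm<..<lp}" if "l \<in> {lm..lp}" "L l \<notin> GL" for l using that L_ends by (auto simp: less_le)
  have "\<exists>l0\<in>{lm<..<lp}. bifurcation_point \<U> F l0"
  proof -
    \<comment> \<open>Radii strictly below \<open>\<eta>0\<close> that tend to 0; the continuum for
      each supplies a nontrivial solution on its sphere with parameter in the compact
      interval.\<close>
    define e where "e n = \<eta>0 * inverse (real (Suc (Suc n)))" for n
    have e: "0 < e n \<and> e n < \<eta>0" for n using \<eta>0 by (simp add: e_def field_simps add_pos_nonneg)
    have "\<exists>q. fst q \<in> {lm..lp} \<and> q \<in> \<U> \<and> F q = 0 \<and> norm (snd q) = e n" for n
      using cont[OF e[of n]] unfolding X_def by fastforce
    then obtain q where q: "\<And>n. fst (q n) \<in> {lm..lp} \<and> q n \<in> \<U> \<and> F (q n) = 0 \<and> norm (snd (q n)) = e n" by metis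
    have "e \<longlonglongrightarrow> \<eta>0 * 0" unfolding e_def by (intro tendsto_mult tendsto_const LIMSEQ_Suc[OF LIMSEQ_inverse_real_of_nat])
    then have e0: "e \<longlonglongrightarrow> 0" by simp
    have "(\<lambda>n. norm (snd (q n))) \<longlonglongrightarrow> 0" using e0 q by simp
    then have s0: "(\<lambda>n. snd (q n)) \<longlonglongrightarrow> 0" by (rule tendsto_norm_zero_cancel)
    obtain l0 k where l0: "l0 \<in> {lm..lp}" and k: "strict_mono (k :: nat \<Rightarrow> nat)" and lim: "((\<lambda>n. fst (q n)) \<circ> k) \<longlonglongrightarrow> l0"
      using compact_Icc[of lm lp] q unfolding compact_def by (metis (no_types, lifting))
    have lim1: "(\<lambda>n. fst (q (k n))) \<longlonglongrightarrow> l0" using lim by (simp add: o_def)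
    have lim2: "(\<lambda>n. snd (q (k n))) \<longlonglongrightarrow> 0" using LIMSEQ_subseq_LIMSEQ[OF s0 k] by (simp add: o_def)
    have qn: "snd (q n) \<noteq> 0" for n using q[of n] e[of n] by auto
    \<comment> \<open>A regular limit parameter would exclude nontrivial solutions nearby;
      singularity moreover keeps \<open>l0\<close> off the ends of the interval.\<close>
    have "L l0 \<notin> GL"
    proof
      assume G: "L l0 \<in> GL"
      have "\<exists>d>0. \<forall>l'\<in>{lm..lp}. \<forall>u. \<bar>l' - l0\<bar> < d \<longrightarrow> norm u < d \<longrightarrow> L l' \<in> GL \<and> (F (l', u) = 0 \<longrightarrow> u = 0)"
        by (rule regular_point_isolated[OF U_open U_nbhd F_C1 L_def F_triv Lc l0 G])
      then obtain d where d: "d > 0" "\<forall>l'\<in>{lm..lp}. \<forall>u. \<bar>l' - l0\<bar> < d \<longrightarrow> norm u < d \<longrightarrow> L l' \<in> GL \<and> (F (l', u) = 0 \<longrightarrow> u = 0)"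
        by (elim exE conjE)
      have "\<forall>\<^sub>F n in sequentially. dist (fst (q (k n))) l0 < d \<and> dist (snd (q (k n))) 0 < d"
        by (rule eventually_conj[OF tendstoD[OF lim1 d(1)] tendstoD[OF lim2 d(1)]])
      then obtain n where "dist (fst (q (k n))) l0 < d \<and> dist (snd (q (k n))) 0 < d" unfolding eventually_sequentially by blast
      then have "\<bar>fst (q (k n)) - l0\<bar> < d" "norm (snd (q (k n))) < d" by (simp_all only: dist_real_def dist_norm diff_0_right)
      then have "F (fst (q (k n)), snd (q (k n))) = 0 \<longrightarrow> snd (q (k n)) = 0"
        using d(2) q[of "k n"] by blast
      then show False using q[of "k n"] qn by simp
    qed
    then have "l0 \<in> {lm<..<lp}" using inner l0 by blast
    moreover have "bifurcation_point \<U> F l0" unfolding bifurcation_point_def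
    proof (intro exI conjI allI)
      show "(\<lambda>n. (fst (q (k n)), snd (q (k n)))) \<longlonglongrightarrow> (l0, 0)" by (rule tendsto_Pair[OF lim1 lim2])
    qed (use q qn in auto)
    ultimately show ?thesis by blast
  qed
  moreover have "\<exists>\<CC>\<in>components (nontrivial_solutions \<U> F L).
      \<CC> \<inter> {(l, 0) | l. l \<in> singular_set {l. (l, 0) \<in> \<U>} L \<inter> {lm<..<lp}} \<noteq> {} \<and> \<CC> \<inter> {(l, u). norm u = \<eta>} \<noteq> {}"
    if \<eta>: "\<eta> \<in> {0<..<\<eta>0}" for \<eta>
  proof -
    obtain C l l' u where C: "connected C" "C \<subseteq> X" and l: "(l, 0) \<in> C" and u: "(l', u) \<in> C" "norm u = \<eta>"
      using cont[of \<eta>] \<eta> by auto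
    have sub: "C \<subseteq> nontrivial_solutions \<U> F L"
      using C(2) by (auto simp: X_def nontrivial_solutions_def singular_set_def)
    \<comment> \<open>The continuum stays over the closed interval, but its component in the full
      nontrivial set may leave it; both meeting points are already supplied by
      \<open>C\<close>.\<close>
    let ?D = "connected_component_set (nontrivial_solutions \<U> F L) (l, 0)"
    have CD: "C \<subseteq> ?D" by (rule connected_component_maximal[OF l C(1) sub])
    have "?D \<in> components (nontrivial_solutions \<U> F L)" using sub l by (intro componentsI) blast
    moreover have "(l, 0) \<in> {(l, 0) | l. l \<in> singular_set {l. (l, 0) \<in> \<U>} L \<inter> {lm<..<lp}}"
      using C(2) l inner[of l] by (auto simp: X_def singular_set_def)
    moreover have "(l', u) \<in> {(l, u). norm u = \<eta>}" using u by simp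
    ultimately show ?thesis using CD l u by blast
  qed
  ultimately show ?thesis using \<eta>0 by blast
qed

end
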